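(* Let $F$ be a nonarchimedean local field, $B$ the quaternion division $F$-algebra, and $O_B$ its maximal $O_F$-order. Every $O_F$-algebra embedding $O_B\hookrightarrow\mathrm{Mat}_n(O_B)$ is $\mathrm{GL}_n(O_B)$-conjugate to $$\mathrm{id}^{\oplus r_1}\oplus\tau^{\oplus r_2}\oplus\varphi_1^{\oplus t_1}\oplus\varphi_2^{\oplus t_2}$$ for a unique quadruple $(r_1,r_2,t_1,t_2)\in\mathbb{Z}_{\ge0}^4$. Equivalently, in terms of lattices, $\{\mathbb{O},\mathbb{P},\mathbb{L}_1,\mathbb{L}_2\}$ forms a complete list of indecomposable $(O_B,O_B)$-bilattices up to isomorphism, and every $(O_B,O_B)$-bilattice $L$ is isomorphic to a direct sum $$\mathbb{O}^{\oplus r_1}\oplus\mathbb{P}^{\oplus r_2}\oplus\mathbb{L}_1^{\oplus t_1}\oplus\mathbb{L}_2^{\oplus t_2}\simeq O_B^{\oplus r_1}\oplus\mathfrak{P}^{\oplus r_2}\oplus\mathbb{L}_1^{\oplus t_1}\oplus\mathbb{L}_2^{\oplus t_2}$$ for some $(r_1,r_2,t_1,t_2)\in\mathbb{Z}_{\ge0}^4$ uniquely determined by $L$.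
   Context: An $(O_B,O_B)$-bilattice is a finitely generated $O_F$-torsion-free $(O_B,O_B)$-bimodule on which the left and right actions of $O_F$ agree; equivalently, a left $O_B\otimes_{O_F}O_B^{\mathrm{opp}}$-lattice. An $O_F$-algebra embedding $\varphi:O_B\hookrightarrow\mathrm{Mat}_n(O_B)$ turns the free right $O_B$-module $O_B^{\oplus n}$ of column vectors into a bilattice $(O_B^{\oplus n},\varphi)$ via $\alpha\cdot x=\varphi(\alpha)x$. For $\psi_i:O_B\hookrightarrow\mathrm{Mat}_{n_i}(O_B)$, $\psi_1\oplus\psi_2$ is the block diagonal embedding into $\mathrm{Mat}_{n_1+n_2}(O_B)$. Let $K$ be the unramified quadratic extension of $F$ with ring of integers $O_K$ and nontrivial automorphism $\sigma$, embedded in $B$; $\pi$ is a fixed uniformizer of $F$ and $\Pi\in O_B$ is chosen so that $O_B=O_K\oplus O_K\Pi$, $\Pi^2=\pi$, $\Pi a=a^\sigma\Pi$ for all $a\in O_K$. Put $\mathfrak{P}=\Pi O_B$. Define $\mathrm{id},\tau:O_B\to O_B$ by $\mathrm{id}(\alpha)=\alpha$, $\tau(\alpha)=\Pi^{-1}\alpha\Pi$, and $\varphi_1,\varphi_2:O_B\hookrightarrow\mathrm{Mat}_2(O_B)$ by $$\varphi_1(\Pi)=\varphi_2(\Pi)=\begin{bmatrix}0&\pi\\1&0\end{bmatrix},\quad \varphi_1(a)=\begin{bmatrix}a&0\\0&a^\sigma\end{bmatrix},\quad\varphi_2(a)=\begin{bmatrix}a^\sigma&0\\0&a\end{bmatrix}\quad(a\in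 O_K).$$ Then $\mathbb{O}=(O_B,\mathrm{id})$, $\mathbb{P}=(O_B,\tau)$, $\mathbb{L}_1=(O_B^{\oplus2},\varphi_1)$, $\mathbb{L}_2=(O_B^{\oplus2},\varphi_2)$. In the second displayed sum, $O_B$ and $\mathfrak{P}$ carry the natural left and right multiplications. *)

theory Defs
  imports
    "HOL-Computational_Algebra.Polynomial"
    "HOL-Algebra.AbelCoset"
    "Jordan_Normal_Form.Matrix"
begin

text \<open>The value of \<open>v\<close> at \<open>0\<close> is irrelevant: \<open>val_ge v x N\<close> encodes \<open>v x \<ge> N\<close> with the
  convention \<open>v 0 = \<infinity>\<close>.\<close>

definition val_ge :: "('f::field \<Rightarrow> int) \<Rightarrow> 'f \<Rightarrow> int \<Rightarrow> bool" where
  "val_ge v x N \<longleftrightarrow> x = 0 \<or> N \<le> v x"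

definition val_ring :: "('f::field \<Rightarrow> int) \<Rightarrow> 'f set" where
  "val_ring v = {x. val_ge v x 0}"

definition val_ideal :: "('f::field \<Rightarrow> int) \<Rightarrow> 'f set" where
  "val_ideal v = {x. val_ge v x 1}"

definition uniformizer :: "('f::field \<Rightarrow> int) \<Rightarrow> 'f \<Rightarrow> bool" where
  "uniformizer v p \<longleftrightarrow> p \<noteq> 0 \<and> v p = 1"

text \<open>A nonarchimedean local field (of any characteristic): a field that is complete with respect
  to a normalized discrete valuation with finite residue field.\<close>

locale nonarch_local_field =
  fixes v :: "'f::field \<Rightarrow> int"
  assumes val_mult: "x \<noteq> 0 \<Longrightarrow> y \<noteq> 0 \<Longrightarrow> v (x * y) = v x + v y"
    and val_add: "x \<noteq> 0 \<Longrightarrow> y \<noteq> 0 \<Longrightarrow> x + y \<noteq> 0 \<Longrightarrow> min (v x) (v y) \<le> v (x + y)"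
    and val_normalized: "\<exists>p. uniformizer v p"
    and val_complete: "\<And>X :: nat \<Rightarrow> 'f.
      (\<forall>N. \<exists>M. \<forall>m\<ge>M. \<forall>n\<ge>M. val_ge v (X m - X n) N) \<Longrightarrow>
      \<exists>l. \<forall>N. \<exists>M. \<forall>n\<ge>M. val_ge v (X n - l) N"
    and finite_residue_field:
      "finite (val_ring v // {(x, y). x \<in> val_ring v \<and> y \<in> val_ring v \<and> x - y \<in> val_ideal v})"

text \<open>\<open>B\<close> is the type \<open>'b\<close>, an algebra over the field \<open>'f\<close> via \<open>\<iota>\<close>. A quaternion division algebra
  is a division algebra that is central of dimension 4.\<close>

locale quaternion_division_algebra =
  fixes \<iota> :: "'f::field \<Rightarrow> 'b::division_ring"
  assumes algebra_map: "Ring_Hom.ring_hom \<iota>"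
    and center: "{z. \<forall>x. z * x = x * z} = range \<iota>"
    and dim_4: "vector_space.dim (\<lambda>c x. \<iota> c * x) (UNIV :: 'b set) = 4"

definition is_subring :: "'b::ring_1 set \<Rightarrow> bool" where
  "is_subring R \<longleftrightarrow> 1 \<in> R \<and> (\<forall>x\<in>R. \<forall>y\<in>R. x - y \<in> R \<and> x * y \<in> R)"

definition is_order :: "('f::field \<Rightarrow> int) \<Rightarrow> ('f \<Rightarrow> 'b::division_ring) \<Rightarrow> 'b set \<Rightarrow> bool" where
  "is_order v \<iota> R \<longleftrightarrow> is_subring R \<and>
    (\<exists>S. finite S \<and> R = {(\<Sum>s\<in>S. \<iota> (c s) * s) | c. \<forall>s\<in>S. c s \<in> val_ring v}) \<and>
    module.span (\<lambda>c x. \<iota> c * x) R = UNIV"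

definition is_maximal_order :: "('f::field \<Rightarrow> int) \<Rightarrow> ('f \<Rightarrow> 'b::division_ring) \<Rightarrow> 'b set \<Rightarrow> bool" where
  "is_maximal_order v \<iota> R \<longleftrightarrow> is_order v \<iota> R \<and> (\<forall>R'. is_order v \<iota> R' \<and> R \<subseteq> R' \<longrightarrow> R' = R)"

definition integral_over :: "('f::field \<Rightarrow> int) \<Rightarrow> ('f \<Rightarrow> 'b::division_ring) \<Rightarrow> 'b \<Rightarrow> bool" where
  "integral_over v \<iota> x \<longleftrightarrow> (\<exists>p :: 'f poly. lead_coeff p = 1 \<and> (\<forall>i. coeff p i \<in> val_ring v) \<and>
    (\<Sum>i\<le>degree p. \<iota> (coeff p i) * x ^ i) = 0)"

definition ring_of_integers :: "('f::field \<Rightarrow> int) \<Rightarrow> ('f \<Rightarrow> 'b::division_ring) \<Rightarrow> 'b set \<Rightarrow> 'b set" where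
  "ring_of_integers v \<iota> K = {x \<in> K. integral_over v \<iota> x}"

definition is_quadratic_subfield :: "('f::field \<Rightarrow> 'b::division_ring) \<Rightarrow> 'b set \<Rightarrow> bool" where
  "is_quadratic_subfield \<iota> K \<longleftrightarrow> is_subring K \<and> range \<iota> \<subseteq> K \<and>
    (\<forall>x\<in>K. inverse x \<in> K) \<and> (\<forall>x\<in>K. \<forall>y\<in>K. x * y = y * x) \<and>
    vector_space.dim (\<lambda>c x. \<iota> c * x) K = 2"

text \<open>\<open>K/F\<close> is unramified if the maximal ideal of \<open>O\<^sub>F\<close> generates the maximal ideal (the set of
  nonunits) of \<open>O\<^sub>K\<close>; the residue extension is separable since the residue fields are finite.
  As the maximal ideal of \<open>O\<^sub>F\<close> is principal, the set on the right is the ideal it generates.\<close>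

definition is_unramified :: "('f::field \<Rightarrow> int) \<Rightarrow> ('f \<Rightarrow> 'b::division_ring) \<Rightarrow> 'b set \<Rightarrow> bool" where
  "is_unramified v \<iota> K \<longleftrightarrow>
    {x \<in> ring_of_integers v \<iota> K. x = 0 \<or> inverse x \<notin> ring_of_integers v \<iota> K} =
    {\<iota> c * x | c x. c \<in> val_ideal v \<and> x \<in> ring_of_integers v \<iota> K}"

definition is_nontrivial_automorphism ::
  "('f::field \<Rightarrow> 'b::division_ring) \<Rightarrow> 'b set \<Rightarrow> ('b \<Rightarrow> 'b) \<Rightarrow> bool" where
  "is_nontrivial_automorphism \<iota> K \<sigma> \<longleftrightarrow> bij_betw \<sigma> K K \<and>
    (\<forall>x\<in>K. \<forall>y\<in>K. \<sigma> (x + y) = \<sigma> x + \<sigma> y \<and> \<sigma> (x * y) = \<sigma> x * \<sigma> y) \<and>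
    (\<forall>c. \<sigma> (\<iota> c) = \<iota> c) \<and> (\<exists>x\<in>K. \<sigma> x \<noteq> x)"

text \<open>The element \<open>\<pi>\<^sub>B\<close> is the one usually denoted by a capital pi:
  \<open>O\<^sub>B = O\<^sub>K \<oplus> O\<^sub>K \<pi>\<^sub>B\<close>, \<open>\<pi>\<^sub>B\<^sup>2 = \<pi>\<close> and \<open>\<pi>\<^sub>B a = a\<^sup>\<sigma> \<pi>\<^sub>B\<close>.\<close>

locale quaternion_setting =
  nonarch_local_field v + quaternion_division_algebra \<iota>
  for v :: "'f::field \<Rightarrow> int" and \<iota> :: "'f \<Rightarrow> 'b::division_ring" +
  fixes OB K :: "'b set" and \<sigma> :: "'b \<Rightarrow> 'b" and \<pi> :: 'f and \<pi>\<^sub>B :: 'b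
  assumes maximal_order: "is_maximal_order v \<iota> OB"
    and quadratic: "is_quadratic_subfield \<iota> K"
    and unramified: "is_unramified v \<iota> K"
    and sigma: "is_nontrivial_automorphism \<iota> K \<sigma>"
    and uniformizer: "uniformizer v \<pi>"
    and piB_in: "\<pi>\<^sub>B \<in> OB"
    and OB_decomposition: "bij_betw (\<lambda>(a, b). a + b * \<pi>\<^sub>B)
      (ring_of_integers v \<iota> K \<times> ring_of_integers v \<iota> K) OB"
    and piB_square: "\<pi>\<^sub>B ^ 2 = \<iota> \<pi>"
    and piB_conj: "\<And>a. a \<in> ring_of_integers v \<iota> K \<Longrightarrow> \<pi>\<^sub>B * a = \<sigma> a * \<pi>\<^sub>B"

text \<open>Functions on \<open>O\<^sub>B\<close> are functions on the type \<open>'b\<close> whose values outside \<open>OB\<close> are ignored.\<close>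

definition mat_over :: "'b::zero set \<Rightarrow> nat \<Rightarrow> 'b mat set" where
  "mat_over R n = {A \<in> carrier_mat n n. elements_mat A \<subseteq> R}"

definition algebra_embedding :: "('f::field \<Rightarrow> int) \<Rightarrow> ('f \<Rightarrow> 'b::division_ring) \<Rightarrow> 'b set \<Rightarrow>
    nat \<Rightarrow> ('b \<Rightarrow> 'b mat) \<Rightarrow> bool" where
  "algebra_embedding v \<iota> OB n \<phi> \<longleftrightarrow>
    \<phi> ` OB \<subseteq> mat_over OB n \<and> inj_on \<phi> OB \<and> \<phi> 1 = 1\<^sub>m n \<and>
    (\<forall>x\<in>OB. \<forall>y\<in>OB. \<phi> (x + y) = \<phi> x + \<phi> y \<and> \<phi> (x * y) = \<phi> x * \<phi> y) \<and>
    (\<forall>c\<in>val_ring v. \<forall>x\<in>OB. \<phi> (\<iota> c * x) = \<iota> c \<cdot>\<^sub>m \<phi> x)"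

text \<open>Conjugacy under \<open>GL\<^sub>n(O\<^sub>B)\<close>. The requirement that both maps take values in \<open>n \<times> n\<close> matrices
  and that \<open>P\<close>, \<open>Q\<close> are mutually inverse is part of \<^const>\<open>similar_mat_wit\<close>.\<close>

definition gl_conjugate :: "'b::ring_1 set \<Rightarrow> nat \<Rightarrow> ('b \<Rightarrow> 'b mat) \<Rightarrow> ('b \<Rightarrow> 'b mat) \<Rightarrow> bool" where
  "gl_conjugate OB n \<phi> \<psi> \<longleftrightarrow> (\<exists>P\<in>mat_over OB n. \<exists>Q\<in>mat_over OB n.
    \<forall>x\<in>OB. \<phi> x \<in> carrier_mat n n \<and> similar_mat_wit (\<phi> x) (\<psi> x) P Q)"

definition emb_sum :: "('b \<Rightarrow> 'b::zero mat) list \<Rightarrow> 'b \<Rightarrow> 'b mat" where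
  "emb_sum \<psi>s x = diag_block_mat (map (\<lambda>\<psi>. \<psi> x) \<psi>s)"

definition emb_id :: "'b \<Rightarrow> 'b mat" where
  "emb_id x = mat 1 1 (\<lambda>_. x)"

definition emb_tau :: "'b::division_ring \<Rightarrow> 'b \<Rightarrow> 'b mat" where
  "emb_tau \<pi>\<^sub>B x = mat 1 1 (\<lambda>_. inverse \<pi>\<^sub>B * x * \<pi>\<^sub>B)"

text \<open>The map \<open>a + b \<pi>\<^sub>B \<mapsto> A(a) + A(b) M\<close> on \<open>O\<^sub>K \<oplus> O\<^sub>K \<pi>\<^sub>B\<close>, i.e. the only possible ring homomorphism
  that restricts to \<open>A\<close> on \<open>O\<^sub>K\<close> and sends \<open>\<pi>\<^sub>B\<close> to \<open>M\<close>.\<close>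

definition emb_extend :: "'b::division_ring set \<Rightarrow> 'b \<Rightarrow> ('b \<Rightarrow> 'b mat) \<Rightarrow> 'b mat \<Rightarrow> 'b \<Rightarrow> 'b mat" where
  "emb_extend OK \<pi>\<^sub>B A M x =
    (case (THE p. fst p \<in> OK \<and> snd p \<in> OK \<and> x = fst p + snd p * \<pi>\<^sub>B) of (a, b) \<Rightarrow> A a + A b * M)"

definition emb_phi1 :: "('f::field \<Rightarrow> int) \<Rightarrow> ('f \<Rightarrow> 'b::division_ring) \<Rightarrow> 'b set \<Rightarrow> ('b \<Rightarrow> 'b) \<Rightarrow>
    'f \<Rightarrow> 'b \<Rightarrow> 'b \<Rightarrow> 'b mat" where
  "emb_phi1 v \<iota> K \<sigma> \<pi> \<pi>\<^sub>B = emb_extend (ring_of_integers v \<iota> K) \<pi>\<^sub>B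
    (\<lambda>a. mat_of_rows_list 2 [[a, 0], [0, \<sigma> a]]) (mat_of_rows_list 2 [[0, \<iota> \<pi>], [1, 0]])"

definition emb_phi2 :: "('f::field \<Rightarrow> int) \<Rightarrow> ('f \<Rightarrow> 'b::division_ring) \<Rightarrow> 'b set \<Rightarrow> ('b \<Rightarrow> 'b) \<Rightarrow>
    'f \<Rightarrow> 'b \<Rightarrow> 'b \<Rightarrow> 'b mat" where
  "emb_phi2 v \<iota> K \<sigma> \<pi> \<pi>\<^sub>B = emb_extend (ring_of_integers v \<iota> K) \<pi>\<^sub>B
    (\<lambda>a. mat_of_rows_list 2 [[\<sigma> a, 0], [0, a]]) (mat_of_rows_list 2 [[0, \<iota> \<pi>], [1, 0]])"

text \<open>The library record \<^type>\<open>module\<close> (whose \<^const>\<open>mult\<close> and \<^const>\<open>one\<close> fields are unused) carries the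
  left action; we add a right action.\<close>

record ('a, 'm) bimodule = "('a, 'm) module" +
  rsmult :: "'m \<Rightarrow> 'a \<Rightarrow> 'm" (infixl \<open>\<triangleleft>\<index>\<close> 70)

locale bimodule = abelian_group L
  for R :: "'b::ring_1 set" and L :: "('b, 'm) bimodule" (structure) +
  assumes left_closed: "a \<in> R \<Longrightarrow> x \<in> carrier L \<Longrightarrow> a \<odot> x \<in> carrier L"
    and left_distrib_scalar: "a \<in> R \<Longrightarrow> b \<in> R \<Longrightarrow> x \<in> carrier L \<Longrightarrow> (a + b) \<odot> x = a \<odot> x \<oplus> b \<odot> x"
    and left_distrib: "a \<in> R \<Longrightarrow> x \<in> carrier L \<Longrightarrow> y \<in> carrier L \<Longrightarrow> a \<odot> (x \<oplus> y) = a \<odot> x \<oplus> a \<odot> y"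
    and left_assoc: "a \<in> R \<Longrightarrow> b \<in> R \<Longrightarrow> x \<in> carrier L \<Longrightarrow> (a * b) \<odot> x = a \<odot> (b \<odot> x)"
    and left_one: "x \<in> carrier L \<Longrightarrow> 1 \<odot> x = x"
    and right_closed: "a \<in> R \<Longrightarrow> x \<in> carrier L \<Longrightarrow> x \<triangleleft> a \<in> carrier L"
    and right_distrib_scalar: "a \<in> R \<Longrightarrow> b \<in> R \<Longrightarrow> x \<in> carrier L \<Longrightarrow> x \<triangleleft> (a + b) = x \<triangleleft> a \<oplus> x \<triangleleft> b"
    and right_distrib: "a \<in> R \<Longrightarrow> x \<in> carrier L \<Longrightarrow> y \<in> carrier L \<Longrightarrow> (x \<oplus> y) \<triangleleft> a = x \<triangleleft> a \<oplus> y \<triangleleft> a"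
    and right_assoc: "a \<in> R \<Longrightarrow> b \<in> R \<Longrightarrow> x \<in> carrier L \<Longrightarrow> x \<triangleleft> (a * b) = (x \<triangleleft> a) \<triangleleft> b"
    and right_one: "x \<in> carrier L \<Longrightarrow> x \<triangleleft> 1 = x"
    and left_right: "a \<in> R \<Longrightarrow> b \<in> R \<Longrightarrow> x \<in> carrier L \<Longrightarrow> (a \<odot> x) \<triangleleft> b = a \<odot> (x \<triangleleft> b)"

definition is_subbimodule :: "'b set \<Rightarrow> 'm set \<Rightarrow> ('b, 'm) bimodule \<Rightarrow> bool" where
  "is_subbimodule R N L \<longleftrightarrow> additive_subgroup N L \<and>
    (\<forall>a\<in>R. \<forall>x\<in>N. a \<odot>\<^bsub>L\<^esub> x \<in> N \<and> x \<triangleleft>\<^bsub>L\<^esub> a \<in> N)"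

definition finitely_generated :: "'b set \<Rightarrow> ('b, 'm) bimodule \<Rightarrow> bool" where
  "finitely_generated R L \<longleftrightarrow> (\<exists>S. finite S \<and> S \<subseteq> carrier L \<and>
    (\<forall>N. is_subbimodule R N L \<and> S \<subseteq> N \<longrightarrow> N = carrier L))"

locale bilattice = bimodule OB L
  for v :: "'f::field \<Rightarrow> int" and \<iota> :: "'f \<Rightarrow> 'b::division_ring" and OB :: "'b set"
    and L :: "('b, 'm) bimodule" (structure) +
  assumes fin_gen: "finitely_generated OB L"
    and torsion_free: "c \<in> val_ring v \<Longrightarrow> x \<in> carrier L \<Longrightarrow> \<iota> c \<odot> x = \<zero> \<Longrightarrow> c = 0 \<or> x = \<zero>"
    and actions_agree: "c \<in> val_ring v \<Longrightarrow> x \<in> carrier L \<Longrightarrow> \<iota> c \<odot> x = x \<triangleleft> \<iota> c"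

definition indecomposable :: "'b set \<Rightarrow> ('b, 'm) bimodule \<Rightarrow> bool" where
  "indecomposable R L \<longleftrightarrow> carrier L \<noteq> {\<zero>\<^bsub>L\<^esub>} \<and>
    (\<forall>M N. is_subbimodule R M L \<and> is_subbimodule R N L \<and>
      M <+>\<^bsub>L\<^esub> N = carrier L \<and> M \<inter> N = {\<zero>\<^bsub>L\<^esub>} \<longrightarrow> M = {\<zero>\<^bsub>L\<^esub>} \<or> N = {\<zero>\<^bsub>L\<^esub>})"

definition bimodule_iso :: "'b set \<Rightarrow> ('b, 'm) bimodule \<Rightarrow> ('b, 'n) bimodule \<Rightarrow> bool" where
  "bimodule_iso R M N \<longleftrightarrow> (\<exists>f. bij_betw f (carrier M) (carrier N) \<and>
    (\<forall>x\<in>carrier M. \<forall>y\<in>carrier M. f (x \<oplus>\<^bsub>M\<^esub> y) = f x \<oplus>\<^bsub>N\<^esub> f y) \<and>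
    (\<forall>a\<in>R. \<forall>x\<in>carrier M. f (a \<odot>\<^bsub>M\<^esub> x) = a \<odot>\<^bsub>N\<^esub> f x \<and> f (x \<triangleleft>\<^bsub>M\<^esub> a) = f x \<triangleleft>\<^bsub>N\<^esub> a))"

text \<open>External direct sums: \<open>M \<oplus> N\<close> on pairs, and \<open>M\<^sup>\<oplus>\<^sup>r\<close> on lists of length \<open>r\<close>.\<close>

definition bimod_sum :: "('b, 'm) bimodule \<Rightarrow> ('b, 'n) bimodule \<Rightarrow> ('b, 'm \<times> 'n) bimodule"
    (infixr \<open>\<oplus>\<^sub>b\<close> 65) where
  "M \<oplus>\<^sub>b N = \<lparr>carrier = carrier M \<times> carrier N, mult = undefined, one = undefined,
    zero = (\<zero>\<^bsub>M\<^esub>, \<zero>\<^bsub>N\<^esub>), add = (\<lambda>x y. (fst x \<oplus>\<^bsub>M\<^esub> fst y, snd x \<oplus>\<^bsub>N\<^esub> snd y)),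
    smult = (\<lambda>a x. (a \<odot>\<^bsub>M\<^esub> fst x, a \<odot>\<^bsub>N\<^esub> snd x)),
    rsmult = (\<lambda>x a. (fst x \<triangleleft>\<^bsub>M\<^esub> a, snd x \<triangleleft>\<^bsub>N\<^esub> a))\<rparr>"

definition bimod_power :: "('b, 'm) bimodule \<Rightarrow> nat \<Rightarrow> ('b, 'm list) bimodule"
    (infixl \<open>^\<^sub>b\<close> 80) where
  "M ^\<^sub>b r = \<lparr>carrier = {xs. length xs = r \<and> set xs \<subseteq> carrier M}, mult = undefined, one = undefined,
    zero = replicate r \<zero>\<^bsub>M\<^esub>, add = map2 (\<lambda>x y. x \<oplus>\<^bsub>M\<^esub> y),
    smult = (\<lambda>a. map (\<lambda>x. a \<odot>\<^bsub>M\<^esub> x)), rsmult = (\<lambda>xs a. map (\<lambda>x. x \<triangleleft>\<^bsub>M\<^esub> a) xs)\<rparr>"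

text \<open>The column vectors \<open>O\<^sub>B\<^sup>n\<close> with left action through \<open>\<phi>\<close> and entrywise right multiplication
  (note that \<open>\<cdot>\<^sub>v\<close> of the matrix library multiplies from the left).\<close>

definition emb_bimodule :: "'b::ring_1 set \<Rightarrow> nat \<Rightarrow> ('b \<Rightarrow> 'b mat) \<Rightarrow> ('b, 'b vec) bimodule" where
  "emb_bimodule OB n \<phi> = \<lparr>carrier = {x \<in> carrier_vec n. \<forall>i<n. x $ i \<in> OB},
    mult = undefined, one = undefined, zero = 0\<^sub>v n, add = (+),
    smult = (\<lambda>a x. \<phi> a *\<^sub>v x), rsmult = (\<lambda>x a. map_vec (\<lambda>y. y * a) x)\<rparr>"

definition natural_bimodule :: "'b::ring_1 set \<Rightarrow> ('b, 'b) bimodule" where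
  "natural_bimodule I = \<lparr>carrier = I, mult = undefined, one = undefined, zero = 0, add = (+),
    smult = (*), rsmult = (*)\<rparr>"

definition lattice_O :: "'b::division_ring set \<Rightarrow> ('b, 'b vec) bimodule" where
  "lattice_O OB = emb_bimodule OB 1 emb_id"

definition lattice_P :: "'b::division_ring set \<Rightarrow> 'b \<Rightarrow> ('b, 'b vec) bimodule" where
  "lattice_P OB \<pi>\<^sub>B = emb_bimodule OB 1 (emb_tau \<pi>\<^sub>B)"

definition lattice_L1 :: "('f::field \<Rightarrow> int) \<Rightarrow> ('f \<Rightarrow> 'b::division_ring) \<Rightarrow> 'b set \<Rightarrow> 'b set \<Rightarrow>
    ('b \<Rightarrow> 'b) \<Rightarrow> 'f \<Rightarrow> 'b \<Rightarrow> ('b, 'b vec) bimodule" where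
  "lattice_L1 v \<iota> OB K \<sigma> \<pi> \<pi>\<^sub>B = emb_bimodule OB 2 (emb_phi1 v \<iota> K \<sigma> \<pi> \<pi>\<^sub>B)"

definition lattice_L2 :: "('f::field \<Rightarrow> int) \<Rightarrow> ('f \<Rightarrow> 'b::division_ring) \<Rightarrow> 'b set \<Rightarrow> 'b set \<Rightarrow>
    ('b \<Rightarrow> 'b) \<Rightarrow> 'f \<Rightarrow> 'b \<Rightarrow> ('b, 'b vec) bimodule" where
  "lattice_L2 v \<iota> OB K \<sigma> \<pi> \<pi>\<^sub>B = emb_bimodule OB 2 (emb_phi2 v \<iota> K \<sigma> \<pi> \<pi>\<^sub>B)"

end

theory Submission
  imports Defs "HOL-Algebra.Multiplicative_Group"
begin

text \<open>Write \<open>P\<close> for the uniformizer \<open>\<pi>\<^sub>B\<close>. A bilattice \<open>L\<close> is a free right \<open>O\<^sub>B\<close>-module, and since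
  \<open>K/F\<close> is unramified some \<open>\<zeta> - \<zeta>\<^sup>\<sigma>\<close> with \<open>\<zeta> \<in> O\<^sub>K\<close> is a unit; hence \<open>L\<close> splits into the part where
  \<open>a x = x a\<close> and the part where \<open>a x = x a\<^sup>\<sigma>\<close> for \<open>a \<in> O\<^sub>K\<close>. Left multiplication by \<open>P\<close> exchanges
  the parts and squares to zero on \<open>V = L / L P\<close>, because \<open>P P x = x \<pi>\<close>. A homogeneous \<open>e\<close> with
  \<open>P e \<noteq> 0\<close> in \<open>V\<close> spans a copy of \<open>L\<^sub>1\<close> or \<open>L\<^sub>2\<close> with basis \<open>e, P e\<close>. The remaining homogeneous
  generators can be chosen in the kernel, and by Galois descent for the semilinear involution
  \<open>x \<mapsto> P x P\<^sup>-\<^sup>1\<close> even with \<open>P x = x P\<close>; each of them spans a copy of \<open>O\<^sub>B\<close> or of its twist by \<open>\<tau>\<close>.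
  So a homomorphism from a sum of the four lattices to \<open>L\<close> that is injective modulo \<open>P\<close>, with
  as many copies of \<open>L\<^sub>1, L\<^sub>2\<close> and then of the other two as possible, is bijective modulo \<open>P\<close>.
  It is surjective by Nakayama's lemma, and injective as
  the sum is \<open>P\<close>-adically separated and \<open>L\<close> is torsion-free. The multiplicities are recovered from
  the sizes of the graded parts of \<open>V\<close> and of the images of \<open>P\<close> on them. A \<open>GL\<^sub>n(O\<^sub>B)\<close>-conjugacy of
  embeddings is the same thing as an isomorphism of the associated bilattices.\<close>

subsection \<open>Arithmetic of the maximal order\<close>

text \<open>Unramifiedness only says that \<pi> generates the maximal ideal of \<open>OK\<close>.
  That \<sigma> acts nontrivially on the residue field has to be drawn from the finiteness of that
  field. Residue characteristic 2 is included, so no step may divide by 2; the unit \<zeta> -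
  \<sigma> \<zeta> takes over, in the projections to the graded parts as well as in the descent.

  Instead of choosing bases of V, the proof counts. The order q of the residue field exceeds 1,
  cosets modulo the radical are finite in number, and their numbers multiply in direct sums, so
  exponents of q serve as dimensions and ranks. A maximal homomorphism that is injective modulo the
  radical replaces a basis; the counts bound its size.

  The order of the two maximality arguments matters. In a sum of copies of L_1 and L_2 alone, the
  kernel of P modulo the radical equals its image. This turns P x = f(u) into P x = P f(w) modulo
  the radical, and then x - f(w) lies in the kernel. With a copy of O_B or its twist the equality
  fails, since P acts on those as zero modulo the radical.\<close>

lemma is_subring_closed:
  assumes "is_subring R"
  shows "0 \<in> R" "1 \<in> R" "x \<in> R \<Longrightarrow> y \<in> R \<Longrightarrow> x + y \<in> R" "x \<in> R \<Longrightarrow> y \<in> R \<Longrightarrow> x - y \<in> R"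
    "x \<in> R \<Longrightarrow> y \<in> R \<Longrightarrow> x * y \<in> R" "x \<in> R \<Longrightarrow> - x \<in> R" "x \<in> R \<Longrightarrow> x ^ n \<in> R"
proof -
  have one: "1 \<in> R" and diff: "\<And>x y. x \<in> R \<Longrightarrow> y \<in> R \<Longrightarrow> x - y \<in> R"
    and mult: "\<And>x y. x \<in> R \<Longrightarrow> y \<in> R \<Longrightarrow> x * y \<in> R"
    using assms by (auto simp: is_subring_def)
  have zero: "0 \<in> R" using diff[OF one one] by simp
  have neg: "- x \<in> R" if "x \<in> R" for x using diff[OF zero that] by simp
  show "0 \<in> R" "1 \<in> R" "x \<in> R \<Longrightarrow> y \<in> R \<Longrightarrow> x - y \<in> R"
    "x \<in> R \<Longrightarrow> y \<in> R \<Longrightarrow> x * y \<in> R" "x \<in> R \<Longrightarrow> - x \<in> R"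
    by (fact zero one diff mult neg)+
  show "x + y \<in> R" if "x \<in> R" "y \<in> R" using diff[OF that(1) neg[OF that(2)]] by simp
  show "x ^ n \<in> R" if "x \<in> R" using that by (induction n) (auto intro: one mult)
qed

section \<open>The valuation and its ring\<close>

context nonarch_local_field
begin

lemma val_one [simp]: "v 1 = 0"
  using val_mult[of 1 1] by simp

lemma val_inverse: "x \<noteq> 0 \<Longrightarrow> v (inverse x) = - v x"
  using val_mult[of x "inverse x"] by simp

lemma val_power: "x \<noteq> 0 \<Longrightarrow> v (x ^ n) = int n * v x"
  by (induction n) (auto simp: val_mult algebra_simps)

lemma val_uminus_one: "v (- 1) = 0"
  using val_mult[of "-1" "-1"] by simp

lemma val_uminus: "x \<noteq> 0 \<Longrightarrow> v (- x) = v x"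
  using val_mult[of "-1" x] val_uminus_one by simp

lemma val_ge_add: "val_ge v x N \<Longrightarrow> val_ge v y N \<Longrightarrow> val_ge v (x + y) N"
  unfolding val_ge_def using val_add[of x y] by fastforce

lemma val_ge_diff: "val_ge v x N \<Longrightarrow> val_ge v y N \<Longrightarrow> val_ge v (x - y) N"
  using val_ge_add[of x N "- y"] val_uminus[of y] by (cases "y = 0") (auto simp: val_ge_def)

lemma val_ge_mult: "val_ge v x M \<Longrightarrow> val_ge v y N \<Longrightarrow> val_ge v (x * y) (M + N)"
  unfolding val_ge_def using val_mult[of x y] by fastforce

lemma val_ring_closed:
  "0 \<in> val_ring v" "1 \<in> val_ring v" "x \<in> val_ring v \<Longrightarrow> y \<in> val_ring v \<Longrightarrow> x + y \<in> val_ring v"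
  "x \<in> val_ring v \<Longrightarrow> y \<in> val_ring v \<Longrightarrow> x - y \<in> val_ring v"
  "x \<in> val_ring v \<Longrightarrow> y \<in> val_ring v \<Longrightarrow> x * y \<in> val_ring v"
  using val_ge_add[of x 0 y] val_ge_diff[of x 0 y] val_ge_mult[of x 0 y 0]
  by (auto simp: val_ring_def val_ge_def[of _ 0] val_ge_def[of _ 1])

end

section \<open>Central scalars of the quaternion algebra\<close>

context quaternion_division_algebra
begin

sublocale iota: Ring_Hom.ring_hom \<iota>
  by (rule algebra_map)

lemma iota_commute: "\<iota> c * x = x * \<iota> c"
  using center by blast

sublocale vs: vector_space "\<lambda>c x. \<iota> c * x"
  by unfold_locales (simp_all add: distrib_left distrib_right iota.hom_add iota.hom_mult mult.assoc)

lemma iota_eq_0 [simp]: "\<iota> c = 0 \<longleftrightarrow> c = 0"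
proof
  assume "\<iota> c = 0"
  show "c = 0"
  proof (rule ccontr)
    assume "c \<noteq> 0"
    then have "\<iota> c * \<iota> (inverse c) = 1" by (simp flip: iota.hom_mult)
    with \<open>\<iota> c = 0\<close> show False by simp
  qed
qed simp

lemma iota_inverse: "\<iota> (inverse c) = inverse (\<iota> c)"
proof (cases "c = 0")
  case False
  then have "\<iota> c * \<iota> (inverse c) = 1" by (simp flip: iota.hom_mult)
  then show ?thesis by (simp add: inverse_unique)
qed simp

end

section \<open>The order \<open>OB\<close>, the integers of \<open>K\<close> and conjugation by
  \<open>\<pi>\<^sub>B\<close>\<close>

context quaternion_setting
begin

abbreviation OK where "OK \<equiv> ring_of_integers v \<iota> K"

lemma pi_nz: "\<pi> \<noteq> 0" and val_pi: "v \<pi> = 1"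
  using uniformizer by (auto simp: uniformizer_def)

lemma varpi_sq: "\<pi>\<^sub>B * \<pi>\<^sub>B = \<iota> \<pi>"
  using piB_square by (simp add: power2_eq_square)

lemma varpi_nz [simp]: "\<pi>\<^sub>B \<noteq> 0"
  using varpi_sq pi_nz by auto

lemma OB_order: "is_order v \<iota> OB"
  using maximal_order by (simp add: is_maximal_order_def)

declare piB_in [simp]

lemma OB_subring: "is_subring OB"
  using OB_order by (simp add: is_order_def)

lemmas OB_closed [simp] = is_subring_closed[OF OB_subring]

lemma K_subring: "is_subring K"
  using quadratic by (simp add: is_quadratic_subfield_def)

lemmas K_closed [simp] = is_subring_closed[OF K_subring]

lemma K_inverse: "x \<in> K \<Longrightarrow> inverse x \<in> K"
  and K_commute: "x \<in> K \<Longrightarrow> y \<in> K \<Longrightarrow> x * y = y * x"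
  and iota_K: "\<iota> c \<in> K"
  using quadratic by (auto simp: is_quadratic_subfield_def)

lemma span_OB: "vs.span OB = UNIV"
  using OB_order by (simp add: is_order_def)

lemma OB_generators:
  obtains S where "finite S" "OB = {(\<Sum>s\<in>S. \<iota> (c s) * s) | c. \<forall>s\<in>S. c s \<in> val_ring v}"
  using OB_order by (auto simp: is_order_def)

lemma OB_scale: assumes "c \<in> val_ring v" "x \<in> OB" shows "\<iota> c * x \<in> OB"
proof -
  obtain S where S: "finite S" "OB = {(\<Sum>s\<in>S. \<iota> (c s) * s) | c. \<forall>s\<in>S. c s \<in> val_ring v}"
    by (rule OB_generators)
  obtain d where d: "x = (\<Sum>s\<in>S. \<iota> (d s) * s)" "\<forall>s\<in>S. d s \<in> val_ring v"
    using assms(2) unfolding S(2) mem_Collect_eq by (elim exE conjE) (rule that)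
  have "\<iota> c * x = (\<Sum>s\<in>S. \<iota> (c * d s) * s)"
    by (simp only: d(1) sum_distrib_left iota.hom_mult mult.assoc)
  moreover have "\<forall>s\<in>S. c * d s \<in> val_ring v" using d(2) assms(1) val_ring_closed(5) by simp
  ultimately show ?thesis unfolding S(2) mem_Collect_eq by (intro exI[of _ "\<lambda>s. c * d s"] conjI)
qed

lemma iota_OB: "c \<in> val_ring v \<Longrightarrow> \<iota> c \<in> OB"
  using OB_scale[of c 1] OB_closed by simp

lemma pi_power_OB: "\<iota> (\<pi> ^ n) * x \<in> OB" if "x \<in> OB"
  by (rule OB_scale) (use that pi_nz val_pi in \<open>simp_all add: val_ring_def val_ge_def val_power\<close>)

lemma pi_OB [simp]: "\<iota> \<pi> \<in> OB"
  using pi_power_OB[of 1 1] OB_closed by simp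

text \<open>An order spans \<open>B\<close> over \<open>F\<close>, so a large power of the
  uniformizer clears the denominators of any given element.\<close>

lemma pi_multiple_OB: obtains n where "\<iota> (\<pi> ^ n) * x \<in> OB"
proof -
  have "x \<in> vs.span OB" by (simp add: span_OB)
  then have "\<exists>n. \<iota> (\<pi> ^ n) * x \<in> OB"
  proof (induction rule: vs.span_induct_alt)
    case base show ?case by simp
  next
    case (step c x y)
    then obtain n where n: "\<iota> (\<pi> ^ n) * y \<in> OB" by blast
    \<comment> \<open>For nonzero \<open>c\<close> this is the exponent of its denominator, or 0 if
      \<open>c\<close> is integral.\<close>
    define m where "m = nat (- v c)"
    have "\<pi> ^ m * c \<in> val_ring v"
      using pi_nz val_pi by (cases "c = 0") (auto simp: val_ring_def val_ge_def val_mult val_power m_def)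
    then have "\<iota> (\<pi> ^ m * c) * x \<in> OB" using step OB_scale by blast
    then have "\<iota> (\<pi> ^ n) * (\<iota> (\<pi> ^ m * c) * x) \<in> OB" using pi_power_OB by blast
    moreover have "\<iota> (\<pi> ^ m) * (\<iota> (\<pi> ^ n) * y) \<in> OB" using n pi_power_OB by blast
    ultimately have "\<iota> (\<pi> ^ n) * (\<iota> (\<pi> ^ m * c) * x) + \<iota> (\<pi> ^ m) * (\<iota> (\<pi> ^ n) * y) \<in> OB"
      using OB_closed by blast
    also have "\<iota> (\<pi> ^ n) * (\<iota> (\<pi> ^ m * c) * x) + \<iota> (\<pi> ^ m) * (\<iota> (\<pi> ^ n) * y)
      = \<iota> (\<pi> ^ (m + n)) * (\<iota> c * x + y)"
      using iota_commute[of "\<pi> ^ n" "\<iota> (\<pi> ^ m)"]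
      by (simp add: power_add iota.hom_mult distrib_left mult.assoc[symmetric])
    finally show ?case by blast
  qed
  then show thesis using that by blast
qed

lemma OK_sub_K: "OK \<subseteq> K"
  by (auto simp: ring_of_integers_def)

text \<open>Wanted before \<open>OK\<close> is known to be a ring: it places \<open>OK\<close>
  inside \<open>OB\<close> through \<open>a + 0 * \<pi>\<^sub>B\<close>.\<close>

lemma zero_OK: "0 \<in> OK"
  unfolding ring_of_integers_def integral_over_def
  using K_closed val_ring_closed by (auto intro!: exI[of _ "[:0, 1:]"] simp: coeff_pCons split: nat.split)

lemma OB_decompose:
  "OB = {a + b * \<pi>\<^sub>B | a b. a \<in> OK \<and> b \<in> OK}"
  "a \<in> OK \<Longrightarrow> b \<in> OK \<Longrightarrow> a' \<in> OK \<Longrightarrow> b' \<in> OK \<Longrightarrow> a + b * \<pi>\<^sub>B = a' + b' * \<pi>\<^sub>B \<Longrightarrow> a = a' \<and> b = b'"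
  using OB_decomposition unfolding bij_betw_def inj_on_def by (auto 0 3)

lemma OB_E: assumes "x \<in> OB" obtains a b where "a \<in> OK" "b \<in> OK" "x = a + b * \<pi>\<^sub>B"
  using assms OB_decompose(1) by auto

lemma OK_sub_OB: "OK \<subseteq> OB"
proof
  fix a assume "a \<in> OK"
  then have "a + 0 * \<pi>\<^sub>B \<in> OB" using zero_OK OB_decompose(1) by blast
  then show "a \<in> OB" by simp
qed

text \<open>Otherwise \<open>OB\<close>, and with it the \<open>F\<close>-span of \<open>OB\<close>,
  lies in \<open>K\<close>; but that span is \<open>B\<close>, of dimension 4 instead of 2.\<close>

lemma varpi_not_K: "\<pi>\<^sub>B \<notin> K"
proof
  assume "\<pi>\<^sub>B \<in> K"
  then have "OB \<subseteq> K" using OB_decompose(1) OK_sub_K by (auto simp: subset_iff)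
  moreover have "vs.subspace K"
    by (rule vs.subspaceI) (simp_all add: iota_K)
  ultimately have "vs.span OB \<subseteq> K" by (rule vs.span_minimal)
  then have "K = UNIV" using span_OB by auto
  moreover have "vs.dim K = 2"
    using quadratic by (simp add: is_quadratic_subfield_def)
  ultimately show False using dim_4 by simp
qed

lemma varpi_multiple_K: assumes "a \<in> K" "b \<in> K" "b * \<pi>\<^sub>B = a" shows "a = 0" "b = 0"
proof -
  show "b = 0"
  proof (rule ccontr)
    assume "b \<noteq> 0"
    then have "\<pi>\<^sub>B = inverse b * a" by (simp flip: assms(3) mult.assoc)
    then show False using assms(1,2) K_inverse varpi_not_K by simp
  qed
  then show "a = 0" using assms by simp
qed

text \<open>If \<open>a + b * \<pi>\<^sub>B\<close> lies in \<open>K\<close> then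
  \<open>b = 0\<close>, because \<open>K\<close> and \<open>K * \<pi>\<^sub>B\<close> meet only in
  0. The ring structure of \<open>OK\<close> follows from this description, without a theory of
  integral elements.\<close>

lemma OK_eq: "OK = K \<inter> OB"
proof
  show "OK \<subseteq> K \<inter> OB" using OK_sub_K OK_sub_OB by blast
  show "K \<inter> OB \<subseteq> OK"
  proof
    fix x assume x: "x \<in> K \<inter> OB"
    then obtain a b where ab: "a \<in> OK" "b \<in> OK" "x = a + b * \<pi>\<^sub>B" using OB_E by blast
    have "b * \<pi>\<^sub>B = x - a" using ab by simp
    moreover have "x - a \<in> K" "b \<in> K"
      using x ab(1,2) OK_sub_K K_closed(4)[of x a] by (simp_all add: subset_iff)
    ultimately have "b = 0" using varpi_multiple_K(2) by blast
    then show "x \<in> OK" using ab by simp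
  qed
qed

lemma OK_subring: "is_subring OK"
  unfolding OK_eq is_subring_def using K_closed OB_closed by auto

lemmas OK_closed [simp] = is_subring_closed[OF OK_subring]

lemma OK_OB [intro, simp]: "a \<in> OK \<Longrightarrow> a \<in> OB"
  using OK_sub_OB by blast

lemma OK_commute: "x \<in> OK \<Longrightarrow> y \<in> OK \<Longrightarrow> x * y = y * x"
  using OK_sub_K K_commute by blast

lemma iota_OK: "c \<in> val_ring v \<Longrightarrow> \<iota> c \<in> OK"
  using OK_eq iota_K iota_OB by simp

lemma pi_OK [simp]: "\<iota> \<pi> \<in> OK"
  using OK_eq iota_K pi_OB by simp

lemma sigma_add: "a \<in> OK \<Longrightarrow> b \<in> OK \<Longrightarrow> \<sigma> (a + b) = \<sigma> a + \<sigma> b"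
  and sigma_mult: "a \<in> OK \<Longrightarrow> b \<in> OK \<Longrightarrow> \<sigma> (a * b) = \<sigma> a * \<sigma> b"
  and sigma_iota: "\<sigma> (\<iota> c) = \<iota> c"
  using sigma OK_sub_K by (auto simp: is_nontrivial_automorphism_def)

lemma sigma_K [simp]: "a \<in> K \<Longrightarrow> \<sigma> a \<in> K"
  using sigma by (auto simp: is_nontrivial_automorphism_def bij_betw_def)

lemma sigma_0 [simp]: "\<sigma> 0 = 0" and sigma_1 [simp]: "\<sigma> 1 = 1"
  using sigma_iota[of 0] sigma_iota[of 1] by auto

text \<open>The product \<open>\<sigma> a * \<pi>\<^sub>B = \<pi>\<^sub>B * a\<close> lies in
  \<open>OB\<close>, and \<sigma> a is its second coefficient there.\<close>

lemma sigma_OK [simp]: assumes "a \<in> OK" shows "\<sigma> a \<in> OK"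
proof -
  have "\<sigma> a * \<pi>\<^sub>B \<in> OB" using piB_conj[OF assms, symmetric] OK_sub_OB assms by (simp add: subset_iff)
  then obtain c d where cd: "c \<in> OK" "d \<in> OK" "\<sigma> a * \<pi>\<^sub>B = c + d * \<pi>\<^sub>B" by (rule OB_E)
  have "(\<sigma> a - d) * \<pi>\<^sub>B = c" using cd by (simp add: left_diff_distrib)
  moreover have "\<sigma> a - d \<in> K" using cd assms OK_sub_K by (simp add: subset_iff)
  ultimately have "\<sigma> a - d = 0" using varpi_multiple_K(2) cd OK_sub_K by blast
  then show ?thesis using cd by simp
qed

lemma sigma_uminus: "a \<in> OK \<Longrightarrow> \<sigma> (- a) = - \<sigma> a"
  using sigma_add[of a "-a"] OK_closed by (simp add: add_eq_0_iff)

lemma sigma_diff: "a \<in> OK \<Longrightarrow> b \<in> OK \<Longrightarrow> \<sigma> (a - b) = \<sigma> a - \<sigma> b"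
  using sigma_add[of a "-b"] OK_closed sigma_uminus by simp

lemma sigma_power: "a \<in> OK \<Longrightarrow> \<sigma> (a ^ n) = \<sigma> a ^ n"
  by (induction n) (auto simp: sigma_mult OK_closed)

text \<open>Conjugating twice by \<open>\<pi>\<^sub>B\<close> is conjugating by its square, which is
  central.\<close>

lemma sigma_sigma [simp]: assumes "a \<in> OK" shows "\<sigma> (\<sigma> a) = a"
proof -
  have "\<sigma> (\<sigma> a) * (\<pi>\<^sub>B * \<pi>\<^sub>B) = \<pi>\<^sub>B * (\<pi>\<^sub>B * a)"
    by (simp add: piB_conj[OF sigma_OK[OF assms], symmetric] piB_conj[OF assms] mult.assoc[symmetric])
  also have "\<dots> = a * (\<pi>\<^sub>B * \<pi>\<^sub>B)" by (metis iota_commute varpi_sq mult.assoc)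
  finally show ?thesis by simp
qed

lemma varpi_conj': "a \<in> OK \<Longrightarrow> a * \<pi>\<^sub>B = \<pi>\<^sub>B * \<sigma> a"
  using piB_conj[of "\<sigma> a"] sigma_OK by simp

lemma OK_nonunits: "{x \<in> OK. x = 0 \<or> inverse x \<notin> OK} = {\<iota> \<pi> * x | x. x \<in> OK}"
proof -
  have "{\<iota> c * x | c x. c \<in> val_ideal v \<and> x \<in> OK} = {\<iota> \<pi> * x | x. x \<in> OK}"
  proof safe
    fix c x assume cx: "c \<in> val_ideal v" "x \<in> OK"
    define d where "d = inverse \<pi> * c"
    have "d \<in> val_ring v" using cx pi_nz val_pi
      by (cases "c = 0") (auto simp: val_ideal_def val_ring_def val_ge_def d_def val_mult val_inverse)
    then have "\<iota> d * x \<in> OK" using cx iota_OK by simp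
    moreover have "\<iota> c * x = \<iota> \<pi> * (\<iota> d * x)"
      using pi_nz by (simp add: d_def mult.assoc[symmetric] flip: iota.hom_mult)
    ultimately show "\<exists>xa. \<iota> c * x = \<iota> \<pi> * xa \<and> xa \<in> OK" by blast
  next
    fix x assume "x \<in> OK"
    then show "\<exists>c xa. \<iota> \<pi> * x = \<iota> c * xa \<and> c \<in> val_ideal v \<and> xa \<in> OK"
      using val_pi by (intro exI[of _ \<pi>] exI[of _ x]) (auto simp: val_ideal_def val_ge_def)
  qed
  then show ?thesis using unramified by (simp add: is_unramified_def)
qed

lemma OK_unit: "a \<in> OK \<Longrightarrow> a \<notin> (*) (\<iota> \<pi>) ` OK \<Longrightarrow> a \<noteq> 0 \<and> inverse a \<in> OK"
  using OK_nonunits by (auto simp: image_def)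

lemma inverse_pi_notin: "inverse (\<iota> \<pi>) \<notin> OK"
proof -
  have "\<iota> \<pi> * 1 \<in> {x \<in> OK. x = 0 \<or> inverse x \<notin> OK}"
    unfolding OK_nonunits using OK_closed by blast
  then show ?thesis using pi_nz by auto
qed

lemma one_notin_pi_OK: "1 \<notin> (*) (\<iota> \<pi>) ` OK"
proof
  assume "1 \<in> (*) (\<iota> \<pi>) ` OK"
  then obtain x where "x \<in> OK" "1 = \<iota> \<pi> * x" by auto
  then show False using inverse_pi_notin inverse_unique[of "\<iota> \<pi>" x] by simp
qed

lemma pi_OK_closed:
  "x \<in> (*) (\<iota> \<pi>) ` OK \<Longrightarrow> y \<in> (*) (\<iota> \<pi>) ` OK \<Longrightarrow> x + y \<in> (*) (\<iota> \<pi>) ` OK"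
  "x \<in> (*) (\<iota> \<pi>) ` OK \<Longrightarrow> y \<in> (*) (\<iota> \<pi>) ` OK \<Longrightarrow> x - y \<in> (*) (\<iota> \<pi>) ` OK"
  "x \<in> (*) (\<iota> \<pi>) ` OK \<Longrightarrow> a \<in> OK \<Longrightarrow> x * a \<in> (*) (\<iota> \<pi>) ` OK"
  "x \<in> (*) (\<iota> \<pi>) ` OK \<Longrightarrow> a \<in> OK \<Longrightarrow> a * x \<in> (*) (\<iota> \<pi>) ` OK"
  "0 \<in> (*) (\<iota> \<pi>) ` OK"
proof -
  have eq: "y \<in> (*) (\<iota> \<pi>) ` OK \<longleftrightarrow> (\<exists>z\<in>OK. y = \<iota> \<pi> * z)" for y by auto
  show "x \<in> (*) (\<iota> \<pi>) ` OK \<Longrightarrow> y \<in> (*) (\<iota> \<pi>) ` OK \<Longrightarrow> x + y \<in> (*) (\<iota> \<pi>) ` OK"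
    "x \<in> (*) (\<iota> \<pi>) ` OK \<Longrightarrow> y \<in> (*) (\<iota> \<pi>) ` OK \<Longrightarrow> x - y \<in> (*) (\<iota> \<pi>) ` OK"
    unfolding eq by (auto simp flip: distrib_left right_diff_distrib)
  show r: "x \<in> (*) (\<iota> \<pi>) ` OK \<Longrightarrow> a \<in> OK \<Longrightarrow> x * a \<in> (*) (\<iota> \<pi>) ` OK" for x a
    unfolding eq by (auto simp: mult.assoc)
  show "x \<in> (*) (\<iota> \<pi>) ` OK \<Longrightarrow> a \<in> OK \<Longrightarrow> a * x \<in> (*) (\<iota> \<pi>) ` OK"
    using r[of x a] OK_commute[of a x] by auto
  show "0 \<in> (*) (\<iota> \<pi>) ` OK" unfolding eq using zero_OK by (intro bexI[of _ 0]) auto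
qed

section \<open>The ideal generated by \<open>\<pi>\<^sub>B\<close> and the units of
  \<open>OB\<close>\<close>

lemma OB_left_varpi: "x \<in> OB \<Longrightarrow> \<exists>y\<in>OB. \<pi>\<^sub>B * x = y * \<pi>\<^sub>B"
proof -
  assume "x \<in> OB"
  then obtain a b where ab: "a \<in> OK" "b \<in> OK" "x = a + b * \<pi>\<^sub>B" by (rule OB_E)
  then have "\<pi>\<^sub>B * x = (\<sigma> a + \<sigma> b * \<pi>\<^sub>B) * \<pi>\<^sub>B"
    using piB_conj by (simp add: distrib_left distrib_right mult.assoc[symmetric])
  moreover have "\<sigma> a + \<sigma> b * \<pi>\<^sub>B \<in> OB" using ab sigma_OK OB_decompose(1) by blast
  ultimately show ?thesis by blast
qed

text \<open>Conjugation by \<open>\<pi>\<^sub>B\<close> acts on the two coefficients through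
  \<sigma> and so preserves \<open>OB\<close>. Together with \<open>OB_left_varpi\<close> this makes
  the ideal generated by \<open>\<pi>\<^sub>B\<close> two-sided.\<close>

lemma OB_right_varpi: "x \<in> OB \<Longrightarrow> \<exists>y\<in>OB. x * \<pi>\<^sub>B = \<pi>\<^sub>B * y"
proof -
  assume "x \<in> OB"
  then obtain a b where ab: "a \<in> OK" "b \<in> OK" "x = a + b * \<pi>\<^sub>B" by (rule OB_E)
  then have "x * \<pi>\<^sub>B = \<pi>\<^sub>B * (\<sigma> a + \<sigma> b * \<pi>\<^sub>B)"
    using varpi_conj'[of a] varpi_conj'[of b]
    by (simp add: distrib_left distrib_right flip: mult.assoc)
  moreover have "\<sigma> a + \<sigma> b * \<pi>\<^sub>B \<in> OB" using ab sigma_OK OB_decompose(1) by blast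
  ultimately show ?thesis by blast
qed

text \<open>In \<open>\<pi>\<^sub>B * (c + e * \<pi>\<^sub>B) = \<iota> \<pi> * \<sigma> e +
  \<sigma> c * \<pi>\<^sub>B\<close> the first coefficient runs through the multiples of \<pi>, and
  the second one is arbitrary.\<close>

lemma OB_nonunit_coeff: 
  assumes "a \<in> OK" "b \<in> OK" 
  shows "a + b * \<pi>\<^sub>B \<in> (*) \<pi>\<^sub>B ` OB \<longleftrightarrow> a \<in> (*) (\<iota> \<pi>) ` OK"
proof
  assume "a + b * \<pi>\<^sub>B \<in> (*) \<pi>\<^sub>B ` OB"
  then obtain y where y: "y \<in> OB" "a + b * \<pi>\<^sub>B = \<pi>\<^sub>B * y" by auto
  then obtain c d where cd: "c \<in> OK" "d \<in> OK" "y = c + d * \<pi>\<^sub>B" using OB_E by blast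
  have "a + b * \<pi>\<^sub>B = \<iota> \<pi> * \<sigma> d + \<sigma> c * \<pi>\<^sub>B"
    using cd y piB_conj varpi_sq iota_commute[of \<pi> "\<sigma> d"]
    by (simp add: distrib_left mult.assoc[symmetric]) (simp add: mult.assoc)
  then have "a = \<iota> \<pi> * \<sigma> d"
    using OB_decompose(2)[of a b "\<iota> \<pi> * \<sigma> d" "\<sigma> c"] assms cd sigma_OK pi_OK OK_closed by simp
  then show "a \<in> (*) (\<iota> \<pi>) ` OK" using cd sigma_OK by blast
next
  assume "a \<in> (*) (\<iota> \<pi>) ` OK"
  then obtain c where c: "c \<in> OK" "a = \<iota> \<pi> * c" by auto
  have "a + b * \<pi>\<^sub>B = \<pi>\<^sub>B * (\<pi>\<^sub>B * c + \<sigma> b)"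
    using c varpi_conj'[OF assms(2)] by (simp add: varpi_sq[symmetric] distrib_left mult.assoc)
  moreover have "\<pi>\<^sub>B * c + \<sigma> b \<in> OB" using c assms by simp
  ultimately show "a + b * \<pi>\<^sub>B \<in> (*) \<pi>\<^sub>B ` OB" by blast
qed

text \<open>\<open>OB\<close> is local. The first coefficient \<open>a\<close> is a unit of
  \<open>OK\<close> and can be pulled out; what remains, \<open>1 + c * \<pi>\<^sub>B\<close>, is
  inverted through its conjugate \<open>1 - c * \<pi>\<^sub>B\<close>, since their product
  \<open>u\<close> is congruent to 1 modulo \<pi>.\<close>

lemma OB_unit: assumes "x \<in> OB" "x \<notin> (*) \<pi>\<^sub>B ` OB" shows "x \<noteq> 0" "inverse x \<in> OB"
proof -
  show nz: "x \<noteq> 0" using assms(2) OB_closed(1) by force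
  obtain a b where ab: "a \<in> OK" "b \<in> OK" "x = a + b * \<pi>\<^sub>B" using assms(1) by (rule OB_E)
  have a: "a \<noteq> 0" "inverse a \<in> OK" using OK_unit ab OB_nonunit_coeff assms(2) by blast+
  define c where "c = inverse a * b"
  have c: "c \<in> OK" using a ab c_def by simp
  have x: "x = a * (1 + c * \<pi>\<^sub>B)" using ab a by (simp add: c_def distrib_left mult.assoc[symmetric])
  have n: "c * \<sigma> c \<in> OK" using c by simp
  define u where "u = 1 - \<iota> \<pi> * (c * \<sigma> c)"
  have u: "u \<in> OK" unfolding u_def using n by simp
  have "u \<notin> (*) (\<iota> \<pi>) ` OK"
  proof
    assume "u \<in> (*) (\<iota> \<pi>) ` OK"
    then have "u + \<iota> \<pi> * (c * \<sigma> c) \<in> (*) (\<iota> \<pi>) ` OK" using n by (intro pi_OK_closed) auto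
    then show False using one_notin_pi_OK u_def by simp
  qed
  then have iu: "u \<noteq> 0" "inverse u \<in> OK" using OK_unit u by blast+
  have "c * \<pi>\<^sub>B * (c * \<pi>\<^sub>B) = c * (\<pi>\<^sub>B * c) * \<pi>\<^sub>B" by (simp add: mult.assoc)
  also have "\<dots> = c * \<sigma> c * (\<pi>\<^sub>B * \<pi>\<^sub>B)" by (simp add: piB_conj[OF c] mult.assoc)
  also have "\<dots> = \<iota> \<pi> * (c * \<sigma> c)" by (simp add: varpi_sq iota_commute)
  finally have "(1 + c * \<pi>\<^sub>B) * (1 - c * \<pi>\<^sub>B) = u"
    by (simp add: u_def ring_distribs)
  then have "x * ((1 - c * \<pi>\<^sub>B) * (inverse u * inverse a)) = 1"
    using iu a by (simp add: x mult.assoc) (simp add: mult.assoc[symmetric])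
  then have "inverse x = (1 - c * \<pi>\<^sub>B) * (inverse u * inverse a)" by (rule inverse_unique)
  then show "inverse x \<in> OB" using iu a c by simp
qed

text \<open>If x is nonzero, some \<open>\<iota> (\<pi> ^ m) * inverse x\<close> lies in
  \<open>OB\<close>. Were x divisible by \<open>\<iota> (\<pi> ^ Suc m)\<close>, the one extra
  factor \<pi> would become invertible in \<open>OB\<close>.\<close>

lemma pi_power_separated: assumes "\<And>n. x \<in> (*) (\<iota> (\<pi> ^ n)) ` OB" shows "x = 0"
proof (rule ccontr)
  assume nz: "x \<noteq> 0"
  obtain m where m: "\<iota> (\<pi> ^ m) * inverse x \<in> OB" by (rule pi_multiple_OB)
  define z where "z = \<iota> (\<pi> ^ m) * inverse x"
  obtain y where y: "y \<in> OB" "x = \<iota> (\<pi> ^ Suc m) * y" using assms by blast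
  have "\<iota> (\<pi> ^ m) = z * x" using nz unfolding z_def by (simp add: mult.assoc)
  also have "\<dots> = \<iota> (\<pi> ^ Suc m) * (z * y)"
    using y iota_commute[of "\<pi> ^ Suc m" z] by (metis mult.assoc)
  also have "\<dots> = \<iota> (\<pi> ^ m) * (\<iota> \<pi> * (z * y))"
    by (metis iota.hom_mult mult.assoc power_Suc2)
  finally have "\<iota> (\<pi> ^ m) * 1 = \<iota> (\<pi> ^ m) * (\<iota> \<pi> * (z * y))" by (simp only: mult_1_right)
  then have "\<iota> \<pi> * (z * y) = 1"
    using pi_nz by (metis iota_eq_0 mult_cancel_left power_not_zero)
  then have "inverse (\<iota> \<pi>) = z * y" by (rule inverse_unique)
  moreover have "z * y \<in> OB" using m y z_def by simp
  ultimately have "inverse (\<iota> \<pi>) \<in> OK" using OK_eq iota_K K_inverse by (metis IntI)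
  then show False using inverse_pi_notin by simp
qed

end

subsection \<open>The residue field\<close>

text \<open>The residues in \<open>R\<close> may lie outside \<open>A\<close>; choosing one element
  of \<open>A\<close> over every residue that occurs gives representatives inside \<open>A\<close>.
  This carries finiteness from \<open>OB\<close> down to \<open>OK\<close>.\<close>

lemma subset_transversal:
  assumes "finite R" "\<And>x. x \<in> A \<Longrightarrow> \<exists>r\<in>R. P x r"
  shows "\<exists>T. finite T \<and> T \<subseteq> A \<and> (\<forall>x\<in>A. \<exists>t\<in>T. \<exists>r. P x r \<and> P t r)"
proof -
  obtain f where f: "\<And>x. x \<in> A \<Longrightarrow> f x \<in> R \<and> P x (f x)" using assms(2) by metis
  define g where "g r = (SOME x. x \<in> A \<and> f x = r)" for r
  have g: "g (f x) \<in> A \<and> f (g (f x)) = f x" if "x \<in> A" for x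
    unfolding g_def by (rule someI[of "\<lambda>y. y \<in> A \<and> f y = f x"]) (use that in auto)
  have "f ` A \<subseteq> R" using f by blast
  then have "finite (f ` A)" using assms(1) finite_subset by blast
  show ?thesis
  proof (intro exI conjI ballI)
    show "finite (g ` f ` A)" using \<open>finite (f ` A)\<close> by blast
    show "g ` f ` A \<subseteq> A" using g by blast
    fix x assume x: "x \<in> A"
    have "P x (f x)" "P (g (f x)) (f x)" using f[OF x] f[of "g (f x)"] g[OF x] by auto
    then show "\<exists>t\<in>g ` f ` A. \<exists>r. P x r \<and> P t r" using x by blast
  qed
qed

context quaternion_setting
begin

lemma OF_residues: obtains T where "finite T" "T \<subseteq> val_ring v"
  "\<And>x. x \<in> val_ring v \<Longrightarrow> \<exists>t\<in>T. \<exists>y\<in>val_ring v. x = t + \<pi> * y"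
proof -
  define r where "r = {(x, y). x \<in> val_ring v \<and> y \<in> val_ring v \<and> x - y \<in> val_ideal v}"
  have sym: "y - x \<in> val_ideal v" if "x - y \<in> val_ideal v" for x y
    using that val_uminus[of "x - y"] by (cases "x = y") (auto simp: val_ideal_def val_ge_def)
  have ex: "\<exists>r'\<in>val_ring v // r. r' \<in> val_ring v // r \<and> x \<in> r'" if "x \<in> val_ring v" for x
    using that by (intro bexI[of _ "r `` {x}"]) (auto simp: r_def quotient_def val_ideal_def val_ge_def)
  have fin: "finite (val_ring v // r)" using finite_residue_field by (simp add: r_def)
  obtain T where T: "finite T" "T \<subseteq> val_ring v"
    "\<forall>x\<in>val_ring v. \<exists>t\<in>T. \<exists>r'. (r' \<in> val_ring v // r \<and> x \<in> r') \<and> (r' \<in> val_ring v // r \<and> t \<in> r')"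
    using subset_transversal[of "val_ring v // r" "val_ring v" "\<lambda>x r'. r' \<in> val_ring v // r \<and> x \<in> r'", OF fin] ex
    by auto
  show thesis
  proof (rule that[OF T(1,2)])
    fix x assume "x \<in> val_ring v"
    then obtain t z where t: "t \<in> T" "z \<in> val_ring v" "(z, x) \<in> r" "(z, t) \<in> r"
      using T(3) unfolding quotient_def by blast
    have "x - t = (z - t) - (z - x)" by simp
    then have "x - t \<in> val_ideal v"
      using t(3,4) val_ge_diff[of "z - t" 1 "z - x"] by (simp add: r_def val_ideal_def)
    then have "(x - t) / \<pi> \<in> val_ring v"
      using val_mult[of "x - t" "inverse \<pi>"] val_inverse[of \<pi>] pi_nz val_pi
      by (cases "x = t") (auto simp: val_ideal_def val_ring_def val_ge_def divide_inverse)
    then show "\<exists>t\<in>T. \<exists>y\<in>val_ring v. x = t + \<pi> * y"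
      using t(1) pi_nz by (intro bexI[of _ t] bexI[of _ "(x - t) / \<pi>"]) simp_all
  qed
qed

text \<open>\<open>OB\<close> is generated by a finite set over the valuation ring, so it suffices
  to reduce the coordinates modulo \<pi>.\<close>

lemma OB_residues: obtains R where "finite R" "R \<subseteq> OB" "\<And>x. x \<in> OB \<Longrightarrow> \<exists>r\<in>R. x - r \<in> (*) (\<iota> \<pi>) ` OB"
proof -
  obtain S where S: "finite S" "OB = {(\<Sum>s\<in>S. \<iota> (c s) * s) | c. \<forall>s\<in>S. c s \<in> val_ring v}"
    by (rule OB_generators)
  obtain T where T: "finite T" "T \<subseteq> val_ring v"
    "\<And>x. x \<in> val_ring v \<Longrightarrow> \<exists>t\<in>T. \<exists>y\<in>val_ring v. x = t + \<pi> * y" by (rule OF_residues) (rule that)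
  define R where "R = (\<lambda>c. \<Sum>s\<in>S. \<iota> (c s) * s) ` (PiE S (\<lambda>_. T))"
  have "finite R" unfolding R_def using S(1) T(1) by (intro finite_imageI finite_PiE) auto
  moreover have "R \<subseteq> OB"
  proof
    fix x assume "x \<in> R"
    then obtain c where c: "c \<in> PiE S (\<lambda>_. T)" "x = (\<Sum>s\<in>S. \<iota> (c s) * s)" unfolding R_def by (elim imageE)
    then have "\<forall>s\<in>S. c s \<in> val_ring v" using T(2) by (auto simp: PiE_def Pi_def)
    then show "x \<in> OB" unfolding S(2) mem_Collect_eq using c(2) by (intro exI[of _ c] conjI)
  qed
  moreover have "\<exists>r\<in>R. x - r \<in> (*) (\<iota> \<pi>) ` OB" if x: "x \<in> OB" for x
  proof -
    obtain d where d: "x = (\<Sum>s\<in>S. \<iota> (d s) * s)" "\<forall>s\<in>S. d s \<in> val_ring v"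
      using x unfolding S(2) mem_Collect_eq by (elim exE conjE) (rule that)
    obtain t y where ty: "\<And>s. s \<in> S \<Longrightarrow> t s \<in> T" "\<And>s. s \<in> S \<Longrightarrow> y s \<in> val_ring v"
      "\<And>s. s \<in> S \<Longrightarrow> d s = t s + \<pi> * y s"
    proof -
      have "\<forall>s\<in>S. \<exists>p. fst p \<in> T \<and> snd p \<in> val_ring v \<and> d s = fst p + \<pi> * snd p"
      proof
        fix s assume "s \<in> S"
        then obtain t y where "t \<in> T" "y \<in> val_ring v" "d s = t + \<pi> * y" using d(2) T(3) by blast
        then show "\<exists>p. fst p \<in> T \<and> snd p \<in> val_ring v \<and> d s = fst p + \<pi> * snd p"
          by (intro exI[of _ "(t, y)"]) simp
      qed
      from bchoice[OF this] obtain p where "\<forall>s\<in>S. fst (p s) \<in> T \<and> snd (p s) \<in> val_ring v \<and> d s = fst (p s) + \<pi> * snd (p s)" ..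
      then show thesis using that[of "\<lambda>s. fst (p s)" "\<lambda>s. snd (p s)"] by simp
    qed
    \<comment> \<open>The restriction is there because \<open>PiE\<close> only contains functions
      with a fixed value outside \<open>S\<close>.\<close>
    define r where "r = (\<Sum>s\<in>S. \<iota> (restrict t S s) * s)"
    have r: "r \<in> R" unfolding R_def r_def using ty(1) by (intro imageI PiE_I) simp_all
    have "(\<Sum>s\<in>S. \<iota> (y s) * s) \<in> OB"
      unfolding S(2) mem_Collect_eq by (intro exI[of _ y] conjI ballI refl) (rule ty(2))
    moreover have "x - r = \<iota> \<pi> * (\<Sum>s\<in>S. \<iota> (y s) * s)"
    proof -
      have "\<iota> (d s) * s - \<iota> (restrict t S s) * s = \<iota> \<pi> * (\<iota> (y s) * s)" if "s \<in> S" for s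
        using that by (simp only: ty(3) restrict_apply' iota.hom_add iota.hom_mult distrib_right mult.assoc add_diff_cancel_left')
      then have "(\<Sum>s\<in>S. \<iota> (d s) * s - \<iota> (restrict t S s) * s) = (\<Sum>s\<in>S. \<iota> \<pi> * (\<iota> (y s) * s))"
        by (rule sum.cong[OF refl])
      then show ?thesis by (simp only: d(1) r_def sum_subtractf sum_distrib_left)
    qed
    ultimately have "x - r \<in> (*) (\<iota> \<pi>) ` OB" by (rule image_eqI[rotated])
    then show ?thesis using r by (rule bexI)
  qed
  ultimately show thesis using that by presburger
qed

text \<open>Finiteness is inherited from \<open>OB\<close>: if two elements of \<open>OK\<close> are
  congruent modulo \<pi> in \<open>OB\<close>, their difference divided by \<pi> lies in
  \<open>K\<close> and in \<open>OB\<close>, hence in \<open>OK\<close>.\<close>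

lemma OK_residues: obtains T where "finite T" "T \<subseteq> OK" "\<And>x. x \<in> OK \<Longrightarrow> \<exists>t\<in>T. x - t \<in> (*) (\<iota> \<pi>) ` OK"
proof -
  obtain R where R: "finite R" "R \<subseteq> OB" "\<And>x. x \<in> OB \<Longrightarrow> \<exists>r\<in>R. x - r \<in> (*) (\<iota> \<pi>) ` OB"
    by (rule OB_residues) (rule that)
  obtain T where T: "finite T" "T \<subseteq> OK"
    "\<forall>x\<in>OK. \<exists>t\<in>T. \<exists>r. x - r \<in> (*) (\<iota> \<pi>) ` OB \<and> t - r \<in> (*) (\<iota> \<pi>) ` OB"
  proof -
    have "\<exists>T. finite T \<and> T \<subseteq> OK \<and> (\<forall>x\<in>OK. \<exists>t\<in>T. \<exists>r. x - r \<in> (*) (\<iota> \<pi>) ` OB \<and> t - r \<in> (*) (\<iota> \<pi>) ` OB)"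
      by (rule subset_transversal[OF R(1)]) (rule R(3)[OF OK_OB])
    then show thesis by (elim exE conjE) (rule that)
  qed
  have *: "x - t \<in> (*) (\<iota> \<pi>) ` OK" if xt: "x \<in> OK" "t \<in> OK"
    "x - r \<in> (*) (\<iota> \<pi>) ` OB" "t - r \<in> (*) (\<iota> \<pi>) ` OB" for x t r
  proof -
    obtain y z where yz: "y \<in> OB" "z \<in> OB" "x - r = \<iota> \<pi> * y" "t - r = \<iota> \<pi> * z" using xt by auto
    have "x - t = (x - r) - (t - r)" by simp
    also have "\<dots> = \<iota> \<pi> * (y - z)" using yz by (simp add: right_diff_distrib)
    finally have e: "x - t = \<iota> \<pi> * (y - z)" .
    then have "y - z = inverse (\<iota> \<pi>) * (x - t)" using pi_nz by (simp add: mult.assoc[symmetric])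
    then have "y - z \<in> K" using xt OK_sub_K K_inverse iota_K by (simp add: subset_iff)
    then have "y - z \<in> OK" using OK_eq yz by simp
    then show ?thesis using e by blast
  qed
  then have "\<exists>t\<in>T. x - t \<in> (*) (\<iota> \<pi>) ` OK" if "x \<in> OK" for x
  proof -
    from bspec[OF T(3) that] obtain t r
      where t: "t \<in> T" "x - r \<in> (*) (\<iota> \<pi>) ` OB" "t - r \<in> (*) (\<iota> \<pi>) ` OB" by (elim bexE exE conjE)
    have "x - t \<in> (*) (\<iota> \<pi>) ` OK" using T(2) t(1) by (intro *[OF that _ t(2,3)]) (rule subsetD)
    then show ?thesis using t(1) by (rule bexI)
  qed
  then show thesis by (rule that[OF T(1,2)])
qed

text \<open>The predicate depends only on the coset of x, so congruent elements receive the same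
  representative. The residue field of \<open>K\<close> is modelled by the set \<open>res\<close>
  followed by its argument set \<open>OK\<close>, that is, by the representatives
  themselves.\<close>

definition res :: "'b \<Rightarrow> 'b" where
  "res x = (SOME y. y \<in> OK \<and> x - y \<in> (*) (\<iota> \<pi>) ` OK)"

lemma res: assumes "x \<in> OK" shows "res x \<in> OK" "x - res x \<in> (*) (\<iota> \<pi>) ` OK"
  using someI[of "\<lambda>y. y \<in> OK \<and> x - y \<in> (*) (\<iota> \<pi>) ` OK" x] assms pi_OK_closed(5)
  unfolding res_def by auto

declare res(1) [simp]

lemma res_eq_iff: assumes "x \<in> OK" "y \<in> OK" shows "res x = res y \<longleftrightarrow> x - y \<in> (*) (\<iota> \<pi>) ` OK"
proof
  assume "res x = res y"
  then have "x - y = (x - res x) - (y - res y)" by simp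
  then show "x - y \<in> (*) (\<iota> \<pi>) ` OK" using pi_OK_closed(2)[OF res(2) res(2)] assms by metis
next
  assume a: "x - y \<in> (*) (\<iota> \<pi>) ` OK"
  have "x - z \<in> (*) (\<iota> \<pi>) ` OK \<longleftrightarrow> y - z \<in> (*) (\<iota> \<pi>) ` OK" for z
    using pi_OK_closed(1)[OF a, of "y - z"] pi_OK_closed(2)[OF _ a, of "x - z"] by auto
  then show "res x = res y" unfolding res_def by metis
qed

lemma res_res [simp]: "x \<in> OK \<Longrightarrow> res (res x) = res x"
  using res_eq_iff[of x "res x"] res by simp

lemma res_mult: assumes "x \<in> OK" "y \<in> OK" shows "res (res x * y) = res (x * y)"
proof -
  have "x * y - res x * y = (x - res x) * y" by (simp add: left_diff_distrib)
  then have "x * y - res x * y \<in> (*) (\<iota> \<pi>) ` OK" using pi_OK_closed(3)[OF res(2)] assms by simp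
  then show ?thesis using res_eq_iff[of "x * y" "res x * y"] assms by simp
qed

lemma finite_residues: "finite (res ` OK)"
proof -
  obtain T where T: "finite T" "T \<subseteq> OK" "\<And>x. x \<in> OK \<Longrightarrow> \<exists>t\<in>T. x - t \<in> (*) (\<iota> \<pi>) ` OK"
    by (rule OK_residues) (rule that)
  have "res ` OK \<subseteq> res ` T"
  proof
    fix y assume "y \<in> res ` OK"
    then obtain x where x: "x \<in> OK" "y = res x" by (elim imageE)
    from T(3)[OF x(1)] obtain t where t: "t \<in> T" "x - t \<in> (*) (\<iota> \<pi>) ` OK" by (elim bexE)
    then have "y = res t" using x res_eq_iff[of x t] subsetD[OF T(2)] by simp
    then show "y \<in> res ` T" using t(1) by (rule image_eqI)
  qed
  then show ?thesis using T(1) finite_subset by blast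
qed

abbreviation q where "q \<equiv> card (res ` OK)"

lemma q_gt_1: "q > 1"
proof -
  have "res 0 \<noteq> res 1" using res_eq_iff[of 1 0] one_notin_pi_OK by auto
  then have "card {res 0, res 1} = 2" by simp
  moreover have "{res 0, res 1} \<subseteq> res ` OK" by auto
  ultimately have "2 \<le> q" using card_mono[OF finite_residues, of "{res 0, res 1}"] by simp
  then show ?thesis by simp
qed

lemma sum_pi_OK: "(\<And>x. x \<in> A \<Longrightarrow> f x \<in> (*) (\<iota> \<pi>) ` OK) \<Longrightarrow> sum f A \<in> (*) (\<iota> \<pi>) ` OK"
  by (induction A rule: infinite_finite_induct) (auto simp: pi_OK_closed)

text \<open>Adding 1 permutes the residues. Comparing the sum of all representatives before and
  after the permutation leaves q times 1 as a multiple of \<pi>.\<close>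

lemma q_pi_OK: "of_nat q \<in> (*) (\<iota> \<pi>) ` OK"
proof -
  let ?T = "res ` OK"
  have T: "t \<in> OK" "res t = t" if "t \<in> ?T" for t using that by auto
  have "inj_on (\<lambda>t. res (t + 1)) ?T"
  proof (rule inj_onI)
    fix s t assume st: "s \<in> ?T" "t \<in> ?T" "res (s + 1) = res (t + 1)"
    then have "s - t \<in> (*) (\<iota> \<pi>) ` OK" using res_eq_iff[of "s + 1" "t + 1"] T(1)[OF st(1)] T(1)[OF st(2)] by simp
    then have "res s = res t" using res_eq_iff[of s t] T(1)[OF st(1)] T(1)[OF st(2)] by simp
    then show "s = t" using T(2)[OF st(1)] T(2)[OF st(2)] by simp
  qed
  moreover have "(\<lambda>t. res (t + 1)) ` ?T \<subseteq> ?T" by (auto intro!: imageI)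
  ultimately have "bij_betw (\<lambda>t. res (t + 1)) ?T ?T"
    using finite_residues by (simp add: bij_betw_def endo_inj_surj)
  then have "(\<Sum>t\<in>?T. res (t + 1)) = (\<Sum>t\<in>?T. t)" by (rule sum.reindex_bij_betw)
  then have "of_nat q = (\<Sum>t\<in>?T. (t + 1) - res (t + 1))"
    by (simp add: sum_subtractf sum.distrib)
  moreover have "(\<Sum>t\<in>?T. (t + 1) - res (t + 1)) \<in> (*) (\<iota> \<pi>) ` OK"
    by (intro sum_pi_OK res OK_closed T)
  ultimately show ?thesis by simp
qed

text \<open>The multiplicative group of the residue field, carried by representatives; it is built
  to apply Lagrange's theorem in \<open>power_q\<close>.\<close>

definition residue_units :: "'b monoid" where
  "residue_units = \<lparr>carrier = res ` OK - {res 0}, mult = (\<lambda>x y. res (x * y)), one = res 1\<rparr>"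

lemma res_eq_0_iff: "x \<in> OK \<Longrightarrow> res x = res 0 \<longleftrightarrow> x \<in> (*) (\<iota> \<pi>) ` OK"
  using res_eq_iff[of x 0] by simp

lemma pi_OK_prime: assumes "x \<in> OK" "y \<in> OK" "x * y \<in> (*) (\<iota> \<pi>) ` OK"
  shows "x \<in> (*) (\<iota> \<pi>) ` OK \<or> y \<in> (*) (\<iota> \<pi>) ` OK"
proof (rule disjCI)
  assume "y \<notin> (*) (\<iota> \<pi>) ` OK"
  then have y: "y \<noteq> 0" "inverse y \<in> OK" using OK_unit assms(2) by auto
  then have "x * y * inverse y \<in> (*) (\<iota> \<pi>) ` OK" using pi_OK_closed(3)[OF assms(3)] by simp
  then show "x \<in> (*) (\<iota> \<pi>) ` OK" using y by (simp add: mult.assoc)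
qed

lemma group_residue_units: "group residue_units"
proof (rule groupI)
  show "\<one>\<^bsub>residue_units\<^esub> \<in> carrier residue_units"
    using res_eq_0_iff[of 1] one_notin_pi_OK by (auto simp: residue_units_def)
next
  fix x y assume "x \<in> carrier residue_units" "y \<in> carrier residue_units"
  then obtain a b where ab: "a \<in> OK" "b \<in> OK" "x = res a" "y = res b" "res a \<noteq> res 0" "res b \<noteq> res 0"
    by (auto simp: residue_units_def)
  then have "res a * res b \<notin> (*) (\<iota> \<pi>) ` OK"
    using pi_OK_prime[of "res a" "res b"] res_eq_0_iff[of "res a"] res_eq_0_iff[of "res b"] by auto
  then show "x \<otimes>\<^bsub>residue_units\<^esub> y \<in> carrier residue_units"
    using ab res_eq_0_iff[of "res a * res b"] by (auto simp: residue_units_def)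
  fix z assume "z \<in> carrier residue_units"
  then obtain c where c: "c \<in> OK" "z = res c" by (auto simp: residue_units_def)
  show "x \<otimes>\<^bsub>residue_units\<^esub> y \<otimes>\<^bsub>residue_units\<^esub> z = x \<otimes>\<^bsub>residue_units\<^esub> (y \<otimes>\<^bsub>residue_units\<^esub> z)"
    using ab c res_mult[of "res a * res b" "res c"] res_mult[of "res b * res c" "res a"]
      OK_commute[of "res a" "res (res b * res c)"] OK_commute[of "res b * res c" "res a"]
    by (simp add: residue_units_def mult.assoc)
next
  fix x assume "x \<in> carrier residue_units"
  then obtain a where a: "a \<in> OK" "x = res a" "res a \<noteq> res 0"
    by (auto simp: residue_units_def)
  then show "\<one>\<^bsub>residue_units\<^esub> \<otimes>\<^bsub>residue_units\<^esub> x = x"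
    using res_mult[of 1 "res a"] by (simp add: residue_units_def)
  have u: "res a \<noteq> 0" "inverse (res a) \<in> OK" using OK_unit[of "res a"] res_eq_0_iff[of "res a"] a by auto
  have "inverse (res a) \<notin> (*) (\<iota> \<pi>) ` OK"
  proof
    assume "inverse (res a) \<in> (*) (\<iota> \<pi>) ` OK"
    then have "inverse (res a) * res a \<in> (*) (\<iota> \<pi>) ` OK" using a pi_OK_closed(3) by simp
    then show False using u one_notin_pi_OK by simp
  qed
  then have "res (inverse (res a)) \<in> carrier residue_units"
    using u res_eq_0_iff by (auto simp: residue_units_def)
  moreover have "res (inverse (res a)) \<otimes>\<^bsub>residue_units\<^esub> x = \<one>\<^bsub>residue_units\<^esub>"
    using a u res_mult[of "inverse (res a)" "res a"] by (simp add: residue_units_def)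
  ultimately show "\<exists>y\<in>carrier residue_units. y \<otimes>\<^bsub>residue_units\<^esub> x = \<one>\<^bsub>residue_units\<^esub>" by blast
qed

text \<open>Fermat's little theorem for the residue field: Lagrange's theorem for nonzero residues,
  while for the zero residue both terms are divisible by \<pi>.\<close>

lemma power_q: assumes "x \<in> OK" shows "x ^ q - x \<in> (*) (\<iota> \<pi>) ` OK"
proof (cases "x \<in> (*) (\<iota> \<pi>) ` OK")
  case True
  obtain m where "q = Suc m" using q_gt_1 by (metis less_imp_Suc_add)
  then show ?thesis using True assms by (simp add: pi_OK_closed)
next
  case False
  interpret G: group residue_units by (rule group_residue_units)
  have pow: "res x [^]\<^bsub>residue_units\<^esub> n = res (x ^ n)" for n :: nat
  proof (induction n)
    case 0 show ?case by (simp add: residue_units_def)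
  next
    case (Suc n)
    have "res (res (x ^ n) * res x) = res (x ^ n * res x)" using assms by (intro res_mult) simp_all
    also have "x ^ n * res x = res x * x ^ n" using assms by (intro OK_commute) simp_all
    also have "res (res x * x ^ n) = res (x * x ^ n)" using assms by (intro res_mult) simp_all
    finally show ?case using Suc by (simp add: residue_units_def)
  qed
  have "res x \<in> carrier residue_units" using False assms res_eq_0_iff by (simp add: residue_units_def)
  then have "res x [^]\<^bsub>residue_units\<^esub> order residue_units = \<one>\<^bsub>residue_units\<^esub>"
    by (rule G.pow_order_eq_1)
  moreover have "order residue_units = q - 1"
    unfolding order_def residue_units_def using finite_residues by simp
  ultimately have "res (x ^ (q - 1)) = res 1" using pow by (simp add: residue_units_def)
  then have "x ^ (q - 1) - 1 \<in> (*) (\<iota> \<pi>) ` OK" using res_eq_iff assms by simp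
  then have "x * (x ^ (q - 1) - 1) \<in> (*) (\<iota> \<pi>) ` OK" using assms by (intro pi_OK_closed(4))
  moreover have "x * (x ^ (q - 1) - 1) = x ^ Suc (q - 1) - x" by (simp add: right_diff_distrib)
  ultimately show ?thesis using q_gt_1 by simp
qed

section \<open>Nontriviality of \<sigma> on the residue field\<close>

definition pi_ideal :: "nat \<Rightarrow> 'b set" where
  "pi_ideal n = (*) (\<iota> (\<pi> ^ n)) ` OK"

lemma pi_ideal_0 [simp]: "pi_ideal 0 = OK" and pi_ideal_1: "pi_ideal 1 = (*) (\<iota> \<pi>) ` OK"
  by (simp_all add: pi_ideal_def)

lemma pi_power_OK [simp]: "\<iota> (\<pi> ^ n) \<in> OK"
  by (induction n) (auto simp: iota.hom_mult)

lemma pi_ideal_closed: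
  "x \<in> pi_ideal n \<Longrightarrow> y \<in> pi_ideal n \<Longrightarrow> x + y \<in> pi_ideal n"
  "x \<in> pi_ideal n \<Longrightarrow> y \<in> pi_ideal n \<Longrightarrow> x - y \<in> pi_ideal n"
  "x \<in> pi_ideal m \<Longrightarrow> y \<in> pi_ideal n \<Longrightarrow> x * y \<in> pi_ideal (m + n)"
  "0 \<in> pi_ideal n"
proof -
  have eq: "y \<in> pi_ideal n \<longleftrightarrow> (\<exists>z\<in>OK. y = \<iota> (\<pi> ^ n) * z)" for y n by (auto simp: pi_ideal_def)
  show "x \<in> pi_ideal n \<Longrightarrow> y \<in> pi_ideal n \<Longrightarrow> x + y \<in> pi_ideal n"
    "x \<in> pi_ideal n \<Longrightarrow> y \<in> pi_ideal n \<Longrightarrow> x - y \<in> pi_ideal n"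
    unfolding eq by (auto simp flip: distrib_left right_diff_distrib)
  show "0 \<in> pi_ideal n" unfolding eq by (rule bexI[of _ 0]) simp_all
  assume "x \<in> pi_ideal m" "y \<in> pi_ideal n"
  then obtain a b where ab: "a \<in> OK" "b \<in> OK" "x = \<iota> (\<pi> ^ m) * a" "y = \<iota> (\<pi> ^ n) * b"
    unfolding eq by blast
  have "x * y = \<iota> (\<pi> ^ (m + n)) * (a * b)"
    unfolding ab power_add iota.hom_mult by (metis iota_commute mult.assoc)
  then show "x * y \<in> pi_ideal (m + n)" unfolding eq using ab by (intro bexI[of _ "a * b"]) simp_all
qed

lemma pi_ideal_mult: "x \<in> pi_ideal n \<Longrightarrow> a \<in> OK \<Longrightarrow> a * x \<in> pi_ideal n"
  "x \<in> pi_ideal n \<Longrightarrow> a \<in> OK \<Longrightarrow> x * a \<in> pi_ideal n"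
  using pi_ideal_closed(3)[of a 0 x n] pi_ideal_closed(3)[of x n a 0] by simp_all

text \<open>If \<open>\<sigma>\<close> were trivial modulo \<open>\<pi>\<close>, then the first nonzero \<open>(1 - \<sigma>) / \<pi>\<^sup>n\<close> would induce a nonzero
  derivation of the residue field; it would kill every \<open>x = x\<^sup>q\<close>, as \<open>q = 0\<close>.\<close>

lemma sigma_trivial_step:
  assumes one: "\<And>x. x \<in> OK \<Longrightarrow> x - \<sigma> x \<in> pi_ideal 1" and n: "\<And>x. x \<in> OK \<Longrightarrow> x - \<sigma> x \<in> pi_ideal n"
    and x: "x \<in> OK"
  shows "x - \<sigma> x \<in> pi_ideal (n + 1)"
proof -
  define d where "d = x - \<sigma> x"
  have d: "d \<in> pi_ideal n" "d \<in> OK" using n x by (auto simp: d_def)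
  \<comment> \<open>The power rule of the derivation. Its error term is
    \<open>d * (x ^ Suc m - \<sigma> x ^ Suc m)\<close>, where \<open>d\<close> has order at least n
    and the second factor order at least 1.\<close>
  have pow: "x ^ Suc m - \<sigma> x ^ Suc m - of_nat (Suc m) * x ^ m * d \<in> pi_ideal (n + 1)" for m
  proof (induction m)
    case 0 show ?case by (simp add: d_def pi_ideal_closed)
  next
    case (Suc m)
    let ?e = "x ^ Suc m - \<sigma> x ^ Suc m - of_nat (Suc m) * x ^ m * d"
    have "x ^ Suc m - \<sigma> (x ^ Suc m) \<in> pi_ideal 1" using x by (intro one) simp
    then have "x ^ Suc m - \<sigma> x ^ Suc m \<in> pi_ideal 1" using x by (simp only: sigma_power)
    then have 1: "d * (x ^ Suc m - \<sigma> x ^ Suc m) \<in> pi_ideal (n + 1)"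
      by (rule pi_ideal_closed(3)[OF d(1)])
    have 2: "x * ?e \<in> pi_ideal (n + 1)" using Suc x by (rule pi_ideal_mult)
    have c: "x ^ Suc m * d = d * x ^ Suc m" using x d by (simp add: OK_commute del: power_Suc)
    have "x ^ Suc (Suc m) - \<sigma> x ^ Suc (Suc m) = x * (x ^ Suc m - \<sigma> x ^ Suc m) + d * \<sigma> x ^ Suc m"
      by (simp add: d_def algebra_simps)
    moreover have "x * ?e = x * (x ^ Suc m - \<sigma> x ^ Suc m) - of_nat (Suc m) * (x ^ Suc m * d)"
      by (simp add: algebra_simps mult_of_nat_commute)
    moreover have "of_nat (Suc (Suc m)) * x ^ Suc m * d = of_nat (Suc m) * (x ^ Suc m * d) + d * x ^ Suc m"
      by (simp only: c[symmetric]) (simp add: algebra_simps)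
    ultimately have eq: "x ^ Suc (Suc m) - \<sigma> x ^ Suc (Suc m) - of_nat (Suc (Suc m)) * x ^ Suc m * d
      = x * ?e - d * (x ^ Suc m - \<sigma> x ^ Suc m)"
      by (simp del: power_Suc of_nat_Suc add: right_diff_distrib)
    show ?case unfolding eq by (rule pi_ideal_closed(2)[OF 2 1])
  qed
  obtain m where m: "q = Suc m" using q_gt_1 by (metis less_imp_Suc_add)
  \<comment> \<open>The derivative of the q-th power carries the factor q, which is divisible by
    \<pi>.\<close>
  have "of_nat q \<in> pi_ideal 1" using q_pi_OK unfolding pi_ideal_1 .
  then have "of_nat q * x ^ m \<in> pi_ideal 1" using x by (intro pi_ideal_mult) simp_all
  then have "of_nat q * x ^ m * d \<in> pi_ideal (n + 1)" using d pi_ideal_closed(3)[of _ 1 d n] by simp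
  then have xq: "x ^ q - \<sigma> x ^ q \<in> pi_ideal (n + 1)" using pow[of m] pi_ideal_closed(1) m by fastforce
  \<comment> \<open>Replacing x by its q-th power costs \<open>\<iota> \<pi> * y\<close>; for this
    correction the hypothesis of order n, applied to y, gains one order from the factor
    \<pi>.\<close>
  obtain y where y: "y \<in> OK" "x ^ q - x = \<iota> \<pi> * y" using power_q[OF x] by auto
  have xy: "x = x ^ q - \<iota> \<pi> * y" using y(2) by (simp add: algebra_simps)
  have "\<sigma> x = \<sigma> (x ^ q) - \<sigma> (\<iota> \<pi> * y)" using xy sigma_diff[of "x ^ q" "\<iota> \<pi> * y"] x y by simp
  then have sx: "\<sigma> x = \<sigma> x ^ q - \<iota> \<pi> * \<sigma> y"
    using x y sigma_mult[of "\<iota> \<pi>" y] by (simp add: sigma_iota sigma_power)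
  have "x - \<sigma> x = (x ^ q - \<iota> \<pi> * y) - (\<sigma> x ^ q - \<iota> \<pi> * \<sigma> y)"
    using xy sx by presburger
  also have "\<dots> = (x ^ q - \<sigma> x ^ q) - \<iota> \<pi> * (y - \<sigma> y)" by (simp add: right_diff_distrib)
  finally have "x - \<sigma> x = (x ^ q - \<sigma> x ^ q) - \<iota> \<pi> * (y - \<sigma> y)" .
  moreover have "\<iota> \<pi> * (y - \<sigma> y) \<in> pi_ideal (n + 1)"
    using pi_ideal_closed(3)[of "\<iota> \<pi>" 1 "y - \<sigma> y" n] n[OF y(1)] image_eqI[of "\<iota> \<pi>" "(*) (\<iota> \<pi>)" 1 OK]
    unfolding pi_ideal_1 by simp
  ultimately show ?thesis using xq pi_ideal_closed(2) by simp
qed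

text \<open>Otherwise \<open>sigma_trivial_step\<close> can be iterated without end, so
  \<open>x - \<sigma> x\<close> is divisible by every power of \<pi> and vanishes on
  \<open>OK\<close>. After clearing denominators \<sigma> is trivial on \<open>K\<close>, a
  contradiction.\<close>

lemma exists_zeta: obtains z where "z \<in> OK" "z - \<sigma> z \<notin> (*) (\<iota> \<pi>) ` OK"
proof -
  have "\<exists>z\<in>OK. z - \<sigma> z \<notin> pi_ideal 1"
  proof (rule ccontr)
    assume "\<not> ?thesis"
    then have one: "\<And>x. x \<in> OK \<Longrightarrow> x - \<sigma> x \<in> pi_ideal 1" by blast
    have all: "\<forall>x\<in>OK. x - \<sigma> x \<in> pi_ideal n" for n
    proof (induction n)
      case (Suc n)
      then show ?case using sigma_trivial_step[OF one, of n] by simp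
    qed simp
    have fixed: "\<sigma> x = x" if "x \<in> OK" for x
    proof -
      have "x - \<sigma> x \<in> (*) (\<iota> (\<pi> ^ n)) ` OB" for n using all[of n] that by (auto simp: pi_ideal_def)
      then show ?thesis using pi_power_separated[of "x - \<sigma> x"] by simp
    qed
    obtain x where x: "x \<in> K" "\<sigma> x \<noteq> x" using sigma by (auto simp: is_nontrivial_automorphism_def)
    obtain n where "\<iota> (\<pi> ^ n) * x \<in> OB" by (rule pi_multiple_OB)
    then have "\<iota> (\<pi> ^ n) * x \<in> OK" using OK_eq iota_K x by simp
    then have "\<sigma> (\<iota> (\<pi> ^ n) * x) = \<iota> (\<pi> ^ n) * x" by (rule fixed)
    moreover have "\<sigma> (\<iota> (\<pi> ^ n) * x) = \<iota> (\<pi> ^ n) * \<sigma> x"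
      using sigma x iota_K by (auto simp: is_nontrivial_automorphism_def)
    ultimately show False using x pi_nz by simp
  qed
  then show thesis using that unfolding pi_ideal_1 by blast
qed

text \<open>The unit \<zeta> - \<sigma> \<zeta> is a square root of the discriminant of the minimal
  polynomial of \<zeta> over \<open>F\<close>.\<close>

definition zeta ("\<zeta>") where "\<zeta> = (SOME z. z \<in> OK \<and> z - \<sigma> z \<notin> (*) (\<iota> \<pi>) ` OK)"

lemma zeta [simp]: "\<zeta> \<in> OK" and zeta_diff: "\<zeta> - \<sigma> \<zeta> \<notin> (*) (\<iota> \<pi>) ` OK"
  using someI_ex[of "\<lambda>z. z \<in> OK \<and> z - \<sigma> z \<notin> (*) (\<iota> \<pi>) ` OK"] exists_zeta
  unfolding zeta_def by blast+

lemma zeta_unit: "\<zeta> - \<sigma> \<zeta> \<noteq> 0" "inverse (\<zeta> - \<sigma> \<zeta>) \<in> OK"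
  using OK_unit[of "\<zeta> - \<sigma> \<zeta>"] zeta_diff by simp_all

text \<open>A fixed element of \<open>OK\<close> commutes with \<open>OK\<close> and with
  \<open>\<pi>\<^sub>B\<close>, hence with \<open>OB\<close> and, after clearing denominators, with
  all of \<open>B\<close>. So it lies in the center, which is the image of \<open>F\<close>.\<close>

lemma OB_fixed: assumes "d \<in> OK" "\<sigma> d = d" obtains c where "c \<in> val_ring v" "d = \<iota> c"
proof -
  have OB: "d * x = x * d" if x: "x \<in> OB" for x
  proof -
    obtain a b where ab: "a \<in> OK" "b \<in> OK" "x = a + b * \<pi>\<^sub>B" using x by (rule OB_E)
    have "b * (d * \<pi>\<^sub>B) = b * (\<pi>\<^sub>B * d)" using piB_conj assms by simp
    then have "d * (b * \<pi>\<^sub>B) = b * \<pi>\<^sub>B * d"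
      using ab assms OK_commute[of d b] by (simp flip: mult.assoc)
    then show ?thesis using ab assms OK_commute[of d a] by (simp add: distrib_left distrib_right)
  qed
  have "d * x = x * d" for x
  proof -
    obtain n where "\<iota> (\<pi> ^ n) * x \<in> OB" by (rule pi_multiple_OB)
    then have "d * (\<iota> (\<pi> ^ n) * x) = \<iota> (\<pi> ^ n) * x * d" by (rule OB)
    then have "\<iota> (\<pi> ^ n) * (d * x) = \<iota> (\<pi> ^ n) * (x * d)" by (metis iota_commute mult.assoc)
    moreover have "\<iota> (\<pi> ^ n) \<noteq> 0" using pi_nz by simp
    ultimately show ?thesis by (metis mult_left_cancel)
  qed
  then obtain c where c: "d = \<iota> c" using center by blast
  have "c \<in> val_ring v"
  proof (rule ccontr)
    assume "c \<notin> val_ring v"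
    then have c0: "c \<noteq> 0" "v c < 0" by (auto simp: val_ring_def val_ge_def)
    then have i: "inverse c \<in> val_ideal v" by (simp add: val_ideal_def val_ge_def val_inverse)
    \<comment> \<open>If \<open>c\<close> were not integral, unramifiedness would make
      \<open>\<iota> (inverse c)\<close> a nonunit of \<open>OK\<close>, although its inverse is
      \<open>d\<close>.\<close>
    have "\<iota> (inverse c) * 1 \<in> {x \<in> OK. x = 0 \<or> inverse x \<notin> OK}"
      using unramified i unfolding is_unramified_def by (metis (mono_tags, lifting) OK_closed(2) mem_Collect_eq)
    then show False using c assms c0 by (simp add: iota_inverse)
  qed
  then show thesis using c that by blast
qed

text \<open>Cramer's rule for a = c + e \<zeta> and its conjugate equation: e is (a - \<sigma> a) /
  (\<zeta> - \<sigma> \<zeta>). The denominator is a unit, and both coefficients are fixed by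
  \<sigma>.\<close>

lemma OK_zeta_decompose: assumes "a \<in> OK"
  obtains c e where "c \<in> val_ring v" "e \<in> val_ring v" "a = \<iota> c + \<iota> e * \<zeta>"
proof -
  define i where "i = inverse (\<zeta> - \<sigma> \<zeta>)"
  have i: "i \<in> OK" "i * (\<zeta> - \<sigma> \<zeta>) = 1" using zeta_unit by (simp_all add: i_def)
  have "\<sigma> i * (\<zeta> - \<sigma> \<zeta>) = -1"
  proof -
    have "\<sigma> (i * (\<zeta> - \<sigma> \<zeta>)) = 1" using i(2) by simp
    then have "\<sigma> i * (\<sigma> \<zeta> - \<zeta>) = 1" using i(1) by (simp add: sigma_mult sigma_diff)
    then show ?thesis by (simp add: right_diff_distrib) (metis minus_diff_eq)
  qed
  then have "(\<sigma> i + i) * (\<zeta> - \<sigma> \<zeta>) = 0" using i by (simp add: distrib_right)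
  then have "\<sigma> i + i = 0" using zeta_unit by simp
  then have si: "\<sigma> i = - i" by (simp add: eq_neg_iff_add_eq_0)
  define d where "d = (a - \<sigma> a) * i"
  have d: "d \<in> OK" "\<sigma> d = d" using assms i si
    by (simp_all add: d_def sigma_mult sigma_diff algebra_simps)
  have da: "d * (\<zeta> - \<sigma> \<zeta>) = a - \<sigma> a" using i by (simp add: d_def mult.assoc)
  have "\<sigma> (a - d * \<zeta>) = a - d * \<zeta>"
    using assms d da by (simp add: sigma_diff sigma_mult algebra_simps)
  moreover have "a - d * \<zeta> \<in> OK" using assms d by simp
  ultimately obtain c where c: "c \<in> val_ring v" "a - d * \<zeta> = \<iota> c" by (metis OB_fixed)
  obtain e where "e \<in> val_ring v" "d = \<iota> e" using d by (rule OB_fixed)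
  then show thesis using c that by (metis add_diff_cancel_right' diff_add_cancel)
qed

text \<open>Here \<open>t\<close> and \<open>n\<close> are the trace and the norm of
  \<zeta>.\<close>

lemma zeta_square: obtains t n where "t \<in> val_ring v" "n \<in> val_ring v"
  "\<zeta> * \<zeta> = \<iota> t * \<zeta> - \<iota> n" "\<sigma> \<zeta> = \<iota> t - \<zeta>" "\<zeta> * \<sigma> \<zeta> = \<iota> n"
proof -
  have "\<sigma> (\<zeta> + \<sigma> \<zeta>) = \<zeta> + \<sigma> \<zeta>" by (simp add: sigma_add add.commute)
  then obtain t where t: "t \<in> val_ring v" "\<zeta> + \<sigma> \<zeta> = \<iota> t" by (rule OB_fixed[rotated]) simp_all
  have "\<sigma> (\<zeta> * \<sigma> \<zeta>) = \<zeta> * \<sigma> \<zeta>" by (simp add: sigma_mult OK_commute)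
  then obtain n where n: "n \<in> val_ring v" "\<zeta> * \<sigma> \<zeta> = \<iota> n" by (rule OB_fixed[rotated]) simp_all
  have s: "\<sigma> \<zeta> = \<iota> t - \<zeta>" using t(2) by (simp add: algebra_simps)
  have "\<zeta> * \<zeta> = \<zeta> * \<iota> t - \<zeta> * \<sigma> \<zeta>" unfolding s by (simp add: algebra_simps)
  then show thesis using that[OF t(1) n(1) _ s n(2)] n(2) by (simp add: iota_commute)
qed

end

subsection \<open>Sums and powers of bimodules\<close>

definition bimodule_hom :: "'b set \<Rightarrow> ('b, 'm) bimodule \<Rightarrow> ('b, 'n) bimodule \<Rightarrow> ('m \<Rightarrow> 'n) \<Rightarrow> bool" where
  "bimodule_hom R M N f \<longleftrightarrow> f \<in> carrier M \<rightarrow> carrier N \<and>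
    (\<forall>x\<in>carrier M. \<forall>y\<in>carrier M. f (x \<oplus>\<^bsub>M\<^esub> y) = f x \<oplus>\<^bsub>N\<^esub> f y) \<and>
    (\<forall>a\<in>R. \<forall>x\<in>carrier M. f (a \<odot>\<^bsub>M\<^esub> x) = a \<odot>\<^bsub>N\<^esub> f x \<and> f (x \<triangleleft>\<^bsub>M\<^esub> a) = f x \<triangleleft>\<^bsub>N\<^esub> a)"

lemma bimodule_homI:
  assumes "\<And>x. x \<in> carrier M \<Longrightarrow> f x \<in> carrier N"
    "\<And>x y. x \<in> carrier M \<Longrightarrow> y \<in> carrier M \<Longrightarrow> f (x \<oplus>\<^bsub>M\<^esub> y) = f x \<oplus>\<^bsub>N\<^esub> f y"
    "\<And>a x. a \<in> R \<Longrightarrow> x \<in> carrier M \<Longrightarrow> f (a \<odot>\<^bsub>M\<^esub> x) = a \<odot>\<^bsub>N\<^esub> f x"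
    "\<And>a x. a \<in> R \<Longrightarrow> x \<in> carrier M \<Longrightarrow> f (x \<triangleleft>\<^bsub>M\<^esub> a) = f x \<triangleleft>\<^bsub>N\<^esub> a"
  shows "bimodule_hom R M N f"
  using assms by (auto simp: bimodule_hom_def)

lemma bimodule_homD:
  assumes "bimodule_hom R M N f"
  shows "x \<in> carrier M \<Longrightarrow> f x \<in> carrier N"
    "x \<in> carrier M \<Longrightarrow> y \<in> carrier M \<Longrightarrow> f (x \<oplus>\<^bsub>M\<^esub> y) = f x \<oplus>\<^bsub>N\<^esub> f y"
    "a \<in> R \<Longrightarrow> x \<in> carrier M \<Longrightarrow> f (a \<odot>\<^bsub>M\<^esub> x) = a \<odot>\<^bsub>N\<^esub> f x"
    "a \<in> R \<Longrightarrow> x \<in> carrier M \<Longrightarrow> f (x \<triangleleft>\<^bsub>M\<^esub> a) = f x \<triangleleft>\<^bsub>N\<^esub> a"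
  using assms by (auto simp: bimodule_hom_def)

lemma bimodule_iso_hom:
  "bimodule_iso R M N \<longleftrightarrow> (\<exists>f. bimodule_hom R M N f \<and> bij_betw f (carrier M) (carrier N))"
  unfolding bimodule_iso_def bimodule_hom_def
  by (intro arg_cong[where f = Ex] ext) (auto simp: bij_betw_def)

lemma bimodule_isoI:
  "bimodule_hom R M N f \<Longrightarrow> bij_betw f (carrier M) (carrier N) \<Longrightarrow> bimodule_iso R M N"
  unfolding bimodule_iso_hom by blast

lemma bimodule_isoE:
  assumes "bimodule_iso R M N"
  obtains f where "bimodule_hom R M N f" "bij_betw f (carrier M) (carrier N)"
  using assms unfolding bimodule_iso_hom by blast

lemma bimodule_hom_comp:
  "bimodule_hom R M N f \<Longrightarrow> bimodule_hom R N Q g \<Longrightarrow> bimodule_hom R M Q (g \<circ> f)"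
  unfolding bimodule_hom_def by (auto simp: Pi_iff)

lemma bimodule_iso_refl: "bimodule_iso R M M"
  by (rule bimodule_isoI[of _ _ _ id]) (auto intro: bimodule_homI)

lemma bimodule_iso_trans: "bimodule_iso R M N \<Longrightarrow> bimodule_iso R N Q \<Longrightarrow> bimodule_iso R M Q"
  by (meson bimodule_hom_comp bij_betw_trans bimodule_iso_hom)

context bimodule
begin

lemmas bimodule_closed [simp] = left_closed right_closed

end

lemma bimodule_hom_inverse:
  assumes M: "bimodule R M" and f: "bimodule_hom R M N f" "bij_betw f (carrier M) (carrier N)"
  shows "bimodule_hom R N M (the_inv_into (carrier M) f)"
proof -
  interpret M: bimodule R M by fact
  let ?g = "the_inv_into (carrier M) f"
  have inj: "inj_on f (carrier M)" and img: "f ` carrier M = carrier N"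
    using f(2) by (auto simp: bij_betw_def)
  have g: "?g y \<in> carrier M" "f (?g y) = y" if "y \<in> carrier N" for y
    using that the_inv_into_into[OF inj, of y "carrier M"] f_the_inv_into_f[OF inj, of y] img by auto
  have eq: "?g y = x" if "x \<in> carrier M" "f x = y" for x y
    using that the_inv_into_f_f[OF inj] by auto
  show ?thesis
    by (rule bimodule_homI) (auto intro!: eq simp: bimodule_homD[OF f(1)] g)
qed

lemma bimodule_iso_sym: "bimodule R M \<Longrightarrow> bimodule_iso R M N \<Longrightarrow> bimodule_iso R N M"
  by (meson bimodule_hom_inverse bij_betw_the_inv_into bimodule_iso_hom)

lemma bimod_sum_simps [simp]:
  "carrier (M \<oplus>\<^sub>b N) = carrier M \<times> carrier N" "\<zero>\<^bsub>M \<oplus>\<^sub>b N\<^esub> = (\<zero>\<^bsub>M\<^esub>, \<zero>\<^bsub>N\<^esub>)"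
  "x \<oplus>\<^bsub>M \<oplus>\<^sub>b N\<^esub> y = (fst x \<oplus>\<^bsub>M\<^esub> fst y, snd x \<oplus>\<^bsub>N\<^esub> snd y)"
  "a \<odot>\<^bsub>M \<oplus>\<^sub>b N\<^esub> x = (a \<odot>\<^bsub>M\<^esub> fst x, a \<odot>\<^bsub>N\<^esub> snd x)"
  "x \<triangleleft>\<^bsub>M \<oplus>\<^sub>b N\<^esub> a = (fst x \<triangleleft>\<^bsub>M\<^esub> a, snd x \<triangleleft>\<^bsub>N\<^esub> a)"
  by (simp_all add: bimod_sum_def)

lemma bimod_power_simps:
  "carrier (M ^\<^sub>b r) = {xs. length xs = r \<and> set xs \<subseteq> carrier M}" "\<zero>\<^bsub>M ^\<^sub>b r\<^esub> = replicate r \<zero>\<^bsub>M\<^esub>"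
  "xs \<oplus>\<^bsub>M ^\<^sub>b r\<^esub> ys = map2 (\<lambda>x y. x \<oplus>\<^bsub>M\<^esub> y) xs ys"
  "a \<odot>\<^bsub>M ^\<^sub>b r\<^esub> xs = map (\<lambda>x. a \<odot>\<^bsub>M\<^esub> x) xs"
  "xs \<triangleleft>\<^bsub>M ^\<^sub>b r\<^esub> a = map (\<lambda>x. x \<triangleleft>\<^bsub>M\<^esub> a) xs"
  by (simp_all add: bimod_power_def)

lemma bimodule_sum:
  assumes "bimodule R M" "bimodule R N"
  shows "bimodule R (M \<oplus>\<^sub>b N)"
proof -
  interpret M: bimodule R M by fact
  interpret N: bimodule R N by fact
  show ?thesis
  proof (rule bimodule.intro)
    show "abelian_group (M \<oplus>\<^sub>b N)"
    proof (rule abelian_groupI)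
      fix x assume "x \<in> carrier (M \<oplus>\<^sub>b N)"
      then show "\<exists>y\<in>carrier (M \<oplus>\<^sub>b N). y \<oplus>\<^bsub>M \<oplus>\<^sub>b N\<^esub> x = \<zero>\<^bsub>M \<oplus>\<^sub>b N\<^esub>"
        by (intro bexI[of _ "(\<ominus>\<^bsub>M\<^esub> fst x, \<ominus>\<^bsub>N\<^esub> snd x)"]) (auto simp: M.l_neg N.l_neg)
    qed (auto simp: M.a_ac N.a_ac)
    show "bimodule_axioms R (M \<oplus>\<^sub>b N)"
      by unfold_locales
        (auto simp: M.left_distrib_scalar M.left_distrib M.left_assoc M.left_one M.right_distrib_scalar
          M.right_distrib M.right_assoc M.right_one M.left_right N.left_distrib_scalar N.left_distrib
          N.left_assoc N.left_one N.right_distrib_scalar N.right_distrib N.right_assoc N.right_one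
          N.left_right)
  qed
qed

lemma bimodule_power:
  assumes "bimodule R M"
  shows "bimodule R (M ^\<^sub>b r)"
proof -
  interpret M: bimodule R M by fact
  have car: "xs \<in> carrier (M ^\<^sub>b r) \<longleftrightarrow> length xs = r \<and> (\<forall>i<r. xs ! i \<in> carrier M)" for xs
    by (auto simp: bimod_power_simps subset_iff in_set_conv_nth)
  note simps = bimod_power_simps(2-)
  show ?thesis
  proof (rule bimodule.intro)
    show "abelian_group (M ^\<^sub>b r)"
    proof (rule abelian_groupI)
      fix x assume "x \<in> carrier (M ^\<^sub>b r)"
      then show "\<exists>y\<in>carrier (M ^\<^sub>b r). y \<oplus>\<^bsub>M ^\<^sub>b r\<^esub> x = \<zero>\<^bsub>M ^\<^sub>b r\<^esub>"
        by (intro bexI[of _ "map (\<lambda>y. \<ominus>\<^bsub>M\<^esub> y) x"])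
          (auto simp: car simps M.l_neg intro!: nth_equalityI)
    qed (auto simp: car simps M.a_ac intro!: nth_equalityI)
    show "bimodule_axioms R (M ^\<^sub>b r)"
      by unfold_locales
        (auto simp: car simps M.left_distrib_scalar M.left_distrib M.left_assoc M.left_one
          M.right_distrib_scalar M.right_distrib M.right_assoc M.right_one M.left_right in_set_conv_nth
          intro!: nth_equalityI)
  qed
qed

lemma bimodule_hom_sum:
  assumes "bimodule R L" "bimodule_hom R M L f" "bimodule_hom R N L g"
  shows "bimodule_hom R (M \<oplus>\<^sub>b N) L (\<lambda>x. f (fst x) \<oplus>\<^bsub>L\<^esub> g (snd x))"
proof -
  interpret L: bimodule R L by fact
  show ?thesis
    by (rule bimodule_homI)
      (auto simp: bimodule_homD[OF assms(2)] bimodule_homD[OF assms(3)] L.a_ac L.left_distrib L.right_distrib)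
qed

lemma bimodule_iso_sum:
  assumes "bimodule_iso R M M'" "bimodule_iso R N N'"
  shows "bimodule_iso R (M \<oplus>\<^sub>b N) (M' \<oplus>\<^sub>b N')"
proof -
  obtain f where f: "bimodule_hom R M M' f" "bij_betw f (carrier M) (carrier M')"
    using assms(1) by (rule bimodule_isoE)
  obtain g where g: "bimodule_hom R N N' g" "bij_betw g (carrier N) (carrier N')"
    using assms(2) by (rule bimodule_isoE)
  show ?thesis
  proof (rule bimodule_isoI)
    show "bimodule_hom R (M \<oplus>\<^sub>b N) (M' \<oplus>\<^sub>b N') (map_prod f g)"
      by (rule bimodule_homI) (auto simp: bimodule_homD[OF f(1)] bimodule_homD[OF g(1)])
    show "bij_betw (map_prod f g) (carrier (M \<oplus>\<^sub>b N)) (carrier (M' \<oplus>\<^sub>b N'))"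
      using bij_betw_map_prod[OF f(2) g(2)] by simp
  qed
qed

lemma bimodule_iso_power:
  assumes "bimodule_iso R M M'"
  shows "bimodule_iso R (M ^\<^sub>b r) (M' ^\<^sub>b r)"
proof -
  obtain f where f: "bimodule_hom R M M' f" "bij_betw f (carrier M) (carrier M')"
    using assms(1) by (rule bimodule_isoE)
  have inj: "inj_on f (carrier M)" and img: "f ` carrier M = carrier M'"
    using f(2) by (auto simp: bij_betw_def)
  show ?thesis
  proof (rule bimodule_isoI)
    show "bimodule_hom R (M ^\<^sub>b r) (M' ^\<^sub>b r) (map f)"
      by (rule bimodule_homI)
        (auto simp: bimodule_homD[OF f(1)] bimod_power_simps subset_iff intro!: nth_equalityI)
    have "inj_on (map f) (lists (carrier M))" using inj by (simp add: inj_on_map_lists)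
    then have "inj_on (map f) (carrier (M ^\<^sub>b r))"
      by (rule inj_on_subset) (auto simp: bimod_power_simps)
    moreover have "map f ` carrier (M ^\<^sub>b r) = carrier (M' ^\<^sub>b r)"
    proof
      show "map f ` carrier (M ^\<^sub>b r) \<subseteq> carrier (M' ^\<^sub>b r)"
        using bimodule_homD(1)[OF f(1)] by (auto simp: bimod_power_simps subset_iff)
      show "carrier (M' ^\<^sub>b r) \<subseteq> map f ` carrier (M ^\<^sub>b r)"
      proof
        fix ys assume "ys \<in> carrier (M' ^\<^sub>b r)"
        then have "length ys = r" "ys \<in> lists (f ` carrier M)" using img by (auto simp: bimod_power_simps)
        then obtain xs where "xs \<in> lists (carrier M)" "ys = map f xs" by (auto simp: lists_image)
        then show "ys \<in> map f ` carrier (M ^\<^sub>b r)"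
          using \<open>length ys = r\<close> by (intro image_eqI[of _ _ xs]) (auto simp: bimod_power_simps)
      qed
    qed
    ultimately show "bij_betw (map f) (carrier (M ^\<^sub>b r)) (carrier (M' ^\<^sub>b r))"
      by (simp add: bij_betw_def)
  qed
qed

lemma bimodule_power_Suc: "bimodule_iso R (M ^\<^sub>b Suc r) (M \<oplus>\<^sub>b M ^\<^sub>b r)"
proof (rule bimodule_isoI)
  show "bimodule_hom R (M ^\<^sub>b Suc r) (M \<oplus>\<^sub>b M ^\<^sub>b r) (\<lambda>xs. (hd xs, tl xs))"
    by (rule bimodule_homI) (auto simp: bimod_power_simps length_Suc_conv)
  show "bij_betw (\<lambda>xs. (hd xs, tl xs)) (carrier (M ^\<^sub>b Suc r)) (carrier (M \<oplus>\<^sub>b M ^\<^sub>b r))"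
    by (rule bij_betw_byWitness[where f' = "\<lambda>(x, xs). x # xs"])
      (auto simp: bimod_power_simps length_Suc_conv)
qed

section \<open>Sums of four bimodules with multiplicities\<close>

type_synonym mult4 = "nat \<times> nat \<times> nat \<times> nat"

definition std_sum :: "('b, 'm) bimodule \<Rightarrow> ('b, 'm) bimodule \<Rightarrow> ('b, 'm) bimodule \<Rightarrow> ('b, 'm) bimodule \<Rightarrow>
    mult4 \<Rightarrow> ('b, 'm list \<times> 'm list \<times> 'm list \<times> 'm list) bimodule" where
  "std_sum M1 M2 M3 M4 = (\<lambda>(r1, r2, t1, t2). M1 ^\<^sub>b r1 \<oplus>\<^sub>b M2 ^\<^sub>b r2 \<oplus>\<^sub>b M3 ^\<^sub>b t1 \<oplus>\<^sub>b M4 ^\<^sub>b t2)"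

fun mult4_add :: "mult4 \<Rightarrow> mult4 \<Rightarrow> mult4" where
  "mult4_add (a, b, c, d) (a', b', c', d') = (a + a', b + b', c + c', d + d')"

fun mult4_size :: "mult4 \<Rightarrow> nat" where "mult4_size (r1, r2, t1, t2) = r1 + r2 + t1 + t2"

lemma mult4_size_add: "mult4_size (mult4_add m m') = mult4_size m + mult4_size m'"
  by (cases m; cases m') simp

lemma mult4_size_0: "mult4_size m = 0 \<longleftrightarrow> m = (0, 0, 0, 0)"
  by (cases m) auto

lemma bij_betw_append:
  "bij_betw (\<lambda>(xs, ys). xs @ ys)
    ({xs. length xs = m \<and> set xs \<subseteq> A} \<times> {xs. length xs = n \<and> set xs \<subseteq> A})
    {xs. length xs = m + n \<and> set xs \<subseteq> A}"
proof (rule bij_betw_byWitness[where f' = "\<lambda>zs. (take m zs, drop m zs)"])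
  show "(\<lambda>zs. (take m zs, drop m zs)) ` {xs. length xs = m + n \<and> set xs \<subseteq> A}
    \<subseteq> {xs. length xs = m \<and> set xs \<subseteq> A} \<times> {xs. length xs = n \<and> set xs \<subseteq> A}"
    by (auto dest: in_set_takeD in_set_dropD)
qed auto

lemma bimodule_power_add: "bimodule_iso R (M ^\<^sub>b m \<oplus>\<^sub>b M ^\<^sub>b n) (M ^\<^sub>b (m + n))"
proof (rule bimodule_isoI)
  show "bimodule_hom R (M ^\<^sub>b m \<oplus>\<^sub>b M ^\<^sub>b n) (M ^\<^sub>b (m + n)) (\<lambda>(xs, ys). xs @ ys)"
    by (rule bimodule_homI) (auto simp: bimod_power_simps)
  show "bij_betw (\<lambda>(xs, ys). xs @ ys) (carrier (M ^\<^sub>b m \<oplus>\<^sub>b M ^\<^sub>b n)) (carrier (M ^\<^sub>b (m + n)))"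
    using bij_betw_append by (simp add: bimod_power_simps)
qed

lemma bimodule_sum_exchange:
  "bimodule_iso R ((A \<oplus>\<^sub>b B) \<oplus>\<^sub>b (C \<oplus>\<^sub>b D)) ((A \<oplus>\<^sub>b C) \<oplus>\<^sub>b (B \<oplus>\<^sub>b D))"
proof (rule bimodule_isoI)
  let ?f = "\<lambda>((a, b), (c, d)). ((a, c), (b, d))"
  show "bimodule_hom R ((A \<oplus>\<^sub>b B) \<oplus>\<^sub>b (C \<oplus>\<^sub>b D)) ((A \<oplus>\<^sub>b C) \<oplus>\<^sub>b (B \<oplus>\<^sub>b D)) ?f"
    by (rule bimodule_homI) auto
  show "bij_betw ?f (carrier ((A \<oplus>\<^sub>b B) \<oplus>\<^sub>b (C \<oplus>\<^sub>b D))) (carrier ((A \<oplus>\<^sub>b C) \<oplus>\<^sub>b (B \<oplus>\<^sub>b D)))"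
    by (rule bij_betw_byWitness[where f' = ?f]) auto
qed

lemma std_sum_add:
  "bimodule_iso R (std_sum A B C D q \<oplus>\<^sub>b std_sum A B C D q') (std_sum A B C D (mult4_add q q'))"
proof -
  obtain a b c d where q: "q = (a, b, c, d)" by (cases q)
  obtain a' b' c' d' where q': "q' = (a', b', c', d')" by (cases q')
  have 1: "bimodule_iso R ((C ^\<^sub>b c \<oplus>\<^sub>b D ^\<^sub>b d) \<oplus>\<^sub>b (C ^\<^sub>b c' \<oplus>\<^sub>b D ^\<^sub>b d')) (C ^\<^sub>b (c + c') \<oplus>\<^sub>b D ^\<^sub>b (d + d'))"
    by (rule bimodule_iso_trans[OF bimodule_sum_exchange])
      (intro bimodule_iso_sum bimodule_power_add)
  have 2: "bimodule_iso R ((B ^\<^sub>b b \<oplus>\<^sub>b C ^\<^sub>b c \<oplus>\<^sub>b D ^\<^sub>b d) \<oplus>\<^sub>b (B ^\<^sub>b b' \<oplus>\<^sub>b C ^\<^sub>b c' \<oplus>\<^sub>b D ^\<^sub>b d'))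
      (B ^\<^sub>b (b + b') \<oplus>\<^sub>b C ^\<^sub>b (c + c') \<oplus>\<^sub>b D ^\<^sub>b (d + d'))"
    by (rule bimodule_iso_trans[OF bimodule_sum_exchange])
      (intro bimodule_iso_sum bimodule_power_add 1)
  show ?thesis unfolding q q' std_sum_def mult4_add.simps prod.case
    by (rule bimodule_iso_trans[OF bimodule_sum_exchange])
      (intro bimodule_iso_sum bimodule_power_add 2)
qed

lemma std_sum_unit:
  "bimodule_iso R A (std_sum A B C D (1, 0, 0, 0))"
  "bimodule_iso R B (std_sum A B C D (0, 1, 0, 0))"
  "bimodule_iso R C (std_sum A B C D (0, 0, 1, 0))"
  "bimodule_iso R D (std_sum A B C D (0, 0, 0, 1))"
proof -
  have bij: "bij_betw (\<lambda>x. ([x], [], [], [])) (carrier A) (carrier (std_sum A B C D (1, 0, 0, 0)))"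
    "bij_betw (\<lambda>x. ([], [x], [], [])) (carrier B) (carrier (std_sum A B C D (0, 1, 0, 0)))"
    "bij_betw (\<lambda>x. ([], [], [x], [])) (carrier C) (carrier (std_sum A B C D (0, 0, 1, 0)))"
    "bij_betw (\<lambda>x. ([], [], [], [x])) (carrier D) (carrier (std_sum A B C D (0, 0, 0, 1)))"
    by (auto simp: bij_betw_def inj_on_def std_sum_def bimod_power_simps length_Suc_conv image_iff)
  show "bimodule_iso R A (std_sum A B C D (1, 0, 0, 0))"
    by (rule bimodule_isoI[OF bimodule_homI bij(1)]) (auto simp: std_sum_def bimod_power_simps)
  show "bimodule_iso R B (std_sum A B C D (0, 1, 0, 0))"
    by (rule bimodule_isoI[OF bimodule_homI bij(2)]) (auto simp: std_sum_def bimod_power_simps)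
  show "bimodule_iso R C (std_sum A B C D (0, 0, 1, 0))"
    by (rule bimodule_isoI[OF bimodule_homI bij(3)]) (auto simp: std_sum_def bimod_power_simps)
  show "bimodule_iso R D (std_sum A B C D (0, 0, 0, 1))"
    by (rule bimodule_isoI[OF bimodule_homI bij(4)]) (auto simp: std_sum_def bimod_power_simps)
qed

lemma bimodule_std_sum:
  assumes "bimodule R A" "bimodule R B" "bimodule R C" "bimodule R D"
  shows "bimodule R (std_sum A B C D q)"
  by (cases q) (simp add: std_sum_def bimodule_sum bimodule_power assms)

subsection \<open>Grading and radical\<close>

text \<open>Both images are the quotient of \<open>A\<close> by one equivalence relation. Sets of
  cosets of different modules, which live in different types, are compared in this way.\<close>

lemma card_image_cong_iff:
  assumes "\<And>x y. x \<in> A \<Longrightarrow> y \<in> A \<Longrightarrow> g x = g y \<longleftrightarrow> h x = h y"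
  shows "card (g ` A) = card (h ` A)" "finite (g ` A) = finite (h ` A)"
proof -
  have "bij_betw (\<lambda>X. h (inv_into A g X)) (g ` A) (h ` A)"
  proof -
    have h: "h (inv_into A g (g x)) = h x" if "x \<in> A" for x
      using assms[of "inv_into A g (g x)" x] that by (simp add: f_inv_into_f inv_into_into)
    then have "inj_on (\<lambda>X. h (inv_into A g X)) (g ` A)" using assms by (auto simp: inj_on_def)
    moreover have "(\<lambda>X. h (inv_into A g X)) ` (g ` A) = h ` A" using h by (auto simp: image_image)
    ultimately show ?thesis by (simp add: bij_betw_def)
  qed
  then show "card (g ` A) = card (h ` A)" "finite (g ` A) = finite (h ` A)"
    by (rule bij_betw_same_card, rule bij_betw_finite)
qed

context quaternion_setting
begin

definition mOB :: "'b set" where "mOB = (*) \<pi>\<^sub>B ` OB"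

lemma mOB_left: "x \<in> mOB \<longleftrightarrow> (\<exists>y\<in>OB. x = \<pi>\<^sub>B * y)"
  unfolding mOB_def by auto

lemma mOB_right: "x \<in> mOB \<longleftrightarrow> (\<exists>y\<in>OB. x = y * \<pi>\<^sub>B)"
proof
  assume "x \<in> mOB"
  then obtain y where "y \<in> OB" "x = \<pi>\<^sub>B * y" unfolding mOB_left by auto
  then show "\<exists>y\<in>OB. x = y * \<pi>\<^sub>B" using OB_left_varpi[of y] by simp
next
  assume "\<exists>y\<in>OB. x = y * \<pi>\<^sub>B"
  then obtain y where "y \<in> OB" "x = y * \<pi>\<^sub>B" by auto
  then show "x \<in> mOB" unfolding mOB_left using OB_right_varpi[of y] by simp
qed

lemma mOB_unit: "x \<in> OB \<Longrightarrow> x \<notin> mOB \<Longrightarrow> x \<noteq> 0" "x \<in> OB \<Longrightarrow> x \<notin> mOB \<Longrightarrow> inverse x \<in> OB"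
  using OB_unit unfolding mOB_def by auto

lemma mOB_closed:
  "0 \<in> mOB" "x \<in> mOB \<Longrightarrow> y \<in> mOB \<Longrightarrow> x + y \<in> mOB" "x \<in> mOB \<Longrightarrow> y \<in> mOB \<Longrightarrow> x - y \<in> mOB"
  "x \<in> mOB \<Longrightarrow> a \<in> OB \<Longrightarrow> x * a \<in> mOB" "x \<in> mOB \<Longrightarrow> a \<in> OB \<Longrightarrow> a * x \<in> mOB"
proof -
  show "0 \<in> mOB" unfolding mOB_left by (rule bexI[of _ 0]) simp_all
  show "x \<in> mOB \<Longrightarrow> y \<in> mOB \<Longrightarrow> x + y \<in> mOB" "x \<in> mOB \<Longrightarrow> y \<in> mOB \<Longrightarrow> x - y \<in> mOB"
    unfolding mOB_left by (auto simp flip: distrib_left right_diff_distrib)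
  show "x \<in> mOB \<Longrightarrow> a \<in> OB \<Longrightarrow> x * a \<in> mOB"
    unfolding mOB_left by (auto simp: mult.assoc)
  show "x \<in> mOB \<Longrightarrow> a \<in> OB \<Longrightarrow> a * x \<in> mOB"
    unfolding mOB_right by (auto simp flip: mult.assoc)
qed

lemma mOB_coeff: "a \<in> OK \<Longrightarrow> b \<in> OK \<Longrightarrow> a + b * \<pi>\<^sub>B \<in> mOB \<longleftrightarrow> a \<in> (*) (\<iota> \<pi>) ` OK"
  unfolding mOB_def by (rule OB_nonunit_coeff)

lemma varpi_mOB [simp]: "\<pi>\<^sub>B \<in> mOB"
  unfolding mOB_left by (rule bexI[of _ 1]) simp_all

lemma pi_mOB [simp]: "\<iota> \<pi> \<in> mOB"
  unfolding mOB_left using varpi_sq[symmetric] by (intro bexI[of _ \<pi>\<^sub>B]) simp_all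

lemma one_notin_mOB: "1 \<notin> mOB"
  using mOB_coeff[of 1 0] one_notin_pi_OK by simp

text \<open>The Boolean stands for an element of the Galois group of \<open>K\<close> over
  \<open>F\<close>, so composing with \<sigma> is negation. It also serves as the degree in the
  grading.\<close>

definition tw :: "bool \<Rightarrow> 'b \<Rightarrow> 'b" where "tw d a = (if d then \<sigma> a else a)"

lemma tw_OK [simp]: "a \<in> OK \<Longrightarrow> tw d a \<in> OK"
  by (simp add: tw_def)

lemma tw_simps [simp]:
  "a \<in> OK \<Longrightarrow> tw d (\<sigma> a) = tw (\<not> d) a" "a \<in> OK \<Longrightarrow> \<sigma> (tw d a) = tw (\<not> d) a"
  "a \<in> OK \<Longrightarrow> tw d (tw d a) = a" "tw d (\<iota> c) = \<iota> c" "tw d 0 = 0" "tw d 1 = 1"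
  by (simp_all add: tw_def sigma_iota)

lemma tw_add: "a \<in> OK \<Longrightarrow> b \<in> OK \<Longrightarrow> tw d (a + b) = tw d a + tw d b"
  and tw_mult: "a \<in> OK \<Longrightarrow> b \<in> OK \<Longrightarrow> tw d (a * b) = tw d a * tw d b"
  by (simp_all add: tw_def sigma_add sigma_mult)

lemma varpi_tw: "a \<in> OK \<Longrightarrow> \<pi>\<^sub>B * tw d a = tw (\<not> d) a * \<pi>\<^sub>B" "a \<in> OK \<Longrightarrow> tw d a * \<pi>\<^sub>B = \<pi>\<^sub>B * tw (\<not> d) a"
  using piB_conj[of "tw d a"] varpi_conj'[of "tw d a"] by simp_all

definition gr :: "bool \<Rightarrow> ('b, 'm) bimodule \<Rightarrow> 'm set" where
  "gr d L = {x \<in> carrier L. \<forall>a\<in>OK. a \<odot>\<^bsub>L\<^esub> x = x \<triangleleft>\<^bsub>L\<^esub> tw d a}"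

definition radical :: "('b, 'm) bimodule \<Rightarrow> 'm set" where
  "radical L = (\<lambda>x. x \<triangleleft>\<^bsub>L\<^esub> \<pi>\<^sub>B) ` carrier L"

lemma radical_iff: "z \<in> radical L \<longleftrightarrow> (\<exists>x\<in>carrier L. z = x \<triangleleft>\<^bsub>L\<^esub> \<pi>\<^sub>B)"
  unfolding radical_def by auto

definition cls :: "('b, 'm) bimodule \<Rightarrow> 'm \<Rightarrow> 'm set" where
  "cls L x = {y \<in> carrier L. x \<ominus>\<^bsub>L\<^esub> y \<in> radical L}"

text \<open>Over the finite residue field these cardinalities replace the dimensions of the two graded
  pieces of \<open>L / L \<pi>\<^sub>B\<close> and the ranks of left multiplication by \<open>\<pi>\<^sub>B\<close> on them. They turn direct sums
  into products.\<close>

definition grade_card :: "bool \<Rightarrow> ('b, 'm) bimodule \<Rightarrow> nat" where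
  "grade_card d L = card (cls L ` gr d L)"

definition shift_card :: "bool \<Rightarrow> ('b, 'm) bimodule \<Rightarrow> nat" where
  "shift_card d L = card ((\<lambda>x. cls L (\<pi>\<^sub>B \<odot>\<^bsub>L\<^esub> x)) ` gr d L)"

text \<open>Lagrange interpolation at the two values by which \<zeta> can act: the bracket vanishes
  in degree \<open>\<not> d\<close>, and in degree \<open>d\<close> it is right multiplication by
  the unit that is then divided out.\<close>

definition proj :: "bool \<Rightarrow> ('b, 'm) bimodule \<Rightarrow> 'm \<Rightarrow> 'm" where
  "proj d L x = (\<zeta> \<odot>\<^bsub>L\<^esub> x \<ominus>\<^bsub>L\<^esub> x \<triangleleft>\<^bsub>L\<^esub> tw (\<not> d) \<zeta>) \<triangleleft>\<^bsub>L\<^esub> inverse (tw d \<zeta> - tw (\<not> d) \<zeta>)"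

definition separated :: "('b, 'm) bimodule \<Rightarrow> bool" where
  "separated L \<longleftrightarrow> (\<forall>x\<in>carrier L. (\<forall>n. \<exists>y\<in>carrier L. x = y \<triangleleft>\<^bsub>L\<^esub> (\<pi>\<^sub>B ^ n)) \<longrightarrow> x = \<zero>\<^bsub>L\<^esub>)"

definition inj_rad :: "('b, 'm) bimodule \<Rightarrow> ('b, 'n) bimodule \<Rightarrow> ('m \<Rightarrow> 'n) \<Rightarrow> bool" where
  "inj_rad M L f \<longleftrightarrow> bimodule_hom OB M L f \<and> (\<forall>u\<in>carrier M. f u \<in> radical L \<longrightarrow> u \<in> radical M)"

text \<open>This is the full preimage in \<open>L\<close> of the image that \<open>f\<close> has in
  the quotient by the radical.\<close>

definition image_rad :: "('b, 'm) bimodule \<Rightarrow> ('b, 'n) bimodule \<Rightarrow> ('m \<Rightarrow> 'n) \<Rightarrow> 'n set" where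
  "image_rad M L f = {x \<in> carrier L. \<exists>u\<in>carrier M. x \<ominus>\<^bsub>L\<^esub> f u \<in> radical L}"

end

section \<open>Arithmetic of the radical and of the graded parts\<close>

locale quaternion_bimodule =
  quaternion_setting v \<iota> OB K \<sigma> \<pi> \<pi>\<^sub>B + bimodule OB L
  for v :: "'f::field \<Rightarrow> int" and \<iota> :: "'f \<Rightarrow> 'b::division_ring"
    and OB K :: "'b set" and \<sigma> :: "'b \<Rightarrow> 'b" and \<pi> :: 'f and \<pi>\<^sub>B :: 'b
    and L :: "('b, 'm) bimodule" (structure)
begin

lemma smult_zero [simp]: "a \<in> OB \<Longrightarrow> a \<odot> \<zero> = \<zero>" "x \<in> carrier L \<Longrightarrow> 0 \<odot> x = \<zero>"
  "a \<in> OB \<Longrightarrow> \<zero> \<triangleleft> a = \<zero>" "x \<in> carrier L \<Longrightarrow> x \<triangleleft> 0 = \<zero>"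
  using left_distrib[of a \<zero> \<zero>] left_distrib_scalar[of 0 0 x] right_distrib[of a \<zero> \<zero>]
    right_distrib_scalar[of 0 0 x]
  by (simp_all add: add.l_cancel_one' r_neg)

lemma smult_neg:
  "a \<in> OB \<Longrightarrow> x \<in> carrier L \<Longrightarrow> a \<odot> (\<ominus> x) = \<ominus> (a \<odot> x)" "a \<in> OB \<Longrightarrow> x \<in> carrier L \<Longrightarrow> (- a) \<odot> x = \<ominus> (a \<odot> x)"
  "a \<in> OB \<Longrightarrow> x \<in> carrier L \<Longrightarrow> (\<ominus> x) \<triangleleft> a = \<ominus> (x \<triangleleft> a)" "a \<in> OB \<Longrightarrow> x \<in> carrier L \<Longrightarrow> x \<triangleleft> (- a) = \<ominus> (x \<triangleleft> a)"
proof -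
  assume a: "a \<in> OB" and x: "x \<in> carrier L"
  show "a \<odot> (\<ominus> x) = \<ominus> (a \<odot> x)"
    using left_distrib[of a "\<ominus> x" x] a x by (intro minus_equality[symmetric]) (simp_all add: l_neg)
  show "(- a) \<odot> x = \<ominus> (a \<odot> x)"
    using left_distrib_scalar[of "- a" a x] a x by (intro minus_equality[symmetric]) (simp_all add: l_neg)
  show "(\<ominus> x) \<triangleleft> a = \<ominus> (x \<triangleleft> a)"
    using right_distrib[of a "\<ominus> x" x] a x by (intro minus_equality[symmetric]) (simp_all add: l_neg)
  show "x \<triangleleft> (- a) = \<ominus> (x \<triangleleft> a)"
    using right_distrib_scalar[of "- a" a x] a x by (intro minus_equality[symmetric]) (simp_all add: l_neg)
qed

lemma smult_minus:
  "a \<in> OB \<Longrightarrow> x \<in> carrier L \<Longrightarrow> y \<in> carrier L \<Longrightarrow> a \<odot> (x \<ominus> y) = a \<odot> x \<ominus> a \<odot> y"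
  "a \<in> OB \<Longrightarrow> b \<in> OB \<Longrightarrow> x \<in> carrier L \<Longrightarrow> (a - b) \<odot> x = a \<odot> x \<ominus> b \<odot> x"
  "a \<in> OB \<Longrightarrow> x \<in> carrier L \<Longrightarrow> y \<in> carrier L \<Longrightarrow> (x \<ominus> y) \<triangleleft> a = x \<triangleleft> a \<ominus> y \<triangleleft> a"
  "a \<in> OB \<Longrightarrow> b \<in> OB \<Longrightarrow> x \<in> carrier L \<Longrightarrow> x \<triangleleft> (a - b) = x \<triangleleft> a \<ominus> x \<triangleleft> b"
  using left_distrib_scalar[of a "- b" x] right_distrib_scalar[of a "- b" x]
  by (simp_all add: minus_eq left_distrib right_distrib smult_neg)

lemma add_cancel:
  assumes "x \<in> carrier L" "y \<in> carrier L"
  shows "x \<oplus> (y \<oplus> \<ominus> x) = y" "\<ominus> x \<oplus> (y \<oplus> x) = y" "x \<oplus> (\<ominus> y \<oplus> \<ominus> x) = \<ominus> y" "\<ominus> x \<oplus> (\<ominus> y \<oplus> x) = \<ominus> y"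
  using assms a_comm[of y "\<ominus> x"] a_comm[of y x] a_comm[of "\<ominus> y" "\<ominus> x"] a_comm[of "\<ominus> y" x]
  by (simp_all add: r_neg1 r_neg2)

lemma minus_simps:
  "x \<in> carrier L \<Longrightarrow> y \<in> carrier L \<Longrightarrow> x \<ominus> y \<oplus> y = x"
  "x \<in> carrier L \<Longrightarrow> y \<in> carrier L \<Longrightarrow> x \<oplus> y \<ominus> y = x"
  "x \<in> carrier L \<Longrightarrow> y \<in> carrier L \<Longrightarrow> y \<oplus> x \<ominus> y = x"
  "x \<in> carrier L \<Longrightarrow> x \<ominus> x = \<zero>" "x \<in> carrier L \<Longrightarrow> x \<ominus> \<zero> = x"
  "x \<in> carrier L \<Longrightarrow> y \<in> carrier L \<Longrightarrow> z \<in> carrier L \<Longrightarrow> (x \<ominus> z) \<ominus> (y \<ominus> z) = x \<ominus> y"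
  "x \<in> carrier L \<Longrightarrow> y \<in> carrier L \<Longrightarrow> \<ominus> (x \<ominus> y) = y \<ominus> x"
  "x \<in> carrier L \<Longrightarrow> y \<in> carrier L \<Longrightarrow> z \<in> carrier L \<Longrightarrow> w \<in> carrier L \<Longrightarrow>
    (x \<oplus> y) \<ominus> (z \<oplus> w) = (x \<ominus> z) \<oplus> (y \<ominus> w)"
  by (simp_all add: minus_eq minus_add a_ac r_neg r_neg1 r_neg2 add_cancel)

lemma minus_eq_0_iff: "x \<in> carrier L \<Longrightarrow> y \<in> carrier L \<Longrightarrow> x \<ominus> y = \<zero> \<longleftrightarrow> x = y"
  using minus_simps(1)[of x y] minus_simps(4) by auto

lemma radical_carrier: "x \<in> radical L \<Longrightarrow> x \<in> carrier L"
  unfolding radical_iff by auto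

lemma radical_closed:
  "\<zero> \<in> radical L" "x \<in> radical L \<Longrightarrow> y \<in> radical L \<Longrightarrow> x \<oplus> y \<in> radical L"
  "x \<in> radical L \<Longrightarrow> y \<in> radical L \<Longrightarrow> x \<ominus> y \<in> radical L" "x \<in> radical L \<Longrightarrow> \<ominus> x \<in> radical L"
  "x \<in> radical L \<Longrightarrow> a \<in> OB \<Longrightarrow> x \<triangleleft> a \<in> radical L" "x \<in> radical L \<Longrightarrow> a \<in> OB \<Longrightarrow> a \<odot> x \<in> radical L"
proof -
  show "\<zero> \<in> radical L" unfolding radical_iff by (rule bexI[of _ \<zero>]) simp_all
  show "x \<in> radical L \<Longrightarrow> y \<in> radical L \<Longrightarrow> x \<oplus> y \<in> radical L"
    unfolding radical_iff by (auto simp flip: right_distrib)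
  show "x \<in> radical L \<Longrightarrow> y \<in> radical L \<Longrightarrow> x \<ominus> y \<in> radical L"
    unfolding radical_iff by (auto simp flip: smult_minus)
  show "x \<in> radical L \<Longrightarrow> \<ominus> x \<in> radical L"
    unfolding radical_iff by (auto simp flip: smult_neg)
  show "x \<in> radical L \<Longrightarrow> a \<in> OB \<Longrightarrow> a \<odot> x \<in> radical L"
    unfolding radical_iff by (auto simp flip: left_right)
  assume "x \<in> radical L" and a: "a \<in> OB"
  then obtain y where y: "y \<in> carrier L" "x = y \<triangleleft> \<pi>\<^sub>B" unfolding radical_iff by auto
  \<comment> \<open>The radical is defined by right multiplication with one element. It is stable
    under right multiplication by \<open>OB\<close> because \<open>\<pi>\<^sub>B\<close> can be
    moved past \<open>a\<close>.\<close>
  obtain b where b: "b \<in> OB" "\<pi>\<^sub>B * a = b * \<pi>\<^sub>B" using OB_left_varpi[OF a] by auto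
  have "x \<triangleleft> a = y \<triangleleft> b \<triangleleft> \<pi>\<^sub>B" using y a b by (simp flip: right_assoc)
  then show "x \<triangleleft> a \<in> radical L" unfolding radical_iff using y b by (intro bexI[of _ "y \<triangleleft> b"]) simp_all
qed

lemma right_mOB_radical: assumes "x \<in> carrier L" "a \<in> mOB" shows "x \<triangleleft> a \<in> radical L"
proof -
  obtain b where "b \<in> OB" "a = b * \<pi>\<^sub>B" using assms(2) unfolding mOB_right by auto
  then show ?thesis unfolding radical_iff using assms(1) by (intro bexI[of _ "x \<triangleleft> b"]) (simp_all add: right_assoc)
qed

lemma gr_carrier: "x \<in> gr d L \<Longrightarrow> x \<in> carrier L"
  by (simp add: gr_def)

lemma gr_left: "x \<in> gr d L \<Longrightarrow> a \<in> OK \<Longrightarrow> a \<odot> x = x \<triangleleft> tw d a"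
  by (simp add: gr_def)

text \<open>Moving an element of \<open>OK\<close> past \<open>\<pi>\<^sub>B\<close> applies
  \<sigma>, so multiplication by \<open>\<pi>\<^sub>B\<close> on either side changes the
  degree.\<close>

lemma gr_closed:
  "\<zero> \<in> gr d L" "x \<in> gr d L \<Longrightarrow> y \<in> gr d L \<Longrightarrow> x \<oplus> y \<in> gr d L" "x \<in> gr d L \<Longrightarrow> y \<in> gr d L \<Longrightarrow> x \<ominus> y \<in> gr d L"
  "x \<in> gr d L \<Longrightarrow> a \<in> OK \<Longrightarrow> x \<triangleleft> a \<in> gr d L"
  "x \<in> gr d L \<Longrightarrow> \<pi>\<^sub>B \<odot> x \<in> gr (\<not> d) L" "x \<in> gr d L \<Longrightarrow> x \<triangleleft> \<pi>\<^sub>B \<in> gr (\<not> d) L"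
proof -
  show "\<zero> \<in> gr d L" by (simp add: gr_def)
  show "x \<in> gr d L \<Longrightarrow> y \<in> gr d L \<Longrightarrow> x \<oplus> y \<in> gr d L" by (simp add: gr_def left_distrib right_distrib)
  show "x \<in> gr d L \<Longrightarrow> y \<in> gr d L \<Longrightarrow> x \<ominus> y \<in> gr d L" by (simp add: gr_def smult_minus)
  assume x: "x \<in> gr d L"
  then have xc: "x \<in> carrier L" by (rule gr_carrier)
  show "x \<triangleleft> a \<in> gr d L" if "a \<in> OK"
    using x xc that OK_commute[of "tw d _" a]
    by (simp add: gr_def flip: left_right right_assoc)
  show "\<pi>\<^sub>B \<odot> x \<in> gr (\<not> d) L"
  proof -
    have "a \<odot> (\<pi>\<^sub>B \<odot> x) = \<pi>\<^sub>B \<odot> x \<triangleleft> tw (\<not> d) a" if a: "a \<in> OK" for a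
    proof -
      have "a \<odot> (\<pi>\<^sub>B \<odot> x) = (\<pi>\<^sub>B * \<sigma> a) \<odot> x" using a xc by (simp add: varpi_conj' flip: left_assoc)
      also have "\<dots> = \<pi>\<^sub>B \<odot> (x \<triangleleft> tw (\<not> d) a)" using a xc gr_left[OF x, of "\<sigma> a"] by (simp add: left_assoc)
      finally show ?thesis using a xc by (simp add: left_right)
    qed
    then show ?thesis using xc by (simp add: gr_def)
  qed
  show "x \<triangleleft> \<pi>\<^sub>B \<in> gr (\<not> d) L"
  proof -
    have "a \<odot> (x \<triangleleft> \<pi>\<^sub>B) = x \<triangleleft> \<pi>\<^sub>B \<triangleleft> tw (\<not> d) a" if a: "a \<in> OK" for a
      using a xc gr_left[OF x a] varpi_tw(2)[OF a, of d] by (simp flip: left_right right_assoc)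
    then show ?thesis using xc by (simp add: gr_def)
  qed
qed

lemma cls_eq_iff:
  assumes "x \<in> carrier L" "y \<in> carrier L"
  shows "cls L x = cls L y \<longleftrightarrow> x \<ominus> y \<in> radical L"
proof
  assume "cls L x = cls L y"
  moreover have "y \<in> cls L y" using assms radical_closed(1) by (simp add: cls_def minus_simps)
  ultimately have "y \<in> cls L x" by simp
  then show "x \<ominus> y \<in> radical L" by (simp add: cls_def)
next
  assume xy: "x \<ominus> y \<in> radical L"
  have "x \<ominus> z \<in> radical L \<longleftrightarrow> y \<ominus> z \<in> radical L" if z: "z \<in> carrier L" for z
  proof
    assume "x \<ominus> z \<in> radical L"
    then have "(x \<ominus> z) \<ominus> (x \<ominus> y) \<in> radical L" using xy by (rule radical_closed(3))
    moreover have "(x \<ominus> z) \<ominus> (x \<ominus> y) = y \<ominus> z" using assms z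
      by (simp add: minus_eq minus_add a_ac r_neg r_neg1 r_neg2)
    ultimately show "y \<ominus> z \<in> radical L" by simp
  next
    assume "y \<ominus> z \<in> radical L"
    then have "(x \<ominus> y) \<oplus> (y \<ominus> z) \<in> radical L" using xy by (intro radical_closed(2))
    moreover have "(x \<ominus> y) \<oplus> (y \<ominus> z) = x \<ominus> z" using assms z
      by (simp add: minus_eq minus_add a_ac r_neg r_neg1 r_neg2)
    ultimately show "x \<ominus> z \<in> radical L" by simp
  qed
  then show "cls L x = cls L y" by (auto simp: cls_def)
qed

end

section \<open>Homomorphisms, direct sums and the coset counts\<close>

context quaternion_setting
begin

lemma quaternion_bimoduleI: "bimodule OB L \<Longrightarrow> quaternion_bimodule v \<iota> OB K \<sigma> \<pi> \<pi>\<^sub>B L"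
  by (intro quaternion_bimodule.intro quaternion_setting_axioms)

lemma hom_minus:
  assumes "bimodule OB M" "bimodule OB N" "bimodule_hom OB M N f" "x \<in> carrier M" "y \<in> carrier M"
  shows "f (x \<ominus>\<^bsub>M\<^esub> y) = f x \<ominus>\<^bsub>N\<^esub> f y" "f \<zero>\<^bsub>M\<^esub> = \<zero>\<^bsub>N\<^esub>"
proof -
  interpret M: quaternion_bimodule v \<iota> OB K \<sigma> \<pi> \<pi>\<^sub>B M using assms(1) by (rule quaternion_bimoduleI)
  interpret N: quaternion_bimodule v \<iota> OB K \<sigma> \<pi> \<pi>\<^sub>B N using assms(2) by (rule quaternion_bimoduleI)
  note f = bimodule_homD[OF assms(3)]
  \<comment> \<open>Homomorphisms are only required to respect sums and the two actions. Negation is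
    the action of -1 and zero is obtained from the action of 0, so both are respected as
    well.\<close>
  have eq: "\<ominus>\<^bsub>M\<^esub> y = (- 1) \<odot>\<^bsub>M\<^esub> y" "\<ominus>\<^bsub>N\<^esub> f y = (- 1) \<odot>\<^bsub>N\<^esub> f y"
    using assms f(1) by (simp_all add: M.smult_neg N.smult_neg M.left_one N.left_one)
  show "f (x \<ominus>\<^bsub>M\<^esub> y) = f x \<ominus>\<^bsub>N\<^esub> f y"
    using assms f by (simp add: M.minus_eq N.minus_eq eq)
  have "f (0 \<odot>\<^bsub>M\<^esub> x) = 0 \<odot>\<^bsub>N\<^esub> f x" using f(3)[of 0 x] assms by simp
  then show "f \<zero>\<^bsub>M\<^esub> = \<zero>\<^bsub>N\<^esub>" using assms f(1) by simp
qed

lemma hom_radical: "bimodule_hom OB M N f \<Longrightarrow> u \<in> radical M \<Longrightarrow> f u \<in> radical N"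
  unfolding radical_iff by (auto simp: bimodule_homD)

lemma hom_gr: "bimodule_hom OB M N f \<Longrightarrow> u \<in> gr d M \<Longrightarrow> f u \<in> gr d N"
proof -
  assume f: "bimodule_hom OB M N f" and u: "u \<in> gr d M"
  have uc: "u \<in> carrier M" and l: "\<And>a. a \<in> OK \<Longrightarrow> a \<odot>\<^bsub>M\<^esub> u = u \<triangleleft>\<^bsub>M\<^esub> tw d a" using u by (auto simp: gr_def)
  have "a \<odot>\<^bsub>N\<^esub> f u = f u \<triangleleft>\<^bsub>N\<^esub> tw d a" if a: "a \<in> OK" for a
    using bimodule_homD(3)[OF f, of a u] bimodule_homD(4)[OF f, of "tw d a" u] l[OF a] a uc by simp
  then show "f u \<in> gr d N" using bimodule_homD(1)[OF f uc] by (simp add: gr_def)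
qed

text \<open>The map induced on classes is injective and keeps the degree. Since \<open>card\<close>
  of an infinite set is 0, the comparison rests on finiteness of the target.\<close>

lemma inj_rad_grade_card:
  assumes M: "bimodule OB M" and N: "bimodule OB N" and f: "inj_rad M N f"
    and fin: "finite (cls N ` carrier N)"
  shows "grade_card d M \<le> grade_card d N"
proof -
  interpret M: quaternion_bimodule v \<iota> OB K \<sigma> \<pi> \<pi>\<^sub>B M using M by (rule quaternion_bimoduleI)
  interpret N: quaternion_bimodule v \<iota> OB K \<sigma> \<pi> \<pi>\<^sub>B N using N by (rule quaternion_bimoduleI)
  have hom: "bimodule_hom OB M N f" using f by (simp add: inj_rad_def)
  note h = bimodule_homD[OF hom]
  have "cls M x = cls M y \<longleftrightarrow> cls N (f x) = cls N (f y)" if "x \<in> gr d M" "y \<in> gr d M" for x y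
  proof -
    have xy: "x \<in> carrier M" "y \<in> carrier M" using that M.gr_carrier by auto
    then have m: "f (x \<ominus>\<^bsub>M\<^esub> y) = f x \<ominus>\<^bsub>N\<^esub> f y" by (intro hom_minus(1)[OF M N hom])
    have "x \<ominus>\<^bsub>M\<^esub> y \<in> radical M \<longleftrightarrow> f (x \<ominus>\<^bsub>M\<^esub> y) \<in> radical N"
      using f hom_radical[OF hom] xy by (auto simp: inj_rad_def)
    then show ?thesis using xy m h(1) M.cls_eq_iff N.cls_eq_iff by simp
  qed
  then have "card (cls M ` gr d M) = card ((\<lambda>x. cls N (f x)) ` gr d M)"
    by (rule card_image_cong_iff(1))
  also have "\<dots> \<le> card (cls N ` gr d N)"
  proof (rule card_mono)
    show "finite (cls N ` gr d N)"
      by (rule finite_subset[OF image_mono fin]) (use N.gr_carrier in blast)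
    show "(\<lambda>x. cls N (f x)) ` gr d M \<subseteq> cls N ` gr d N" using hom_gr[OF hom] by (auto intro!: imageI)
  qed
  finally show ?thesis by (simp add: grade_card_def)
qed

lemma iso_image_gr:
  assumes M: "bimodule OB M" and f: "bimodule_hom OB M N f" "bij_betw f (carrier M) (carrier N)"
  shows "f ` gr d M = gr d N" "u \<in> carrier M \<Longrightarrow> f u \<in> radical N \<longleftrightarrow> u \<in> radical M"
proof -
  let ?g = "the_inv_into (carrier M) f"
  have g: "bimodule_hom OB N M ?g" using M f by (rule bimodule_hom_inverse)
  have inj: "inj_on f (carrier M)" and img: "f ` carrier M = carrier N"
    using f(2) by (auto simp: bij_betw_def)
  have gf: "?g (f x) = x" if "x \<in> carrier M" for x using that inj by (rule the_inv_into_f_f[rotated])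
  have fg: "f (?g y) = y" if "y \<in> carrier N" for y
    using that img by (intro f_the_inv_into_f[OF inj]) simp
  show "f ` gr d M = gr d N"
  proof
    show "f ` gr d M \<subseteq> gr d N" using hom_gr[OF f(1)] by auto
    show "gr d N \<subseteq> f ` gr d M"
    proof
      fix y assume y: "y \<in> gr d N"
      then have "y = f (?g y)" using fg by (simp add: gr_def)
      then show "y \<in> f ` gr d M" using hom_gr[OF g y] by (rule image_eqI)
    qed
  qed
  assume "u \<in> carrier M"
  then show "f u \<in> radical N \<longleftrightarrow> u \<in> radical M"
    using hom_radical[OF f(1), of u] hom_radical[OF g, of "f u"] gf by auto
qed

lemma iso_inj_rad:
  assumes M: "bimodule OB M" and f: "bimodule_hom OB M N f" "bij_betw f (carrier M) (carrier N)"
  shows "inj_rad M N f"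
  using iso_image_gr(2)[OF assms] f(1) by (simp add: inj_rad_def)

lemma inj_rad_comp: "inj_rad M N f \<Longrightarrow> inj_rad N Q g \<Longrightarrow> inj_rad M Q (g \<circ> f)"
  unfolding inj_rad_def using bimodule_hom_comp[of OB M N f Q g] bimodule_homD(1)[of OB M N f] by simp

lemma iso_cards:
  assumes M: "bimodule OB M" and N: "bimodule OB N" and iso: "bimodule_iso OB M N"
  shows "grade_card d M = grade_card d N" "shift_card d M = shift_card d N"
    "card (cls M ` carrier M) = card (cls N ` carrier N)"
proof -
  interpret M: quaternion_bimodule v \<iota> OB K \<sigma> \<pi> \<pi>\<^sub>B M using M by (rule quaternion_bimoduleI)
  interpret N: quaternion_bimodule v \<iota> OB K \<sigma> \<pi> \<pi>\<^sub>B N using N by (rule quaternion_bimoduleI)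
  obtain f where f: "bimodule_hom OB M N f" "bij_betw f (carrier M) (carrier N)"
    using iso by (rule bimodule_isoE)
  note h = bimodule_homD[OF f(1)]
  have cls: "cls M x = cls M y \<longleftrightarrow> cls N (f x) = cls N (f y)" if "x \<in> carrier M" "y \<in> carrier M" for x y
    using that iso_image_gr(2)[OF M f, of "x \<ominus>\<^bsub>M\<^esub> y"] hom_minus(1)[OF M N f(1)] h(1)
      M.cls_eq_iff N.cls_eq_iff by simp
  have gr: "f ` gr d M = gr d N" using iso_image_gr(1)[OF M f] .
  have "card (cls M ` gr d M) = card ((\<lambda>x. cls N (f x)) ` gr d M)"
    by (rule card_image_cong_iff(1)) (use cls M.gr_carrier in blast)
  then show "grade_card d M = grade_card d N"
    by (simp add: grade_card_def gr[symmetric] image_image)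
  have "card ((\<lambda>x. cls M (\<pi>\<^sub>B \<odot>\<^bsub>M\<^esub> x)) ` gr d M) = card ((\<lambda>x. cls N (\<pi>\<^sub>B \<odot>\<^bsub>N\<^esub> f x)) ` gr d M)"
    by (rule card_image_cong_iff(1)) (simp add: cls M.gr_carrier h)
  then show "shift_card d M = shift_card d N"
    by (simp add: shift_card_def gr[symmetric] image_image)
  have "card (cls M ` carrier M) = card ((\<lambda>x. cls N (f x)) ` carrier M)"
    by (rule card_image_cong_iff(1)) (use cls in blast)
  then show "card (cls M ` carrier M) = card (cls N ` carrier N)"
    using f(2) by (simp add: bij_betw_def image_image[symmetric])
qed

lemma gr_sum: "gr d (M \<oplus>\<^sub>b N) = gr d M \<times> gr d N"
  by (auto simp: gr_def)

lemma radical_sum: "(x, y) \<in> radical (M \<oplus>\<^sub>b N) \<longleftrightarrow> x \<in> radical M \<and> y \<in> radical N"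
  unfolding radical_iff by auto

lemma sum_minus:
  assumes M: "bimodule OB M" and N: "bimodule OB N" and "x \<in> carrier M \<times> carrier N" "y \<in> carrier M \<times> carrier N"
  shows "x \<ominus>\<^bsub>M \<oplus>\<^sub>b N\<^esub> y = (fst x \<ominus>\<^bsub>M\<^esub> fst y, snd x \<ominus>\<^bsub>N\<^esub> snd y)"
proof -
  have fs: "bimodule_hom OB (M \<oplus>\<^sub>b N) M fst" "bimodule_hom OB (M \<oplus>\<^sub>b N) N snd"
    by (auto intro!: bimodule_homI)
  show ?thesis
    using hom_minus(1)[OF bimodule_sum[OF M N] M fs(1), of x y]
      hom_minus(1)[OF bimodule_sum[OF M N] N fs(2), of x y] assms by (intro prod_eqI) simp_all
qed

lemma sum_cards:
  assumes M: "bimodule OB M" and N: "bimodule OB N"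
  shows "grade_card d (M \<oplus>\<^sub>b N) = grade_card d M * grade_card d N"
    "shift_card d (M \<oplus>\<^sub>b N) = shift_card d M * shift_card d N"
    "card (cls (M \<oplus>\<^sub>b N) ` carrier (M \<oplus>\<^sub>b N)) = card (cls M ` carrier M) * card (cls N ` carrier N)"
proof -
  interpret M: quaternion_bimodule v \<iota> OB K \<sigma> \<pi> \<pi>\<^sub>B M using M by (rule quaternion_bimoduleI)
  interpret N: quaternion_bimodule v \<iota> OB K \<sigma> \<pi> \<pi>\<^sub>B N using N by (rule quaternion_bimoduleI)
  interpret MN: quaternion_bimodule v \<iota> OB K \<sigma> \<pi> \<pi>\<^sub>B "M \<oplus>\<^sub>b N"
    using bimodule_sum[OF M N] by (rule quaternion_bimoduleI)
  have cls: "cls (M \<oplus>\<^sub>b N) x = cls (M \<oplus>\<^sub>b N) y \<longleftrightarrow>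
      (cls M (fst x), cls N (snd x)) = (cls M (fst y), cls N (snd y))"
    if "x \<in> carrier M \<times> carrier N" "y \<in> carrier M \<times> carrier N" for x y
    using that MN.cls_eq_iff[of x y] M.cls_eq_iff[of "fst x" "fst y"] N.cls_eq_iff[of "snd x" "snd y"]
    by (auto simp: sum_minus[OF M N] radical_sum)
  have prod: "card ((\<lambda>x. (g (fst x), h (snd x))) ` (A \<times> B)) = card (g ` A) * card (h ` B)"
    for g :: "'m \<Rightarrow> 'm set" and h :: "'n \<Rightarrow> 'n set" and A B
  proof -
    have "(\<lambda>x. (g (fst x), h (snd x))) ` (A \<times> B) = g ` A \<times> h ` B" by force
    then show ?thesis by (simp add: card_cartesian_product)
  qed
  have "card (cls (M \<oplus>\<^sub>b N) ` gr d (M \<oplus>\<^sub>b N)) = card ((\<lambda>x. (cls M (fst x), cls N (snd x))) ` gr d (M \<oplus>\<^sub>b N))"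
    by (rule card_image_cong_iff(1), rule cls) (auto simp: gr_sum M.gr_carrier N.gr_carrier)
  then show "grade_card d (M \<oplus>\<^sub>b N) = grade_card d M * grade_card d N"
    by (simp only: grade_card_def gr_sum prod)
  have "card ((\<lambda>x. cls (M \<oplus>\<^sub>b N) (\<pi>\<^sub>B \<odot>\<^bsub>M \<oplus>\<^sub>b N\<^esub> x)) ` gr d (M \<oplus>\<^sub>b N))
    = card ((\<lambda>x. (cls M (\<pi>\<^sub>B \<odot>\<^bsub>M\<^esub> fst x), cls N (\<pi>\<^sub>B \<odot>\<^bsub>N\<^esub> snd x))) ` gr d (M \<oplus>\<^sub>b N))"
    by (rule card_image_cong_iff(1))
      (subst cls, auto simp: gr_sum M.gr_carrier N.gr_carrier)
  then show "shift_card d (M \<oplus>\<^sub>b N) = shift_card d M * shift_card d N"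
    by (simp only: shift_card_def gr_sum prod[of "\<lambda>x. cls M (\<pi>\<^sub>B \<odot>\<^bsub>M\<^esub> x)" "\<lambda>x. cls N (\<pi>\<^sub>B \<odot>\<^bsub>N\<^esub> x)"])
  have "card (cls (M \<oplus>\<^sub>b N) ` carrier (M \<oplus>\<^sub>b N)) = card ((\<lambda>x. (cls M (fst x), cls N (snd x))) ` carrier (M \<oplus>\<^sub>b N))"
    by (rule card_image_cong_iff(1), rule cls) simp_all
  then show "card (cls (M \<oplus>\<^sub>b N) ` carrier (M \<oplus>\<^sub>b N)) = card (cls M ` carrier M) * card (cls N ` carrier N)"
    by (simp only: bimod_sum_simps(1) prod)
qed

lemma power_cards:
  assumes M: "bimodule OB M"
  shows "grade_card d (M ^\<^sub>b r) = grade_card d M ^ r" "shift_card d (M ^\<^sub>b r) = shift_card d M ^ r"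
    "card (cls (M ^\<^sub>b r) ` carrier (M ^\<^sub>b r)) = card (cls M ` carrier M) ^ r"
proof -
  have "grade_card d (M ^\<^sub>b r) = grade_card d M ^ r \<and> shift_card d (M ^\<^sub>b r) = shift_card d M ^ r \<and>
    card (cls (M ^\<^sub>b r) ` carrier (M ^\<^sub>b r)) = card (cls M ` carrier M) ^ r"
  proof (induction r)
    case 0
    have "gr d (M ^\<^sub>b 0) = {[]}" "carrier (M ^\<^sub>b 0) = {[]}" by (auto simp: gr_def bimod_power_simps)
    then show ?case by (simp add: grade_card_def shift_card_def)
  next
    case (Suc r)
    note P = bimodule_power[OF M]
    show ?case using iso_cards[OF P bimodule_sum[OF M P] bimodule_power_Suc] sum_cards[OF M P] Suc by simp
  qed
  then show "grade_card d (M ^\<^sub>b r) = grade_card d M ^ r" "shift_card d (M ^\<^sub>b r) = shift_card d M ^ r"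
    "card (cls (M ^\<^sub>b r) ` carrier (M ^\<^sub>b r)) = card (cls M ` carrier M) ^ r"
    by auto
qed

end

subsection \<open>Bilattices\<close>

locale quaternion_bilattice =
  quaternion_bimodule v \<iota> OB K \<sigma> \<pi> \<pi>\<^sub>B L + bilattice v \<iota> OB L
  for v :: "'f::field \<Rightarrow> int" and \<iota> :: "'f \<Rightarrow> 'b::division_ring"
    and OB K :: "'b set" and \<sigma> :: "'b \<Rightarrow> 'b" and \<pi> :: 'f and \<pi>\<^sub>B :: 'b
    and L :: "('b, 'm) bimodule" (structure)
begin

lemma pi_val_ring: "\<pi> \<in> val_ring v"
  using val_pi by (simp add: val_ring_def val_ge_def)

lemma right_varpi_varpi: "x \<in> carrier L \<Longrightarrow> x \<triangleleft> \<pi>\<^sub>B \<triangleleft> \<pi>\<^sub>B = x \<triangleleft> \<iota> \<pi>" "x \<in> carrier L \<Longrightarrow> \<pi>\<^sub>B \<odot> (\<pi>\<^sub>B \<odot> x) = x \<triangleleft> \<iota> \<pi>"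
  using actions_agree[OF pi_val_ring, of x] by (simp_all add: varpi_sq flip: right_assoc left_assoc)

text \<open>Torsion-freeness speaks of scalars from \<open>F\<close>; multiplying by
  \<open>\<pi>\<^sub>B\<close> once more reduces to the scalar \<pi>.\<close>

lemma right_varpi_inj: assumes "x \<in> carrier L" "x \<triangleleft> \<pi>\<^sub>B = \<zero>" shows "x = \<zero>"
proof -
  have "\<iota> \<pi> \<odot> x = x \<triangleleft> \<pi>\<^sub>B \<triangleleft> \<pi>\<^sub>B" using assms(1) actions_agree[OF pi_val_ring] right_varpi_varpi by simp
  then have "\<iota> \<pi> \<odot> x = \<zero>" using assms(2) by simp
  then show ?thesis using torsion_free[OF pi_val_ring assms(1)] pi_nz by simp
qed

text \<open>The elements 1 and \<zeta> generate \<open>OK\<close> over the valuation ring, whose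
  left and right actions agree, so the degree can be tested on \<zeta> alone.\<close>

lemma gr_zeta: assumes u: "u \<in> carrier L" and z: "\<zeta> \<odot> u = u \<triangleleft> tw d \<zeta>" shows "u \<in> gr d L"
proof -
  have "a \<odot> u = u \<triangleleft> tw d a" if "a \<in> OK" for a
  proof -
    obtain c e where ce: "c \<in> val_ring v" "e \<in> val_ring v" "a = \<iota> c + \<iota> e * \<zeta>"
      using \<open>a \<in> OK\<close> by (rule OK_zeta_decompose)
    have [simp]: "\<iota> c \<in> OK" "\<iota> e \<in> OK" using ce iota_OK by auto
    have "a \<odot> u = \<iota> c \<odot> u \<oplus> \<iota> e \<odot> (\<zeta> \<odot> u)" using u by (simp add: ce left_distrib_scalar left_assoc)
    also have "\<dots> = u \<triangleleft> \<iota> c \<oplus> u \<triangleleft> tw d \<zeta> \<triangleleft> \<iota> e" using u z ce actions_agree by simp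
    also have "\<dots> = u \<triangleleft> (\<iota> c + tw d \<zeta> * \<iota> e)" using u by (simp add: right_distrib_scalar right_assoc)
    also have "\<iota> c + tw d \<zeta> * \<iota> e = tw d a" by (simp add: ce tw_add tw_mult iota_commute)
    finally show ?thesis .
  qed
  then show ?thesis using u by (simp add: gr_def)
qed

text \<open>Left multiplication by \<zeta> is a root of X^2 - t X + n. This polynomial factors as (X
  - \<alpha>)(X - \<beta>) with the two conjugates of \<zeta> acting on the right, so X - \<alpha>
  annihilates the image of X - \<beta>.\<close>

lemma zeta_projection: assumes x: "x \<in> carrier L" shows "\<zeta> \<odot> x \<ominus> x \<triangleleft> tw (\<not> d) \<zeta> \<in> gr d L"
proof -
  let ?A = "\<zeta> \<odot> x" and ?\<alpha> = "tw d \<zeta>" and ?\<beta> = "tw (\<not> d) \<zeta>"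
  obtain t n where tn: "t \<in> val_ring v" "n \<in> val_ring v"
    "\<zeta> * \<zeta> = \<iota> t * \<zeta> - \<iota> n" "\<sigma> \<zeta> = \<iota> t - \<zeta>" "\<zeta> * \<sigma> \<zeta> = \<iota> n" by (rule zeta_square)
  have [simp]: "\<iota> t \<in> OB" "\<iota> n \<in> OB" using tn iota_OB by auto
  have ab: "?\<beta> + ?\<alpha> = \<iota> t" "?\<beta> * ?\<alpha> = \<iota> n" using tn(4,5) OK_commute[OF zeta sigma_OK[OF zeta]]
    by (auto simp: tw_def)
  have "\<zeta> \<odot> ?A = \<iota> t \<odot> ?A \<ominus> \<iota> n \<odot> x"
    using x by (simp add: tn(3) smult_minus(2) flip: left_assoc)
  also have "\<dots> = (?A \<triangleleft> ?\<beta> \<oplus> ?A \<triangleleft> ?\<alpha>) \<ominus> x \<triangleleft> (?\<beta> * ?\<alpha>)"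
    using x ab tn actions_agree by (simp flip: right_distrib_scalar)
  finally have "\<zeta> \<odot> (?A \<ominus> x \<triangleleft> ?\<beta>) = (?A \<triangleleft> ?\<beta> \<oplus> ?A \<triangleleft> ?\<alpha>) \<ominus> x \<triangleleft> (?\<beta> * ?\<alpha>) \<ominus> ?A \<triangleleft> ?\<beta>"
    using x by (simp add: smult_minus(1) left_right)
  also have "\<dots> = ?A \<triangleleft> ?\<alpha> \<ominus> x \<triangleleft> (?\<beta> * ?\<alpha>)"
    using x by (simp add: minus_eq a_ac r_neg1 r_neg2 add_cancel)
  also have "\<dots> = (?A \<ominus> x \<triangleleft> ?\<beta>) \<triangleleft> ?\<alpha>" using x by (simp add: smult_minus(3) right_assoc)
  finally show ?thesis using x by (intro gr_zeta) simp_all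
qed

lemma gr_proj: assumes x: "x \<in> carrier L"
  shows "proj d L x \<in> gr d L" "x = proj d L x \<oplus> proj (\<not> d) L x"
proof -
  define i where "i = inverse (tw d \<zeta> - tw (\<not> d) \<zeta>)"
  have nz: "tw d \<zeta> - tw (\<not> d) \<zeta> \<noteq> 0" and i: "i \<in> OK"
    using zeta_unit OK_closed(6)[OF zeta_unit(2)] inverse_minus_eq[of "\<zeta> - \<sigma> \<zeta>"] by (auto simp: i_def tw_def)
  have i': "inverse (tw (\<not> d) \<zeta> - tw (\<not> \<not> d) \<zeta>) = - i"
    using inverse_minus_eq[of "tw d \<zeta> - tw (\<not> d) \<zeta>"] by (simp add: i_def)
  let ?u = "\<zeta> \<odot> x \<ominus> x \<triangleleft> tw (\<not> d) \<zeta>" and ?w = "\<zeta> \<odot> x \<ominus> x \<triangleleft> tw d \<zeta>"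
  show "proj d L x \<in> gr d L"
    using zeta_projection[OF x, of d] i unfolding proj_def i_def by (rule gr_closed(4))
  \<comment> \<open>The two projections have opposite denominators. In their sum the terms with left
    multiplication by \<zeta> cancel, and x times a unit times its inverse is left.\<close>
  have "?u \<triangleleft> i \<oplus> ?w \<triangleleft> (- i) = (?u \<ominus> ?w) \<triangleleft> i"
    using x i smult_minus(3)[of i ?u ?w] by (simp add: smult_neg minus_eq)
  also have "?u \<ominus> ?w = x \<triangleleft> tw d \<zeta> \<ominus> x \<triangleleft> tw (\<not> d) \<zeta>"
    using x by (simp add: minus_eq minus_add a_ac r_neg1 r_neg2 add_cancel)
  also have "\<dots> \<triangleleft> i = x \<triangleleft> ((tw d \<zeta> - tw (\<not> d) \<zeta>) * i)"
    using x i by (simp add: right_assoc smult_minus(4))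
  also have "\<dots> = x" using x nz by (simp add: i_def right_one)
  finally show "x = proj d L x \<oplus> proj (\<not> d) L x" unfolding proj_def i' i_def by simp
qed

text \<open>The operator of \<open>zeta_projection\<close> preserves the radical; it kills y and
  multiplies x by a unit.\<close>

lemma radical_gr: assumes x: "x \<in> gr d L" and y: "y \<in> gr (\<not> d) L" and xy: "x \<oplus> y \<in> radical L"
  shows "x \<in> radical L"
proof -
  define e where "e = tw d \<zeta> - tw (\<not> d) \<zeta>"
  have e: "e \<noteq> 0" "e \<in> OK" "inverse e \<in> OK"
    using zeta_unit OK_closed(6)[OF zeta_unit(2)] inverse_minus_eq[of "\<zeta> - \<sigma> \<zeta>"] by (auto simp: e_def tw_def)
  have c: "x \<in> carrier L" "y \<in> carrier L" using x y gr_carrier by auto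
  have "\<zeta> \<odot> (x \<oplus> y) \<ominus> (x \<oplus> y) \<triangleleft> tw (\<not> d) \<zeta> \<in> radical L"
    by (intro radical_closed(3) radical_closed(5,6)[OF xy]) simp_all
  also have "\<zeta> \<odot> (x \<oplus> y) \<ominus> (x \<oplus> y) \<triangleleft> tw (\<not> d) \<zeta> = x \<triangleleft> e"
    using c gr_left[OF x, of \<zeta>] gr_left[OF y, of \<zeta>]
    by (simp add: left_distrib right_distrib minus_simps smult_minus(4) e_def)
  finally have "x \<triangleleft> e \<triangleleft> inverse e \<in> radical L" by (rule radical_closed(5)) (simp add: e(3))
  then show ?thesis using c e by (simp add: right_one flip: right_assoc)
qed

section \<open>Right submodules, Nakayama's lemma and finiteness modulo the radical\<close>

definition right_submodule :: "'m set \<Rightarrow> bool" where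
  "right_submodule N \<longleftrightarrow> N \<subseteq> carrier L \<and> \<zero> \<in> N \<and> (\<forall>x\<in>N. \<forall>y\<in>N. x \<oplus> y \<in> N) \<and> (\<forall>x\<in>N. \<forall>a\<in>OB. x \<triangleleft> a \<in> N)"

lemma right_submoduleD:
  assumes "right_submodule N"
  shows "x \<in> N \<Longrightarrow> x \<in> carrier L" "\<zero> \<in> N" "x \<in> N \<Longrightarrow> y \<in> N \<Longrightarrow> x \<oplus> y \<in> N" "x \<in> N \<Longrightarrow> a \<in> OB \<Longrightarrow> x \<triangleleft> a \<in> N"
    "x \<in> N \<Longrightarrow> \<ominus> x \<in> N" "x \<in> N \<Longrightarrow> y \<in> N \<Longrightarrow> x \<ominus> y \<in> N"
proof -
  note N = assms[unfolded right_submodule_def]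
  show c: "x \<in> N \<Longrightarrow> x \<in> carrier L" for x using N by auto
  show "\<zero> \<in> N" using N by auto
  show a: "x \<in> N \<Longrightarrow> y \<in> N \<Longrightarrow> x \<oplus> y \<in> N" for x y using N by auto
  show r: "x \<in> N \<Longrightarrow> a \<in> OB \<Longrightarrow> x \<triangleleft> a \<in> N" for x a using N by auto
  show m: "x \<in> N \<Longrightarrow> \<ominus> x \<in> N" for x using r[of x "- 1"] c[of x] by (simp add: smult_neg right_one)
  show "x \<in> N \<Longrightarrow> y \<in> N \<Longrightarrow> x \<ominus> y \<in> N" using a m by (simp add: minus_eq)
qed

text \<open>The elements 1, \<zeta>, \<open>\<pi>\<^sub>B\<close> and
  \<open>\<zeta> * \<pi>\<^sub>B\<close> generate \<open>OB\<close> over the valuation ring, and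
  these scalars can be moved to the right. Hence the translates of bimodule generators by the four
  elements generate \<open>L\<close> on the right.\<close>

lemma right_generators:
  obtains G where "finite G" "G \<subseteq> carrier L" "\<And>N. right_submodule N \<Longrightarrow> G \<subseteq> N \<Longrightarrow> N = carrier L"
proof -
  obtain S where S: "finite S" "S \<subseteq> carrier L"
    "\<And>N. is_subbimodule OB N L \<Longrightarrow> S \<subseteq> N \<Longrightarrow> N = carrier L"
    using fin_gen unfolding finitely_generated_def by auto
  define G where "G = (\<Union>s\<in>S. {s, \<zeta> \<odot> s, \<pi>\<^sub>B \<odot> s, \<zeta> \<odot> (\<pi>\<^sub>B \<odot> s)})"
  show thesis
  proof (rule that)
    show "finite G" using S(1) by (simp add: G_def)
    show "G \<subseteq> carrier L" using S(2) by (auto simp: G_def subset_iff)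
    fix N assume N: "right_submodule N" and GN: "G \<subseteq> N"
    note n = right_submoduleD[OF N]
    \<comment> \<open>This is the largest subbimodule of \<open>L\<close> contained in
      \<open>N\<close>; it is everything as soon as it contains \<open>S\<close>.\<close>
    define N' where "N' = {x \<in> carrier L. \<forall>a\<in>OB. a \<odot> x \<in> N}"
    have "is_subbimodule OB N' L"
      unfolding is_subbimodule_def
    proof (intro conjI ballI)
      show "additive_subgroup N' L"
      proof (rule additive_subgroup.intro, rule add.subgroupI)
        show "N' \<subseteq> carrier L" by (auto simp: N'_def)
        have "\<zero> \<in> N'" using n(2) by (simp add: N'_def)
        then show "N' \<noteq> {}" by blast
        show "\<ominus> x \<in> N'" if "x \<in> N'" for x using that n(5) by (simp add: N'_def smult_neg)
        show "x \<oplus> y \<in> N'" if "x \<in> N'" "y \<in> N'" for x y using that n(3) by (simp add: N'_def left_distrib)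
      qed
      fix a x assume a: "a \<in> OB" and x: "x \<in> N'"
      show "a \<odot> x \<in> N'" using a x by (simp add: N'_def flip: left_assoc)
      show "x \<triangleleft> a \<in> N'" using a x n(4) by (simp add: N'_def flip: left_right)
    qed
    moreover have "S \<subseteq> N'"
    proof
      fix s assume s: "s \<in> S"
      have sc: "s \<in> carrier L" using s S(2) by auto
      have g: "s \<in> N" "\<zeta> \<odot> s \<in> N" "\<pi>\<^sub>B \<odot> s \<in> N" "\<zeta> \<odot> (\<pi>\<^sub>B \<odot> s) \<in> N" using s GN by (auto simp: G_def)
      have OK: "a \<odot> y \<in> N" if a: "a \<in> OK" and y: "y \<in> carrier L" "y \<in> N" "\<zeta> \<odot> y \<in> N" for a y
      proof -
        obtain c e where ce: "c \<in> val_ring v" "e \<in> val_ring v" "a = \<iota> c + \<iota> e * \<zeta>"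
          using a by (rule OK_zeta_decompose)
        have [simp]: "\<iota> c \<in> OK" "\<iota> e \<in> OK" using ce iota_OK by auto
        have "a \<odot> y = y \<triangleleft> \<iota> c \<oplus> \<zeta> \<odot> y \<triangleleft> \<iota> e"
          using y(1) ce actions_agree by (simp add: left_distrib_scalar left_assoc)
        then show ?thesis using n(3,4) y by simp
      qed
      have "a \<odot> s \<in> N" if "a \<in> OB" for a
      proof -
        obtain b c where bc: "b \<in> OK" "c \<in> OK" "a = b + c * \<pi>\<^sub>B" using \<open>a \<in> OB\<close> by (rule OB_E)
        have "b \<odot> s \<in> N" "c \<odot> (\<pi>\<^sub>B \<odot> s) \<in> N" using OK bc g sc by simp_all
        moreover have "a \<odot> s = b \<odot> s \<oplus> c \<odot> (\<pi>\<^sub>B \<odot> s)" using bc sc by (simp add: left_distrib_scalar left_assoc)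
        ultimately show ?thesis using n(3) by simp
      qed
      then show "s \<in> N'" using sc by (simp add: N'_def)
    qed
    ultimately have "N' = carrier L" by (rule S(3))
    then have "x \<in> N'" if "x \<in> carrier L" for x using that by simp
    then have "1 \<odot> x \<in> N" if "x \<in> carrier L" for x using that by (simp add: N'_def)
    then have "x \<in> N" if "x \<in> carrier L" for x using that left_one by simp
    then show "N = carrier L" using n(1) by blast
  qed
qed

lemma right_submodule_insert:
  assumes N: "right_submodule N" and g: "g \<in> carrier L"
  defines "N' \<equiv> {n \<oplus> g \<triangleleft> c | n c. n \<in> N \<and> c \<in> OB}"
  shows "right_submodule N'" "N \<subseteq> N'" "g \<in> N'"
proof -
  note n = right_submoduleD[OF N]
  have I: "x \<in> N'" if "n \<in> N" "c \<in> OB" "x = n \<oplus> g \<triangleleft> c" for x n c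
    using that by (auto simp: N'_def)
  have E: "\<exists>n c. n \<in> N \<and> c \<in> OB \<and> x = n \<oplus> g \<triangleleft> c" if "x \<in> N'" for x using that by (auto simp: N'_def)
  show "N \<subseteq> N'"
  proof
    fix x assume "x \<in> N"
    then show "x \<in> N'" using n(1) g by (intro I[of x 0]) simp_all
  qed
  show "g \<in> N'" using n(2) g by (intro I[of \<zero> 1]) (simp_all add: right_one)
  show "right_submodule N'"
    unfolding right_submodule_def
  proof (intro conjI ballI)
    show "N' \<subseteq> carrier L" using n(1) g by (auto simp: N'_def)
    show "\<zero> \<in> N'" using \<open>N \<subseteq> N'\<close> n(2) by blast
    fix x assume "x \<in> N'"
    then obtain m c where mc: "m \<in> N" "c \<in> OB" "x = m \<oplus> g \<triangleleft> c" using E by blast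
    show "x \<triangleleft> a \<in> N'" if "a \<in> OB" for a
      by (rule I[of "m \<triangleleft> a" "c * a"]) (use mc n that g in \<open>simp_all add: right_distrib right_assoc\<close>)
    fix y assume "y \<in> N'"
    then obtain m' c' where mc': "m' \<in> N" "c' \<in> OB" "y = m' \<oplus> g \<triangleleft> c'" using E by blast
    show "x \<oplus> y \<in> N'"
      by (rule I[of "m \<oplus> m'" "c + c'"]) (use mc mc' n g in \<open>simp_all add: right_distrib_scalar a_ac\<close>)
  qed
qed

text \<open>Generators are discarded one at a time. If g = n + y \<open>\<pi>\<^sub>B\<close> and y
  = m + g c with n and m in the submodule, then g (1 - c \<open>\<pi>\<^sub>B\<close>) lies in the
  submodule, and the factor is a unit.\<close>

lemma nakayama:
  assumes N: "right_submodule N" and top: "\<And>x. x \<in> carrier L \<Longrightarrow> \<exists>n\<in>N. x \<ominus> n \<in> radical L"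
  shows "N = carrier L"
proof -
  obtain G where G: "finite G" "G \<subseteq> carrier L" "\<And>N. right_submodule N \<Longrightarrow> G \<subseteq> N \<Longrightarrow> N = carrier L"
    by (rule right_generators) (rule that)
  \<comment> \<open>The premise expresses that \<open>N\<close> and \<open>G\<close> together
    generate \<open>L\<close> on the right; the induction removes the elements of
    \<open>G\<close>.\<close>
  have "(\<And>N'. right_submodule N' \<Longrightarrow> N \<union> G \<subseteq> N' \<Longrightarrow> N' = carrier L) \<Longrightarrow> N = carrier L"
    using G(1,2)
  proof (induction G)
    case empty
    then show ?case using N by simp
  next
    case (insert g G)
    show ?case
    proof (rule insert.IH)
      show "G \<subseteq> carrier L" using insert.prems(2) by simp
      fix N' assume N': "right_submodule N'" "N \<union> G \<subseteq> N'"
      note n' = right_submoduleD[OF N'(1)]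
      have g: "g \<in> carrier L" using insert.prems by simp
      note ins = right_submodule_insert[OF N'(1) g]
      have all: "{n \<oplus> g \<triangleleft> c | n c. n \<in> N' \<and> c \<in> OB} = carrier L"
        using ins N'(2) by (intro insert.prems(1)) auto
      obtain n where n: "n \<in> N" "g \<ominus> n \<in> radical L" using top[OF g] by blast
      obtain y where y: "y \<in> carrier L" "g \<ominus> n = y \<triangleleft> \<pi>\<^sub>B" using n(2) by (auto simp: radical_iff)
      obtain m c where mc: "m \<in> N'" "c \<in> OB" "y = m \<oplus> g \<triangleleft> c" using y(1) all by blast
      have nN': "n \<in> N'" using n N' by blast
      have "g = (g \<ominus> n) \<oplus> n" using g nN' n'(1) by (simp add: minus_simps)
      also have "\<dots> = (m \<triangleleft> \<pi>\<^sub>B \<oplus> n) \<oplus> g \<triangleleft> (c * \<pi>\<^sub>B)"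
        using y mc g nN' n'(1) by (simp add: right_distrib right_assoc a_ac)
      finally have e: "g \<ominus> g \<triangleleft> (c * \<pi>\<^sub>B) = m \<triangleleft> \<pi>\<^sub>B \<oplus> n"
        using g mc n'(1) nN' minus_simps(2)[of "m \<triangleleft> \<pi>\<^sub>B \<oplus> n" "g \<triangleleft> (c * \<pi>\<^sub>B)"] by simp
      have cv: "c * \<pi>\<^sub>B \<in> mOB" using mc(2) by (simp add: mOB_closed)
      have u: "1 - c * \<pi>\<^sub>B \<in> OB" "1 - c * \<pi>\<^sub>B \<notin> mOB"
      proof -
        show "1 - c * \<pi>\<^sub>B \<in> OB" using mc by simp
        show "1 - c * \<pi>\<^sub>B \<notin> mOB"
        proof
          assume "1 - c * \<pi>\<^sub>B \<in> mOB"
          then have "(1 - c * \<pi>\<^sub>B) + c * \<pi>\<^sub>B \<in> mOB" using cv by (rule mOB_closed(2))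
          then show False using one_notin_mOB by simp
        qed
      qed
      have "g \<triangleleft> (1 - c * \<pi>\<^sub>B) \<in> N'"
        using e g mc(2) n'(3)[OF n'(4)[OF mc(1) piB_in] nN'] by (simp add: smult_minus(4) right_one)
      then have "g \<triangleleft> (1 - c * \<pi>\<^sub>B) \<triangleleft> inverse (1 - c * \<pi>\<^sub>B) \<in> N'" using mOB_unit(2)[OF u] n'(4) by blast
      moreover have "g \<triangleleft> (1 - c * \<pi>\<^sub>B) \<triangleleft> inverse (1 - c * \<pi>\<^sub>B) = g"
        using g u mOB_unit[OF u] by (simp add: right_one flip: right_assoc)
      ultimately show "N' = carrier L" using N' by (intro insert.prems(1)) auto
    qed
  qed
  then show ?thesis using G(3) by blast
qed

text \<open>Adjoining a generator multiplies the number of classes by at most the number of residues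
  of \<open>OK\<close>, since modulo the radical its coefficient matters only modulo
  \<open>mOB\<close>.\<close>

lemma finite_cls: "finite (cls L ` carrier L)"
proof -
  define fin where "fin N \<longleftrightarrow> (\<exists>T. finite T \<and> T \<subseteq> N \<and> (\<forall>x\<in>N. \<exists>t\<in>T. x \<ominus> t \<in> radical L))" for N
  obtain R where R: "finite R" "R \<subseteq> OK" "\<And>x. x \<in> OK \<Longrightarrow> \<exists>t\<in>R. x - t \<in> (*) (\<iota> \<pi>) ` OK"
    by (rule OK_residues) (rule that)
  have R': "\<exists>t\<in>R. x - t \<in> mOB" if x: "x \<in> OB" for x
  proof -
    obtain a b where ab: "a \<in> OK" "b \<in> OK" "x = a + b * \<pi>\<^sub>B" using x by (rule OB_E)
    from R(3)[OF ab(1)] obtain t where t: "t \<in> R" "a - t \<in> (*) (\<iota> \<pi>) ` OK" by (elim bexE)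
    have "(a - t) + b * \<pi>\<^sub>B \<in> mOB" using t R(2) ab by (subst mOB_coeff) auto
    then show ?thesis using t(1) ab by (intro bexI[of _ t]) (simp_all add: algebra_simps)
  qed
  obtain G where G: "finite G" "G \<subseteq> carrier L" "\<And>N. right_submodule N \<Longrightarrow> G \<subseteq> N \<Longrightarrow> N = carrier L"
    by (rule right_generators) (rule that)
  \<comment> \<open>The submodule grows from zero and absorbs the generators in \<open>G\<close>,
    while the premise keeps track of what is still missing.\<close>
  have "right_submodule N \<Longrightarrow> fin N \<Longrightarrow> (\<And>N'. right_submodule N' \<Longrightarrow> N \<union> G \<subseteq> N' \<Longrightarrow> N' = carrier L) \<Longrightarrow> fin (carrier L)" for N
    using G(1,2)
  proof (induction G arbitrary: N)
    case empty
    have "N = carrier L" using empty.prems(1) by (intro empty.prems(3)) simp_all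
    then show ?case using empty.prems(2) by simp
  next
    case (insert g G)
    have g: "g \<in> carrier L" using insert.prems by simp
    note n = right_submoduleD[OF insert.prems(1)]
    note ins = right_submodule_insert[OF insert.prems(1) g]
    let ?N = "{n \<oplus> g \<triangleleft> c | n c. n \<in> N \<and> c \<in> OB}"
    show ?case
    proof (rule insert.IH[OF ins(1)])
      show "G \<subseteq> carrier L" using insert.prems by simp
      show "N' = carrier L" if "right_submodule N'" "?N \<union> G \<subseteq> N'" for N'
        using that ins(2,3) by (intro insert.prems(3)) auto
      obtain T where T: "finite T" "T \<subseteq> N" "\<forall>x\<in>N. \<exists>t\<in>T. x \<ominus> t \<in> radical L"
        using insert.prems(2) unfolding fin_def by blast
      define T' where "T' = (\<lambda>(t, r). t \<oplus> g \<triangleleft> r) ` (T \<times> R)"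
      have "\<exists>t\<in>T'. x \<ominus> t \<in> radical L" if x: "x \<in> ?N" for x
      proof -
        obtain m c where mc: "m \<in> N" "c \<in> OB" "x = m \<oplus> g \<triangleleft> c" using x by blast
        obtain t where t: "t \<in> T" "m \<ominus> t \<in> radical L" using T(3) mc(1) by blast
        obtain r where r: "r \<in> R" "c - r \<in> mOB" using R' mc(2) by blast
        have rO: "r \<in> OB" using r R(2) by auto
        have tc: "t \<in> carrier L" using t T n(1) by blast
        have "x \<ominus> (t \<oplus> g \<triangleleft> r) = (m \<ominus> t) \<oplus> g \<triangleleft> (c - r)"
          using mc n(1) tc g rO by (simp add: minus_simps smult_minus(4))
        also have "\<dots> \<in> radical L" using t(2) right_mOB_radical[OF g r(2)] by (rule radical_closed(2))
        finally show ?thesis using t(1) r(1) by (auto simp: T'_def)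
      qed
      moreover have "finite T'" using T(1) R(1) by (simp add: T'_def)
      moreover have "T' \<subseteq> ?N"
      proof
        fix x assume "x \<in> T'"
        then obtain t r where "t \<in> T" "r \<in> R" "x = t \<oplus> g \<triangleleft> r" by (auto simp: T'_def)
        moreover have "r \<in> OB" "t \<in> N" using calculation R(2) T(2) by auto
        ultimately show "x \<in> ?N" by blast
      qed
      ultimately show "fin ?N" unfolding fin_def by (intro exI[of _ T'] conjI ballI)
    qed
  qed
  moreover have "right_submodule {\<zero>}" by (simp add: right_submodule_def)
  moreover have "fin {\<zero>}" unfolding fin_def by (intro exI[of _ "{\<zero>}"]) (simp add: minus_simps radical_closed)
  ultimately have "fin (carrier L)" using G(3) by blast
  then obtain T where T: "finite T" "T \<subseteq> carrier L" "\<forall>x\<in>carrier L. \<exists>t\<in>T. x \<ominus> t \<in> radical L"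
    unfolding fin_def by blast
  have "cls L ` carrier L \<subseteq> cls L ` T"
  proof
    fix X assume "X \<in> cls L ` carrier L"
    then obtain x where x: "x \<in> carrier L" "X = cls L x" by (elim imageE)
    obtain t where t: "t \<in> T" "x \<ominus> t \<in> radical L" using T(3) x(1) by blast
    then have "X = cls L t" using x T(2) cls_eq_iff[of x t] by auto
    then show "X \<in> cls L ` T" using t(1) by (rule image_eqI)
  qed
  then show ?thesis using T(1) finite_subset by blast
qed

text \<open>A kernel element is divisible by \<open>\<pi>\<^sub>B\<close> because the map is
  injective modulo the radical. The quotient lies in the kernel again, as
  \<open>\<pi>\<^sub>B\<close> acts injectively on \<open>L\<close>, so divisibility continues
  through all powers.\<close>

lemma hom_bijective:
  assumes M: "bimodule OB M" and sep: "separated M" and f: "inj_rad M L f"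
    and top: "image_rad M L f = carrier L"
  shows "bij_betw f (carrier M) (carrier L)"
proof -
  interpret M: quaternion_bimodule v \<iota> OB K \<sigma> \<pi> \<pi>\<^sub>B M using M by (rule quaternion_bimoduleI)
  have hom: "bimodule_hom OB M L f" and rad: "\<And>u. u \<in> carrier M \<Longrightarrow> f u \<in> radical L \<Longrightarrow> u \<in> radical M"
    using f by (auto simp: inj_rad_def)
  note h = bimodule_homD[OF hom] and hm = hom_minus[OF M bimodule_axioms hom]
  have f0: "f \<zero>\<^bsub>M\<^esub> = \<zero>" by (rule hm(2)[OF M.zero_closed M.zero_closed])
  have ker: "u = \<zero>\<^bsub>M\<^esub>" if u: "u \<in> carrier M" "f u = \<zero>" for u
  proof -
    have "\<exists>w\<in>carrier M. u = w \<triangleleft>\<^bsub>M\<^esub> (\<pi>\<^sub>B ^ n) \<and> f w = \<zero>" for n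
    proof (induction n)
      case 0
      show ?case using u M.right_one by auto
    next
      case (Suc n)
      then obtain w where w: "w \<in> carrier M" "u = w \<triangleleft>\<^bsub>M\<^esub> (\<pi>\<^sub>B ^ n)" "f w = \<zero>" by blast
      then have "w \<in> radical M" using rad radical_closed(1) by simp
      then obtain w' where w': "w' \<in> carrier M" "w = w' \<triangleleft>\<^bsub>M\<^esub> \<pi>\<^sub>B" by (auto simp: radical_iff)
      have "f w' \<triangleleft> \<pi>\<^sub>B = \<zero>" using w w' h(4)[of \<pi>\<^sub>B w'] by simp
      then have "f w' = \<zero>" using right_varpi_inj h(1) w' by blast
      moreover have "u = w' \<triangleleft>\<^bsub>M\<^esub> (\<pi>\<^sub>B ^ Suc n)" using w w' by (simp add: M.right_assoc)
      ultimately show ?case using w' by blast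
    qed
    then show ?thesis using sep u(1) unfolding separated_def by blast
  qed
  have "inj_on f (carrier M)"
  proof (rule inj_onI)
    fix x y assume xy: "x \<in> carrier M" "y \<in> carrier M" "f x = f y"
    then have "f (x \<ominus>\<^bsub>M\<^esub> y) = \<zero>" using hm(1) h(1) by (simp add: minus_simps)
    then have "x \<ominus>\<^bsub>M\<^esub> y = \<zero>\<^bsub>M\<^esub>" using ker xy by simp
    then show "x = y" using xy M.minus_eq_0_iff by simp
  qed
  moreover have "f ` carrier M = carrier L"
  proof (rule nakayama)
    show "right_submodule (f ` carrier M)"
      unfolding right_submodule_def
    proof (intro conjI ballI)
      show "f ` carrier M \<subseteq> carrier L" using h(1) by auto
      show "\<zero> \<in> f ` carrier M" using f0 by (intro image_eqI[of _ _ "\<zero>\<^bsub>M\<^esub>"]) simp_all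
      fix x assume "x \<in> f ` carrier M"
      then obtain u where u: "u \<in> carrier M" "x = f u" by auto
      show "x \<triangleleft> a \<in> f ` carrier M" if "a \<in> OB" for a
        using that u h(4) by (intro image_eqI[of _ _ "u \<triangleleft>\<^bsub>M\<^esub> a"]) simp_all
      fix y assume "y \<in> f ` carrier M"
      then obtain w where w: "w \<in> carrier M" "y = f w" by auto
      then show "x \<oplus> y \<in> f ` carrier M"
        using u h(2) by (intro image_eqI[of _ _ "u \<oplus>\<^bsub>M\<^esub> w"]) simp_all
    qed
    fix x assume "x \<in> carrier L"
    then show "\<exists>n\<in>f ` carrier M. x \<ominus> n \<in> radical L" using top by (auto simp: image_rad_def)
  qed
  ultimately show ?thesis by (simp add: bij_betw_def)
qed

text \<open>The last item is where locality of \<open>OB\<close> enters: a coefficient outside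
  \<open>mOB\<close> is a unit and may be cancelled. It takes the place of linear independence over
  a division ring.\<close>

lemma image_rad_closed:
  assumes M: "bimodule OB M" and f: "bimodule_hom OB M L f"
  defines "I \<equiv> image_rad M L f"
  shows "x \<in> radical L \<Longrightarrow> x \<in> I" "u \<in> carrier M \<Longrightarrow> f u \<in> I" "x \<in> I \<Longrightarrow> y \<in> I \<Longrightarrow> x \<oplus> y \<in> I"
    "x \<in> I \<Longrightarrow> a \<in> OB \<Longrightarrow> x \<triangleleft> a \<in> I" "x \<in> I \<Longrightarrow> y \<in> I \<Longrightarrow> x \<ominus> y \<in> I" "x \<in> I \<Longrightarrow> x \<in> carrier L"
    "x \<in> carrier L \<Longrightarrow> a \<in> OB \<Longrightarrow> a \<notin> mOB \<Longrightarrow> x \<triangleleft> a \<in> I \<Longrightarrow> x \<in> I"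
proof -
  interpret M: quaternion_bimodule v \<iota> OB K \<sigma> \<pi> \<pi>\<^sub>B M using M by (rule quaternion_bimoduleI)
  note h = bimodule_homD[OF f] and hm = hom_minus[OF M bimodule_axioms f]
  have iff: "x \<in> I \<longleftrightarrow> x \<in> carrier L \<and> (\<exists>u\<in>carrier M. x \<ominus> f u \<in> radical L)" for x
    by (simp add: I_def image_rad_def)
  have f0: "f \<zero>\<^bsub>M\<^esub> = \<zero>" by (rule hm(2)[OF M.zero_closed M.zero_closed])
  show "x \<in> radical L \<Longrightarrow> x \<in> I"
    unfolding iff using f0 radical_carrier by (auto intro!: bexI[of _ "\<zero>\<^bsub>M\<^esub>"] simp: minus_simps)
  show "u \<in> carrier M \<Longrightarrow> f u \<in> I"
    unfolding iff using h(1) radical_closed(1) by (auto intro!: bexI[of _ u] simp: minus_simps)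
  show car: "x \<in> I \<Longrightarrow> x \<in> carrier L" for x using iff by blast
  show right: "x \<triangleleft> a \<in> I" if "x \<in> I" "a \<in> OB" for x a
  proof -
    obtain u where u: "u \<in> carrier M" "x \<ominus> f u \<in> radical L" using \<open>x \<in> I\<close> iff by blast
    have "(x \<ominus> f u) \<triangleleft> a \<in> radical L" using u(2) that(2) by (rule radical_closed(5))
    then have "x \<triangleleft> a \<ominus> f (u \<triangleleft>\<^bsub>M\<^esub> a) \<in> radical L" using u that car h by (simp add: smult_minus(3))
    then show ?thesis unfolding iff using u that car by (intro conjI bexI[of _ "u \<triangleleft>\<^bsub>M\<^esub> a"]) simp_all
  qed
  have add: "x \<oplus> y \<in> I" if "x \<in> I" "y \<in> I" for x y
  proof -
    obtain u where u: "u \<in> carrier M" "x \<ominus> f u \<in> radical L" using \<open>x \<in> I\<close> iff by blast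
    obtain w where w: "w \<in> carrier M" "y \<ominus> f w \<in> radical L" using \<open>y \<in> I\<close> iff by blast
    have "(x \<oplus> y) \<ominus> f (u \<oplus>\<^bsub>M\<^esub> w) = (x \<ominus> f u) \<oplus> (y \<ominus> f w)"
      using u w car that h by (simp add: minus_simps)
    then have "(x \<oplus> y) \<ominus> f (u \<oplus>\<^bsub>M\<^esub> w) \<in> radical L" using u(2) w(2) radical_closed(2) by simp
    then show ?thesis unfolding iff using u w that car by (intro conjI bexI[of _ "u \<oplus>\<^bsub>M\<^esub> w"]) simp_all
  qed
  then show "x \<in> I \<Longrightarrow> y \<in> I \<Longrightarrow> x \<oplus> y \<in> I" by blast
  show "x \<ominus> y \<in> I" if "x \<in> I" "y \<in> I"
    using add[OF that(1) right[OF that(2), of "- 1"]] car[OF that(2)]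
    by (simp add: minus_eq smult_neg right_one)
  show "x \<in> I" if "x \<in> carrier L" "a \<in> OB" "a \<notin> mOB" "x \<triangleleft> a \<in> I"
    using right[OF that(4) mOB_unit(2)[OF that(2,3)]] mOB_unit[OF that(2,3)] that(1,2)
    by (simp add: right_one flip: right_assoc)
qed

end

subsection \<open>Bilattices attached to embeddings\<close>

lemma emb_bimodule_simps:
  "carrier (emb_bimodule R n \<phi>) = {x \<in> carrier_vec n. \<forall>i<n. x $ i \<in> R}"
  "\<zero>\<^bsub>emb_bimodule R n \<phi>\<^esub> = 0\<^sub>v n" "x \<oplus>\<^bsub>emb_bimodule R n \<phi>\<^esub> y = x + y"
  "a \<odot>\<^bsub>emb_bimodule R n \<phi>\<^esub> x = \<phi> a *\<^sub>v x" "x \<triangleleft>\<^bsub>emb_bimodule R n \<phi>\<^esub> a = map_vec (\<lambda>y. y * a) x"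
  by (simp_all add: emb_bimodule_def)

lemma mult_mat_vec_index_sum:
  assumes "A \<in> carrier_mat n m" "x \<in> carrier_vec m" "i < n"
  shows "(A *\<^sub>v x) $ i = (\<Sum>j<m. A $$ (i, j) * x $ j)"
  using assms by (simp add: scalar_prod_def atLeast0LessThan row_def)

lemma mult_mat_vec_map_right:
  fixes A :: "'a::ring_1 mat"
  assumes "A \<in> carrier_mat n m" "x \<in> carrier_vec m"
  shows "A *\<^sub>v map_vec (\<lambda>y. y * c) x = map_vec (\<lambda>y. y * c) (A *\<^sub>v x)"
proof (rule eq_vecI)
  fix i assume "i < dim_vec (map_vec (\<lambda>y. y * c) (A *\<^sub>v x))"
  then have i: "i < n" using assms by simp
  have "(A *\<^sub>v map_vec (\<lambda>y. y * c) x) $ i = (\<Sum>j<m. A $$ (i, j) * (x $ j * c))"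
    using assms i by (subst mult_mat_vec_index_sum[of _ n m]) (auto intro!: sum.cong)
  also have "\<dots> = (A *\<^sub>v x) $ i * c"
    using assms i by (subst mult_mat_vec_index_sum[of A n m]) (auto simp: sum_distrib_right mult.assoc)
  finally show "(A *\<^sub>v map_vec (\<lambda>y. y * c) x) $ i = map_vec (\<lambda>y. y * c) (A *\<^sub>v x) $ i"
    using assms i by simp
qed (use assms in simp)

context quaternion_setting
begin

text \<open>Stated for an arbitrary set \<open>N\<close> so that it yields both finite generation
  and the fact that right linear maps are given by matrices.\<close>

lemma vec_right_generated:
  assumes N: "0\<^sub>v n \<in> N" "\<And>x y. x \<in> N \<Longrightarrow> y \<in> N \<Longrightarrow> x + y \<in> N"
    "\<And>x a. x \<in> N \<Longrightarrow> a \<in> OB \<Longrightarrow> map_vec (\<lambda>y. y * a) x \<in> N" "\<And>i. i < n \<Longrightarrow> unit_vec n i \<in> N"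
    and x: "x \<in> carrier_vec n" "\<forall>i<n. x $ i \<in> OB"
  shows "x \<in> N"
proof -
  \<comment> \<open>The vector is built up by its truncations to the first \<open>k\<close>
    coordinates.\<close>
  have "k \<le> n \<Longrightarrow> vec n (\<lambda>i. if i < k then x $ i else 0) \<in> N" for k
  proof (induction k)
    case 0
    have "vec n (\<lambda>i. if i < 0 then x $ i else 0) = 0\<^sub>v n" by (simp add: zero_vec_def)
    then show ?case using N(1) by (simp only:)
  next
    case (Suc k)
    then have "map_vec (\<lambda>y. y * x $ k) (unit_vec n k) \<in> N" using x(2) by (intro N(3,4)) simp_all
    then have "vec n (\<lambda>i. if i < k then x $ i else 0) + map_vec (\<lambda>y. y * x $ k) (unit_vec n k) \<in> N"
      using Suc by (intro N(2)) simp_all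
    moreover have "vec n (\<lambda>i. if i < k then x $ i else 0) + map_vec (\<lambda>y. y * x $ k) (unit_vec n k)
      = vec n (\<lambda>i. if i < Suc k then x $ i else 0)"
      using Suc.prems by (intro eq_vecI) (auto simp: unit_vec_def less_Suc_eq)
    ultimately show ?case by simp
  qed
  from this[of n] have "vec n (\<lambda>i. if i < n then x $ i else 0) \<in> N" by simp
  moreover have "vec n (\<lambda>i. if i < n then x $ i else 0) = x" using x(1) by (intro eq_vecI) auto
  ultimately show ?thesis by simp
qed

lemma OB_sum: "(\<And>x. x \<in> A \<Longrightarrow> f x \<in> OB) \<Longrightarrow> sum f A \<in> OB"
  by (induction A rule: infinite_finite_induct) auto

lemma mat_over_iff: "A \<in> mat_over OB n \<longleftrightarrow> A \<in> carrier_mat n n \<and> (\<forall>i<n. \<forall>j<n. A $$ (i, j) \<in> OB)"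
  by (force simp: mat_over_def elements_mat_def subset_iff)

lemma mat_over_mult_vec:
  assumes "A \<in> mat_over OB n" "x \<in> carrier_vec n" "\<forall>i<n. x $ i \<in> OB" "i < n"
  shows "(A *\<^sub>v x) $ i \<in> OB"
proof -
  have "(A *\<^sub>v x) $ i = (\<Sum>j<n. A $$ (i, j) * x $ j)"
    using assms by (intro mult_mat_vec_index_sum) (simp_all add: mat_over_iff)
  also have "\<dots> \<in> OB" using assms by (intro OB_sum) (simp add: mat_over_iff)
  finally show ?thesis .
qed

lemma algebra_embeddingD:
  assumes "algebra_embedding v \<iota> OB n \<phi>"
  shows "a \<in> OB \<Longrightarrow> \<phi> a \<in> mat_over OB n" "a \<in> OB \<Longrightarrow> \<phi> a \<in> carrier_mat n n" "\<phi> 1 = 1\<^sub>m n"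
    "a \<in> OB \<Longrightarrow> b \<in> OB \<Longrightarrow> \<phi> (a + b) = \<phi> a + \<phi> b" "a \<in> OB \<Longrightarrow> b \<in> OB \<Longrightarrow> \<phi> (a * b) = \<phi> a * \<phi> b"
    "c \<in> val_ring v \<Longrightarrow> a \<in> OB \<Longrightarrow> \<phi> (\<iota> c * a) = \<iota> c \<cdot>\<^sub>m \<phi> a"
  using assms by (auto simp: algebra_embedding_def mat_over_def)

context
  fixes n \<phi>
  assumes emb: "algebra_embedding v \<iota> OB n \<phi>"
begin

lemmas emb_D = algebra_embeddingD[OF emb]

lemma emb_smult_closed:
  "a \<in> OB \<Longrightarrow> x \<in> carrier (emb_bimodule OB n \<phi>) \<Longrightarrow> \<phi> a *\<^sub>v x \<in> carrier (emb_bimodule OB n \<phi>)"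
proof -
  assume a: "a \<in> OB" and x: "x \<in> carrier (emb_bimodule OB n \<phi>)"
  have "\<phi> a *\<^sub>v x \<in> carrier_vec n" using emb_D(2)[OF a] x by (simp add: emb_bimodule_simps)
  moreover have "\<forall>i<n. (\<phi> a *\<^sub>v x) $ i \<in> OB"
    using mat_over_mult_vec[OF emb_D(1)[OF a]] x by (simp only: emb_bimodule_simps mem_Collect_eq) blast
  ultimately show ?thesis by (simp only: emb_bimodule_simps mem_Collect_eq)
qed

lemma emb_bimodule: "bimodule OB (emb_bimodule OB n \<phi>)"
proof (rule bimodule.intro)
  let ?E = "emb_bimodule OB n \<phi>"
  show "abelian_group ?E"
  proof (rule abelian_groupI)
    fix x assume "x \<in> carrier ?E"
    then show "\<exists>y\<in>carrier ?E. y \<oplus>\<^bsub>?E\<^esub> x = \<zero>\<^bsub>?E\<^esub>"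
      by (intro bexI[of _ "- x"]) (auto simp: emb_bimodule_simps)
  qed (auto simp: emb_bimodule_simps comm_add_vec)
  show "bimodule_axioms OB ?E"
  proof
    fix x assume "x \<in> carrier ?E"
    then have x: "x \<in> carrier_vec n" by (simp add: emb_bimodule_simps)
    show "1 \<odot>\<^bsub>?E\<^esub> x = x" unfolding emb_bimodule_simps using x by (simp add: emb_D)
    show "x \<triangleleft>\<^bsub>?E\<^esub> 1 = x" unfolding emb_bimodule_simps by (intro eq_vecI) simp_all
  next
    fix a b x y assume a: "a \<in> OB" and b: "b \<in> OB" and x: "x \<in> carrier ?E" and y: "y \<in> carrier ?E"
    note ab = emb_D(2)[OF a] emb_D(2)[OF b]
    have xy: "x \<in> carrier_vec n" "y \<in> carrier_vec n" using x y by (simp_all add: emb_bimodule_simps)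
    show "a \<odot>\<^bsub>?E\<^esub> x \<in> carrier ?E" using emb_smult_closed[OF a x] by (simp add: emb_bimodule_simps(4))
    show "(a + b) \<odot>\<^bsub>?E\<^esub> x = a \<odot>\<^bsub>?E\<^esub> x \<oplus>\<^bsub>?E\<^esub> b \<odot>\<^bsub>?E\<^esub> x"
      unfolding emb_bimodule_simps using a b ab xy by (simp add: emb_D add_mult_distrib_mat_vec[OF ab xy(1)])
    show "a \<odot>\<^bsub>?E\<^esub> (x \<oplus>\<^bsub>?E\<^esub> y) = a \<odot>\<^bsub>?E\<^esub> x \<oplus>\<^bsub>?E\<^esub> a \<odot>\<^bsub>?E\<^esub> y"
      unfolding emb_bimodule_simps using ab xy by (simp add: mult_add_distrib_mat_vec[OF ab(1) xy])
    show "(a * b) \<odot>\<^bsub>?E\<^esub> x = a \<odot>\<^bsub>?E\<^esub> (b \<odot>\<^bsub>?E\<^esub> x)"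
      unfolding emb_bimodule_simps using assoc_mult_mat_vec[OF ab xy(1)] a b by (simp add: emb_D)
    show "x \<triangleleft>\<^bsub>?E\<^esub> a \<in> carrier ?E" using x a by (auto simp: emb_bimodule_simps)
    show "x \<triangleleft>\<^bsub>?E\<^esub> (a + b) = x \<triangleleft>\<^bsub>?E\<^esub> a \<oplus>\<^bsub>?E\<^esub> x \<triangleleft>\<^bsub>?E\<^esub> b"
      unfolding emb_bimodule_simps using xy by (intro eq_vecI) (simp_all add: distrib_left)
    show "(x \<oplus>\<^bsub>?E\<^esub> y) \<triangleleft>\<^bsub>?E\<^esub> a = x \<triangleleft>\<^bsub>?E\<^esub> a \<oplus>\<^bsub>?E\<^esub> y \<triangleleft>\<^bsub>?E\<^esub> a"
      unfolding emb_bimodule_simps using xy by (intro eq_vecI) (simp_all add: distrib_right)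
    show "x \<triangleleft>\<^bsub>?E\<^esub> (a * b) = x \<triangleleft>\<^bsub>?E\<^esub> a \<triangleleft>\<^bsub>?E\<^esub> b"
      unfolding emb_bimodule_simps using xy by (intro eq_vecI) (simp_all add: mult.assoc)
    show "a \<odot>\<^bsub>?E\<^esub> x \<triangleleft>\<^bsub>?E\<^esub> b = a \<odot>\<^bsub>?E\<^esub> (x \<triangleleft>\<^bsub>?E\<^esub> b)"
      unfolding emb_bimodule_simps using ab xy by (simp add: mult_mat_vec_map_right)
  qed
qed

lemma emb_quaternion_bimodule: "quaternion_bimodule v \<iota> OB K \<sigma> \<pi> \<pi>\<^sub>B (emb_bimodule OB n \<phi>)"
  using emb_bimodule by (rule quaternion_bimoduleI)

lemma emb_minus:
  assumes "x \<in> carrier (emb_bimodule OB n \<phi>)" "y \<in> carrier (emb_bimodule OB n \<phi>)" "i < n"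
  shows "(x \<ominus>\<^bsub>emb_bimodule OB n \<phi>\<^esub> y) $ i = x $ i - y $ i"
proof -
  interpret E: quaternion_bimodule v \<iota> OB K \<sigma> \<pi> \<pi>\<^sub>B "emb_bimodule OB n \<phi>" by (rule emb_quaternion_bimodule)
  have "\<ominus>\<^bsub>emb_bimodule OB n \<phi>\<^esub> y = y \<triangleleft>\<^bsub>emb_bimodule OB n \<phi>\<^esub> (- 1)"
    using assms by (simp add: E.smult_neg E.right_one)
  then have "x \<ominus>\<^bsub>emb_bimodule OB n \<phi>\<^esub> y = x + map_vec (\<lambda>z. z * (- 1)) y"
    by (simp add: E.minus_eq emb_bimodule_simps)
  then show ?thesis using assms by (auto simp: emb_bimodule_simps)
qed

lemma emb_radical: "x \<in> radical (emb_bimodule OB n \<phi>) \<longleftrightarrow> x \<in> carrier_vec n \<and> (\<forall>i<n. x $ i \<in> mOB)"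
proof
  assume "x \<in> radical (emb_bimodule OB n \<phi>)"
  then show "x \<in> carrier_vec n \<and> (\<forall>i<n. x $ i \<in> mOB)"
    by (auto simp: radical_iff emb_bimodule_simps mOB_right)
next
  assume x: "x \<in> carrier_vec n \<and> (\<forall>i<n. x $ i \<in> mOB)"
  then have "\<forall>i. \<exists>y. i < n \<longrightarrow> y \<in> OB \<and> x $ i = y * \<pi>\<^sub>B" by (auto simp: mOB_right)
  from choice[OF this] obtain y where y: "\<And>i. i < n \<Longrightarrow> y i \<in> OB \<and> x $ i = y i * \<pi>\<^sub>B" by auto
  have "x = map_vec (\<lambda>z. z * \<pi>\<^sub>B) (vec n y)" using x y by (intro eq_vecI) auto
  then show "x \<in> radical (emb_bimodule OB n \<phi>)"
    unfolding radical_iff using y by (intro bexI[of _ "vec n y"]) (auto simp: emb_bimodule_simps)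
qed

lemma emb_cls:
  assumes "x \<in> carrier (emb_bimodule OB n \<phi>)" "y \<in> carrier (emb_bimodule OB n \<phi>)"
  shows "cls (emb_bimodule OB n \<phi>) x = cls (emb_bimodule OB n \<phi>) y \<longleftrightarrow> (\<forall>i<n. x $ i - y $ i \<in> mOB)"
proof -
  interpret E: quaternion_bimodule v \<iota> OB K \<sigma> \<pi> \<pi>\<^sub>B "emb_bimodule OB n \<phi>" by (rule emb_quaternion_bimodule)
  have "x \<ominus>\<^bsub>emb_bimodule OB n \<phi>\<^esub> y \<in> carrier_vec n"
    using E.minus_closed[OF assms] by (simp add: emb_bimodule_simps)
  then show ?thesis using E.cls_eq_iff[OF assms] emb_minus[OF assms] by (simp add: emb_radical)
qed

lemma emb_bilattice: "bilattice v \<iota> OB (emb_bimodule OB n \<phi>)"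
proof (intro bilattice.intro emb_bimodule bilattice_axioms.intro)
  let ?E = "emb_bimodule OB n \<phi>"
  interpret E: quaternion_bimodule v \<iota> OB K \<sigma> \<pi> \<pi>\<^sub>B ?E by (rule emb_quaternion_bimodule)
  have scalar: "\<iota> c \<odot>\<^bsub>?E\<^esub> x = vec n (\<lambda>i. \<iota> c * x $ i)" if "c \<in> val_ring v" "x \<in> carrier ?E" for c x
  proof -
    have "\<phi> (\<iota> c) = \<iota> c \<cdot>\<^sub>m 1\<^sub>m n" using emb_D(6)[of c 1] emb_D(3) that by simp
    moreover have x: "x \<in> carrier_vec n" using that by (simp add: emb_bimodule_simps)
    have "(\<iota> c \<cdot>\<^sub>m 1\<^sub>m n) *\<^sub>v x = vec n (\<lambda>i. \<iota> c * x $ i)"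
    proof (rule eq_vecI)
      fix i assume "i < dim_vec (vec n (\<lambda>i. \<iota> c * x $ i))"
      then have i: "i < n" by simp
      have "((\<iota> c \<cdot>\<^sub>m 1\<^sub>m n) *\<^sub>v x) $ i = (\<Sum>j<n. (\<iota> c \<cdot>\<^sub>m 1\<^sub>m n) $$ (i, j) * x $ j)"
        using i x by (intro mult_mat_vec_index_sum) simp_all
      also have "\<dots> = (\<Sum>j<n. (if i = j then \<iota> c * x $ j else 0))"
        using i by (intro sum.cong refl) auto
      finally show "((\<iota> c \<cdot>\<^sub>m 1\<^sub>m n) *\<^sub>v x) $ i = vec n (\<lambda>i. \<iota> c * x $ i) $ i" using i by simp
    qed (use x in simp)
    ultimately show ?thesis by (simp add: emb_bimodule_simps(4))
  qed
  fix c x assume c: "c \<in> val_ring v" and x: "x \<in> carrier ?E"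
  have xn: "x \<in> carrier_vec n" using x by (simp add: emb_bimodule_simps)
  show "\<iota> c \<odot>\<^bsub>?E\<^esub> x = x \<triangleleft>\<^bsub>?E\<^esub> \<iota> c"
    unfolding scalar[OF c x] emb_bimodule_simps(5) using xn by (intro eq_vecI) (simp_all add: iota_commute)
  show "c = 0 \<or> x = \<zero>\<^bsub>?E\<^esub>" if "\<iota> c \<odot>\<^bsub>?E\<^esub> x = \<zero>\<^bsub>?E\<^esub>"
  proof (rule disjCI)
    assume nz: "x \<noteq> \<zero>\<^bsub>?E\<^esub>"
    have "\<exists>i<n. x $ i \<noteq> 0"
    proof (rule ccontr)
      assume "\<not> (\<exists>i<n. x $ i \<noteq> 0)"
      then have "x = 0\<^sub>v n" using xn by (intro eq_vecI) auto
      then show False using nz by (simp add: emb_bimodule_simps)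
    qed
    then obtain i where i: "i < n" "x $ i \<noteq> 0" by blast
    have "vec n (\<lambda>i. \<iota> c * x $ i) $ i = 0\<^sub>v n $ i" using that scalar[OF c x] by (simp add: emb_bimodule_simps(2))
    then show "c = 0" using i by simp
  qed
next
  let ?E = "emb_bimodule OB n \<phi>"
  show "finitely_generated OB ?E"
    unfolding finitely_generated_def
  proof (intro exI conjI allI impI)
    show "finite (unit_vec n ` {..<n})" by simp
    show "unit_vec n ` {..<n} \<subseteq> carrier ?E" by (auto simp: emb_bimodule_simps unit_vec_def)
    fix N assume "is_subbimodule OB N ?E \<and> unit_vec n ` {..<n} \<subseteq> N"
    then have N: "additive_subgroup N ?E" "\<And>a x. a \<in> OB \<Longrightarrow> x \<in> N \<Longrightarrow> x \<triangleleft>\<^bsub>?E\<^esub> a \<in> N"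
      "unit_vec n ` {..<n} \<subseteq> N" by (auto simp: is_subbimodule_def)
    have "carrier ?E \<subseteq> N"
    proof
      fix x assume x: "x \<in> carrier ?E"
      show "x \<in> N"
      proof (rule vec_right_generated)
        show "0\<^sub>v n \<in> N" using additive_subgroup.zero_closed[OF N(1)] by (simp add: emb_bimodule_simps)
        show "x + y \<in> N" if "x \<in> N" "y \<in> N" for x y
          using additive_subgroup.a_closed[OF N(1) that] by (simp add: emb_bimodule_simps)
        show "map_vec (\<lambda>y. y * a) x \<in> N" if "x \<in> N" "a \<in> OB" for x a
          using N(2)[OF that(2,1)] by (simp add: emb_bimodule_simps)
      qed (use x N(3) in \<open>auto simp: emb_bimodule_simps\<close>)
    qed
    moreover have "N \<subseteq> carrier ?E" using additive_subgroup.a_subset[OF N(1)] .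
    ultimately show "N = carrier ?E" by blast
  qed
qed

lemma emb_separated: "separated (emb_bimodule OB n \<phi>)"
  unfolding separated_def
proof (intro ballI impI)
  let ?E = "emb_bimodule OB n \<phi>"
  fix x assume x: "x \<in> carrier ?E" and div: "\<forall>n. \<exists>y\<in>carrier ?E. x = y \<triangleleft>\<^bsub>?E\<^esub> \<pi>\<^sub>B ^ n"
  have "x $ i = 0" if i: "i < n" for i
  proof (rule pi_power_separated)
    fix m
    \<comment> \<open>Twice the exponent is taken because the square of \<open>\<pi>\<^sub>B\<close>
      is \<pi>.\<close>
    obtain y where y: "y \<in> carrier ?E" "x = y \<triangleleft>\<^bsub>?E\<^esub> \<pi>\<^sub>B ^ (2 * m)" using div by blast
    have "x $ i = y $ i * \<pi>\<^sub>B ^ (2 * m)" using y i by (auto simp: emb_bimodule_simps)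
    also have "\<pi>\<^sub>B ^ (2 * m) = \<iota> (\<pi> ^ m)" by (simp add: power_mult piB_square iota.hom_power)
    also have "y $ i * \<dots> = \<iota> (\<pi> ^ m) * y $ i" by (simp add: iota_commute)
    finally show "x $ i \<in> (*) (\<iota> (\<pi> ^ m)) ` OB"
      using y(1) i by (intro image_eqI[of _ _ "y $ i"]) (simp_all add: emb_bimodule_simps)
  qed
  then show "x = \<zero>\<^bsub>?E\<^esub>" using x by (intro eq_vecI) (auto simp: emb_bimodule_simps)
qed

end

section \<open>Residues of \<open>OB\<close> and the rank of the attached bilattice\<close>

definition resB :: "'b \<Rightarrow> 'b set" where "resB x = {y \<in> OB. x - y \<in> mOB}"

lemma resB_eq_iff: assumes "x \<in> OB" "y \<in> OB" shows "resB x = resB y \<longleftrightarrow> x - y \<in> mOB"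
proof
  assume "resB x = resB y"
  moreover have "y \<in> resB y" using assms mOB_closed(1) by (simp add: resB_def)
  ultimately have "y \<in> resB x" by simp
  then show "x - y \<in> mOB" by (simp add: resB_def)
next
  assume xy: "x - y \<in> mOB"
  have "x - z \<in> mOB \<longleftrightarrow> y - z \<in> mOB" for z
    using mOB_closed(2)[OF xy, of "y - z"] mOB_closed(3)[OF _ xy, of "x - z"] by auto
  then show "resB x = resB y" by (simp add: resB_def)
qed

lemma mOB_OK: "a \<in> OK \<Longrightarrow> a \<in> mOB \<longleftrightarrow> a \<in> (*) (\<iota> \<pi>) ` OK"
  using mOB_coeff[of a 0] by simp

text \<open>Modulo \<open>\<pi>\<^sub>B\<close> only the first coefficient survives, so the quotient
  of \<open>OB\<close> is the residue field of \<open>K\<close>.\<close>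

lemma card_resB: "card (resB ` OB) = q"
proof -
  have "resB ` OB = resB ` OK"
  proof
    show "resB ` OK \<subseteq> resB ` OB" by (intro image_mono OK_sub_OB)
    show "resB ` OB \<subseteq> resB ` OK"
    proof
      fix X assume "X \<in> resB ` OB"
      then obtain x where x: "x \<in> OB" "X = resB x" by (elim imageE)
      obtain a b where ab: "a \<in> OK" "b \<in> OK" "x = a + b * \<pi>\<^sub>B" using x(1) by (rule OB_E)
      have "x - a \<in> mOB" using ab mOB_closed(5)[OF varpi_mOB, of b] by simp
      then have "X = resB a" using x ab by (simp add: resB_eq_iff)
      then show "X \<in> resB ` OK" using ab(1) by (rule image_eqI)
    qed
  qed
  also have "card (resB ` OK) = card (res ` OK)"
    by (rule card_image_cong_iff(1)) (simp add: resB_eq_iff res_eq_iff mOB_OK)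
  finally show ?thesis .
qed

text \<open>As q exceeds 1, this count recovers the matrix size n from the isomorphism class of the
  bilattice.\<close>

lemma emb_card: assumes emb: "algebra_embedding v \<iota> OB n \<phi>"
  shows "card (cls (emb_bimodule OB n \<phi>) ` carrier (emb_bimodule OB n \<phi>)) = q ^ n"
proof -
  let ?E = "emb_bimodule OB n \<phi>"
  let ?h = "\<lambda>x. restrict (\<lambda>i. resB (x $ i)) {..<n}"
  have "card (cls ?E ` carrier ?E) = card (?h ` carrier ?E)"
  proof (rule card_image_cong_iff(1))
    fix x y assume xy: "x \<in> carrier ?E" "y \<in> carrier ?E"
    have "cls ?E x = cls ?E y \<longleftrightarrow> (\<forall>i<n. resB (x $ i) = resB (y $ i))"
      using emb_cls[OF emb xy] xy resB_eq_iff by (auto simp: emb_bimodule_simps)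
    also have "\<dots> \<longleftrightarrow> ?h x = ?h y" by (auto simp: fun_eq_iff restrict_def)
    finally show "cls ?E x = cls ?E y \<longleftrightarrow> ?h x = ?h y" .
  qed
  also have "?h ` carrier ?E = (PiE {..<n} (\<lambda>_. resB ` OB))"
  proof
    show "?h ` carrier ?E \<subseteq> PiE {..<n} (\<lambda>_. resB ` OB)" by (auto simp: emb_bimodule_simps intro!: imageI)
    show "PiE {..<n} (\<lambda>_. resB ` OB) \<subseteq> ?h ` carrier ?E"
    proof
      fix g assume g: "g \<in> PiE {..<n} (\<lambda>_. resB ` OB)"
      then have "\<forall>i. \<exists>x. i < n \<longrightarrow> x \<in> OB \<and> g i = resB x" unfolding PiE_def Pi_def image_iff by auto
      from choice[OF this] obtain x where x: "\<And>i. i < n \<Longrightarrow> x i \<in> OB" "\<And>i. i < n \<Longrightarrow> g i = resB (x i)" by auto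
      have "g = ?h (vec n x)" using g x by (auto simp: fun_eq_iff restrict_def PiE_def extensional_def)
      moreover have "vec n x \<in> carrier ?E" using x by (simp add: emb_bimodule_simps)
      ultimately show "g \<in> ?h ` carrier ?E" by (rule image_eqI)
    qed
  qed
  also have "card \<dots> = q ^ n" by (simp add: card_PiE card_resB)
  finally show ?thesis .
qed

section \<open>The four basic embeddings\<close>

abbreviation emb1 :: "bool \<Rightarrow> 'b \<Rightarrow> 'b mat" where
  "emb1 d \<equiv> (if d then emb_tau \<pi>\<^sub>B else emb_id)"

abbreviation emb2 :: "bool \<Rightarrow> 'b \<Rightarrow> 'b mat" where
  "emb2 d \<equiv> (if d then emb_phi2 v \<iota> K \<sigma> \<pi> \<pi>\<^sub>B else emb_phi1 v \<iota> K \<sigma> \<pi> \<pi>\<^sub>B)"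

text \<open>Both for \<open>basic1 d\<close> and for \<open>basic2 d\<close>, the index is the
  degree of the first unit vector e, that is, a e = e \<open>tw d a\<close> for a in
  \<open>OK\<close>. This lets the two lattices of each rank be treated together.\<close>

definition basic1 :: "bool \<Rightarrow> ('b, 'b vec) bimodule" where "basic1 d = emb_bimodule OB 1 (emb1 d)"

definition basic2 :: "bool \<Rightarrow> ('b, 'b vec) bimodule" where "basic2 d = emb_bimodule OB 2 (emb2 d)"

lemma emb1_eq: assumes "a \<in> OK" "b \<in> OK"
  shows "emb1 d (a + b * \<pi>\<^sub>B) = mat 1 1 (\<lambda>_. tw d a + tw d b * \<pi>\<^sub>B)"
proof -
  have "inverse \<pi>\<^sub>B * (a + b * \<pi>\<^sub>B) * \<pi>\<^sub>B = inverse \<pi>\<^sub>B * (\<pi>\<^sub>B * (\<sigma> a + \<sigma> b * \<pi>\<^sub>B))"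
    using assms varpi_conj'[of a] varpi_conj'[of b] by (simp add: distrib_left distrib_right mult.assoc)
  also have "\<dots> = \<sigma> a + \<sigma> b * \<pi>\<^sub>B" by (simp flip: mult.assoc)
  finally show ?thesis by (simp add: emb_id_def emb_tau_def tw_def)
qed

lemma emb2_eq: assumes "a \<in> OK" "b \<in> OK"
  shows "emb2 d (a + b * \<pi>\<^sub>B) = mat 2 2 (\<lambda>(i, j).
    if i = 0 then (if j = 0 then tw d a else tw d b * \<iota> \<pi>) else (if j = 0 then tw (\<not> d) b else tw (\<not> d) a))"
proof -
  have the: "(THE p. fst p \<in> OK \<and> snd p \<in> OK \<and> a + b * \<pi>\<^sub>B = fst p + snd p * \<pi>\<^sub>B) = (a, b)"
  proof (rule the_equality)
    fix p assume "fst p \<in> OK \<and> snd p \<in> OK \<and> a + b * \<pi>\<^sub>B = fst p + snd p * \<pi>\<^sub>B"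
    then show "p = (a, b)" using OB_decompose(2)[OF assms, of "fst p" "snd p"] by (cases p) auto
  qed (use assms in simp)
  have 2: "i < 2 \<longleftrightarrow> i = 0 \<or> i = 1" for i :: nat by auto
  show ?thesis
    by (rule eq_matI)
      (auto simp: emb_phi1_def emb_phi2_def emb_extend_def the mat_of_rows_list_def tw_def 2
        scalar_prod_def numeral_2_eq_2)
qed

lemma OB_mult: assumes "a \<in> OK" "b \<in> OK" "c \<in> OK" "e \<in> OK"
  shows "(a + b * \<pi>\<^sub>B) * (c + e * \<pi>\<^sub>B) = (a * c + b * \<sigma> e * \<iota> \<pi>) + (a * e + b * \<sigma> c) * \<pi>\<^sub>B"
proof -
  have "b * \<pi>\<^sub>B * (c + e * \<pi>\<^sub>B) = b * (\<pi>\<^sub>B * c) + b * (\<pi>\<^sub>B * e) * \<pi>\<^sub>B" by (simp add: distrib_left mult.assoc)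
  also have "\<dots> = b * \<sigma> c * \<pi>\<^sub>B + b * \<sigma> e * \<iota> \<pi>"
    using assms by (simp add: piB_conj varpi_sq mult.assoc)
  finally show ?thesis by (simp add: distrib_left distrib_right mult.assoc)
qed

lemma emb1_embedding: "algebra_embedding v \<iota> OB 1 (emb1 d)"
proof -
  have entry: "(emb1 d x) $$ (0, 0) \<in> OB" and car: "emb1 d x \<in> carrier_mat 1 1" if x: "x \<in> OB" for x
  proof -
    obtain a b where ab: "a \<in> OK" "b \<in> OK" "x = a + b * \<pi>\<^sub>B" using x by (rule OB_E)
    show "(emb1 d x) $$ (0, 0) \<in> OB" "emb1 d x \<in> carrier_mat 1 1" using ab by (simp_all only: emb1_eq) simp_all
  qed
  have form: "emb1 d x = mat 1 1 (\<lambda>_. (if d then inverse \<pi>\<^sub>B * x * \<pi>\<^sub>B else x))" for x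
    by (simp add: emb_id_def emb_tau_def)
  show ?thesis
    unfolding algebra_embedding_def
  proof (intro conjI ballI)
    show "emb1 d ` OB \<subseteq> mat_over OB 1" using entry car by (auto simp: mat_over_iff)
    show "inj_on (emb1 d) OB"
    proof (rule inj_onI)
      fix x y assume "emb1 d x = emb1 d y"
      then have "mat 1 1 (\<lambda>_. if d then inverse \<pi>\<^sub>B * x * \<pi>\<^sub>B else x) $$ (0, 0)
        = mat 1 1 (\<lambda>_. if d then inverse \<pi>\<^sub>B * y * \<pi>\<^sub>B else y) $$ (0, 0)" by (simp only: form)
      then show "x = y" by (simp split: if_splits)
    qed
    show "emb1 d 1 = 1\<^sub>m 1" unfolding form by (rule eq_matI) auto
    fix x y assume "x \<in> OB" "y \<in> OB"
    show "emb1 d (x + y) = emb1 d x + emb1 d y" unfolding form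
      by (rule eq_matI) (auto simp: distrib_left distrib_right)
    have "inverse \<pi>\<^sub>B * (x * y) * \<pi>\<^sub>B = inverse \<pi>\<^sub>B * x * (\<pi>\<^sub>B * inverse \<pi>\<^sub>B) * y * \<pi>\<^sub>B"
      by (simp add: mult.assoc)
    also have "\<dots> = inverse \<pi>\<^sub>B * x * \<pi>\<^sub>B * (inverse \<pi>\<^sub>B * y * \<pi>\<^sub>B)" by (simp only: mult.assoc)
    finally show "emb1 d (x * y) = emb1 d x * emb1 d y" unfolding form
      by (intro eq_matI) (auto simp: scalar_prod_def)
  next
    fix c x assume "c \<in> val_ring v" "x \<in> OB"
    have "inverse \<pi>\<^sub>B * (\<iota> c * x) * \<pi>\<^sub>B = \<iota> c * (inverse \<pi>\<^sub>B * x * \<pi>\<^sub>B)" by (metis iota_commute mult.assoc)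
    then show "emb1 d (\<iota> c * x) = \<iota> c \<cdot>\<^sub>m emb1 d x" unfolding form
      by (intro eq_matI) auto
  qed
qed

lemma emb2_embedding: "algebra_embedding v \<iota> OB 2 (emb2 d)"
proof -
  have 2: "i < 2 \<longleftrightarrow> i = 0 \<or> i = 1" for i :: nat by auto
  have car: "emb2 d x \<in> carrier_mat 2 2" if x: "x \<in> OB" for x
  proof -
    obtain a b where ab: "a \<in> OK" "b \<in> OK" "x = a + b * \<pi>\<^sub>B" using x by (rule OB_E)
    show ?thesis unfolding ab(3) emb2_eq[OF ab(1,2)] by simp
  qed
  show ?thesis
    unfolding algebra_embedding_def
  proof (intro conjI ballI)
    show "emb2 d ` OB \<subseteq> mat_over OB 2"
    proof
      fix A assume "A \<in> emb2 d ` OB"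
      then obtain x where x: "x \<in> OB" "A = emb2 d x" by (elim imageE)
      obtain a b where ab: "a \<in> OK" "b \<in> OK" "x = a + b * \<pi>\<^sub>B" using x(1) by (rule OB_E)
      show "A \<in> mat_over OB 2" unfolding x(2) ab(3) emb2_eq[OF ab(1,2)] using ab by (auto simp: mat_over_iff 2)
    qed
    show "inj_on (emb2 d) OB"
    proof (rule inj_onI)
      fix x y assume xy: "x \<in> OB" "y \<in> OB" "emb2 d x = emb2 d y"
      obtain a b where ab: "a \<in> OK" "b \<in> OK" "x = a + b * \<pi>\<^sub>B" using xy(1) by (rule OB_E)
      obtain c e where ce: "c \<in> OK" "e \<in> OK" "y = c + e * \<pi>\<^sub>B" using xy(2) by (rule OB_E)
      have "emb2 d x $$ (0, 0) = emb2 d y $$ (0, 0)" "emb2 d x $$ (1, 0) = emb2 d y $$ (1, 0)"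
        using xy(3) by simp_all
      then have "tw d a = tw d c" "tw (\<not> d) b = tw (\<not> d) e"
        unfolding ab(3) ce(3) emb2_eq[OF ab(1,2)] emb2_eq[OF ce(1,2)] by simp_all
      then have "tw d (tw d a) = tw d (tw d c)" "tw (\<not> d) (tw (\<not> d) b) = tw (\<not> d) (tw (\<not> d) e)" by simp_all
      then show "x = y" using ab ce by simp
    qed
    have "emb2 d (1 + 0 * \<pi>\<^sub>B) = 1\<^sub>m 2"
      unfolding emb2_eq[OF OK_closed(2) OK_closed(1)] by (rule eq_matI) (auto simp: 2)
    then show "emb2 d 1 = 1\<^sub>m 2" by simp
    fix x y assume xy: "x \<in> OB" "y \<in> OB"
    obtain a b where ab: "a \<in> OK" "b \<in> OK" "x = a + b * \<pi>\<^sub>B" using xy(1) by (rule OB_E)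
    obtain c e where ce: "c \<in> OK" "e \<in> OK" "y = c + e * \<pi>\<^sub>B" using xy(2) by (rule OB_E)
    have [simp]: "a * e \<in> OK" "b * \<sigma> c \<in> OK" "a * c \<in> OK" "b * \<sigma> e \<in> OK" using ab ce by simp_all
    have sum: "x + y = (a + c) + (b + e) * \<pi>\<^sub>B" using ab ce by (simp add: distrib_right)
    have sumOK: "a + c \<in> OK" "b + e \<in> OK" using ab ce by simp_all
    show "emb2 d (x + y) = emb2 d x + emb2 d y"
      unfolding sum emb2_eq[OF sumOK] unfolding ab(3) ce(3) emb2_eq[OF ab(1,2)] emb2_eq[OF ce(1,2)]
      using ab ce by (intro eq_matI) (auto simp: tw_add distrib_right 2)
    have prod: "x * y = (a * c + b * \<sigma> e * \<iota> \<pi>) + (a * e + b * \<sigma> c) * \<pi>\<^sub>B"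
      using ab ce OB_mult by simp
    have prodOK: "a * c + b * \<sigma> e * \<iota> \<pi> \<in> OK" "a * e + b * \<sigma> c \<in> OK" using ab ce by simp_all
    have e: "tw d (a * c + b * \<sigma> e * \<iota> \<pi>) = tw d a * tw d c + tw d b * tw (\<not> d) e * \<iota> \<pi>"
      "tw d (a * e + b * \<sigma> c) = tw d a * tw d e + tw d b * tw (\<not> d) c" for d
      using ab ce by (simp_all add: tw_add tw_mult)
    have f: "tw d a * (tw d e * \<iota> \<pi>) = tw d a * tw d e * \<iota> \<pi>" "tw d b * \<iota> \<pi> * tw (\<not> d) e = tw d b * tw (\<not> d) e * \<iota> \<pi>"
      "tw d b * \<iota> \<pi> * tw (\<not> d) c = tw d b * tw (\<not> d) c * \<iota> \<pi>"
      "tw (\<not> d) b * (tw d e * \<iota> \<pi>) = tw (\<not> d) b * tw d e * \<iota> \<pi>"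
      by (simp_all add: mult.assoc iota_commute)
    show "emb2 d (x * y) = emb2 d x * emb2 d y"
      unfolding prod emb2_eq[OF prodOK] unfolding ab(3) ce(3) emb2_eq[OF ab(1,2)] emb2_eq[OF ce(1,2)]
      by (intro eq_matI) (auto simp: 2 e f scalar_prod_def numeral_2_eq_2 distrib_right add.commute)
  next
    fix c x assume c: "c \<in> val_ring v" and x: "x \<in> OB"
    obtain a b where ab: "a \<in> OK" "b \<in> OK" "x = a + b * \<pi>\<^sub>B" using x by (rule OB_E)
    have cOK: "\<iota> c \<in> OK" using c by (rule iota_OK)
    then have OK: "\<iota> c * a \<in> OK" "\<iota> c * b \<in> OK" using ab by simp_all
    have eq: "\<iota> c * x = \<iota> c * a + (\<iota> c * b) * \<pi>\<^sub>B" using ab by (simp add: distrib_left mult.assoc)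
    show "emb2 d (\<iota> c * x) = \<iota> c \<cdot>\<^sub>m emb2 d x"
      unfolding eq emb2_eq[OF OK] unfolding ab(3) emb2_eq[OF ab(1,2)]
      using ab cOK by (intro eq_matI) (auto simp: 2 tw_mult mult.assoc)
  qed
qed

lemma basic1_carrier: "x \<in> carrier (basic1 d) \<longleftrightarrow> x \<in> carrier_vec 1 \<and> x $ 0 \<in> OB"
  by (auto simp: basic1_def emb_bimodule_simps)

lemma basic2_carrier: "x \<in> carrier (basic2 d) \<longleftrightarrow> x \<in> carrier_vec 2 \<and> x $ 0 \<in> OB \<and> x $ 1 \<in> OB"
  by (auto simp: basic2_def emb_bimodule_simps numeral_2_eq_2 less_Suc_eq)

lemma basic1_left:
  assumes "a \<in> OK" "b \<in> OK" "x \<in> carrier (basic1 d)"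
  shows "((a + b * \<pi>\<^sub>B) \<odot>\<^bsub>basic1 d\<^esub> x) $ 0 = (tw d a + tw d b * \<pi>\<^sub>B) * x $ 0"
proof -
  have "((a + b * \<pi>\<^sub>B) \<odot>\<^bsub>basic1 d\<^esub> x) $ 0 = (mat 1 1 (\<lambda>_. tw d a + tw d b * \<pi>\<^sub>B) *\<^sub>v x) $ 0"
    using emb1_eq[OF assms(1,2), of d] by (simp only: basic1_def emb_bimodule_simps)
  also have "\<dots> = (\<Sum>j<1. mat 1 1 (\<lambda>_. tw d a + tw d b * \<pi>\<^sub>B) $$ (0, j) * x $ j)"
    using assms(3) by (intro mult_mat_vec_index_sum[of _ 1 1]) (simp_all add: basic1_carrier)
  finally show ?thesis by simp
qed

lemma basic2_left:
  assumes "a \<in> OK" "b \<in> OK" "x \<in> carrier (basic2 d)"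
  shows "((a + b * \<pi>\<^sub>B) \<odot>\<^bsub>basic2 d\<^esub> x) $ 0 = tw d a * x $ 0 + tw d b * \<iota> \<pi> * x $ 1"
    "((a + b * \<pi>\<^sub>B) \<odot>\<^bsub>basic2 d\<^esub> x) $ 1 = tw (\<not> d) b * x $ 0 + tw (\<not> d) a * x $ 1"
proof -
  let ?A = "mat 2 2 (\<lambda>(i, j).
    if i = 0 then (if j = 0 then tw d a else tw d b * \<iota> \<pi>) else (if j = 0 then tw (\<not> d) b else tw (\<not> d) a))"
  have eq: "(a + b * \<pi>\<^sub>B) \<odot>\<^bsub>basic2 d\<^esub> x = ?A *\<^sub>v x"
    using emb2_eq[OF assms(1,2), of d] by (simp only: basic2_def emb_bimodule_simps)
  have "(?A *\<^sub>v x) $ i = (\<Sum>j<2. ?A $$ (i, j) * x $ j)" if "i < 2" for i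
    using assms(3) that by (intro mult_mat_vec_index_sum[of _ 2 2]) (simp_all add: basic2_carrier)
  from this[of 0] this[of 1] show "((a + b * \<pi>\<^sub>B) \<odot>\<^bsub>basic2 d\<^esub> x) $ 0 = tw d a * x $ 0 + tw d b * \<iota> \<pi> * x $ 1"
    "((a + b * \<pi>\<^sub>B) \<odot>\<^bsub>basic2 d\<^esub> x) $ 1 = tw (\<not> d) b * x $ 0 + tw (\<not> d) a * x $ 1"
    unfolding eq by (simp_all add: numeral_2_eq_2)
qed

lemma basic_right:
  "x \<in> carrier (basic1 d) \<Longrightarrow> (x \<triangleleft>\<^bsub>basic1 d\<^esub> a) $ 0 = x $ 0 * a"
  "x \<in> carrier (basic2 d) \<Longrightarrow> (x \<triangleleft>\<^bsub>basic2 d\<^esub> a) $ 0 = x $ 0 * a"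
  "x \<in> carrier (basic2 d) \<Longrightarrow> (x \<triangleleft>\<^bsub>basic2 d\<^esub> a) $ 1 = x $ 1 * a"
  unfolding basic1_carrier basic2_carrier by (auto simp: basic1_def basic2_def emb_bimodule_simps)

lemma basic_add:
  "x \<in> carrier (basic1 d) \<Longrightarrow> y \<in> carrier (basic1 d) \<Longrightarrow> (x \<oplus>\<^bsub>basic1 d\<^esub> y) $ 0 = x $ 0 + y $ 0"
  "x \<in> carrier (basic2 d) \<Longrightarrow> y \<in> carrier (basic2 d) \<Longrightarrow> (x \<oplus>\<^bsub>basic2 d\<^esub> y) $ 0 = x $ 0 + y $ 0"
  "x \<in> carrier (basic2 d) \<Longrightarrow> y \<in> carrier (basic2 d) \<Longrightarrow> (x \<oplus>\<^bsub>basic2 d\<^esub> y) $ 1 = x $ 1 + y $ 1"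
  unfolding basic1_carrier basic2_carrier by (auto simp: basic1_def basic2_def emb_bimodule_simps)

lemma bimodule_basic: "bimodule OB (basic1 d)" "bimodule OB (basic2 d)"
  unfolding basic1_def basic2_def by (intro emb_bimodule emb1_embedding emb2_embedding)+

lemma basic_radical:
  "x \<in> radical (basic1 d) \<longleftrightarrow> x \<in> carrier_vec 1 \<and> x $ 0 \<in> mOB"
  "x \<in> radical (basic2 d) \<longleftrightarrow> x \<in> carrier_vec 2 \<and> x $ 0 \<in> mOB \<and> x $ 1 \<in> mOB"
  using emb_radical[OF emb1_embedding, of x d] emb_radical[OF emb2_embedding, of x d]
  by (auto simp: basic1_def basic2_def numeral_2_eq_2 less_Suc_eq)

lemma basic_cls:
  "x \<in> carrier (basic1 d) \<Longrightarrow> y \<in> carrier (basic1 d) \<Longrightarrow> cls (basic1 d) x = cls (basic1 d) y \<longleftrightarrow> x $ 0 - y $ 0 \<in> mOB"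
  "x \<in> carrier (basic2 d) \<Longrightarrow> y \<in> carrier (basic2 d) \<Longrightarrow>
    cls (basic2 d) x = cls (basic2 d) y \<longleftrightarrow> x $ 0 - y $ 0 \<in> mOB \<and> x $ 1 - y $ 1 \<in> mOB"
  using emb_cls[OF emb1_embedding, of x d y] emb_cls[OF emb2_embedding, of x d y]
  by (auto simp: basic1_def basic2_def numeral_2_eq_2 less_Suc_eq)

subsection \<open>The standard lattices\<close>

text \<open>For z = a + b \<open>\<pi>\<^sub>B\<close>, moving an element of \<open>OK\<close> past
  z twists it by \<open>\<pi>\<^sub>B\<close> only in the second term. Testing with \<zeta>, whose
  two conjugates differ, forces the coefficient of the wrong degree to vanish.\<close>

lemma twisted_commute_iff:
  assumes z: "z \<in> OB"
  shows "(\<forall>a\<in>OK. tw d a * z = z * tw d' a) \<longleftrightarrow> (if d = d' then z \<in> OK else \<exists>r\<in>OK. z = r * \<pi>\<^sub>B)"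
proof -
  obtain a b where ab: "a \<in> OK" "b \<in> OK" "z = a + b * \<pi>\<^sub>B" using z by (rule OB_E)
  have expand: "z * tw d' c = a * tw d' c + b * tw (\<not> d') c * \<pi>\<^sub>B" if "c \<in> OK" for c
    using that ab varpi_tw(1)[OF that, of d'] by (simp add: distrib_right mult.assoc)
  have expand': "tw d c * z = a * tw d c + b * tw d c * \<pi>\<^sub>B" if "c \<in> OK" for c
    using that ab OK_commute[of "tw d c" a] OK_commute[of "tw d c" b]
    by (simp add: distrib_left flip: mult.assoc)
  show ?thesis
  proof (cases "d = d'")
    case True
    have "z \<in> OK" if "\<forall>a\<in>OK. tw d a * z = z * tw d' a"
    proof -
      have "a * tw d \<zeta> + b * tw d \<zeta> * \<pi>\<^sub>B = a * tw d' \<zeta> + b * tw (\<not> d') \<zeta> * \<pi>\<^sub>B"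
        using that expand[of \<zeta>] expand'[of \<zeta>] by simp
      then have "b * tw d \<zeta> = b * tw (\<not> d') \<zeta>"
        using OB_decompose(2)[of "a * tw d \<zeta>" "b * tw d \<zeta>" "a * tw d' \<zeta>" "b * tw (\<not> d') \<zeta>"] ab by simp
      then have "b = 0" using True zeta_unit(1) by (auto simp: tw_def)
      then show "z \<in> OK" using ab by simp
    qed
    then show ?thesis using True OK_commute by auto
  next
    case False
    have d': "(\<not> d') = d" using False by auto
    have "a = 0" if "\<forall>a\<in>OK. tw d a * z = z * tw d' a"
    proof -
      have "a * tw d \<zeta> + b * tw d \<zeta> * \<pi>\<^sub>B = a * tw d' \<zeta> + b * tw (\<not> d') \<zeta> * \<pi>\<^sub>B"
        using that expand[of \<zeta>] expand'[of \<zeta>] by simp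
      then have "a * tw d \<zeta> = a * tw d' \<zeta>"
        using OB_decompose(2)[of "a * tw d \<zeta>" "b * tw d \<zeta>" "a * tw d' \<zeta>" "b * tw (\<not> d') \<zeta>"] ab by simp
      then show "a = 0" using False zeta_unit(1) by (auto simp: tw_def)
    qed
    moreover have "tw d c * z = z * tw d' c" if "c \<in> OK" "r \<in> OK" "z = r * \<pi>\<^sub>B" for c r
      using that OK_commute[of "tw d c" r] varpi_tw(1)[of c d'] d' by (simp add: mult.assoc) (simp flip: mult.assoc)
    ultimately show ?thesis using False ab by auto
  qed
qed

text \<open>The two homogeneous parts of \<open>OB\<close> under conjugation by \<open>OK\<close>;
  \<open>True\<close> selects the part that commutes with \<open>OK\<close>.\<close>

definition tw_part :: "bool \<Rightarrow> 'b set" where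
  "tw_part s = {z \<in> OB. if s then z \<in> OK else \<exists>r\<in>OK. z = r * \<pi>\<^sub>B}"

lemma left_basic_OK:
  assumes "a \<in> OK"
  shows "x \<in> carrier (basic1 d) \<Longrightarrow> (a \<odot>\<^bsub>basic1 d\<^esub> x) $ 0 = tw d a * x $ 0"
    "x \<in> carrier (basic2 d) \<Longrightarrow> (a \<odot>\<^bsub>basic2 d\<^esub> x) $ 0 = tw d a * x $ 0"
    "x \<in> carrier (basic2 d) \<Longrightarrow> (a \<odot>\<^bsub>basic2 d\<^esub> x) $ 1 = tw (\<not> d) a * x $ 1"
  using basic1_left[OF assms OK_closed(1), of x d] basic2_left[OF assms OK_closed(1), of x d] by simp_all

lemma left_basic_varpi:
  "x \<in> carrier (basic1 d) \<Longrightarrow> (\<pi>\<^sub>B \<odot>\<^bsub>basic1 d\<^esub> x) $ 0 = \<pi>\<^sub>B * x $ 0"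
  "x \<in> carrier (basic2 d) \<Longrightarrow> (\<pi>\<^sub>B \<odot>\<^bsub>basic2 d\<^esub> x) $ 0 = \<iota> \<pi> * x $ 1"
  "x \<in> carrier (basic2 d) \<Longrightarrow> (\<pi>\<^sub>B \<odot>\<^bsub>basic2 d\<^esub> x) $ 1 = x $ 0"
  using basic1_left[OF OK_closed(1) OK_closed(2), of x d] basic2_left[OF OK_closed(1) OK_closed(2), of x d]
  by simp_all

lemma basic_eq_iff:
  "x \<in> carrier (basic1 d) \<Longrightarrow> y \<in> carrier (basic1 d) \<Longrightarrow> x = y \<longleftrightarrow> x $ 0 = y $ 0"
  "x \<in> carrier (basic2 d) \<Longrightarrow> y \<in> carrier (basic2 d) \<Longrightarrow> x = y \<longleftrightarrow> x $ 0 = y $ 0 \<and> x $ 1 = y $ 1"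
  unfolding basic1_carrier basic2_carrier
  by (auto simp: vec_eq_iff numeral_2_eq_2 less_Suc_eq)

lemma gr_basic:
  "x \<in> gr d' (basic1 d) \<longleftrightarrow> x \<in> carrier_vec 1 \<and> x $ 0 \<in> tw_part (d = d')"
  "x \<in> gr d' (basic2 d) \<longleftrightarrow> x \<in> carrier_vec 2 \<and> x $ 0 \<in> tw_part (d = d') \<and> x $ 1 \<in> tw_part (d \<noteq> d')"
proof -
  interpret B1: quaternion_bimodule v \<iota> OB K \<sigma> \<pi> \<pi>\<^sub>B "basic1 d"
    using bimodule_basic(1) by (rule quaternion_bimoduleI)
  interpret B2: quaternion_bimodule v \<iota> OB K \<sigma> \<pi> \<pi>\<^sub>B "basic2 d"
    using bimodule_basic(2) by (rule quaternion_bimoduleI)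
  have "a \<odot>\<^bsub>basic1 d\<^esub> x = x \<triangleleft>\<^bsub>basic1 d\<^esub> tw d' a \<longleftrightarrow> tw d a * x $ 0 = x $ 0 * tw d' a"
    if "a \<in> OK" "x \<in> carrier (basic1 d)" for a
    using that by (subst basic_eq_iff(1)[of _ d]) (simp_all add: left_basic_OK basic_right)
  then have "x \<in> gr d' (basic1 d) \<longleftrightarrow> x \<in> carrier (basic1 d) \<and> (\<forall>a\<in>OK. tw d a * x $ 0 = x $ 0 * tw d' a)"
    by (auto simp: gr_def)
  also have "\<dots> \<longleftrightarrow> x \<in> carrier_vec 1 \<and> x $ 0 \<in> tw_part (d = d')"
    using twisted_commute_iff[of "x $ 0" d d'] by (auto simp: basic1_carrier tw_part_def)
  finally show "x \<in> gr d' (basic1 d) \<longleftrightarrow> x \<in> carrier_vec 1 \<and> x $ 0 \<in> tw_part (d = d')" .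
  have "a \<odot>\<^bsub>basic2 d\<^esub> x = x \<triangleleft>\<^bsub>basic2 d\<^esub> tw d' a \<longleftrightarrow>
      tw d a * x $ 0 = x $ 0 * tw d' a \<and> tw (\<not> d) a * x $ 1 = x $ 1 * tw d' a"
    if "a \<in> OK" "x \<in> carrier (basic2 d)" for a
    unfolding left_basic_OK(2,3)[OF that, symmetric] basic_right(2,3)[OF that(2), symmetric]
    using that by (intro basic_eq_iff(2)[of _ d]) simp_all
  then have "x \<in> gr d' (basic2 d) \<longleftrightarrow> x \<in> carrier (basic2 d) \<and>
      (\<forall>a\<in>OK. tw d a * x $ 0 = x $ 0 * tw d' a) \<and> (\<forall>a\<in>OK. tw (\<not> d) a * x $ 1 = x $ 1 * tw d' a)"
    by (auto simp: gr_def)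
  also have "\<dots> \<longleftrightarrow> x \<in> carrier_vec 2 \<and> x $ 0 \<in> tw_part (d = d') \<and> x $ 1 \<in> tw_part (d \<noteq> d')"
    using twisted_commute_iff[of "x $ 0" d d'] twisted_commute_iff[of "x $ 1" "\<not> d" d']
    by (auto simp: basic2_carrier tw_part_def)
  finally show "x \<in> gr d' (basic2 d) \<longleftrightarrow> x \<in> carrier_vec 2 \<and> x $ 0 \<in> tw_part (d = d') \<and> x $ 1 \<in> tw_part (d \<noteq> d')" .
qed

text \<open>The part \<open>OK * \<pi>\<^sub>B\<close> lies in \<open>mOB\<close>, so it disappears
  from all counts and only the part \<open>OK\<close> is seen modulo \<pi>.\<close>

lemma tw_part_diff: assumes "x \<in> tw_part s" "y \<in> tw_part s"
  shows "x - y \<in> mOB \<longleftrightarrow> (s \<longrightarrow> res x = res y)"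
proof (cases s)
  case True
  then show ?thesis using assms by (simp add: tw_part_def res_eq_iff mOB_OK)
next
  case False
  then have "x \<in> mOB" "y \<in> mOB" using assms mOB_closed(5)[OF varpi_mOB] by (auto simp: tw_part_def)
  then show ?thesis using False mOB_closed(3) by simp
qed

lemma tw_part_OK: "a \<in> OK \<Longrightarrow> a \<in> tw_part True" "0 \<in> tw_part s"
  by (auto simp: tw_part_def intro!: bexI[of _ 0])

lemma card_gr_image:
  assumes "\<And>x y. x \<in> A \<Longrightarrow> y \<in> A \<Longrightarrow> c x = c y \<longleftrightarrow> (s \<longrightarrow> res (h x) = res (h y))"
    and "A \<noteq> {}" "s \<Longrightarrow> h ` A = OK"
  shows "card (c ` A) = (if s then q else 1)"
proof -
  have "card (c ` A) = card ((\<lambda>x. if s then res (h x) else 0) ` A)"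
    by (rule card_image_cong_iff(1)) (use assms(1) in simp)
  also have "\<dots> = (if s then q else 1)"
  proof (cases s)
    case True
    then have "(\<lambda>x. if s then res (h x) else 0) ` A = res ` OK" using assms(3) by (simp flip: image_image)
    then show ?thesis using True by simp
  next
    case False
    then have "(\<lambda>x. if s then res (h x) else 0) ` A = {0}" using assms(2) by auto
    then show ?thesis using False by simp
  qed
  finally show ?thesis .
qed

lemma gr_basic_entry:
  "gr d' (basic1 d) \<noteq> {}" "gr d' (basic2 d) \<noteq> {}"
  "d = d' \<Longrightarrow> (\<lambda>x. x $ 0) ` gr d' (basic1 d) = OK" "d = d' \<Longrightarrow> (\<lambda>x. x $ 0) ` gr d' (basic2 d) = OK"
  "d \<noteq> d' \<Longrightarrow> (\<lambda>x. x $ 1) ` gr d' (basic2 d) = OK"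
proof -
  have "vec 1 (\<lambda>_. 0) \<in> gr d' (basic1 d)" by (simp add: gr_basic tw_part_OK)
  then show "gr d' (basic1 d) \<noteq> {}" by blast
  have "vec 2 (\<lambda>_. 0) \<in> gr d' (basic2 d)" by (simp add: gr_basic tw_part_OK)
  then show "gr d' (basic2 d) \<noteq> {}" by blast
  have sub: "h ` A = OK" if "\<And>x. x \<in> A \<Longrightarrow> h x \<in> OK" "\<And>a. a \<in> OK \<Longrightarrow> \<exists>x\<in>A. h x = a"
    for h :: "'b vec \<Rightarrow> 'b" and A
    using that by force
  show "(\<lambda>x. x $ 0) ` gr d' (basic1 d) = OK" if "d = d'"
  proof (rule sub)
    show "x \<in> gr d' (basic1 d) \<Longrightarrow> x $ 0 \<in> OK" for x using that by (simp add: gr_basic tw_part_def)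
    show "\<exists>x\<in>gr d' (basic1 d). x $ 0 = a" if "a \<in> OK" for a
      using that \<open>d = d'\<close> by (intro bexI[of _ "vec 1 (\<lambda>_. a)"]) (simp_all add: gr_basic tw_part_OK)
  qed
  show "(\<lambda>x. x $ 0) ` gr d' (basic2 d) = OK" if "d = d'"
  proof (rule sub)
    show "x \<in> gr d' (basic2 d) \<Longrightarrow> x $ 0 \<in> OK" for x using that by (simp add: gr_basic tw_part_def)
    show "\<exists>x\<in>gr d' (basic2 d). x $ 0 = a" if "a \<in> OK" for a
      using that \<open>d = d'\<close> by (intro bexI[of _ "vec 2 (\<lambda>i. if i = 0 then a else 0)"]) (simp_all add: gr_basic tw_part_OK)
  qed
  show "(\<lambda>x. x $ 1) ` gr d' (basic2 d) = OK" if "d \<noteq> d'"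
  proof (rule sub)
    show "x \<in> gr d' (basic2 d) \<Longrightarrow> x $ 1 \<in> OK" for x using that by (simp add: gr_basic tw_part_def)
    show "\<exists>x\<in>gr d' (basic2 d). x $ 1 = a" if "a \<in> OK" for a
      using that \<open>d \<noteq> d'\<close> by (intro bexI[of _ "vec 2 (\<lambda>i. if i = 1 then a else 0)"]) (simp_all add: gr_basic tw_part_OK)
  qed
qed

text \<open>On \<open>basic1\<close>, left multiplication by \<open>\<pi>\<^sub>B\<close> vanishes
  modulo the radical. On \<open>basic2 d\<close> it sends the first unit vector to the second and
  the second to a multiple of \<pi>, so it is nonzero in degree \<open>d\<close> only.\<close>

lemma basic_cards:
  "grade_card d' (basic1 d) = (if d = d' then q else 1)" "shift_card d' (basic1 d) = 1"
  "grade_card d' (basic2 d) = q" "shift_card d' (basic2 d) = (if d = d' then q else 1)"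
proof -
  interpret B1: quaternion_bimodule v \<iota> OB K \<sigma> \<pi> \<pi>\<^sub>B "basic1 d"
    using bimodule_basic(1) by (rule quaternion_bimoduleI)
  interpret B2: quaternion_bimodule v \<iota> OB K \<sigma> \<pi> \<pi>\<^sub>B "basic2 d"
    using bimodule_basic(2) by (rule quaternion_bimoduleI)
  have car: "x \<in> gr d' (basic1 d) \<Longrightarrow> x \<in> carrier (basic1 d)" "x \<in> gr d' (basic2 d) \<Longrightarrow> x \<in> carrier (basic2 d)" for x
    by (auto simp: gr_def)
  have mul: "\<pi>\<^sub>B * x - \<pi>\<^sub>B * y \<in> mOB" "\<iota> \<pi> * x - \<iota> \<pi> * y \<in> mOB" if "x \<in> OB" "y \<in> OB" for x y
    using that mOB_closed(4)[OF varpi_mOB, of "x - y"] mOB_closed(4)[OF pi_mOB, of "x - y"]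
    by (simp_all add: right_diff_distrib)
  show "grade_card d' (basic1 d) = (if d = d' then q else 1)"
    unfolding grade_card_def
  proof (rule card_gr_image[of _ _ _ "\<lambda>x. x $ 0"])
    fix x y assume "x \<in> gr d' (basic1 d)" "y \<in> gr d' (basic1 d)"
    then show "cls (basic1 d) x = cls (basic1 d) y \<longleftrightarrow> (d = d' \<longrightarrow> res (x $ 0) = res (y $ 0))"
      using tw_part_diff[of "x $ 0" "d = d'" "y $ 0"] by (simp add: basic_cls car gr_basic)
  qed (simp_all add: gr_basic_entry)
  \<comment> \<open>The instance \<open>False\<close> of the counting lemma expresses that all the
    classes coincide.\<close>
  have "card ((\<lambda>x. cls (basic1 d) (\<pi>\<^sub>B \<odot>\<^bsub>basic1 d\<^esub> x)) ` gr d' (basic1 d)) = (if False then q else 1)"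
  proof (rule card_gr_image[of _ _ _ "\<lambda>x. x $ 0"])
    fix x y assume "x \<in> gr d' (basic1 d)" "y \<in> gr d' (basic1 d)"
    then show "cls (basic1 d) (\<pi>\<^sub>B \<odot>\<^bsub>basic1 d\<^esub> x) = cls (basic1 d) (\<pi>\<^sub>B \<odot>\<^bsub>basic1 d\<^esub> y) \<longleftrightarrow>
      (False \<longrightarrow> res (x $ 0) = res (y $ 0))"
      using car[of x] car[of y] mul[of "x $ 0" "y $ 0"]
      by (simp add: basic_cls left_basic_varpi) (simp add: basic1_carrier)
  qed (simp_all add: gr_basic_entry)
  then show "shift_card d' (basic1 d) = 1" by (simp add: shift_card_def)
  show "grade_card d' (basic2 d) = q"
  proof -
    \<comment> \<open>The two coordinates of an element of degree \<open>d'\<close> lie in different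
      parts of \<open>OB\<close>; the one in \<open>OK\<close> is visible modulo \<open>mOB\<close>,
      and it is the first one exactly if \<open>d = d'\<close>.\<close>
    have "card (cls (basic2 d) ` gr d' (basic2 d)) = (if True then q else 1)"
    proof (rule card_gr_image[of _ _ _ "\<lambda>x. if d = d' then x $ 0 else x $ 1"])
      fix x y assume "x \<in> gr d' (basic2 d)" "y \<in> gr d' (basic2 d)"
      then show "cls (basic2 d) x = cls (basic2 d) y \<longleftrightarrow>
        (True \<longrightarrow> res (if d = d' then x $ 0 else x $ 1) = res (if d = d' then y $ 0 else y $ 1))"
        using tw_part_diff[of "x $ 0" "d = d'" "y $ 0"] tw_part_diff[of "x $ 1" "d \<noteq> d'" "y $ 1"]
          car(2)[of x] car(2)[of y]
        by (auto simp: basic_cls gr_basic)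
    next
      show "(\<lambda>x. if d = d' then x $ 0 else x $ 1) ` gr d' (basic2 d) = OK"
        using gr_basic_entry(4,5)[of d d'] by (cases "d = d'") simp_all
    qed (rule gr_basic_entry)
    then show ?thesis by (simp add: grade_card_def)
  qed
  show "shift_card d' (basic2 d) = (if d = d' then q else 1)"
    unfolding shift_card_def
  proof (rule card_gr_image[of _ _ _ "\<lambda>x. x $ 0"])
    fix x y assume xy: "x \<in> gr d' (basic2 d)" "y \<in> gr d' (basic2 d)"
    have "x $ 1 \<in> OB" "y $ 1 \<in> OB" using car(2)[OF xy(1)] car(2)[OF xy(2)] by (simp_all add: basic2_carrier)
    then show "cls (basic2 d) (\<pi>\<^sub>B \<odot>\<^bsub>basic2 d\<^esub> x) = cls (basic2 d) (\<pi>\<^sub>B \<odot>\<^bsub>basic2 d\<^esub> y) \<longleftrightarrow>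
      (d = d' \<longrightarrow> res (x $ 0) = res (y $ 0))"
      using xy tw_part_diff[of "x $ 0" "d = d'" "y $ 0"] car(2)[of x] car(2)[of y]
        mul(2)[of "x $ 1" "y $ 1"]
      by (simp add: basic_cls left_basic_varpi[simplified] gr_basic)
  qed (simp_all add: gr_basic_entry)
qed

section \<open>Standard sums and their invariants\<close>

definition std :: "mult4 \<Rightarrow> ('b, 'b vec list \<times> 'b vec list \<times> 'b vec list \<times> 'b vec list) bimodule" where
  "std = std_sum (basic1 False) (basic1 True) (basic2 False) (basic2 True)"

lemma bimodule_std: "bimodule OB (std m)"
  unfolding std_def by (intro bimodule_std_sum bimodule_basic)

lemma std_cards:
  "grade_card False (std (r1, r2, t1, t2)) = q ^ (r1 + t1 + t2)"
  "grade_card True (std (r1, r2, t1, t2)) = q ^ (r2 + t1 + t2)"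
  "shift_card False (std (r1, r2, t1, t2)) = q ^ t1" "shift_card True (std (r1, r2, t1, t2)) = q ^ t2"
  by (simp_all add: std_def std_sum_def sum_cards power_cards basic_cards bimodule_sum bimodule_power
      bimodule_basic power_add mult.assoc)

text \<open>The shift counts give t1 and t2; removing t1 + t2 from the exponents of the grade counts
  leaves r1 and r2.\<close>

lemma std_iso_unique: assumes "bimodule_iso OB (std m) (std m')" shows "m = m'"
proof -
  obtain r1 r2 t1 t2 where m: "m = (r1, r2, t1, t2)" by (cases m)
  obtain r1' r2' t1' t2' where m': "m' = (r1', r2', t1', t2')" by (cases m')
  note c = iso_cards[OF bimodule_std bimodule_std assms, unfolded m m']
  have inj: "i = j" if "q ^ i = q ^ j" for i j using that q_gt_1 by (simp add: power_inject_exp)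
  have "t1 = t1'" "t2 = t2'" "r1 + t1 + t2 = r1' + t1' + t2'" "r2 + t1 + t2 = r2' + t1' + t2'"
    using c(1)[of False] c(1)[of True] c(2)[of False] c(2)[of True]
    by (auto simp only: std_cards intro!: inj)
  then show ?thesis by (simp add: m m')
qed

section \<open>Separated and exact standard sums\<close>

lemma separated_iso:
  assumes M: "bimodule OB M" and N: "bimodule OB N" and iso: "bimodule_iso OB M N" and sep: "separated N"
  shows "separated M"
  unfolding separated_def
proof (intro ballI impI)
  interpret M: bimodule OB M by fact
  obtain f where f: "bimodule_hom OB M N f" "bij_betw f (carrier M) (carrier N)"
    using iso by (rule bimodule_isoE)
  note h = bimodule_homD[OF f(1)]
  fix x assume x: "x \<in> carrier M" "\<forall>n. \<exists>y\<in>carrier M. x = y \<triangleleft>\<^bsub>M\<^esub> \<pi>\<^sub>B ^ n"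
  have "\<exists>y\<in>carrier N. f x = y \<triangleleft>\<^bsub>N\<^esub> \<pi>\<^sub>B ^ n" for n
  proof -
    obtain y where "y \<in> carrier M" "x = y \<triangleleft>\<^bsub>M\<^esub> \<pi>\<^sub>B ^ n" using x(2) by blast
    then show ?thesis using h(1,4) by (intro bexI[of _ "f y"]) simp_all
  qed
  then have "f x = \<zero>\<^bsub>N\<^esub>" using sep h(1)[OF x(1)] by (simp add: separated_def)
  also have "\<dots> = f \<zero>\<^bsub>M\<^esub>" using hom_minus(2)[OF M N f(1) x(1) x(1)] by simp
  finally show "x = \<zero>\<^bsub>M\<^esub>" using f(2) x(1) by (auto simp: bij_betw_def inj_on_def)
qed

lemma separated_sum: "separated M \<Longrightarrow> separated N \<Longrightarrow> separated (M \<oplus>\<^sub>b N)"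
  unfolding separated_def
proof (intro ballI impI)
  assume M: "\<forall>x\<in>carrier M. (\<forall>n. \<exists>y\<in>carrier M. x = y \<triangleleft>\<^bsub>M\<^esub> \<pi>\<^sub>B ^ n) \<longrightarrow> x = \<zero>\<^bsub>M\<^esub>"
    and N: "\<forall>x\<in>carrier N. (\<forall>n. \<exists>y\<in>carrier N. x = y \<triangleleft>\<^bsub>N\<^esub> \<pi>\<^sub>B ^ n) \<longrightarrow> x = \<zero>\<^bsub>N\<^esub>"
  fix x assume x: "x \<in> carrier (M \<oplus>\<^sub>b N)" "\<forall>n. \<exists>y\<in>carrier (M \<oplus>\<^sub>b N). x = y \<triangleleft>\<^bsub>M \<oplus>\<^sub>b N\<^esub> \<pi>\<^sub>B ^ n"
  have "\<exists>y\<in>carrier M. fst x = y \<triangleleft>\<^bsub>M\<^esub> \<pi>\<^sub>B ^ n" "\<exists>y\<in>carrier N. snd x = y \<triangleleft>\<^bsub>N\<^esub> \<pi>\<^sub>B ^ n" for n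
    using x(2)[rule_format, of n] by auto
  then have "fst x = \<zero>\<^bsub>M\<^esub>" "snd x = \<zero>\<^bsub>N\<^esub>" using M N x(1) by auto
  then show "x = \<zero>\<^bsub>M \<oplus>\<^sub>b N\<^esub>" by (simp add: prod_eq_iff)
qed

lemma separated_power: assumes M: "bimodule OB M" and sep: "separated M" shows "separated (M ^\<^sub>b r)"
proof (induction r)
  case 0
  show ?case by (simp add: separated_def bimod_power_simps)
next
  case (Suc r)
  show ?case
    by (rule separated_iso[OF bimodule_power[OF M] bimodule_sum[OF M bimodule_power[OF M]] bimodule_power_Suc])
      (intro separated_sum sep Suc)
qed

lemma separated_std: "separated (std m)"
proof -
  have b: "separated (basic1 d)" "separated (basic2 d)" for d
    unfolding basic1_def basic2_def by (intro emb_separated emb1_embedding emb2_embedding)+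
  show ?thesis
    by (cases m) (simp add: std_def std_sum_def separated_sum separated_power bimodule_basic b)
qed

text \<open>Left multiplication by \<open>\<pi>\<^sub>B\<close> squares to zero modulo the radical; \<open>exact\<close> means that its
  kernel there equals its image.\<close>

definition exact :: "('b, 'm) bimodule \<Rightarrow> bool" where
  "exact M \<longleftrightarrow> (\<forall>u\<in>carrier M. \<pi>\<^sub>B \<odot>\<^bsub>M\<^esub> u \<in> radical M \<longrightarrow> (\<exists>w\<in>carrier M. u \<ominus>\<^bsub>M\<^esub> \<pi>\<^sub>B \<odot>\<^bsub>M\<^esub> w \<in> radical M))"

lemma exact_iso:
  assumes M: "bimodule OB M" and N: "bimodule OB N" and iso: "bimodule_iso OB M N" and ex: "exact N"
  shows "exact M"
  unfolding exact_def
proof (intro ballI impI)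
  interpret M: quaternion_bimodule v \<iota> OB K \<sigma> \<pi> \<pi>\<^sub>B M using M by (rule quaternion_bimoduleI)
  obtain f where f: "bimodule_hom OB M N f" "bij_betw f (carrier M) (carrier N)"
    using iso by (rule bimodule_isoE)
  note h = bimodule_homD[OF f(1)]
  fix u assume u: "u \<in> carrier M" "\<pi>\<^sub>B \<odot>\<^bsub>M\<^esub> u \<in> radical M"
  have "\<pi>\<^sub>B \<odot>\<^bsub>N\<^esub> f u \<in> radical N" using hom_radical[OF f(1) u(2)] h(3) u(1) by simp
  then obtain w where w: "w \<in> carrier N" "f u \<ominus>\<^bsub>N\<^esub> \<pi>\<^sub>B \<odot>\<^bsub>N\<^esub> w \<in> radical N"
    using ex h(1)[OF u(1)] by (auto simp: exact_def)
  obtain w' where w': "w' \<in> carrier M" "w = f w'" using w(1) f(2) by (auto simp: bij_betw_def)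
  have "f (u \<ominus>\<^bsub>M\<^esub> \<pi>\<^sub>B \<odot>\<^bsub>M\<^esub> w') \<in> radical N"
    using w w' u(1) hom_minus(1)[OF M N f(1), of u "\<pi>\<^sub>B \<odot>\<^bsub>M\<^esub> w'"] h(3) by simp
  then have "u \<ominus>\<^bsub>M\<^esub> \<pi>\<^sub>B \<odot>\<^bsub>M\<^esub> w' \<in> radical M" using iso_image_gr(2)[OF M f] u(1) w' by simp
  then show "\<exists>w\<in>carrier M. u \<ominus>\<^bsub>M\<^esub> \<pi>\<^sub>B \<odot>\<^bsub>M\<^esub> w \<in> radical M" using w'(1) by (rule bexI)
qed

lemma exact_sum:
  assumes M: "bimodule OB M" and N: "bimodule OB N" and ex: "exact M" "exact N"
  shows "exact (M \<oplus>\<^sub>b N)"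
  unfolding exact_def
proof (intro ballI impI)
  interpret M: quaternion_bimodule v \<iota> OB K \<sigma> \<pi> \<pi>\<^sub>B M using M by (rule quaternion_bimoduleI)
  interpret N: quaternion_bimodule v \<iota> OB K \<sigma> \<pi> \<pi>\<^sub>B N using N by (rule quaternion_bimoduleI)
  fix u assume u: "u \<in> carrier (M \<oplus>\<^sub>b N)" "\<pi>\<^sub>B \<odot>\<^bsub>M \<oplus>\<^sub>b N\<^esub> u \<in> radical (M \<oplus>\<^sub>b N)"
  then have c: "fst u \<in> carrier M" "snd u \<in> carrier N"
    "\<pi>\<^sub>B \<odot>\<^bsub>M\<^esub> fst u \<in> radical M" "\<pi>\<^sub>B \<odot>\<^bsub>N\<^esub> snd u \<in> radical N" by (auto simp: radical_sum)
  obtain w where w: "w \<in> carrier M" "fst u \<ominus>\<^bsub>M\<^esub> \<pi>\<^sub>B \<odot>\<^bsub>M\<^esub> w \<in> radical M" using ex(1) c by (auto simp: exact_def)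
  obtain z where z: "z \<in> carrier N" "snd u \<ominus>\<^bsub>N\<^esub> \<pi>\<^sub>B \<odot>\<^bsub>N\<^esub> z \<in> radical N" using ex(2) c by (auto simp: exact_def)
  show "\<exists>w\<in>carrier (M \<oplus>\<^sub>b N). u \<ominus>\<^bsub>M \<oplus>\<^sub>b N\<^esub> \<pi>\<^sub>B \<odot>\<^bsub>M \<oplus>\<^sub>b N\<^esub> w \<in> radical (M \<oplus>\<^sub>b N)"
    using w z u(1) by (intro bexI[of _ "(w, z)"]) (simp_all add: sum_minus[OF M N] mem_Times_iff radical_sum)
qed

text \<open>A separate case because \<open>basic1\<close>, which is not exact, still occurs with
  exponent 0 in \<open>std (0, 0, t1, t2)\<close>.\<close>

lemma exact_power_0: assumes M: "bimodule OB M" shows "exact (M ^\<^sub>b 0)"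
proof -
  interpret P: quaternion_bimodule v \<iota> OB K \<sigma> \<pi> \<pi>\<^sub>B "M ^\<^sub>b 0"
    using bimodule_power[OF M] by (rule quaternion_bimoduleI)
  have "carrier (M ^\<^sub>b 0) = {\<zero>\<^bsub>M ^\<^sub>b 0\<^esub>}" by (auto simp: bimod_power_simps)
  then show ?thesis using P.radical_closed(1) by (simp add: exact_def P.minus_simps)
qed

lemma exact_power: assumes M: "bimodule OB M" and ex: "exact M" shows "exact (M ^\<^sub>b r)"
proof (induction r)
  case 0
  show ?case using M by (rule exact_power_0)
next
  case (Suc r)
  show ?case
    by (rule exact_iso[OF bimodule_power[OF M] bimodule_sum[OF M bimodule_power[OF M]] bimodule_power_Suc])
      (intro exact_sum M bimodule_power ex Suc)
qed

lemma exact_basic2: "exact (basic2 d)"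
  unfolding exact_def
proof (intro ballI impI)
  interpret B: quaternion_bimodule v \<iota> OB K \<sigma> \<pi> \<pi>\<^sub>B "basic2 d"
    using bimodule_basic(2) by (rule quaternion_bimoduleI)
  fix u assume u: "u \<in> carrier (basic2 d)" "\<pi>\<^sub>B \<odot>\<^bsub>basic2 d\<^esub> u \<in> radical (basic2 d)"
  then have u0: "u $ 0 \<in> mOB" using left_basic_varpi(3)[OF u(1)] by (simp add: basic_radical)
  \<comment> \<open>Multiplication by \<open>\<pi>\<^sub>B\<close> moves the first coordinate to the
    second place, so this \<open>w\<close> hits the second coordinate of \<open>u\<close>; the first
    one already lies in \<open>mOB\<close>.\<close>
  define w where "w = vec 2 (\<lambda>i. if i = 0 then u $ 1 else 0)"
  have w: "w \<in> carrier (basic2 d)" using u(1) by (simp add: w_def basic2_carrier)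
  have cw: "\<pi>\<^sub>B \<odot>\<^bsub>basic2 d\<^esub> w \<in> carrier (basic2 d)" using w by simp
  have "cls (basic2 d) u = cls (basic2 d) (\<pi>\<^sub>B \<odot>\<^bsub>basic2 d\<^esub> w)"
    unfolding basic_cls(2)[OF u(1) cw] left_basic_varpi(2,3)[OF w] using u0 mOB_closed(1)
    by (simp add: w_def)
  then have "u \<ominus>\<^bsub>basic2 d\<^esub> \<pi>\<^sub>B \<odot>\<^bsub>basic2 d\<^esub> w \<in> radical (basic2 d)" using B.cls_eq_iff[OF u(1) cw] by simp
  then show "\<exists>w\<in>carrier (basic2 d). u \<ominus>\<^bsub>basic2 d\<^esub> \<pi>\<^sub>B \<odot>\<^bsub>basic2 d\<^esub> w \<in> radical (basic2 d)" using w by (rule bexI)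
qed

lemma exact_std: "exact (std (0, 0, t1, t2))"
  by (simp add: std_def std_sum_def)
    (intro exact_sum bimodule_sum bimodule_power bimodule_basic exact_power exact_basic2 exact_power_0)

lemma std_extend:
  "bimodule_iso OB (std (mult4_add m (if d then (0, 1, 0, 0) else (1, 0, 0, 0)))) (std m \<oplus>\<^sub>b basic1 d)"
  "bimodule_iso OB (std (mult4_add m (if d then (0, 0, 0, 1) else (0, 0, 1, 0)))) (std m \<oplus>\<^sub>b basic2 d)"
proof -
  have *: "bimodule_iso OB (std (mult4_add m e)) (std m \<oplus>\<^sub>b B)" if B: "bimodule OB B" "bimodule_iso OB B (std e)"
    for B :: "('b, 'b vec) bimodule" and e
  proof -
    have 1: "bimodule_iso OB (std m \<oplus>\<^sub>b B) (std m \<oplus>\<^sub>b std e)"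
      by (intro bimodule_iso_sum bimodule_iso_refl B)
    have 2: "bimodule_iso OB (std m \<oplus>\<^sub>b std e) (std (mult4_add m e))"
      unfolding std_def by (rule std_sum_add)
    show ?thesis
      by (rule bimodule_iso_sym[OF bimodule_sum[OF bimodule_std B(1)] bimodule_iso_trans[OF 1 2]])
  qed
  show "bimodule_iso OB (std (mult4_add m (if d then (0, 1, 0, 0) else (1, 0, 0, 0)))) (std m \<oplus>\<^sub>b basic1 d)"
    by (rule *, rule bimodule_basic, cases d)
      (simp_all only: if_True if_False std_def std_sum_unit)
  show "bimodule_iso OB (std (mult4_add m (if d then (0, 0, 0, 1) else (0, 0, 1, 0)))) (std m \<oplus>\<^sub>b basic2 d)"
    by (rule *, rule bimodule_basic, cases d)
      (simp_all only: if_True if_False std_def std_sum_unit)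
qed

end

subsection \<open>Existence of the decomposition\<close>

context quaternion_bilattice
begin

text \<open>The degree of x and its commuting with \<open>\<pi>\<^sub>B\<close> are the relations
  satisfied by the generator of \<open>basic1 d\<close>, so x can be its image.\<close>

lemma hom_basic1:
  assumes x: "x \<in> gr d L" and comm: "\<pi>\<^sub>B \<odot> x = x \<triangleleft> \<pi>\<^sub>B"
  shows "bimodule_hom OB (basic1 d) L (\<lambda>p. x \<triangleleft> (p $ 0))"
proof (rule bimodule_homI)
  have xc: "x \<in> carrier L" using x by (rule gr_carrier)
  fix p q assume p: "p \<in> carrier (basic1 d)" and q: "q \<in> carrier (basic1 d)"
  have pq: "p $ 0 \<in> OB" "q $ 0 \<in> OB" using p q by (simp_all add: basic1_carrier)
  show "x \<triangleleft> (p $ 0) \<in> carrier L" using xc pq by simp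
  show "x \<triangleleft> ((p \<oplus>\<^bsub>basic1 d\<^esub> q) $ 0) = x \<triangleleft> (p $ 0) \<oplus> x \<triangleleft> (q $ 0)"
    using p q pq xc by (simp add: basic_add right_distrib_scalar)
next
  have xc: "x \<in> carrier L" using x by (rule gr_carrier)
  fix c p assume c: "c \<in> OB" and p: "p \<in> carrier (basic1 d)"
  have pc: "p $ 0 \<in> OB" using p by (simp add: basic1_carrier)
  obtain a b where ab: "a \<in> OK" "b \<in> OK" "c = a + b * \<pi>\<^sub>B" using c by (rule OB_E)
  have "c \<odot> x = x \<triangleleft> tw d a \<oplus> x \<triangleleft> tw d b \<triangleleft> \<pi>\<^sub>B"
    using ab xc gr_left[OF x] by (simp add: left_distrib_scalar left_assoc comm flip: left_right)
  also have "\<dots> = x \<triangleleft> (tw d a + tw d b * \<pi>\<^sub>B)"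
    using ab xc by (simp add: right_distrib_scalar right_assoc)
  finally have cx: "c \<odot> x = x \<triangleleft> (tw d a + tw d b * \<pi>\<^sub>B)" .
  have "(c \<odot>\<^bsub>basic1 d\<^esub> p) $ 0 = (tw d a + tw d b * \<pi>\<^sub>B) * p $ 0"
    using basic1_left[OF ab(1,2) p] ab(3) by simp
  then show "x \<triangleleft> ((c \<odot>\<^bsub>basic1 d\<^esub> p) $ 0) = c \<odot> (x \<triangleleft> (p $ 0))"
    using xc pc c ab(1,2) left_right[of c "p $ 0" x] by (simp add: cx right_assoc)
  show "x \<triangleleft> ((p \<triangleleft>\<^bsub>basic1 d\<^esub> c) $ 0) = x \<triangleleft> (p $ 0) \<triangleleft> c"
    using xc pc c p by (simp add: basic_right right_assoc)
qed

text \<open>Only the degree of e is prescribed: the remaining relation, that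
  \<open>\<pi>\<^sub>B\<close> applied twice is right multiplication by \<pi>, holds throughout a
  bilattice.\<close>

lemma hom_basic2:
  assumes e: "e \<in> gr d L"
  shows "bimodule_hom OB (basic2 d) L (\<lambda>p. e \<triangleleft> (p $ 0) \<oplus> \<pi>\<^sub>B \<odot> e \<triangleleft> (p $ 1))"
proof (rule bimodule_homI)
  have ec: "e \<in> carrier L" using e by (rule gr_carrier)
  fix p q assume p: "p \<in> carrier (basic2 d)" and q: "q \<in> carrier (basic2 d)"
  have pq: "p $ 0 \<in> OB" "q $ 0 \<in> OB" "p $ 1 \<in> OB" "q $ 1 \<in> OB" using p q by (simp_all add: basic2_carrier)
  show "e \<triangleleft> (p $ 0) \<oplus> \<pi>\<^sub>B \<odot> e \<triangleleft> (p $ 1) \<in> carrier L" using ec pq by simp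
  show "e \<triangleleft> ((p \<oplus>\<^bsub>basic2 d\<^esub> q) $ 0) \<oplus> \<pi>\<^sub>B \<odot> e \<triangleleft> ((p \<oplus>\<^bsub>basic2 d\<^esub> q) $ 1)
      = (e \<triangleleft> (p $ 0) \<oplus> \<pi>\<^sub>B \<odot> e \<triangleleft> (p $ 1)) \<oplus> (e \<triangleleft> (q $ 0) \<oplus> \<pi>\<^sub>B \<odot> e \<triangleleft> (q $ 1))"
    unfolding basic_add(2,3)[OF p q] using pq ec by (simp add: right_distrib_scalar a_ac)
next
  have ec: "e \<in> carrier L" using e by (rule gr_carrier)
  fix c p assume c: "c \<in> OB" and p: "p \<in> carrier (basic2 d)"
  have pc: "p $ 0 \<in> OB" "p $ 1 \<in> OB" using p by (simp_all add: basic2_carrier)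
  obtain a b where ab: "a \<in> OK" "b \<in> OK" "c = a + b * \<pi>\<^sub>B" using c by (rule OB_E)
  let ?E = "\<pi>\<^sub>B \<odot> e"
  have E: "?E \<in> gr (\<not> d) L" using e by (rule gr_closed(5))
  have Ec: "?E \<in> carrier L" using ec by simp
  have ce: "c \<odot> e = e \<triangleleft> tw d a \<oplus> ?E \<triangleleft> tw (\<not> d) b"
    using ab ec gr_left[OF e] gr_left[OF E] by (simp add: left_distrib_scalar left_assoc)
  have "c \<odot> ?E = a \<odot> ?E \<oplus> b \<odot> (\<pi>\<^sub>B \<odot> ?E)" using ab Ec by (simp add: left_distrib_scalar left_assoc)
  also have "\<pi>\<^sub>B \<odot> ?E = e \<triangleleft> \<iota> \<pi>" using ec by (rule right_varpi_varpi)
  also have "b \<odot> (e \<triangleleft> \<iota> \<pi>) = e \<triangleleft> (tw d b * \<iota> \<pi>)"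
    using ab ec gr_left[OF e] by (simp add: right_assoc flip: left_right)
  also have "a \<odot> ?E = ?E \<triangleleft> tw (\<not> d) a" using gr_left[OF E ab(1)] .
  finally have cE: "c \<odot> ?E = ?E \<triangleleft> tw (\<not> d) a \<oplus> e \<triangleleft> (tw d b * \<iota> \<pi>)" .
  have left: "(c \<odot>\<^bsub>basic2 d\<^esub> p) $ 0 = tw d a * p $ 0 + tw d b * \<iota> \<pi> * p $ 1"
    "(c \<odot>\<^bsub>basic2 d\<^esub> p) $ 1 = tw (\<not> d) b * p $ 0 + tw (\<not> d) a * p $ 1"
    using basic2_left[OF ab(1,2) p] ab(3) by simp_all
  have "c \<odot> (e \<triangleleft> (p $ 0) \<oplus> ?E \<triangleleft> (p $ 1)) = c \<odot> e \<triangleleft> (p $ 0) \<oplus> c \<odot> ?E \<triangleleft> (p $ 1)"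
    using c ec Ec pc by (simp add: left_distrib left_right)
  also have "\<dots> = (e \<triangleleft> (tw d a * p $ 0) \<oplus> ?E \<triangleleft> (tw (\<not> d) b * p $ 0)) \<oplus>
      (?E \<triangleleft> (tw (\<not> d) a * p $ 1) \<oplus> e \<triangleleft> (tw d b * \<iota> \<pi> * p $ 1))"
    unfolding ce cE using ec Ec pc ab by (simp add: right_distrib right_assoc)
  also have "\<dots> = e \<triangleleft> (tw d a * p $ 0 + tw d b * \<iota> \<pi> * p $ 1) \<oplus> ?E \<triangleleft> (tw (\<not> d) b * p $ 0 + tw (\<not> d) a * p $ 1)"
    using ec Ec pc ab by (simp add: right_distrib_scalar a_ac)
  finally show "e \<triangleleft> ((c \<odot>\<^bsub>basic2 d\<^esub> p) $ 0) \<oplus> ?E \<triangleleft> ((c \<odot>\<^bsub>basic2 d\<^esub> p) $ 1) = c \<odot> (e \<triangleleft> (p $ 0) \<oplus> ?E \<triangleleft> (p $ 1))"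
    unfolding left by simp
  show "e \<triangleleft> ((p \<triangleleft>\<^bsub>basic2 d\<^esub> c) $ 0) \<oplus> ?E \<triangleleft> ((p \<triangleleft>\<^bsub>basic2 d\<^esub> c) $ 1) = (e \<triangleleft> (p $ 0) \<oplus> ?E \<triangleleft> (p $ 1)) \<triangleleft> c"
    unfolding basic_right(2,3)[OF p] using ec Ec pc c by (simp add: right_distrib right_assoc)
qed

section \<open>Enlarging a map that is injective modulo the radical\<close>

lemma radical_cancel:
  assumes "x \<in> carrier L" "y \<in> carrier L" "x \<oplus> y \<in> radical L"
  shows "x \<in> radical L \<longleftrightarrow> y \<in> radical L"
  using assms radical_closed(3)[of "x \<oplus> y" x] radical_closed(3)[of "x \<oplus> y" y]
  by (auto simp: minus_simps)

lemma image_rad_neg: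
  assumes M: "bimodule OB M" and f: "bimodule_hom OB M L f" and u: "u \<in> carrier M"
    and x: "x \<in> carrier L" "f u \<oplus> x \<in> radical L"
  shows "x \<in> image_rad M L f"
proof -
  note I = image_rad_closed[OF M f]
  have "(f u \<oplus> x) \<ominus> f u \<in> image_rad M L f" using I(1)[OF x(2)] I(2)[OF u] by (rule I(5))
  then show ?thesis using x bimodule_homD(1)[OF f u] by (simp add: minus_simps)
qed

text \<open>In a relation modulo the radical the coefficient of x must be a nonunit, since otherwise
  x would lie in the image. Its term then drops out, and the relation is one for \<open>f\<close>
  alone.\<close>

lemma extend_basic1:
  assumes S: "bimodule OB S" and f: "inj_rad S L f"
    and x: "x \<in> gr d L" and comm: "\<pi>\<^sub>B \<odot> x = x \<triangleleft> \<pi>\<^sub>B" and new: "x \<notin> image_rad S L f"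
  shows "inj_rad (S \<oplus>\<^sub>b basic1 d) L (\<lambda>w. f (fst w) \<oplus> x \<triangleleft> (snd w $ 0))"
  unfolding inj_rad_def
proof (intro conjI ballI impI)
  have hom: "bimodule_hom OB S L f" and rad: "\<And>u. u \<in> carrier S \<Longrightarrow> f u \<in> radical L \<Longrightarrow> u \<in> radical S"
    using f by (auto simp: inj_rad_def)
  have xc: "x \<in> carrier L" using x by (rule gr_carrier)
  note I = image_rad_closed[OF S hom]
  show "bimodule_hom OB (S \<oplus>\<^sub>b basic1 d) L (\<lambda>w. f (fst w) \<oplus> x \<triangleleft> (snd w $ 0))"
    by (rule bimodule_hom_sum[OF bimodule_axioms hom hom_basic1[OF x comm]])
  fix w assume w: "w \<in> carrier (S \<oplus>\<^sub>b basic1 d)" "f (fst w) \<oplus> x \<triangleleft> (snd w $ 0) \<in> radical L"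
  then have u: "fst w \<in> carrier S" and p: "snd w \<in> carrier (basic1 d)" by auto
  have pc: "snd w $ 0 \<in> OB" using p by (simp add: basic1_carrier)
  have "x \<triangleleft> (snd w $ 0) \<in> image_rad S L f"
    using w(2) xc pc by (intro image_rad_neg[OF S hom u]) simp_all
  then have p0: "snd w $ 0 \<in> mOB" using I(7)[OF xc pc] new by blast
  then have "f (fst w) \<in> radical L"
    using w(2) radical_cancel[of "f (fst w)" "x \<triangleleft> (snd w $ 0)"] right_mOB_radical[OF xc] xc pc
      bimodule_homD(1)[OF hom u] by simp
  then have "fst w \<in> radical S" using rad u by blast
  moreover have "snd w \<in> radical (basic1 d)" using p0 p by (simp add: basic_radical basic1_carrier)
  ultimately show "w \<in> radical (S \<oplus>\<^sub>b basic1 d)" using radical_sum[of "fst w" "snd w"] by simp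
qed

text \<open>A hypothesis on \<open>\<pi>\<^sub>B \<odot> e\<close> alone controls both new
  generators: applying \<open>\<pi>\<^sub>B\<close> to a relation turns the term of e into one of
  \<open>\<pi>\<^sub>B \<odot> e\<close> and pushes the other term into the radical.\<close>

lemma extend_basic2:
  assumes S: "bimodule OB S" and f: "inj_rad S L f"
    and e: "e \<in> gr d L" and new: "\<pi>\<^sub>B \<odot> e \<notin> image_rad S L f"
  shows "inj_rad (S \<oplus>\<^sub>b basic2 d) L (\<lambda>w. f (fst w) \<oplus> (e \<triangleleft> (snd w $ 0) \<oplus> \<pi>\<^sub>B \<odot> e \<triangleleft> (snd w $ 1)))"
  unfolding inj_rad_def
proof (intro conjI ballI impI)
  interpret S: quaternion_bimodule v \<iota> OB K \<sigma> \<pi> \<pi>\<^sub>B S using S by (rule quaternion_bimoduleI)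
  have hom: "bimodule_hom OB S L f" and rad: "\<And>u. u \<in> carrier S \<Longrightarrow> f u \<in> radical L \<Longrightarrow> u \<in> radical S"
    using f by (auto simp: inj_rad_def)
  have ec: "e \<in> carrier L" using e by (rule gr_carrier)
  note I = image_rad_closed[OF S hom] and h = bimodule_homD[OF hom]
  show "bimodule_hom OB (S \<oplus>\<^sub>b basic2 d) L (\<lambda>w. f (fst w) \<oplus> (e \<triangleleft> (snd w $ 0) \<oplus> \<pi>\<^sub>B \<odot> e \<triangleleft> (snd w $ 1)))"
    by (rule bimodule_hom_sum[OF bimodule_axioms hom hom_basic2[OF e]])
  fix w assume w: "w \<in> carrier (S \<oplus>\<^sub>b basic2 d)"
    "f (fst w) \<oplus> (e \<triangleleft> (snd w $ 0) \<oplus> \<pi>\<^sub>B \<odot> e \<triangleleft> (snd w $ 1)) \<in> radical L"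
  define u a b where "u = fst w" and "a = snd w $ 0" and "b = snd w $ 1"
  have u: "u \<in> carrier S" and p: "snd w \<in> carrier (basic2 d)" using w by (auto simp: u_def)
  have ab: "a \<in> OB" "b \<in> OB" using p by (simp_all add: basic2_carrier a_def b_def)
  have r: "f u \<oplus> (e \<triangleleft> a \<oplus> \<pi>\<^sub>B \<odot> e \<triangleleft> b) \<in> radical L" using w(2) by (simp only: u_def a_def b_def)
  have fu: "f u \<in> carrier L" using h(1) u by simp
  \<comment> \<open>The shifted relation determines the coefficient \<open>a\<close> first; the
    original relation without its \<open>a\<close>-term then determines \<open>b\<close>.\<close>
  have "\<pi>\<^sub>B \<odot> (f u \<oplus> (e \<triangleleft> a \<oplus> \<pi>\<^sub>B \<odot> e \<triangleleft> b)) = \<pi>\<^sub>B \<odot> (\<pi>\<^sub>B \<odot> e) \<triangleleft> b \<oplus> (f (\<pi>\<^sub>B \<odot>\<^bsub>S\<^esub> u) \<oplus> \<pi>\<^sub>B \<odot> e \<triangleleft> a)"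
    using fu ec ab h(3)[OF piB_in u] by (simp add: left_distrib left_right a_ac)
  moreover have "\<pi>\<^sub>B \<odot> (\<pi>\<^sub>B \<odot> e) \<triangleleft> b \<in> radical L"
    unfolding right_varpi_varpi(2)[OF ec] using ec ab by (intro radical_closed(5) right_mOB_radical) simp_all
  ultimately have "f (\<pi>\<^sub>B \<odot>\<^bsub>S\<^esub> u) \<oplus> \<pi>\<^sub>B \<odot> e \<triangleleft> a \<in> radical L"
    using radical_closed(6)[OF r piB_in] radical_cancel[of "\<pi>\<^sub>B \<odot> (\<pi>\<^sub>B \<odot> e) \<triangleleft> b" "f (\<pi>\<^sub>B \<odot>\<^bsub>S\<^esub> u) \<oplus> \<pi>\<^sub>B \<odot> e \<triangleleft> a"]
      ec ab h(1) u by simp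
  then have "\<pi>\<^sub>B \<odot> e \<triangleleft> a \<in> image_rad S L f"
    using ec ab u by (intro image_rad_neg[OF S hom, of "\<pi>\<^sub>B \<odot>\<^bsub>S\<^esub> u"]) simp_all
  then have a: "a \<in> mOB" using I(7)[of "\<pi>\<^sub>B \<odot> e" a] ab ec new by auto
  then have "e \<triangleleft> a \<in> radical L" using right_mOB_radical ec by blast
  moreover have "e \<triangleleft> a \<oplus> (f u \<oplus> \<pi>\<^sub>B \<odot> e \<triangleleft> b) \<in> radical L" using r fu ec ab by (simp add: a_ac)
  ultimately have r2: "f u \<oplus> \<pi>\<^sub>B \<odot> e \<triangleleft> b \<in> radical L"
    using radical_cancel[of "e \<triangleleft> a" "f u \<oplus> \<pi>\<^sub>B \<odot> e \<triangleleft> b"] fu ec ab by simp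
  then have "\<pi>\<^sub>B \<odot> e \<triangleleft> b \<in> image_rad S L f"
    using ec ab by (intro image_rad_neg[OF S hom u]) simp_all
  then have b: "b \<in> mOB" using I(7)[of "\<pi>\<^sub>B \<odot> e" b] ab ec new by auto
  then have "\<pi>\<^sub>B \<odot> e \<triangleleft> b \<in> radical L" using right_mOB_radical ec by simp
  then have "f u \<in> radical L" using r2 radical_cancel[of "f u" "\<pi>\<^sub>B \<odot> e \<triangleleft> b"] fu ec ab by simp
  then have "u \<in> radical S" using rad u by blast
  moreover have "snd w \<in> radical (basic2 d)"
    using a b p by (simp add: basic_radical basic2_carrier a_def b_def)
  ultimately show "w \<in> radical (S \<oplus>\<^sub>b basic2 d)" using radical_sum[of "fst w" "snd w"] by (simp add: u_def)
qed

text \<open>Galois descent: \<open>y \<mapsto> \<pi>\<^sub>B y \<pi>\<^sub>B\<^sup>-\<^sup>1\<close> is a semilinear involution of the elements in question, so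
  traces of \<open>y\<close> and \<open>y \<zeta>\<close> are fixed, and \<open>y\<close> is a combination of them.\<close>

lemma gr_fixed_span:
  assumes y: "y \<in> gr d L" and r: "\<pi>\<^sub>B \<odot> y \<in> radical L"
  obtains u w where "u \<in> gr d L" "w \<in> gr d L" "\<pi>\<^sub>B \<odot> u = u \<triangleleft> \<pi>\<^sub>B" "\<pi>\<^sub>B \<odot> w = w \<triangleleft> \<pi>\<^sub>B"
    "y \<triangleleft> (\<zeta> - \<sigma> \<zeta>) = w \<ominus> u \<triangleleft> \<sigma> \<zeta>"
proof -
  have yc: "y \<in> carrier L" using y by (rule gr_carrier)
  \<comment> \<open>\<open>z\<close> is the conjugate
    \<open>\<pi>\<^sub>B y \<pi>\<^sub>B^-1\<close>, which exists in \<open>L\<close> because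
    \<open>\<pi>\<^sub>B \<odot> y\<close> lies in the radical. Right multiplication by
    \<open>\<pi>\<^sub>B\<close> is injective, so identities for \<open>z\<close> are checked after
    applying it.\<close>
  obtain z where z: "z \<in> carrier L" "\<pi>\<^sub>B \<odot> y = z \<triangleleft> \<pi>\<^sub>B" using r by (auto simp: radical_iff)
  have "(\<pi>\<^sub>B \<odot> z \<ominus> y \<triangleleft> \<pi>\<^sub>B) \<triangleleft> \<pi>\<^sub>B = \<pi>\<^sub>B \<odot> (z \<triangleleft> \<pi>\<^sub>B) \<ominus> y \<triangleleft> \<pi>\<^sub>B \<triangleleft> \<pi>\<^sub>B"
    using z yc by (simp add: smult_minus(3) left_right)
  also have "\<dots> = \<zero>" using yc by (simp add: right_varpi_varpi minus_simps flip: z(2))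
  finally have "\<pi>\<^sub>B \<odot> z \<ominus> y \<triangleleft> \<pi>\<^sub>B = \<zero>" using z yc by - (rule right_varpi_inj, simp_all)
  then have pz: "\<pi>\<^sub>B \<odot> z = y \<triangleleft> \<pi>\<^sub>B" using z yc minus_eq_0_iff by simp
  have "a \<odot> z = z \<triangleleft> tw d a" if a: "a \<in> OK" for a
  proof -
    have "(a \<odot> z \<ominus> z \<triangleleft> tw d a) \<triangleleft> \<pi>\<^sub>B = a \<odot> (z \<triangleleft> \<pi>\<^sub>B) \<ominus> z \<triangleleft> \<pi>\<^sub>B \<triangleleft> tw (\<not> d) a"
      using z(1) a varpi_tw(2)[OF a, of d] by (simp add: smult_minus(3) left_right flip: right_assoc)
    also have "a \<odot> (z \<triangleleft> \<pi>\<^sub>B) = z \<triangleleft> \<pi>\<^sub>B \<triangleleft> tw (\<not> d) a"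
      using gr_left[OF gr_closed(5)[OF y] a] by (simp add: z(2))
    also have "z \<triangleleft> \<pi>\<^sub>B \<triangleleft> tw (\<not> d) a \<ominus> z \<triangleleft> \<pi>\<^sub>B \<triangleleft> tw (\<not> d) a = \<zero>" using z(1) a by (simp add: minus_simps)
    finally have "a \<odot> z \<ominus> z \<triangleleft> tw d a = \<zero>" using z a by - (rule right_varpi_inj, simp_all)
    then show ?thesis using z a minus_eq_0_iff by simp
  qed
  then have zg: "z \<in> gr d L" using z by (simp add: gr_def)
  show thesis
  proof (rule that)
    show "y \<oplus> z \<in> gr d L" using y zg by (rule gr_closed(2))
    show "y \<triangleleft> \<zeta> \<oplus> z \<triangleleft> \<sigma> \<zeta> \<in> gr d L" using y zg by (intro gr_closed) simp_all
    show "\<pi>\<^sub>B \<odot> (y \<oplus> z) = (y \<oplus> z) \<triangleleft> \<pi>\<^sub>B" using yc z pz by (simp add: left_distrib right_distrib a_ac)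
    have "\<pi>\<^sub>B \<odot> (y \<triangleleft> \<zeta> \<oplus> z \<triangleleft> \<sigma> \<zeta>) = z \<triangleleft> (\<pi>\<^sub>B * \<zeta>) \<oplus> y \<triangleleft> (\<pi>\<^sub>B * \<sigma> \<zeta>)"
      using yc z(1) by (simp add: left_distrib z(2) pz right_assoc flip: left_right)
    also have "\<dots> = (y \<triangleleft> \<zeta> \<oplus> z \<triangleleft> \<sigma> \<zeta>) \<triangleleft> \<pi>\<^sub>B"
      using yc z(1) by (simp add: right_distrib piB_conj a_comm flip: right_assoc)
    finally show "\<pi>\<^sub>B \<odot> (y \<triangleleft> \<zeta> \<oplus> z \<triangleleft> \<sigma> \<zeta>) = (y \<triangleleft> \<zeta> \<oplus> z \<triangleleft> \<sigma> \<zeta>) \<triangleleft> \<pi>\<^sub>B" .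
    \<comment> \<open>With u = y + z and w = y \<zeta> + z \<sigma> \<zeta>, the terms in z
      cancel.\<close>
    show "y \<triangleleft> (\<zeta> - \<sigma> \<zeta>) = (y \<triangleleft> \<zeta> \<oplus> z \<triangleleft> \<sigma> \<zeta>) \<ominus> (y \<oplus> z) \<triangleleft> \<sigma> \<zeta>"
      using yc z(1) by (simp add: smult_minus(4) right_distrib minus_simps)
  qed
qed

section \<open>Maximal maps from standard sums\<close>

lemma std_bound:
  assumes "inj_rad (std (r1, r2, t1, t2)) L f"
  shows "r1 + r2 + t1 + t2 \<le> grade_card False L + grade_card True L"
proof -
  \<comment> \<open>A crude bound is enough: its purpose is that a map of maximal size
    exists.\<close>
  have "n < q ^ n" for n using q_gt_1 by (intro power_gt_expt) simp
  moreover have "q ^ (r1 + t1 + t2) \<le> grade_card False L" "q ^ (r2 + t1 + t2) \<le> grade_card True L"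
    using inj_rad_grade_card[OF bimodule_std bimodule_axioms assms finite_cls, of False]
      inj_rad_grade_card[OF bimodule_std bimodule_axioms assms finite_cls, of True]
    by (simp_all add: std_cards)
  ultimately have "r1 + t1 + t2 \<le> grade_card False L" "r2 + t1 + t2 \<le> grade_card True L"
    by (meson le_trans less_imp_le_nat)+
  then show ?thesis by simp
qed

lemma inj_rad_transport:
  assumes "bimodule OB S" "bimodule OB S'" "bimodule_iso OB S' S" "inj_rad S L g"
  obtains g' where "inj_rad S' L g'" "\<And>w. w \<in> carrier S \<Longrightarrow> \<exists>w'\<in>carrier S'. g' w' = g w"
proof -
  obtain k where k: "bimodule_hom OB S' S k" "bij_betw k (carrier S') (carrier S)"
    using assms(3) by (rule bimodule_isoE)
  have "inj_rad S' L (g \<circ> k)"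
    by (rule inj_rad_comp[OF iso_inj_rad[OF assms(2) k] assms(4)])
  moreover have "\<exists>w'\<in>carrier S'. (g \<circ> k) w' = g w" if "w \<in> carrier S" for w
  proof -
    have "w \<in> k ` carrier S'" using k(2) that by (simp add: bij_betw_def)
    then obtain w' where "w' \<in> carrier S'" "w = k w'" by (elim imageE)
    then show ?thesis by (intro bexI[of _ w']) simp_all
  qed
  ultimately show thesis by (rule that)
qed

text \<open>The side condition \<open>P\<close> is left open because maximality is invoked twice,
  once for sums of \<open>basic2\<close> only and once for sums of all four kinds.\<close>

lemma maximal_inj_rad:
  assumes "P m f" "inj_rad (std m) L f"
  obtains m f where "P m f" "inj_rad (std m) L f"
    "\<And>m' f'. P m' f' \<Longrightarrow> inj_rad (std m') L f' \<Longrightarrow> mult4_size m' \<le> mult4_size m"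
proof -
  let ?Q = "\<lambda>m. \<exists>f. P m f \<and> inj_rad (std m) L f"
  have bound: "\<forall>m. ?Q m \<longrightarrow> mult4_size m < Suc (grade_card False L + grade_card True L)"
  proof (intro allI impI)
    fix m assume "?Q m"
    then obtain f where f: "inj_rad (std m) L f" by blast
    obtain r1 r2 t1 t2 where m: "m = (r1, r2, t1, t2)" by (cases m)
    show "mult4_size m < Suc (grade_card False L + grade_card True L)"
      using std_bound[of r1 r2 t1 t2 f] f by (simp add: m)
  qed
  have "?Q m" using assms by blast
  from ex_has_greatest_nat[of ?Q, OF this bound] show thesis using that by blast
qed

text \<open>If some homogeneous e had \<open>\<pi>\<^sub>B \<odot> e\<close> outside the image,
  \<open>extend_basic2\<close> would enlarge a maximal map. The restriction to copies of
  \<open>basic2\<close> keeps the source exact.\<close>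

lemma exists_varpi_image:
  obtains t1 t2 f where "inj_rad (std (0, 0, t1, t2)) L f"
    "\<And>x. x \<in> carrier L \<Longrightarrow> \<pi>\<^sub>B \<odot> x \<in> image_rad (std (0, 0, t1, t2)) L f"
proof -
  define P where "P m f \<longleftrightarrow> (\<exists>t1 t2. m = (0, 0, t1, t2))" for m :: mult4 and f :: "'b vec list \<times> 'b vec list \<times> 'b vec list \<times> 'b vec list \<Rightarrow> 'm"
  have zero: "inj_rad (std (0, 0, 0, 0)) L (\<lambda>_. \<zero>)"
    unfolding inj_rad_def
  proof (intro conjI ballI impI)
    interpret Z: quaternion_bimodule v \<iota> OB K \<sigma> \<pi> \<pi>\<^sub>B "std (0, 0, 0, 0)"
      using bimodule_std by (rule quaternion_bimoduleI)
    show "bimodule_hom OB (std (0, 0, 0, 0)) L (\<lambda>_. \<zero>)" by (rule bimodule_homI) simp_all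
    fix u assume "u \<in> carrier (std (0, 0, 0, 0))"
    then have "u = \<zero>\<^bsub>std (0, 0, 0, 0)\<^esub>" by (auto simp: std_def std_sum_def bimod_power_simps)
    then show "u \<in> radical (std (0, 0, 0, 0))" using Z.radical_closed(1) by simp
  qed
  have "P (0, 0, 0, 0) (\<lambda>_. \<zero>)" by (simp add: P_def)
  then obtain m f where m: "P m f" "inj_rad (std m) L f"
    "\<And>m' f'. P m' f' \<Longrightarrow> inj_rad (std m') L f' \<Longrightarrow> mult4_size m' \<le> mult4_size m"
    using zero by (rule maximal_inj_rad) (rule that)
  obtain t1 t2 where t: "m = (0, 0, t1, t2)" using m(1) by (auto simp: P_def)
  have hom: "bimodule_hom OB (std m) L f" using m(2) by (simp add: inj_rad_def)
  note I = image_rad_closed[OF bimodule_std hom]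
  have gr: "\<pi>\<^sub>B \<odot> e \<in> image_rad (std m) L f" if e: "e \<in> gr d L" for e d
  proof (rule ccontr)
    assume new: "\<pi>\<^sub>B \<odot> e \<notin> image_rad (std m) L f"
    let ?m = "mult4_add m (if d then (0, 0, 0, 1) else (0, 0, 1, 0))"
    have ext: "inj_rad (std m \<oplus>\<^sub>b basic2 d) L (\<lambda>w. f (fst w) \<oplus> (e \<triangleleft> (snd w $ 0) \<oplus> \<pi>\<^sub>B \<odot> e \<triangleleft> (snd w $ 1)))"
      by (rule extend_basic2[OF bimodule_std m(2) e new])
    obtain f' where f': "inj_rad (std ?m) L f'"
      by (rule inj_rad_transport[OF bimodule_sum[OF bimodule_std bimodule_basic(2)] bimodule_std std_extend(2) ext])
        (rule that)
    have "P ?m f'" by (simp add: P_def t)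
    then have "mult4_size ?m \<le> mult4_size m" using f' by (rule m(3))
    then show False by (simp add: mult4_size_add split: if_splits)
  qed
  have all: "\<pi>\<^sub>B \<odot> x \<in> image_rad (std m) L f" if x: "x \<in> carrier L" for x
  proof -
    note p = gr_proj[OF x, of False]
    have p1: "proj True L x \<in> gr True L" using gr_proj(1)[OF x] .
    have "\<pi>\<^sub>B \<odot> (proj False L x \<oplus> proj True L x) = \<pi>\<^sub>B \<odot> proj False L x \<oplus> \<pi>\<^sub>B \<odot> proj True L x"
      using gr_carrier[OF p(1)] gr_carrier[OF p1] by (intro left_distrib) simp_all
    also have "proj False L x \<oplus> proj True L x = x" using p(2) by simp
    finally show ?thesis using I(3)[OF gr[OF p(1)] gr[OF p1]] by simp
  qed
  show thesis using m(2) all unfolding t by (rule that)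
qed

text \<open>Let \<open>\<pi>\<^sub>B \<odot> x\<close> be congruent to f u. Applying
  \<open>\<pi>\<^sub>B\<close> again shows that \<open>\<pi>\<^sub>B\<close> sends u into the
  radical of the source; exactness writes u as \<open>\<pi>\<^sub>B\<close> times some w, and f w
  has the same shift as x.\<close>

lemma exists_shift_image:
  obtains m f where "inj_rad (std m) L f"
    "\<And>x. x \<in> carrier L \<Longrightarrow> \<exists>u\<in>carrier (std m). \<pi>\<^sub>B \<odot> x \<ominus> \<pi>\<^sub>B \<odot> f u \<in> radical L"
proof -
  obtain t1 t2 f where f: "inj_rad (std (0, 0, t1, t2)) L f"
    "\<And>x. x \<in> carrier L \<Longrightarrow> \<pi>\<^sub>B \<odot> x \<in> image_rad (std (0, 0, t1, t2)) L f"
    by (rule exists_varpi_image) (rule that)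
  let ?S = "std (0, 0, t1, t2)"
  interpret S: quaternion_bimodule v \<iota> OB K \<sigma> \<pi> \<pi>\<^sub>B ?S using bimodule_std by (rule quaternion_bimoduleI)
  have hom: "bimodule_hom OB ?S L f" and rad: "\<And>u. u \<in> carrier ?S \<Longrightarrow> f u \<in> radical L \<Longrightarrow> u \<in> radical ?S"
    using f(1) by (auto simp: inj_rad_def)
  note h = bimodule_homD[OF hom]
  have "\<exists>w\<in>carrier ?S. \<pi>\<^sub>B \<odot> x \<ominus> \<pi>\<^sub>B \<odot> f w \<in> radical L" if x: "x \<in> carrier L" for x
  proof -
    obtain u where u: "u \<in> carrier ?S" "\<pi>\<^sub>B \<odot> x \<ominus> f u \<in> radical L"
      using f(2)[OF x] by (auto simp: image_rad_def)
    have fu: "f u \<in> carrier L" using h(1) u by simp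
    have "\<pi>\<^sub>B \<odot> (\<pi>\<^sub>B \<odot> x) \<ominus> \<pi>\<^sub>B \<odot> (\<pi>\<^sub>B \<odot> x \<ominus> f u) \<in> radical L"
    proof (rule radical_closed(3))
      show "\<pi>\<^sub>B \<odot> (\<pi>\<^sub>B \<odot> x) \<in> radical L" unfolding right_varpi_varpi(2)[OF x] by (rule right_mOB_radical[OF x pi_mOB])
      show "\<pi>\<^sub>B \<odot> (\<pi>\<^sub>B \<odot> x \<ominus> f u) \<in> radical L" using u(2) by (rule radical_closed(6)) simp
    qed
    also have "\<pi>\<^sub>B \<odot> (\<pi>\<^sub>B \<odot> x \<ominus> f u) = \<pi>\<^sub>B \<odot> (\<pi>\<^sub>B \<odot> x) \<ominus> \<pi>\<^sub>B \<odot> f u" using x fu by (intro smult_minus(1)) simp_all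
    also have "\<pi>\<^sub>B \<odot> (\<pi>\<^sub>B \<odot> x) \<ominus> (\<pi>\<^sub>B \<odot> (\<pi>\<^sub>B \<odot> x) \<ominus> \<pi>\<^sub>B \<odot> f u) = f (\<pi>\<^sub>B \<odot>\<^bsub>?S\<^esub> u)"
      using x fu u h(3)[of \<pi>\<^sub>B u] by (simp add: minus_eq minus_add r_neg r_neg1 r_neg2 a_ac)
    finally have "\<pi>\<^sub>B \<odot>\<^bsub>?S\<^esub> u \<in> radical ?S" using rad u by simp
    then obtain w where w: "w \<in> carrier ?S" "u \<ominus>\<^bsub>?S\<^esub> \<pi>\<^sub>B \<odot>\<^bsub>?S\<^esub> w \<in> radical ?S"
      using exact_std u(1) unfolding exact_def by blast
    have "f (u \<ominus>\<^bsub>?S\<^esub> \<pi>\<^sub>B \<odot>\<^bsub>?S\<^esub> w) \<in> radical L" using hom_radical[OF hom w(2)] .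
    then have "f u \<ominus> \<pi>\<^sub>B \<odot> f w \<in> radical L"
      using hom_minus(1)[OF bimodule_std bimodule_axioms hom u(1), of "\<pi>\<^sub>B \<odot>\<^bsub>?S\<^esub> w"] w(1) h(3) by simp
    with u(2) have "(\<pi>\<^sub>B \<odot> x \<ominus> f u) \<oplus> (f u \<ominus> \<pi>\<^sub>B \<odot> f w) \<in> radical L" by (rule radical_closed(2))
    also have "(\<pi>\<^sub>B \<odot> x \<ominus> f u) \<oplus> (f u \<ominus> \<pi>\<^sub>B \<odot> f w) = \<pi>\<^sub>B \<odot> x \<ominus> \<pi>\<^sub>B \<odot> f w"
      using x fu h(1)[OF w(1)] by (simp add: minus_eq a_assoc r_neg1)
    finally show ?thesis using w(1) by (rule bexI)
  qed
  then show thesis by (rule that[OF f(1)])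
qed

lemma hom_proj: assumes M: "bimodule OB M" and f: "bimodule_hom OB M L f" and u: "u \<in> carrier M"
  shows "proj d M u \<in> carrier M" "f (proj d M u) = proj d L (f u)"
proof -
  interpret M: quaternion_bimodule v \<iota> OB K \<sigma> \<pi> \<pi>\<^sub>B M using M by (rule quaternion_bimoduleI)
  note h = bimodule_homD[OF f]
  have i: "inverse (tw d \<zeta> - tw (\<not> d) \<zeta>) \<in> OB"
    using zeta_unit OK_closed(6)[OF zeta_unit(2)] inverse_minus_eq[of "\<zeta> - \<sigma> \<zeta>"] by (auto simp: tw_def)
  show "proj d M u \<in> carrier M" using u i by (simp add: proj_def)
  show "f (proj d M u) = proj d L (f u)"
    using u i h hom_minus(1)[OF M bimodule_axioms f] by (simp add: proj_def)
qed

text \<open>The condition \<open>P\<close> survives the addition of copies of \<open>basic1\<close>,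
  so a maximal map may be taken among all maps satisfying it. Maximality puts the homogeneous
  vectors that commute with \<open>\<pi>\<^sub>B\<close> into the image, and \<open>P\<close>
  together with descent reduces every homogeneous vector to those.\<close>

theorem exists_std: "\<exists>m. bimodule_iso OB (std m) L"
proof -
  define P where "P m f \<longleftrightarrow> (\<forall>x\<in>carrier L. \<exists>u\<in>carrier (std m). \<pi>\<^sub>B \<odot> x \<ominus> \<pi>\<^sub>B \<odot> f u \<in> radical L)" for m f
  obtain m0 f0 where 0: "inj_rad (std m0) L f0"
    "\<And>x. x \<in> carrier L \<Longrightarrow> \<exists>u\<in>carrier (std m0). \<pi>\<^sub>B \<odot> x \<ominus> \<pi>\<^sub>B \<odot> f0 u \<in> radical L"
    by (rule exists_shift_image) (rule that)
  have "P m0 f0" using 0(2) by (simp add: P_def)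
  then obtain m f where m: "P m f" "inj_rad (std m) L f"
    "\<And>m' f'. P m' f' \<Longrightarrow> inj_rad (std m') L f' \<Longrightarrow> mult4_size m' \<le> mult4_size m"
    using 0(1) by (rule maximal_inj_rad) (rule that)
  interpret S: quaternion_bimodule v \<iota> OB K \<sigma> \<pi> \<pi>\<^sub>B "std m" using bimodule_std by (rule quaternion_bimoduleI)
  have hom: "bimodule_hom OB (std m) L f" using m(2) by (simp add: inj_rad_def)
  note I = image_rad_closed[OF bimodule_std hom] and h = bimodule_homD[OF hom]
  let ?I = "image_rad (std m) L f"
  have fixed: "x \<in> ?I" if x: "x \<in> gr d L" "\<pi>\<^sub>B \<odot> x = x \<triangleleft> \<pi>\<^sub>B" for x d
  proof (rule ccontr)
    assume new: "x \<notin> ?I"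
    let ?m = "mult4_add m (if d then (0, 1, 0, 0) else (1, 0, 0, 0))"
    let ?g = "\<lambda>w. f (fst w) \<oplus> x \<triangleleft> (snd w $ 0)"
    have ext: "inj_rad (std m \<oplus>\<^sub>b basic1 d) L ?g"
      by (rule extend_basic1[OF bimodule_std m(2) x new])
    obtain f' where f': "inj_rad (std ?m) L f'"
      "\<And>w. w \<in> carrier (std m \<oplus>\<^sub>b basic1 d) \<Longrightarrow> \<exists>w'\<in>carrier (std ?m). f' w' = ?g w"
      by (rule inj_rad_transport[OF bimodule_sum[OF bimodule_std bimodule_basic(1)] bimodule_std std_extend(1) ext])
        (rule that)
    \<comment> \<open>Old values are attained at the pairs (u, 0), so \<open>P\<close> is inherited
      by the enlarged map.\<close>
    have lift: "\<exists>w'\<in>carrier (std ?m). f' w' = f u" if "u \<in> carrier (std m)" for u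
    proof -
      have "(u, 0\<^sub>v 1) \<in> carrier (std m \<oplus>\<^sub>b basic1 d)" using that by (simp add: basic1_carrier)
      from f'(2)[OF this] show ?thesis using h(1)[OF that] gr_carrier[OF x(1)] by simp
    qed
    have "P ?m f'"
      unfolding P_def
    proof
      fix y assume "y \<in> carrier L"
      then obtain u where u: "u \<in> carrier (std m)" "\<pi>\<^sub>B \<odot> y \<ominus> \<pi>\<^sub>B \<odot> f u \<in> radical L" using m(1) by (auto simp: P_def)
      obtain w where "w \<in> carrier (std ?m)" "f' w = f u" using lift[OF u(1)] by blast
      then show "\<exists>w\<in>carrier (std ?m). \<pi>\<^sub>B \<odot> y \<ominus> \<pi>\<^sub>B \<odot> f' w \<in> radical L" using u(2) by (intro bexI[of _ w]) simp_all
    qed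
    then have "mult4_size ?m \<le> mult4_size m" using f'(1) by (rule m(3))
    then show False by (simp add: mult4_size_add split: if_splits)
  qed
  have gr: "x \<in> ?I" if x: "x \<in> gr d L" for x d
  proof -
    have xc: "x \<in> carrier L" using x by (rule gr_carrier)
    obtain u where u: "u \<in> carrier (std m)" "\<pi>\<^sub>B \<odot> x \<ominus> \<pi>\<^sub>B \<odot> f u \<in> radical L" using m(1) xc by (auto simp: P_def)
    \<comment> \<open>The vector u supplied by \<open>P\<close> need not be homogeneous; its image
      is split into degrees, and only the component \<open>a\<close> of the degree of x is
      subtracted.\<close>
    define a b where "a = f (proj d (std m) u)" and "b = f (proj (\<not> d) (std m) u)"
    have fu: "f u \<in> carrier L" using h(1) u by simp
    have ab: "a \<in> gr d L" "b \<in> gr (\<not> d) L" "f u = a \<oplus> b"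
      using gr_proj(1)[OF fu, of d] gr_proj(1)[OF fu, of "\<not> d"] gr_proj(2)[OF fu, of d]
        hom_proj(2)[OF bimodule_std hom u(1)] by (simp_all add: a_def b_def)
    have c: "a \<in> carrier L" "b \<in> carrier L" using ab gr_carrier by auto
    have aI: "a \<in> ?I" unfolding a_def by (intro I(2) hom_proj(1)[OF bimodule_std hom u(1)])
    define y where "y = x \<ominus> a"
    have y: "y \<in> gr d L" "y \<in> carrier L" using gr_closed(3)[OF x ab(1)] gr_carrier by (auto simp: y_def)
    have "\<pi>\<^sub>B \<odot> x \<ominus> \<pi>\<^sub>B \<odot> f u = \<pi>\<^sub>B \<odot> y \<oplus> \<pi>\<^sub>B \<odot> (\<ominus> b)"
      using xc c by (simp add: y_def ab(3) left_distrib minus_eq minus_add smult_neg a_ac)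
    \<comment> \<open>The two terms have opposite degrees, so \<open>radical_gr\<close> puts each of
      them into the radical separately; the one with \<open>y\<close> is kept.\<close>
    then have yb: "\<pi>\<^sub>B \<odot> y \<oplus> \<pi>\<^sub>B \<odot> (\<ominus> b) \<in> radical L" using u(2) by simp
    have "\<ominus> b \<in> gr (\<not> d) L" using gr_closed(3)[OF gr_closed(1) ab(2)] c by (simp add: minus_eq)
    then have "\<pi>\<^sub>B \<odot> (\<ominus> b) \<in> gr (\<not> \<not> d) L" by (rule gr_closed(5))
    then have "\<pi>\<^sub>B \<odot> y \<in> radical L" using yb by (rule radical_gr[OF gr_closed(5)[OF y(1)]])
    with y(1) obtain s w where sw: "s \<in> gr d L" "w \<in> gr d L" "\<pi>\<^sub>B \<odot> s = s \<triangleleft> \<pi>\<^sub>B" "\<pi>\<^sub>B \<odot> w = w \<triangleleft> \<pi>\<^sub>B"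
      "y \<triangleleft> (\<zeta> - \<sigma> \<zeta>) = w \<ominus> s \<triangleleft> \<sigma> \<zeta>" by (rule gr_fixed_span) (rule that)
    have "w \<ominus> s \<triangleleft> \<sigma> \<zeta> \<in> ?I" by (intro I(5) I(4) fixed[OF sw(1,3)] fixed[OF sw(2,4)]) simp
    then have "y \<triangleleft> (\<zeta> - \<sigma> \<zeta>) \<in> ?I" by (simp add: sw(5))
    \<comment> \<open>Descent yields y only up to the factor \<zeta> - \<sigma> \<zeta>, which is a
      unit and is cancelled.\<close>
    moreover have "\<zeta> - \<sigma> \<zeta> \<notin> mOB" using zeta_diff mOB_OK by simp
    ultimately have "y \<in> ?I" using y(2) by (intro I(7)[of y "\<zeta> - \<sigma> \<zeta>"]) simp_all
    then have "y \<oplus> a \<in> ?I" using aI by (rule I(3))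
    then show ?thesis using xc c by (simp add: y_def minus_simps)
  qed
  have "carrier L \<subseteq> ?I"
  proof
    fix x assume x: "x \<in> carrier L"
    have "proj False L x \<oplus> proj True L x \<in> ?I"
      using gr_proj(1)[OF x, of False] gr_proj(1)[OF x, of True] by (intro I(3) gr)
    then show "x \<in> ?I" using gr_proj(2)[OF x, of False] by simp
  qed
  then have "?I = carrier L" by (auto simp: image_rad_def)
  then have "bij_betw f (carrier (std m)) (carrier L)"
    by (rule hom_bijective[OF bimodule_std separated_std m(2)])
  then show ?thesis using hom by (intro exI[of _ m] bimodule_isoI)
qed

end

subsection \<open>Indecomposable bilattices\<close>

lemma bimodule_sum_assoc: "bimodule_iso R ((A \<oplus>\<^sub>b B) \<oplus>\<^sub>b C) (A \<oplus>\<^sub>b B \<oplus>\<^sub>b C)"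
proof (rule bimodule_isoI)
  show "bimodule_hom R ((A \<oplus>\<^sub>b B) \<oplus>\<^sub>b C) (A \<oplus>\<^sub>b B \<oplus>\<^sub>b C) (\<lambda>((a, b), c). (a, b, c))"
    by (rule bimodule_homI) auto
  show "bij_betw (\<lambda>((a, b), c). (a, b, c)) (carrier ((A \<oplus>\<^sub>b B) \<oplus>\<^sub>b C)) (carrier (A \<oplus>\<^sub>b B \<oplus>\<^sub>b C))"
    by (rule bij_betw_byWitness[where f' = "\<lambda>(a, b, c). ((a, b), c)"]) auto
qed

lemma bimodule_power_0_sum: "bimodule_iso R (A ^\<^sub>b 0 \<oplus>\<^sub>b B) B"
proof (rule bimodule_isoI)
  show "bimodule_hom R (A ^\<^sub>b 0 \<oplus>\<^sub>b B) B snd" by (rule bimodule_homI) auto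
  show "bij_betw snd (carrier (A ^\<^sub>b 0 \<oplus>\<^sub>b B)) (carrier B)"
    by (rule bij_betw_byWitness[where f' = "\<lambda>b. ([], b)"]) (auto simp: bimod_power_simps)
qed

lemma set_add_iff: "x \<in> A <+>\<^bsub>L\<^esub> B \<longleftrightarrow> (\<exists>a\<in>A. \<exists>b\<in>B. x = a \<oplus>\<^bsub>L\<^esub> b)"
  by (auto simp: set_add_def')

context quaternion_bimodule
begin

lemma subbimodule_iff:
  "is_subbimodule OB N L \<longleftrightarrow> N \<subseteq> carrier L \<and> \<zero> \<in> N \<and> (\<forall>x\<in>N. \<forall>y\<in>N. x \<oplus> y \<in> N) \<and>
    (\<forall>a\<in>OB. \<forall>x\<in>N. a \<odot> x \<in> N \<and> x \<triangleleft> a \<in> N)" (is "_ \<longleftrightarrow> ?P")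
proof
  assume N: "is_subbimodule OB N L"
  then interpret N: additive_subgroup N L by (simp add: is_subbimodule_def)
  show ?P using N N.a_subset N.zero_closed N.a_closed by (simp add: is_subbimodule_def)
next
  assume P: ?P
  have neg: "\<ominus> x \<in> N" if x: "x \<in> N" for x
  proof -
    have "(- 1) \<odot> x \<in> N" using P x by simp
    moreover have "x \<in> carrier L" using P x by auto
    ultimately show ?thesis by (simp add: smult_neg left_one)
  qed
  have "additive_subgroup N L"
  proof (rule additive_subgroup.intro, rule add.subgroupI)
    show "N \<subseteq> carrier L" "N \<noteq> {}" using P by auto
    show "\<ominus> x \<in> N" if "x \<in> N" for x using that by (rule neg)
    show "x \<oplus> y \<in> N" if "x \<in> N" "y \<in> N" for x y using P that by simp
  qed
  then show "is_subbimodule OB N L" using P by (simp add: is_subbimodule_def)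
qed

lemma subbimodule_bimodule:
  assumes M: "is_subbimodule OB M L" shows "bimodule OB (L\<lparr>carrier := M\<rparr>)"
proof (rule bimodule.intro)
  have sub: "\<And>x. x \<in> M \<Longrightarrow> x \<in> carrier L" and z: "\<zero> \<in> M" and add: "\<And>x y. x \<in> M \<Longrightarrow> y \<in> M \<Longrightarrow> x \<oplus> y \<in> M"
    and act: "\<And>a x. a \<in> OB \<Longrightarrow> x \<in> M \<Longrightarrow> a \<odot> x \<in> M" "\<And>a x. a \<in> OB \<Longrightarrow> x \<in> M \<Longrightarrow> x \<triangleleft> a \<in> M"
    using M unfolding subbimodule_iff by auto
  show "abelian_group (L\<lparr>carrier := M\<rparr>)"
  proof (rule abelian_groupI)
    fix x assume "x \<in> carrier (L\<lparr>carrier := M\<rparr>)"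
    then have x: "x \<in> M" by simp
    have "(- 1) \<odot> x \<oplus> x = \<zero>" using sub[OF x] by (simp add: smult_neg left_one l_neg)
    then show "\<exists>y\<in>carrier (L\<lparr>carrier := M\<rparr>). y \<oplus>\<^bsub>L\<lparr>carrier := M\<rparr>\<^esub> x = \<zero>\<^bsub>L\<lparr>carrier := M\<rparr>\<^esub>"
      using act(1)[OF _ x, of "- 1"] by (intro bexI[of _ "(- 1) \<odot> x"]) simp_all
  qed (auto simp: z add sub a_ac)
  show "bimodule_axioms OB (L\<lparr>carrier := M\<rparr>)"
    by unfold_locales
      (auto simp: act sub left_distrib_scalar left_distrib left_assoc left_one right_distrib_scalar
        right_distrib right_assoc right_one left_right)
qed

end

context quaternion_bilattice
begin

text \<open>A direct summand is generated by the components of generators of \<open>L\<close>.\<close>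

lemma summand_bilattice:
  assumes M: "is_subbimodule OB M L" and N: "is_subbimodule OB N L"
    and sum: "M <+>\<^bsub>L\<^esub> N = carrier L" and int: "M \<inter> N = {\<zero>}"
  shows "bilattice v \<iota> OB (L\<lparr>carrier := M\<rparr>)"
proof (intro bilattice.intro bilattice_axioms.intro)
  show bM: "bimodule OB (L\<lparr>carrier := M\<rparr>)" using M by (rule subbimodule_bimodule)
  interpret M: quaternion_bimodule v \<iota> OB K \<sigma> \<pi> \<pi>\<^sub>B "L\<lparr>carrier := M\<rparr>" using bM by (rule quaternion_bimoduleI)
  note m = M[unfolded subbimodule_iff] and n = N[unfolded subbimodule_iff]
  have sub: "M \<subseteq> carrier L" "N \<subseteq> carrier L" using m n by auto
  have split: "\<exists>a b. a \<in> M \<and> b \<in> N \<and> x = a \<oplus> b" if "x \<in> carrier L" for x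
  proof -
    have "x \<in> M <+>\<^bsub>L\<^esub> N" using that sum by simp
    then show ?thesis unfolding set_add_iff by blast
  qed
  show "\<iota> c \<odot>\<^bsub>L\<lparr>carrier := M\<rparr>\<^esub> x = x \<triangleleft>\<^bsub>L\<lparr>carrier := M\<rparr>\<^esub> \<iota> c" if "c \<in> val_ring v" "x \<in> carrier (L\<lparr>carrier := M\<rparr>)" for c x
    using actions_agree that sub by auto
  show "c = 0 \<or> x = \<zero>\<^bsub>L\<lparr>carrier := M\<rparr>\<^esub>"
    if "c \<in> val_ring v" "x \<in> carrier (L\<lparr>carrier := M\<rparr>)" "\<iota> c \<odot>\<^bsub>L\<lparr>carrier := M\<rparr>\<^esub> x = \<zero>\<^bsub>L\<lparr>carrier := M\<rparr>\<^esub>" for c x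
    using torsion_free[of c x] that sub by auto
  obtain S where S: "finite S" "S \<subseteq> carrier L" "\<And>N. is_subbimodule OB N L \<Longrightarrow> S \<subseteq> N \<Longrightarrow> N = carrier L"
    using fin_gen unfolding finitely_generated_def by auto
  have "\<forall>x. \<exists>a. x \<in> carrier L \<longrightarrow> a \<in> M \<and> (\<exists>b\<in>N. x = a \<oplus> b)" using split by blast
  from choice[OF this] obtain p where p: "\<And>x. x \<in> carrier L \<Longrightarrow> p x \<in> M \<and> (\<exists>b\<in>N. x = p x \<oplus> b)" by blast
  show "finitely_generated OB (L\<lparr>carrier := M\<rparr>)"
    unfolding finitely_generated_def
  proof (intro exI conjI allI impI)
    show "finite (p ` S)" using S(1) by simp
    show "p ` S \<subseteq> carrier (L\<lparr>carrier := M\<rparr>)" using p S(2) by auto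
    fix M' assume a: "is_subbimodule OB M' (L\<lparr>carrier := M\<rparr>) \<and> p ` S \<subseteq> M'"
    then have m': "M' \<subseteq> M" "\<zero> \<in> M'" "\<And>x y. x \<in> M' \<Longrightarrow> y \<in> M' \<Longrightarrow> x \<oplus> y \<in> M'"
      "\<And>a x. a \<in> OB \<Longrightarrow> x \<in> M' \<Longrightarrow> a \<odot> x \<in> M'" "\<And>a x. a \<in> OB \<Longrightarrow> x \<in> M' \<Longrightarrow> x \<triangleleft> a \<in> M'"
      unfolding M.subbimodule_iff by auto
    \<comment> \<open>T is M' + N. It contains the generators of \<open>L\<close>, so it equals
      \<open>L\<close>, and intersecting with \<open>M\<close> leaves M'.\<close>
    define T where "T = {a \<oplus> b | a b. a \<in> M' \<and> b \<in> N}"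
    have TI: "x \<in> T" if "a \<in> M'" "b \<in> N" "x = a \<oplus> b" for x a b using that by (auto simp: T_def)
    have TE: "\<exists>a b. a \<in> M' \<and> b \<in> N \<and> x = a \<oplus> b" if "x \<in> T" for x using that by (auto simp: T_def)
    have c: "x \<in> M' \<Longrightarrow> x \<in> carrier L" "x \<in> N \<Longrightarrow> x \<in> carrier L" for x using m'(1) sub by auto
    have "is_subbimodule OB T L"
      unfolding subbimodule_iff
    proof (intro conjI ballI)
      show "T \<subseteq> carrier L" using c by (auto simp: T_def)
      show "\<zero> \<in> T" using m'(2) n by (intro TI[of \<zero> \<zero>]) simp_all
      fix x assume "x \<in> T"
      then obtain a b where ab: "a \<in> M'" "b \<in> N" "x = a \<oplus> b" using TE by blast
      show "r \<odot> x \<in> T" if "r \<in> OB" for r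
        using ab m'(4) n c that by (intro TI[of "r \<odot> a" "r \<odot> b"]) (simp_all add: left_distrib)
      show "x \<triangleleft> r \<in> T" if "r \<in> OB" for r
        using ab m'(5) n c that by (intro TI[of "a \<triangleleft> r" "b \<triangleleft> r"]) (simp_all add: right_distrib)
      fix y assume "y \<in> T"
      then obtain a' b' where ab': "a' \<in> M'" "b' \<in> N" "y = a' \<oplus> b'" using TE by blast
      show "x \<oplus> y \<in> T"
        using ab ab' m'(3) n c by (intro TI[of "a \<oplus> a'" "b \<oplus> b'"]) (simp_all add: a_ac)
    qed
    moreover have "S \<subseteq> T"
    proof
      fix s assume s: "s \<in> S"
      then obtain b where "b \<in> N" "s = p s \<oplus> b" using p S(2) by blast
      moreover have "p s \<in> M'" using a s by auto
      ultimately show "s \<in> T" by (intro TI)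
    qed
    ultimately have T: "T = carrier L" by (rule S(3))
    have "M \<subseteq> M'"
    proof
      fix x assume x: "x \<in> M"
      then obtain a b where ab: "a \<in> M'" "b \<in> N" "x = a \<oplus> b" using T TE sub by blast
      have am: "a \<in> M" using ab(1) m'(1) by blast
      have "b = x \<oplus> (- 1) \<odot> a"
        using ab c[of b] c(1)[OF ab(1)] c(2)[OF ab(2)] by (simp add: smult_neg left_one a_ac r_neg1 r_neg2 add_cancel)
      also have "\<dots> \<in> M" using m x am by simp
      finally have "b = \<zero>" using int ab(2) by blast
      then show "x \<in> M'" using ab c by simp
    qed
    then show "M' = carrier (L\<lparr>carrier := M\<rparr>)" using m'(1) by auto
  qed
qed

lemma summand_iso:
  assumes M: "is_subbimodule OB M L" and N: "is_subbimodule OB N L"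
    and sum: "M <+>\<^bsub>L\<^esub> N = carrier L" and int: "M \<inter> N = {\<zero>}"
  shows "bimodule_iso OB (L\<lparr>carrier := M\<rparr> \<oplus>\<^sub>b L\<lparr>carrier := N\<rparr>) L"
proof (rule bimodule_isoI)
  note m = M[unfolded subbimodule_iff] and n = N[unfolded subbimodule_iff]
  have sub: "\<And>x. x \<in> M \<Longrightarrow> x \<in> carrier L" "\<And>x. x \<in> N \<Longrightarrow> x \<in> carrier L" using m n by auto
  let ?f = "\<lambda>(x, y). x \<oplus> y"
  show "bimodule_hom OB (L\<lparr>carrier := M\<rparr> \<oplus>\<^sub>b L\<lparr>carrier := N\<rparr>) L ?f"
    by (rule bimodule_homI) (auto simp: sub a_ac left_distrib right_distrib)
  have "inj_on ?f (M \<times> N)"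
  proof (rule inj_onI, clarify)
    fix a b a' b' assume h: "a \<in> M" "b \<in> N" "a' \<in> M" "b' \<in> N" "a \<oplus> b = a' \<oplus> b'"
    have c: "a \<in> carrier L" "b \<in> carrier L" "a' \<in> carrier L" "b' \<in> carrier L" using h sub by auto
    have "a \<ominus> a' = b' \<ominus> b"
    proof -
      have "a \<ominus> a' = (a \<oplus> b) \<ominus> (a' \<oplus> b)" using c by (simp add: minus_simps)
      also have "\<dots> = (a' \<oplus> b') \<ominus> (a' \<oplus> b)" using h(5) by simp
      also have "\<dots> = b' \<ominus> b" using c by (simp add: minus_simps)
      finally show ?thesis .
    qed
    moreover have "a \<oplus> (- 1) \<odot> a' \<in> M" "b' \<oplus> (- 1) \<odot> b \<in> N" using m n h by simp_all
    then have "a \<ominus> a' \<in> M" "b' \<ominus> b \<in> N" using c by (simp_all add: smult_neg left_one minus_eq)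
    ultimately have "a \<ominus> a' \<in> M \<inter> N" by simp
    then have "a \<ominus> a' = \<zero>" "b' \<ominus> b = \<zero>" using int \<open>a \<ominus> a' = b' \<ominus> b\<close> by auto
    then show "a = a' \<and> b = b'" using c minus_eq_0_iff by auto
  qed
  moreover have "?f ` (M \<times> N) = carrier L"
    unfolding sum[symmetric]
  proof
    show "?f ` (M \<times> N) \<subseteq> M <+>\<^bsub>L\<^esub> N" unfolding subset_iff set_add_iff by auto
    show "M <+>\<^bsub>L\<^esub> N \<subseteq> ?f ` (M \<times> N)"
    proof
      fix x assume "x \<in> M <+>\<^bsub>L\<^esub> N"
      then obtain a b where "a \<in> M" "b \<in> N" "x = a \<oplus> b" unfolding set_add_iff by blast
      then show "x \<in> ?f ` (M \<times> N)" by (intro image_eqI[of _ _ "(a, b)"]) simp_all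
    qed
  qed
  ultimately show "bij_betw ?f (carrier (L\<lparr>carrier := M\<rparr> \<oplus>\<^sub>b L\<lparr>carrier := N\<rparr>)) (carrier L)"
    by (simp add: bij_betw_def)
qed

end

context quaternion_setting
begin

lemma quaternion_bilatticeI: "bilattice v \<iota> OB L \<Longrightarrow> quaternion_bilattice v \<iota> OB K \<sigma> \<pi> \<pi>\<^sub>B L"
  by (intro quaternion_bilattice.intro quaternion_bimodule.intro quaternion_setting_axioms)
    (simp_all add: bilattice_def)

lemma bilattice_bimodule: "bilattice v \<iota> OB L \<Longrightarrow> bimodule OB L"
  by (simp add: bilattice_def)

lemma exists_iso_std: assumes L: "bilattice v \<iota> OB L" obtains m where "bimodule_iso OB L (std m)"
proof -
  interpret L: quaternion_bilattice v \<iota> OB K \<sigma> \<pi> \<pi>\<^sub>B L using L by (rule quaternion_bilatticeI)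
  obtain m where "bimodule_iso OB (std m) L" using L.exists_std by blast
  then show thesis using bimodule_iso_sym[OF bimodule_std] that by blast
qed

lemma iso_std_unique:
  assumes "bimodule OB L" "bimodule_iso OB L (std m)" "bimodule_iso OB L (std m')"
  shows "m = m'"
  using std_iso_unique[OF bimodule_iso_trans[OF bimodule_iso_sym[OF assms(1,2)] assms(3)]] .

lemma std_0_carrier: "carrier (std (0, 0, 0, 0)) = {\<zero>\<^bsub>std (0, 0, 0, 0)\<^esub>}"
  by (auto simp: std_def std_sum_def bimod_power_simps)

lemma iso_std_0: 
  assumes L: "bimodule OB L" and iso: "bimodule_iso OB L (std m)"
  shows "carrier L = {\<zero>\<^bsub>L\<^esub>} \<longleftrightarrow> m = (0, 0, 0, 0)"
proof
  interpret L: quaternion_bimodule v \<iota> OB K \<sigma> \<pi> \<pi>\<^sub>B L using L by (rule quaternion_bimoduleI)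
  assume triv: "carrier L = {\<zero>\<^bsub>L\<^esub>}"
  have "bimodule_iso OB L (std (0, 0, 0, 0))"
  proof (rule bimodule_isoI)
    interpret Z: quaternion_bimodule v \<iota> OB K \<sigma> \<pi> \<pi>\<^sub>B "std (0, 0, 0, 0)"
      using bimodule_std by (rule quaternion_bimoduleI)
    show "bimodule_hom OB L (std (0, 0, 0, 0)) (\<lambda>_. \<zero>\<^bsub>std (0, 0, 0, 0)\<^esub>)" by (rule bimodule_homI) simp_all
    show "bij_betw (\<lambda>_. \<zero>\<^bsub>std (0, 0, 0, 0)\<^esub>) (carrier L) (carrier (std (0, 0, 0, 0)))"
      unfolding triv std_0_carrier by (simp add: bij_betw_def)
  qed
  then show "m = (0, 0, 0, 0)" using iso_std_unique[OF L iso] by blast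
next
  interpret L: quaternion_bimodule v \<iota> OB K \<sigma> \<pi> \<pi>\<^sub>B L using L by (rule quaternion_bimoduleI)
  assume m: "m = (0, 0, 0, 0)"
  obtain f where "bij_betw f (carrier L) (carrier (std m))" using iso by (rule bimodule_isoE)
  then have "bij_betw f (carrier L) {\<zero>\<^bsub>std (0, 0, 0, 0)\<^esub>}" using m std_0_carrier by simp
  then have inj: "inj_on f (carrier L)" and img: "f ` carrier L = {\<zero>\<^bsub>std (0, 0, 0, 0)\<^esub>}"
    by (simp_all add: bij_betw_def)
  have "f x = \<zero>\<^bsub>std (0, 0, 0, 0)\<^esub>" if "x \<in> carrier L" for x using imageI[OF that, of f] by (simp add: img)
  then have "x = \<zero>\<^bsub>L\<^esub>" if "x \<in> carrier L" for x using that by (intro inj_onD[OF inj]) simp_all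
  then show "carrier L = {\<zero>\<^bsub>L\<^esub>}" using L.zero_closed by blast
qed

text \<open>The summands of a bilattice are bilattices and have multiplicities of their own. By
  uniqueness these add up to m, so total size 1 leaves nothing for one of the summands.\<close>

lemma bilattice_indecomposable:
  assumes L: "bilattice v \<iota> OB L" and iso: "bimodule_iso OB L (std m)" and size: "mult4_size m = 1"
  shows "indecomposable OB L"
  unfolding indecomposable_def
proof (intro conjI allI impI)
  interpret L: quaternion_bilattice v \<iota> OB K \<sigma> \<pi> \<pi>\<^sub>B L using L by (rule quaternion_bilatticeI)
  show "carrier L \<noteq> {\<zero>\<^bsub>L\<^esub>}" using iso_std_0[OF L.bimodule_axioms iso] size by auto
  fix M N assume "is_subbimodule OB M L \<and> is_subbimodule OB N L \<and> M <+>\<^bsub>L\<^esub> N = carrier L \<and> M \<inter> N = {\<zero>\<^bsub>L\<^esub>}"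
  then have M: "is_subbimodule OB M L" and N: "is_subbimodule OB N L"
    and sum: "M <+>\<^bsub>L\<^esub> N = carrier L" and int: "M \<inter> N = {\<zero>\<^bsub>L\<^esub>}" by auto
  have sum': "N <+>\<^bsub>L\<^esub> M = carrier L"
  proof -
    have "M \<subseteq> carrier L" "N \<subseteq> carrier L" using M N L.subbimodule_iff by auto
    then have "a \<oplus>\<^bsub>L\<^esub> b = b \<oplus>\<^bsub>L\<^esub> a" if "a \<in> M" "b \<in> N" for a b using that by (intro L.a_comm) auto
    then have "x \<in> N <+>\<^bsub>L\<^esub> M \<longleftrightarrow> x \<in> M <+>\<^bsub>L\<^esub> N" for x unfolding set_add_iff by metis
    then show ?thesis using sum by blast
  qed
  have int': "N \<inter> M = {\<zero>\<^bsub>L\<^esub>}" using int by blast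
  have bM: "bilattice v \<iota> OB (L\<lparr>carrier := M\<rparr>)" by (rule L.summand_bilattice[OF M N sum int])
  have bN: "bilattice v \<iota> OB (L\<lparr>carrier := N\<rparr>)" by (rule L.summand_bilattice[OF N M sum' int'])
  note M' = bilattice_bimodule[OF bM] and N' = bilattice_bimodule[OF bN]
  obtain m1 where m1: "bimodule_iso OB (L\<lparr>carrier := M\<rparr>) (std m1)" using bM by (rule exists_iso_std)
  obtain m2 where m2: "bimodule_iso OB (L\<lparr>carrier := N\<rparr>) (std m2)" using bN by (rule exists_iso_std)
  have "bimodule_iso OB L (L\<lparr>carrier := M\<rparr> \<oplus>\<^sub>b L\<lparr>carrier := N\<rparr>)"
    by (rule bimodule_iso_sym[OF bimodule_sum[OF M' N'] L.summand_iso[OF M N sum int]])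
  then have "bimodule_iso OB L (std m1 \<oplus>\<^sub>b std m2)"
    by (rule bimodule_iso_trans[OF _ bimodule_iso_sum[OF m1 m2]])
  moreover have "bimodule_iso OB (std m1 \<oplus>\<^sub>b std m2) (std (mult4_add m1 m2))"
    unfolding std_def by (rule std_sum_add)
  ultimately have "bimodule_iso OB L (std (mult4_add m1 m2))" by (rule bimodule_iso_trans)
  then have "m = mult4_add m1 m2" by (rule iso_std_unique[OF L.bimodule_axioms iso])
  then have "mult4_size m1 = 0 \<or> mult4_size m2 = 0" using size by (cases m1; cases m2) auto
  then show "M = {\<zero>\<^bsub>L\<^esub>} \<or> N = {\<zero>\<^bsub>L\<^esub>}"
    using iso_std_0[OF M' m1] iso_std_0[OF N' m2] by (simp add: mult4_size_0)
qed

text \<open>If the size is at least 2, one basic summand splits off with nonzero complement; the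
  images of both under an isomorphism form an internal decomposition of \<open>L\<close>.\<close>

lemma indecomposable_size:
  assumes L: "bilattice v \<iota> OB L" and ind: "indecomposable OB L" and iso: "bimodule_iso OB L (std m)"
  shows "mult4_size m = 1"
proof (rule ccontr)
  interpret L: quaternion_bilattice v \<iota> OB K \<sigma> \<pi> \<pi>\<^sub>B L using L by (rule quaternion_bilatticeI)
  assume n1: "mult4_size m \<noteq> 1"
  have "m \<noteq> (0, 0, 0, 0)" using ind iso_std_0[OF L.bimodule_axioms iso] by (simp add: indecomposable_def)
  then have "mult4_size m \<noteq> 0" by (simp add: mult4_size_0)
  moreover obtain r1 r2 t1 t2 where m: "m = (r1, r2, t1, t2)" by (cases m)
  \<comment> \<open>A positive entry gives the unit vector \<open>e\<close>; the remainder is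
    nonzero because the total differs from 1.\<close>
  ultimately obtain e m' where em: "m = mult4_add e m'" "e \<noteq> (0, 0, 0, 0)" "m' \<noteq> (0, 0, 0, 0)"
  proof -
    consider "r1 > 0" | "r2 > 0" | "t1 > 0" | "t2 > 0" using \<open>mult4_size m \<noteq> 0\<close> m by auto
    then show thesis
    proof cases
      case 1 then show thesis using n1 m by (intro that[of "(1, 0, 0, 0)" "(r1 - 1, r2, t1, t2)"]) auto
    next
      case 2 then show thesis using n1 m by (intro that[of "(0, 1, 0, 0)" "(r1, r2 - 1, t1, t2)"]) auto
    next
      case 3 then show thesis using n1 m by (intro that[of "(0, 0, 1, 0)" "(r1, r2, t1 - 1, t2)"]) auto
    next
      case 4 then show thesis using n1 m by (intro that[of "(0, 0, 0, 1)" "(r1, r2, t1, t2 - 1)"]) auto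
    qed
  qed
  have bs: "bimodule OB (std e \<oplus>\<^sub>b std m')" by (intro bimodule_sum bimodule_std)
  have "bimodule_iso OB (std e \<oplus>\<^sub>b std m') (std m)"
    unfolding em(1) std_def by (rule std_sum_add)
  then have "bimodule_iso OB (std e \<oplus>\<^sub>b std m') L"
    by (rule bimodule_iso_trans[OF _ bimodule_iso_sym[OF L.bimodule_axioms iso]])
  then obtain g where g: "bimodule_hom OB (std e \<oplus>\<^sub>b std m') L g"
    "bij_betw g (carrier (std e \<oplus>\<^sub>b std m')) (carrier L)" by (rule bimodule_isoE)
  note h = bimodule_homD[OF g(1)]
  interpret E: quaternion_bimodule v \<iota> OB K \<sigma> \<pi> \<pi>\<^sub>B "std e" using bimodule_std by (rule quaternion_bimoduleI)
  interpret M: quaternion_bimodule v \<iota> OB K \<sigma> \<pi> \<pi>\<^sub>B "std m'" using bimodule_std by (rule quaternion_bimoduleI)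
  interpret EM: quaternion_bimodule v \<iota> OB K \<sigma> \<pi> \<pi>\<^sub>B "std e \<oplus>\<^sub>b std m'" using bs by (rule quaternion_bimoduleI)
  have inj: "inj_on g (carrier (std e) \<times> carrier (std m'))" and img: "g ` (carrier (std e) \<times> carrier (std m')) = carrier L"
    using g(2) by (auto simp: bij_betw_def)
  have g0: "g (\<zero>\<^bsub>std e\<^esub>, \<zero>\<^bsub>std m'\<^esub>) = \<zero>\<^bsub>L\<^esub>" using hom_minus(2)[OF bs L.bimodule_axioms g(1) EM.zero_closed EM.zero_closed] by simp
  have sub: "is_subbimodule OB (g ` A) L" if A: "is_subbimodule OB A (std e \<oplus>\<^sub>b std m')" for A
  proof -
    note A' = A[unfolded EM.subbimodule_iff]
    have Ac: "\<And>x. x \<in> A \<Longrightarrow> x \<in> carrier (std e \<oplus>\<^sub>b std m')" using A' by blast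
    show ?thesis
      unfolding L.subbimodule_iff
    proof (intro conjI ballI)
      show "g ` A \<subseteq> carrier L" using Ac h(1) by blast
      show "\<zero>\<^bsub>L\<^esub> \<in> g ` A" using A' g0 by (intro image_eqI[of _ _ "(\<zero>\<^bsub>std e\<^esub>, \<zero>\<^bsub>std m'\<^esub>)"]) simp_all
      fix x assume "x \<in> g ` A"
      then obtain a where a: "a \<in> A" "x = g a" by (elim imageE)
      show "r \<odot>\<^bsub>L\<^esub> x \<in> g ` A" if "r \<in> OB" for r
        using that a A' h(3)[OF that Ac[OF a(1)]] by (intro image_eqI[of _ _ "r \<odot>\<^bsub>std e \<oplus>\<^sub>b std m'\<^esub> a"]) auto
      show "x \<triangleleft>\<^bsub>L\<^esub> r \<in> g ` A" if "r \<in> OB" for r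
        using that a A' h(4)[OF that Ac[OF a(1)]] by (intro image_eqI[of _ _ "a \<triangleleft>\<^bsub>std e \<oplus>\<^sub>b std m'\<^esub> r"]) auto
      fix y assume "y \<in> g ` A"
      then obtain b where b: "b \<in> A" "y = g b" by (elim imageE)
      show "x \<oplus>\<^bsub>L\<^esub> y \<in> g ` A"
        using a b A' h(2)[OF Ac[OF a(1)] Ac[OF b(1)]] by (intro image_eqI[of _ _ "a \<oplus>\<^bsub>std e \<oplus>\<^sub>b std m'\<^esub> b"]) auto
    qed
  qed
  define A where "A = carrier (std e) \<times> {\<zero>\<^bsub>std m'\<^esub>}"
  define B where "B = {\<zero>\<^bsub>std e\<^esub>} \<times> carrier (std m')"
  have "is_subbimodule OB A (std e \<oplus>\<^sub>b std m')" "is_subbimodule OB B (std e \<oplus>\<^sub>b std m')"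
    unfolding EM.subbimodule_iff A_def B_def by auto
  then have AB: "is_subbimodule OB (g ` A) L" "is_subbimodule OB (g ` B) L" using sub by auto
  have ABc: "A \<subseteq> carrier (std e) \<times> carrier (std m')" "B \<subseteq> carrier (std e) \<times> carrier (std m')"
    by (auto simp: A_def B_def)
  have "g ` A <+>\<^bsub>L\<^esub> g ` B = carrier L"
  proof
    have "x \<in> carrier L" if "x \<in> g ` A" for x using AB(1) that L.subbimodule_iff by auto
    moreover have "y \<in> carrier L" if "y \<in> g ` B" for y using AB(2) that L.subbimodule_iff by auto
    ultimately show "g ` A <+>\<^bsub>L\<^esub> g ` B \<subseteq> carrier L" unfolding subset_iff set_add_iff by blast
    show "carrier L \<subseteq> g ` A <+>\<^bsub>L\<^esub> g ` B"
    proof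
      fix z assume "z \<in> carrier L"
      then have "z \<in> g ` (carrier (std e) \<times> carrier (std m'))" using img by simp
      then obtain x y where xy: "x \<in> carrier (std e)" "y \<in> carrier (std m')" "z = g (x, y)"
        by (elim imageE SigmaE) simp
      have "z = g (x, \<zero>\<^bsub>std m'\<^esub>) \<oplus>\<^bsub>L\<^esub> g (\<zero>\<^bsub>std e\<^esub>, y)"
        using xy h(2)[of "(x, \<zero>\<^bsub>std m'\<^esub>)" "(\<zero>\<^bsub>std e\<^esub>, y)"] by simp
      moreover have "g (x, \<zero>\<^bsub>std m'\<^esub>) \<in> g ` A" "g (\<zero>\<^bsub>std e\<^esub>, y) \<in> g ` B" using xy by (auto simp: A_def B_def)
      ultimately show "z \<in> g ` A <+>\<^bsub>L\<^esub> g ` B" unfolding set_add_iff by blast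
    qed
  qed
  moreover have "g ` A \<inter> g ` B = {\<zero>\<^bsub>L\<^esub>}"
  proof -
    have "g ` A \<inter> g ` B = g ` (A \<inter> B)" using inj_on_image_Int[OF inj ABc] by simp
    also have "A \<inter> B = {(\<zero>\<^bsub>std e\<^esub>, \<zero>\<^bsub>std m'\<^esub>)}" by (auto simp: A_def B_def)
    finally show ?thesis using g0 by simp
  qed
  ultimately have "g ` A = {\<zero>\<^bsub>L\<^esub>} \<or> g ` B = {\<zero>\<^bsub>L\<^esub>}" using ind AB by (auto simp: indecomposable_def)
  moreover have "A = {(\<zero>\<^bsub>std e\<^esub>, \<zero>\<^bsub>std m'\<^esub>)}" if "g ` A = {\<zero>\<^bsub>L\<^esub>}"
  proof -
    have "x = (\<zero>\<^bsub>std e\<^esub>, \<zero>\<^bsub>std m'\<^esub>)" if x: "x \<in> A" for x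
      using inj_onD[OF inj, of x "(\<zero>\<^bsub>std e\<^esub>, \<zero>\<^bsub>std m'\<^esub>)"] x subsetD[OF ABc(1) x] imageI[OF x, of g] \<open>g ` A = {\<zero>\<^bsub>L\<^esub>}\<close> g0 by simp
    moreover have "(\<zero>\<^bsub>std e\<^esub>, \<zero>\<^bsub>std m'\<^esub>) \<in> A" by (simp add: A_def)
    ultimately show ?thesis by blast
  qed
  moreover have "B = {(\<zero>\<^bsub>std e\<^esub>, \<zero>\<^bsub>std m'\<^esub>)}" if "g ` B = {\<zero>\<^bsub>L\<^esub>}"
  proof -
    have "x = (\<zero>\<^bsub>std e\<^esub>, \<zero>\<^bsub>std m'\<^esub>)" if x: "x \<in> B" for x
      using inj_onD[OF inj, of x "(\<zero>\<^bsub>std e\<^esub>, \<zero>\<^bsub>std m'\<^esub>)"] x subsetD[OF ABc(2) x] imageI[OF x, of g] \<open>g ` B = {\<zero>\<^bsub>L\<^esub>}\<close> g0 by simp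
    moreover have "(\<zero>\<^bsub>std e\<^esub>, \<zero>\<^bsub>std m'\<^esub>) \<in> B" by (simp add: B_def)
    ultimately show ?thesis by blast
  qed
  moreover have "carrier (std e) = fst ` A" "carrier (std m') = snd ` B" by (simp_all add: A_def B_def)
  ultimately have "carrier (std e) = {\<zero>\<^bsub>std e\<^esub>} \<or> carrier (std m') = {\<zero>\<^bsub>std m'\<^esub>}"
    by (elim disjE) simp_all
  then show False
    using iso_std_0[OF bimodule_std bimodule_iso_refl, of e] iso_std_0[OF bimodule_std bimodule_iso_refl, of m'] em
    by auto
qed

subsection \<open>Conjugacy of embeddings\<close>

lemma unit_vec_carrier: "j < n \<Longrightarrow> unit_vec n j \<in> carrier (emb_bimodule OB n \<phi>)"
  by (auto simp: emb_bimodule_simps unit_vec_def)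

lemma mat_mult_unit_vec:
  fixes A :: "'b mat"
  assumes "A \<in> carrier_mat n n" "i < n" "j < n"
  shows "(A *\<^sub>v unit_vec n j) $ i = A $$ (i, j)"
proof -
  have "(A *\<^sub>v unit_vec n j) $ i = (\<Sum>k<n. A $$ (i, k) * unit_vec n j $ k)"
    using assms by (intro mult_mat_vec_index_sum) simp_all
  also have "\<dots> = (\<Sum>k<n. if k = j then A $$ (i, k) else 0)"
    using assms by (intro sum.cong) (auto simp: unit_vec_def)
  finally show ?thesis using assms(3) by simp
qed

lemma mat_eq_by_vec:
  fixes A B :: "'b mat"
  assumes "A \<in> carrier_mat n n" "B \<in> carrier_mat n n" "\<And>j. j < n \<Longrightarrow> A *\<^sub>v unit_vec n j = B *\<^sub>v unit_vec n j"
  shows "A = B"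
proof (rule eq_matI)
  fix i j assume "i < dim_row B" "j < dim_col B"
  then have ij: "i < n" "j < n" using assms(2) by auto
  have "(A *\<^sub>v unit_vec n j) $ i = (B *\<^sub>v unit_vec n j) $ i" using assms(3)[OF ij(2)] by simp
  then show "A $$ (i, j) = B $$ (i, j)" using mat_mult_unit_vec[OF assms(1) ij] mat_mult_unit_vec[OF assms(2) ij] by simp
qed (use assms in auto)

text \<open>The columns are the images of the unit vectors. Left multiplication by a matrix commutes
  with right scalars, so agreement on unit vectors extends to all vectors by
  \<open>vec_right_generated\<close>.\<close>

lemma hom_matrix:
  assumes f: "bimodule_hom OB (emb_bimodule OB n \<phi>) (emb_bimodule OB n \<psi>) f"
  obtains A where "A \<in> mat_over OB n" "\<And>x. x \<in> carrier (emb_bimodule OB n \<phi>) \<Longrightarrow> f x = A *\<^sub>v x"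
proof -
  let ?E = "emb_bimodule OB n \<phi>" and ?F = "emb_bimodule OB n \<psi>"
  note h = bimodule_homD[OF f]
  define A where "A = mat n n (\<lambda>(i, j). f (unit_vec n j) $ i)"
  have fu: "f (unit_vec n j) \<in> carrier_vec n" "\<And>i. i < n \<Longrightarrow> f (unit_vec n j) $ i \<in> OB" if "j < n" for j
    using h(1)[OF unit_vec_carrier[OF that]] by (auto simp: emb_bimodule_simps)
  have Ac: "A \<in> carrier_mat n n" by (simp add: A_def)
  have A: "A \<in> mat_over OB n" using fu by (auto simp: mat_over_iff A_def)
  have car: "x \<in> carrier ?E \<longleftrightarrow> x \<in> carrier_vec n \<and> (\<forall>i<n. x $ i \<in> OB)" for x
    by (simp add: emb_bimodule_simps)
  have "x \<in> {x \<in> carrier ?E. f x = A *\<^sub>v x}" if x: "x \<in> carrier ?E" for x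
  proof (rule vec_right_generated)
    have z: "0\<^sub>v n \<in> carrier ?E" by (simp add: car)
    \<comment> \<open>The value at zero is derived from additivity, since the two sides are not
      known to be bimodules here.\<close>
    have "f (0\<^sub>v n) + f (0\<^sub>v n) = f (0\<^sub>v n)" using h(2)[OF z z] by (simp add: emb_bimodule_simps)
    moreover have fz: "f (0\<^sub>v n) \<in> carrier_vec n" using h(1)[OF z] by (simp add: emb_bimodule_simps)
    ultimately have "f (0\<^sub>v n) $ i + f (0\<^sub>v n) $ i = f (0\<^sub>v n) $ i" if "i < n" for i
      using that by (metis carrier_vecD index_add_vec(1))
    then have "f (0\<^sub>v n) = 0\<^sub>v n" using fz by (intro eq_vecI) auto
    moreover have "A *\<^sub>v 0\<^sub>v n = 0\<^sub>v n" using Ac by (intro eq_vecI) (auto simp: scalar_prod_def)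
    ultimately show "0\<^sub>v n \<in> {x \<in> carrier ?E. f x = A *\<^sub>v x}" using z by simp
    fix x y assume x: "x \<in> {x \<in> carrier ?E. f x = A *\<^sub>v x}"
    then have xc: "x \<in> carrier ?E" "x \<in> carrier_vec n" "f x = A *\<^sub>v x" by (auto simp: car)
    show "x + y \<in> {x \<in> carrier ?E. f x = A *\<^sub>v x}" if "y \<in> {x \<in> carrier ?E. f x = A *\<^sub>v x}"
    proof -
      have yc: "y \<in> carrier ?E" "y \<in> carrier_vec n" "f y = A *\<^sub>v y" using that by (auto simp: car)
      have "f (x + y) = A *\<^sub>v (x + y)"
        using h(2)[OF xc(1) yc(1)] xc(3) yc(3) mult_add_distrib_mat_vec[OF Ac xc(2) yc(2)]
        by (simp add: emb_bimodule_simps)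
      moreover have "x + y \<in> carrier ?E" using xc(1) yc(1) by (auto simp: car)
      ultimately show ?thesis by simp
    qed
    show "map_vec (\<lambda>y. y * a) x \<in> {x \<in> carrier ?E. f x = A *\<^sub>v x}" if a: "a \<in> OB" for a
    proof -
      have "f (map_vec (\<lambda>y. y * a) x) = A *\<^sub>v map_vec (\<lambda>y. y * a) x"
        using h(4)[OF a xc(1)] xc(3) mult_mat_vec_map_right[OF Ac xc(2)] by (simp add: emb_bimodule_simps)
      moreover have "map_vec (\<lambda>y. y * a) x \<in> carrier ?E" using xc(1) a by (auto simp: car)
      ultimately show ?thesis by simp
    qed
  next
    fix j assume j: "j < n"
    have "f (unit_vec n j) = A *\<^sub>v unit_vec n j"
    proof (rule eq_vecI)
      fix i assume "i < dim_vec (A *\<^sub>v unit_vec n j)"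
      then have i: "i < n" using Ac by simp
      then show "f (unit_vec n j) $ i = (A *\<^sub>v unit_vec n j) $ i"
        using mat_mult_unit_vec[OF Ac i j] j by (simp add: A_def)
    qed (use fu(1)[OF j] Ac in simp)
    then show "unit_vec n j \<in> {x \<in> carrier ?E. f x = A *\<^sub>v x}" using unit_vec_carrier[OF j] by simp
  qed (use x in \<open>simp_all add: car\<close>)
  then show thesis using A by (intro that) auto
qed

text \<open>From \<phi> = P \<psi> Q with Q inverse to P, the matrix Q intertwines the two left
  actions, and it has entries in \<open>OB\<close> together with its inverse.\<close>

lemma gl_conjugate_imp_iso:
  assumes "gl_conjugate OB n \<phi> \<psi>"
  shows "bimodule_iso OB (emb_bimodule OB n \<phi>) (emb_bimodule OB n \<psi>)"
proof -
  let ?E = "emb_bimodule OB n \<phi>" and ?F = "emb_bimodule OB n \<psi>"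
  obtain P Q where PQ: "P \<in> mat_over OB n" "Q \<in> mat_over OB n"
    "\<And>x. x \<in> OB \<Longrightarrow> \<phi> x \<in> carrier_mat n n \<and> similar_mat_wit (\<phi> x) (\<psi> x) P Q"
    using assms unfolding gl_conjugate_def by blast
  have w: "\<phi> x \<in> carrier_mat n n" "\<psi> x \<in> carrier_mat n n" "P * Q = 1\<^sub>m n" "Q * P = 1\<^sub>m n" "\<phi> x = P * \<psi> x * Q"
    if "x \<in> OB" for x
    using similar_mat_witD2[OF conjunct1[OF PQ(3)[OF that]] conjunct2[OF PQ(3)[OF that]]] by blast+
  have c: "P \<in> carrier_mat n n" "Q \<in> carrier_mat n n" using PQ by (simp_all add: mat_over_iff)
  have car: "x \<in> carrier ?E \<longleftrightarrow> x \<in> carrier_vec n \<and> (\<forall>i<n. x $ i \<in> OB)"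
    "x \<in> carrier ?F \<longleftrightarrow> x \<in> carrier_vec n \<and> (\<forall>i<n. x $ i \<in> OB)" for x
    by (simp_all add: emb_bimodule_simps)
  have mv: "A *\<^sub>v x \<in> carrier_vec n \<and> (\<forall>i<n. (A *\<^sub>v x) $ i \<in> OB)"
    if "A \<in> mat_over OB n" "x \<in> carrier_vec n" "\<forall>i<n. x $ i \<in> OB" for A x
    using that mat_over_mult_vec[OF that] mult_mat_vec_carrier[of A n n x] by (auto simp: mat_over_iff)
  have inv: "P *\<^sub>v (Q *\<^sub>v x) = x" "Q *\<^sub>v (P *\<^sub>v x) = x" if "x \<in> carrier_vec n" for x
    using assoc_mult_mat_vec[OF c(1) c(2) that] assoc_mult_mat_vec[OF c(2) c(1) that] w(3,4)[OF OB_closed(2)] that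
    by simp_all
  show ?thesis
  proof (rule bimodule_isoI)
    show "bimodule_hom OB ?E ?F (\<lambda>x. Q *\<^sub>v x)"
    proof (rule bimodule_homI)
      fix x y assume xy: "x \<in> carrier ?E" "y \<in> carrier ?E"
      show "Q *\<^sub>v x \<in> carrier ?F" using mv[OF PQ(2)] xy(1) unfolding car by blast
      show "Q *\<^sub>v (x \<oplus>\<^bsub>?E\<^esub> y) = Q *\<^sub>v x \<oplus>\<^bsub>?F\<^esub> Q *\<^sub>v y"
        using mult_add_distrib_mat_vec[OF c(2)] xy by (simp add: emb_bimodule_simps)
    next
      fix a x assume a: "a \<in> OB" and x: "x \<in> carrier ?E"
      have xc: "x \<in> carrier_vec n" using x by (simp add: car)
      have Qx: "Q *\<^sub>v x \<in> carrier_vec n" using c xc by simp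
      have "\<phi> a *\<^sub>v x = P *\<^sub>v (\<psi> a *\<^sub>v (Q *\<^sub>v x))"
        unfolding w(5)[OF a]
        using assoc_mult_mat_vec[OF mult_carrier_mat[OF c(1) w(2)[OF a]] c(2) xc]
          assoc_mult_mat_vec[OF c(1) w(2)[OF a] Qx] by simp
      then have "Q *\<^sub>v (\<phi> a *\<^sub>v x) = \<psi> a *\<^sub>v (Q *\<^sub>v x)"
        using inv(2)[of "\<psi> a *\<^sub>v (Q *\<^sub>v x)"] w(2)[OF a] Qx by simp
      then show "Q *\<^sub>v (a \<odot>\<^bsub>?E\<^esub> x) = a \<odot>\<^bsub>?F\<^esub> (Q *\<^sub>v x)" by (simp add: emb_bimodule_simps)
      show "Q *\<^sub>v (x \<triangleleft>\<^bsub>?E\<^esub> a) = (Q *\<^sub>v x) \<triangleleft>\<^bsub>?F\<^esub> a"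
        using mult_mat_vec_map_right[OF c(2) xc] by (simp add: emb_bimodule_simps)
    qed
    show "bij_betw (\<lambda>x. Q *\<^sub>v x) (carrier ?E) (carrier ?F)"
    proof (rule bij_betw_byWitness[where f' = "\<lambda>x. P *\<^sub>v x"])
      show "\<forall>x\<in>carrier ?E. P *\<^sub>v (Q *\<^sub>v x) = x" "\<forall>x\<in>carrier ?F. Q *\<^sub>v (P *\<^sub>v x) = x"
        using inv by (simp_all add: car)
      show "(*\<^sub>v) Q ` carrier ?E \<subseteq> carrier ?F" "(*\<^sub>v) P ` carrier ?F \<subseteq> carrier ?E"
        using mv[OF PQ(2)] mv[OF PQ(1)] by (auto simp only: car)
    qed
  qed
qed

text \<open>The matrices of an isomorphism and of its inverse are mutually inverse, and
  compatibility with the left actions is the conjugation equation, tested on unit vectors.\<close>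

lemma iso_imp_gl_conjugate:
  assumes emb: "algebra_embedding v \<iota> OB n \<phi>" and \<psi>: "\<And>a. a \<in> OB \<Longrightarrow> \<psi> a \<in> carrier_mat n n"
    and iso: "bimodule_iso OB (emb_bimodule OB n \<phi>) (emb_bimodule OB n \<psi>)"
  shows "gl_conjugate OB n \<phi> \<psi>"
proof -
  let ?E = "emb_bimodule OB n \<phi>" and ?F = "emb_bimodule OB n \<psi>"
  note E = emb_bimodule[OF emb]
  obtain f where f: "bimodule_hom OB ?E ?F f" "bij_betw f (carrier ?E) (carrier ?F)"
    using iso by (rule bimodule_isoE)
  let ?g = "the_inv_into (carrier ?E) f"
  have g: "bimodule_hom OB ?F ?E ?g" using E f by (rule bimodule_hom_inverse)
  obtain Q where Q: "Q \<in> mat_over OB n" "\<And>x. x \<in> carrier ?E \<Longrightarrow> f x = Q *\<^sub>v x" using f(1) by (rule hom_matrix) (rule that)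
  obtain P where P: "P \<in> mat_over OB n" "\<And>x. x \<in> carrier ?F \<Longrightarrow> ?g x = P *\<^sub>v x" using g by (rule hom_matrix) (rule that)
  have c: "P \<in> carrier_mat n n" "Q \<in> carrier_mat n n" using P Q by (simp_all add: mat_over_iff)
  have inj: "inj_on f (carrier ?E)" and img: "f ` carrier ?E = carrier ?F" using f(2) by (auto simp: bij_betw_def)
  have u: "unit_vec n j \<in> carrier ?E" "unit_vec n j \<in> carrier ?F" "unit_vec n j \<in> carrier_vec n" if "j < n" for j
    using unit_vec_carrier that by simp_all
  have PQ: "P * Q = 1\<^sub>m n"
  proof (rule mat_eq_by_vec)
    fix j assume j: "j < n"
    have "P *\<^sub>v (Q *\<^sub>v unit_vec n j) = ?g (f (unit_vec n j))"
      using Q(2)[OF u(1)[OF j]] P(2)[OF bimodule_homD(1)[OF f(1) u(1)[OF j]]] by simp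
    also have "\<dots> = unit_vec n j" using inj u(1)[OF j] by (rule the_inv_into_f_f)
    finally show "P * Q *\<^sub>v unit_vec n j = 1\<^sub>m n *\<^sub>v unit_vec n j"
      using assoc_mult_mat_vec[OF c(1) c(2) u(3)[OF j]] by simp
  qed (use c in simp_all)
  have QP: "Q * P = 1\<^sub>m n"
  proof (rule mat_eq_by_vec)
    fix j assume j: "j < n"
    have "Q *\<^sub>v (P *\<^sub>v unit_vec n j) = f (?g (unit_vec n j))"
      using P(2)[OF u(2)[OF j]] Q(2)[OF bimodule_homD(1)[OF g u(2)[OF j]]] by simp
    also have "\<dots> = unit_vec n j" using inj u(2)[OF j] img by (intro f_the_inv_into_f) simp_all
    finally show "Q * P *\<^sub>v unit_vec n j = 1\<^sub>m n *\<^sub>v unit_vec n j"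
      using assoc_mult_mat_vec[OF c(2) c(1) u(3)[OF j]] by simp
  qed (use c in simp_all)
  have "\<phi> a = P * \<psi> a * Q" if a: "a \<in> OB" for a
  proof (rule mat_eq_by_vec)
    have \<phi>: "\<phi> a \<in> carrier_mat n n" using algebra_embeddingD(2)[OF emb a] .
    show "\<phi> a \<in> carrier_mat n n" by (rule \<phi>)
    show "P * \<psi> a * Q \<in> carrier_mat n n" using c \<psi>[OF a] by simp
    fix j assume j: "j < n"
    let ?u = "unit_vec n j"
    have au: "\<phi> a *\<^sub>v ?u \<in> carrier ?E" using emb_smult_closed[OF emb a u(1)[OF j]] .
    have "f (a \<odot>\<^bsub>?E\<^esub> ?u) = a \<odot>\<^bsub>?F\<^esub> f ?u" using bimodule_homD(3)[OF f(1) a u(1)[OF j]] .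
    then have e: "Q *\<^sub>v (\<phi> a *\<^sub>v ?u) = \<psi> a *\<^sub>v (Q *\<^sub>v ?u)"
      using Q(2)[OF au] Q(2)[OF u(1)[OF j]] by (simp add: emb_bimodule_simps)
    have v: "\<phi> a *\<^sub>v ?u \<in> carrier_vec n" "Q *\<^sub>v ?u \<in> carrier_vec n" using \<phi> c u(3)[OF j] by simp_all
    have "\<phi> a *\<^sub>v ?u = P *\<^sub>v (Q *\<^sub>v (\<phi> a *\<^sub>v ?u))"
      using assoc_mult_mat_vec[OF c v(1)] PQ v(1) by simp
    also have "\<dots> = (P * \<psi> a) *\<^sub>v (Q *\<^sub>v ?u)" unfolding e using assoc_mult_mat_vec[OF c(1) \<psi>[OF a] v(2)] by simp
    also have "\<dots> = (P * \<psi> a * Q) *\<^sub>v ?u"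
      using assoc_mult_mat_vec[OF mult_carrier_mat[OF c(1) \<psi>[OF a]] c(2) u(3)[OF j]] by simp
    finally show "\<phi> a *\<^sub>v ?u = P * \<psi> a * Q *\<^sub>v ?u" .
  qed
  then show ?thesis
    unfolding gl_conjugate_def
    using P(1) Q(1) PQ QP c \<psi> algebra_embeddingD(2)[OF emb]
    by (intro bexI[of _ P] bexI[of _ Q]) (auto simp: similar_mat_wit_def Let_def)
qed

section \<open>Block diagonal sums of embeddings\<close>

lemma emb_sum_Cons: "emb_sum (\<psi> # \<psi>s) a = four_block_mat (\<psi> a) (0\<^sub>m (dim_row (\<psi> a)) (dim_col (emb_sum \<psi>s a)))
    (0\<^sub>m (dim_row (emb_sum \<psi>s a)) (dim_col (\<psi> a))) (emb_sum \<psi>s a)"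
  by (simp add: emb_sum_def Let_def)

lemma emb_sum_iso_Cons:
  assumes \<psi>: "\<And>a. a \<in> OB \<Longrightarrow> \<psi> a \<in> carrier_mat n n" and \<psi>s: "\<And>a. a \<in> OB \<Longrightarrow> emb_sum \<psi>s a \<in> carrier_mat k k"
  shows "bimodule_iso OB (emb_bimodule OB n \<psi> \<oplus>\<^sub>b emb_bimodule OB k (emb_sum \<psi>s))
    (emb_bimodule OB (n + k) (emb_sum (\<psi> # \<psi>s)))"
proof (rule bimodule_isoI)
  let ?E = "emb_bimodule OB n \<psi>" and ?F = "emb_bimodule OB k (emb_sum \<psi>s)"
    and ?G = "emb_bimodule OB (n + k) (emb_sum (\<psi> # \<psi>s))"
  let ?f = "\<lambda>(x, y). x @\<^sub>v y"
  show "bimodule_hom OB (?E \<oplus>\<^sub>b ?F) ?G ?f"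
  proof (rule bimodule_homI)
    fix z w assume "z \<in> carrier (?E \<oplus>\<^sub>b ?F)" "w \<in> carrier (?E \<oplus>\<^sub>b ?F)"
    then show "?f z \<in> carrier ?G" "?f (z \<oplus>\<^bsub>?E \<oplus>\<^sub>b ?F\<^esub> w) = ?f z \<oplus>\<^bsub>?G\<^esub> ?f w"
      by (auto simp: emb_bimodule_simps append_vec_add split: prod.splits)
  next
    fix a z assume a: "a \<in> OB" and "z \<in> carrier (?E \<oplus>\<^sub>b ?F)"
    then obtain x y where z: "z = (x, y)" "x \<in> carrier_vec n" "y \<in> carrier_vec k"
      by (auto simp: emb_bimodule_simps)
    have d: "dim_row (\<psi> a) = n" "dim_col (\<psi> a) = n" "dim_row (emb_sum \<psi>s a) = k" "dim_col (emb_sum \<psi>s a) = k"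
      using \<psi>[OF a] \<psi>s[OF a] by auto
    have "emb_sum (\<psi> # \<psi>s) a *\<^sub>v (x @\<^sub>v y) = (\<psi> a *\<^sub>v x + 0\<^sub>m n k *\<^sub>v y) @\<^sub>v (0\<^sub>m k n *\<^sub>v x + emb_sum \<psi>s a *\<^sub>v y)"
      unfolding emb_sum_Cons d by (rule four_block_mat_mult_vec) (use \<psi>[OF a] \<psi>s[OF a] z in auto)
    also have "0\<^sub>m n k *\<^sub>v y = 0\<^sub>v n" using z by (intro eq_vecI) (auto simp: scalar_prod_def)
    also have "0\<^sub>m k n *\<^sub>v x = 0\<^sub>v k" using z by (intro eq_vecI) (auto simp: scalar_prod_def)
    finally show "?f (a \<odot>\<^bsub>?E \<oplus>\<^sub>b ?F\<^esub> z) = a \<odot>\<^bsub>?G\<^esub> ?f z"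
      using z \<psi>[OF a] \<psi>s[OF a] by (simp add: emb_bimodule_simps)
    show "?f (z \<triangleleft>\<^bsub>?E \<oplus>\<^sub>b ?F\<^esub> a) = ?f z \<triangleleft>\<^bsub>?G\<^esub> a"
      using z by (intro eq_vecI) (auto simp: emb_bimodule_simps)
  qed
  show "bij_betw ?f (carrier (?E \<oplus>\<^sub>b ?F)) (carrier ?G)"
  proof (rule bij_betw_byWitness[where f' = "\<lambda>z. (vec_first z n, vec_last z k)"])
    show "\<forall>z\<in>carrier (?E \<oplus>\<^sub>b ?F). (vec_first (?f z) n, vec_last (?f z) k) = z"
    proof
      fix z assume "z \<in> carrier (?E \<oplus>\<^sub>b ?F)"
      then obtain x y where z: "z = (x, y)" "x \<in> carrier_vec n" "y \<in> carrier_vec k"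
        by (auto simp: emb_bimodule_simps)
      have "vec_first (x @\<^sub>v y) n = x" using z by (intro eq_vecI) (auto simp: vec_first_def)
      moreover have "vec_last (x @\<^sub>v y) k = y" using z by (intro eq_vecI) (auto simp: vec_last_def)
      ultimately show "(vec_first (?f z) n, vec_last (?f z) k) = z" using z by simp
    qed
    show "\<forall>z\<in>carrier ?G. ?f (vec_first z n, vec_last z k) = z"
      by (simp add: emb_bimodule_simps)
    show "?f ` carrier (?E \<oplus>\<^sub>b ?F) \<subseteq> carrier ?G"
      by (auto simp: emb_bimodule_simps)
    show "(\<lambda>z. (vec_first z n, vec_last z k)) ` carrier ?G \<subseteq> carrier (?E \<oplus>\<^sub>b ?F)"
      by (auto simp: emb_bimodule_simps vec_first_def vec_last_def)
  qed
qed

lemma emb_sum_carrier_Cons: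
  "\<psi> a \<in> carrier_mat n n \<Longrightarrow> emb_sum \<psi>s a \<in> carrier_mat k k \<Longrightarrow> emb_sum (\<psi> # \<psi>s) a \<in> carrier_mat (n + k) (n + k)"
  unfolding emb_sum_Cons by (rule four_block_carrier_mat)

text \<open>The tail \<open>\<psi>s\<close>, with the bimodule \<open>M\<close> it represents, is
  carried along so that the four blocks can be prepended one after the other, starting from the
  last.\<close>

lemma emb_sum_replicate:
  assumes \<psi>: "\<And>a. a \<in> OB \<Longrightarrow> \<psi> a \<in> carrier_mat n n" and \<psi>s: "\<And>a. a \<in> OB \<Longrightarrow> emb_sum \<psi>s a \<in> carrier_mat k k"
    and iso: "bimodule_iso OB M (emb_bimodule OB k (emb_sum \<psi>s))"
  shows "a \<in> OB \<Longrightarrow> emb_sum (replicate r \<psi> @ \<psi>s) a \<in> carrier_mat (r * n + k) (r * n + k)"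
    "bimodule_iso OB (emb_bimodule OB n \<psi> ^\<^sub>b r \<oplus>\<^sub>b M) (emb_bimodule OB (r * n + k) (emb_sum (replicate r \<psi> @ \<psi>s)))"
proof -
  have "(\<forall>a\<in>OB. emb_sum (replicate r \<psi> @ \<psi>s) a \<in> carrier_mat (r * n + k) (r * n + k)) \<and>
    bimodule_iso OB (emb_bimodule OB n \<psi> ^\<^sub>b r \<oplus>\<^sub>b M) (emb_bimodule OB (r * n + k) (emb_sum (replicate r \<psi> @ \<psi>s)))"
  proof (induction r)
    case 0
    show ?case using \<psi>s bimodule_iso_trans[OF bimodule_power_0_sum iso] by simp
  next
    case (Suc r)
    let ?A = "emb_bimodule OB n \<psi>"
    have c: "\<And>a. a \<in> OB \<Longrightarrow> emb_sum (replicate r \<psi> @ \<psi>s) a \<in> carrier_mat (r * n + k) (r * n + k)" using Suc by blast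
    have "bimodule_iso OB (?A ^\<^sub>b Suc r \<oplus>\<^sub>b M) ((?A \<oplus>\<^sub>b ?A ^\<^sub>b r) \<oplus>\<^sub>b M)"
      by (intro bimodule_iso_sum bimodule_power_Suc bimodule_iso_refl)
    then have "bimodule_iso OB (?A ^\<^sub>b Suc r \<oplus>\<^sub>b M) (?A \<oplus>\<^sub>b ?A ^\<^sub>b r \<oplus>\<^sub>b M)"
      by (rule bimodule_iso_trans) (rule bimodule_sum_assoc)
    then have "bimodule_iso OB (?A ^\<^sub>b Suc r \<oplus>\<^sub>b M) (?A \<oplus>\<^sub>b emb_bimodule OB (r * n + k) (emb_sum (replicate r \<psi> @ \<psi>s)))"
      by (rule bimodule_iso_trans) (use Suc in \<open>intro bimodule_iso_sum bimodule_iso_refl, blast\<close>)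
    then have "bimodule_iso OB (?A ^\<^sub>b Suc r \<oplus>\<^sub>b M) (emb_bimodule OB (n + (r * n + k)) (emb_sum (\<psi> # replicate r \<psi> @ \<psi>s)))"
      by (rule bimodule_iso_trans) (rule emb_sum_iso_Cons[OF \<psi> c])
    then show ?case using emb_sum_carrier_Cons[OF \<psi> c] by (simp add: add.assoc)
  qed
  then show "a \<in> OB \<Longrightarrow> emb_sum (replicate r \<psi> @ \<psi>s) a \<in> carrier_mat (r * n + k) (r * n + k)"
    "bimodule_iso OB (emb_bimodule OB n \<psi> ^\<^sub>b r \<oplus>\<^sub>b M) (emb_bimodule OB (r * n + k) (emb_sum (replicate r \<psi> @ \<psi>s)))"
    by blast+
qed

text \<open>Start of the chain of \<open>emb_sum_replicate\<close>, which always prepends to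
  something, whereas a standard sum ends with its fourth summand. Vectors of length 0 form the zero
  module.\<close>

lemma emb_sum_Nil_iso: "bimodule_iso OB M (M \<oplus>\<^sub>b emb_bimodule OB 0 (emb_sum []))"
proof (rule bimodule_isoI)
  have vec0: "x = y" if "dim_vec x = 0" "dim_vec y = 0" for x y :: "'b vec" using that by (intro eq_vecI) auto
  have d: "dim_row (emb_sum [] a) = 0" for a :: 'b by (simp add: emb_sum_def)
  show "bimodule_hom OB M (M \<oplus>\<^sub>b emb_bimodule OB 0 (emb_sum [])) (\<lambda>x. (x, 0\<^sub>v 0))"
    by (rule bimodule_homI) (auto simp: emb_bimodule_simps d intro!: vec0)
  show "bij_betw (\<lambda>x. (x, 0\<^sub>v 0)) (carrier M) (carrier (M \<oplus>\<^sub>b emb_bimodule OB 0 (emb_sum [])))"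
    by (rule bij_betw_byWitness[where f' = fst]) (auto simp: emb_bimodule_simps intro!: vec0)
qed

definition std_emb :: "mult4 \<Rightarrow> 'b \<Rightarrow> 'b mat" where
  "std_emb = (\<lambda>(r1, r2, t1, t2). emb_sum (replicate r1 emb_id @ replicate r2 (emb_tau \<pi>\<^sub>B) @
    replicate t1 (emb_phi1 v \<iota> K \<sigma> \<pi> \<pi>\<^sub>B) @ replicate t2 (emb_phi2 v \<iota> K \<sigma> \<pi> \<pi>\<^sub>B)))"

fun std_dim :: "mult4 \<Rightarrow> nat" where "std_dim (r1, r2, t1, t2) = r1 + r2 + 2 * t1 + 2 * t2"

lemma std_emb_iso:
  "a \<in> OB \<Longrightarrow> std_emb m a \<in> carrier_mat (std_dim m) (std_dim m)"
  "bimodule_iso OB (std m) (emb_bimodule OB (std_dim m) (std_emb m))"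
proof -
  obtain r1 r2 t1 t2 where m: "m = (r1, r2, t1, t2)" by (cases m)
  note c1 = algebra_embeddingD(2)[OF emb1_embedding] and c2 = algebra_embeddingD(2)[OF emb2_embedding]
  have c0: "emb_sum [] a \<in> carrier_mat 0 0" for a :: 'b by (simp add: emb_sum_def)
  note p4 = emb_sum_replicate[where \<psi> = "emb2 True" and r = t2, OF c2 c0 bimodule_iso_refl]
  note iso4 = bimodule_iso_trans[OF emb_sum_Nil_iso p4(2)]
  note p3 = emb_sum_replicate[where \<psi> = "emb2 False" and r = t1, OF c2 p4(1) iso4]
  note p2 = emb_sum_replicate[where \<psi> = "emb1 True" and r = r2, OF c1 p3]
  note p1 = emb_sum_replicate[where \<psi> = "emb1 False" and r = r1, OF c1 p2]
  have dim: "r1 * 1 + (r2 * 1 + (t1 * 2 + (t2 * 2 + 0))) = std_dim m" by (simp add: m)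
  show "std_emb m a \<in> carrier_mat (std_dim m) (std_dim m)" if "a \<in> OB"
    using p1(1) that unfolding dim by (simp add: std_emb_def m)
  show "bimodule_iso OB (std m) (emb_bimodule OB (std_dim m) (std_emb m))"
    using p1(2) unfolding dim by (simp add: std_emb_def std_def std_sum_def basic1_def basic2_def m)
qed

lemma std_card: "card (cls (std m) ` carrier (std m)) = q ^ std_dim m"
proof -
  have b: "card (cls (basic1 d) ` carrier (basic1 d)) = q" "card (cls (basic2 d) ` carrier (basic2 d)) = q ^ 2" for d
    unfolding basic1_def basic2_def by (simp_all only: emb_card[OF emb1_embedding] emb_card[OF emb2_embedding] power_one_right)
  obtain r1 r2 t1 t2 where m: "m = (r1, r2, t1, t2)" by (cases m)
  show ?thesis unfolding m std_def std_sum_def prod.case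
    by (simp only: sum_cards(3) power_cards(3) bimodule_sum bimodule_power bimodule_basic b)
      (simp add: power_add power_mult mult.assoc)
qed

text \<open>The multiplicities m are not tied to n in advance, so each direction recovers
  \<open>std_dim m = n\<close>: conjugacy from the matrix sizes at 1, isomorphism from the numbers
  of classes modulo the radical.\<close>

lemma gl_conjugate_iff_iso:
  assumes emb: "algebra_embedding v \<iota> OB n \<phi>"
  shows "gl_conjugate OB n \<phi> (std_emb m) \<longleftrightarrow> bimodule_iso OB (emb_bimodule OB n \<phi>) (std m)"
proof
  note E = emb_bimodule[OF emb]
  {
    assume conj: "gl_conjugate OB n \<phi> (std_emb m)"
    then obtain P Q where "similar_mat_wit (\<phi> 1) (std_emb m 1) P Q" "\<phi> 1 \<in> carrier_mat n n"
      unfolding gl_conjugate_def using OB_closed(2) by blast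
    then have "std_emb m 1 \<in> carrier_mat n n" using similar_mat_witD2(5) by blast
    then have n: "std_dim m = n" using std_emb_iso(1)[OF OB_closed(2), of m] by auto
    have "bimodule_iso OB (emb_bimodule OB n (std_emb m)) (emb_bimodule OB n \<phi>)"
      by (rule bimodule_iso_sym[OF E gl_conjugate_imp_iso[OF conj]])
    with std_emb_iso(2)[of m] have "bimodule_iso OB (std m) (emb_bimodule OB n \<phi>)"
      unfolding n by (rule bimodule_iso_trans)
    then show "bimodule_iso OB (emb_bimodule OB n \<phi>) (std m)" by (rule bimodule_iso_sym[OF bimodule_std])
  next
    assume iso: "bimodule_iso OB (emb_bimodule OB n \<phi>) (std m)"
    have "q ^ n = q ^ std_dim m"
      using iso_cards(3)[OF E bimodule_std iso] emb_card[OF emb] std_card by simp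
    then have n: "std_dim m = n" using q_gt_1 by (simp add: power_inject_exp)
    have "bimodule_iso OB (emb_bimodule OB n \<phi>) (emb_bimodule OB n (std_emb m))"
      using bimodule_iso_trans[OF iso std_emb_iso(2)] n by simp
    then show "gl_conjugate OB n \<phi> (std_emb m)"
      using std_emb_iso(1)[of _ m] n by (intro iso_imp_gl_conjugate[OF emb]) simp_all
  }
qed

end

section \<open>\<open>OB\<close> and its maximal ideal as natural bimodules\<close>

lemma natural_bimodule_simps:
  "carrier (natural_bimodule I) = I" "x \<oplus>\<^bsub>natural_bimodule I\<^esub> y = x + y"
  "a \<odot>\<^bsub>natural_bimodule I\<^esub> x = a * x" "x \<triangleleft>\<^bsub>natural_bimodule I\<^esub> a = x * a"
  by (simp_all add: natural_bimodule_def)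

context quaternion_setting
begin

lemma standard_lattices:
  "lattice_O OB = basic1 False" "lattice_P OB \<pi>\<^sub>B = basic1 True"
  "lattice_L1 v \<iota> OB K \<sigma> \<pi> \<pi>\<^sub>B = basic2 False" "lattice_L2 v \<iota> OB K \<sigma> \<pi> \<pi>\<^sub>B = basic2 True"
  by (simp_all add: lattice_O_def lattice_P_def lattice_L1_def lattice_L2_def basic1_def basic2_def)

lemma standard_sum:
  "lattice_O OB ^\<^sub>b r1 \<oplus>\<^sub>b lattice_P OB \<pi>\<^sub>B ^\<^sub>b r2 \<oplus>\<^sub>b lattice_L1 v \<iota> OB K \<sigma> \<pi> \<pi>\<^sub>B ^\<^sub>b t1 \<oplus>\<^sub>b lattice_L2 v \<iota> OB K \<sigma> \<pi> \<pi>\<^sub>B ^\<^sub>b t2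
    = std (r1, r2, t1, t2)"
  by (simp add: standard_lattices std_def std_sum_def)

lemma lattice_O_natural: "bimodule_iso OB (lattice_O OB) (natural_bimodule OB)"
  unfolding standard_lattices
proof (rule bimodule_isoI)
  show "bimodule_hom OB (basic1 False) (natural_bimodule OB) (\<lambda>x. x $ 0)"
  proof (rule bimodule_homI)
    fix a x assume a: "a \<in> OB" and x: "x \<in> carrier (basic1 False)"
    obtain b c where bc: "b \<in> OK" "c \<in> OK" "a = b + c * \<pi>\<^sub>B" using a by (rule OB_E)
    show "(a \<odot>\<^bsub>basic1 False\<^esub> x) $ 0 = a \<odot>\<^bsub>natural_bimodule OB\<^esub> (x $ 0)"
      unfolding bc(3) basic1_left[OF bc(1,2) x] by (simp add: tw_def natural_bimodule_simps)
  qed (simp_all add: natural_bimodule_simps basic_add basic_right, simp add: basic1_carrier)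
  show "bij_betw (\<lambda>x. x $ 0) (carrier (basic1 False)) (carrier (natural_bimodule OB))"
    by (rule bij_betw_byWitness[where f' = "\<lambda>y. vec 1 (\<lambda>_. y)"])
      (auto simp: natural_bimodule_simps basic1_carrier intro!: eq_vecI)
qed

text \<open>Left multiplication by \<open>\<pi>\<^sub>B\<close> undoes the twist:
  \<open>\<pi>\<^sub>B\<close> \<tau>(a) = a \<open>\<pi>\<^sub>B\<close>.\<close>

lemma lattice_P_natural: "bimodule_iso OB (lattice_P OB \<pi>\<^sub>B) (natural_bimodule ((\<lambda>x. \<pi>\<^sub>B * x) ` OB))"
  unfolding standard_lattices
proof (rule bimodule_isoI)
  let ?N = "natural_bimodule ((\<lambda>x. \<pi>\<^sub>B * x) ` OB)"
  show "bimodule_hom OB (basic1 True) ?N (\<lambda>x. \<pi>\<^sub>B * x $ 0)"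
  proof (rule bimodule_homI)
    fix a x assume a: "a \<in> OB" and x: "x \<in> carrier (basic1 True)"
    obtain b c where bc: "b \<in> OK" "c \<in> OK" "a = b + c * \<pi>\<^sub>B" using a by (rule OB_E)
    have "\<pi>\<^sub>B * (\<sigma> b + \<sigma> c * \<pi>\<^sub>B) = a * \<pi>\<^sub>B"
      using bc varpi_conj'[of b] varpi_conj'[of c] by (simp add: distrib_left distrib_right flip: mult.assoc)
    then show "\<pi>\<^sub>B * (a \<odot>\<^bsub>basic1 True\<^esub> x) $ 0 = a \<odot>\<^bsub>?N\<^esub> (\<pi>\<^sub>B * x $ 0)"
      unfolding natural_bimodule_simps using basic1_left[OF bc(1,2) x] bc(3)
      by (simp add: tw_def flip: mult.assoc)
  qed (simp_all add: natural_bimodule_simps basic_add basic_right distrib_left mult.assoc, simp add: basic1_carrier)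
  show "bij_betw (\<lambda>x. \<pi>\<^sub>B * x $ 0) (carrier (basic1 True)) (carrier ?N)"
    by (rule bij_betw_byWitness[where f' = "\<lambda>y. vec 1 (\<lambda>_. inverse \<pi>\<^sub>B * y)"])
      (auto simp: natural_bimodule_simps basic1_carrier mult.assoc[symmetric] intro!: eq_vecI)
qed

section \<open>Completeness and uniqueness for the four standard lattices\<close>

lemma bilattice_basic: "bilattice v \<iota> OB (basic1 d)" "bilattice v \<iota> OB (basic2 d)"
  unfolding basic1_def basic2_def by (intro emb_bilattice emb1_embedding emb2_embedding)+

lemma basic_iso_std:
  "bimodule_iso OB (lattice_O OB) (std (1, 0, 0, 0))"
  "bimodule_iso OB (lattice_P OB \<pi>\<^sub>B) (std (0, 1, 0, 0))"
  "bimodule_iso OB (lattice_L1 v \<iota> OB K \<sigma> \<pi> \<pi>\<^sub>B) (std (0, 0, 1, 0))"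
  "bimodule_iso OB (lattice_L2 v \<iota> OB K \<sigma> \<pi> \<pi>\<^sub>B) (std (0, 0, 0, 1))"
  unfolding standard_lattices std_def by (rule std_sum_unit)+

lemma standard_bilattices:
  "bilattice v \<iota> OB (lattice_O OB)" "bilattice v \<iota> OB (lattice_P OB \<pi>\<^sub>B)"
  "bilattice v \<iota> OB (lattice_L1 v \<iota> OB K \<sigma> \<pi> \<pi>\<^sub>B)" "bilattice v \<iota> OB (lattice_L2 v \<iota> OB K \<sigma> \<pi> \<pi>\<^sub>B)"
  unfolding standard_lattices by (rule bilattice_basic)+

lemma standard_indecomposable:
  "indecomposable OB (lattice_O OB)" "indecomposable OB (lattice_P OB \<pi>\<^sub>B)"
  "indecomposable OB (lattice_L1 v \<iota> OB K \<sigma> \<pi> \<pi>\<^sub>B)" "indecomposable OB (lattice_L2 v \<iota> OB K \<sigma> \<pi> \<pi>\<^sub>B)"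
  by (rule bilattice_indecomposable[OF standard_bilattices(1) basic_iso_std(1)], simp)
    (rule bilattice_indecomposable[OF standard_bilattices(2) basic_iso_std(2)], simp,
     rule bilattice_indecomposable[OF standard_bilattices(3) basic_iso_std(3)], simp,
     rule bilattice_indecomposable[OF standard_bilattices(4) basic_iso_std(4)], simp)

lemma not_iso_standard:
  assumes "bilattice v \<iota> OB M" "bimodule_iso OB M (std m)" "bimodule_iso OB N (std m')" "m \<noteq> m'"
  shows "\<not> bimodule_iso OB M N"
  using iso_std_unique[OF bilattice_bimodule[OF assms(1)] assms(2) bimodule_iso_trans[OF _ assms(3)]] assms(4)
  by blast

lemma standard_pairwise_not_iso:
  "sorted_wrt (\<lambda>M N. \<not> bimodule_iso OB M N)
    [lattice_O OB, lattice_P OB \<pi>\<^sub>B, lattice_L1 v \<iota> OB K \<sigma> \<pi> \<pi>\<^sub>B, lattice_L2 v \<iota> OB K \<sigma> \<pi> \<pi>\<^sub>B]"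
  by (simp add: not_iso_standard[OF standard_bilattices(1) basic_iso_std(1) basic_iso_std(2)]
    not_iso_standard[OF standard_bilattices(1) basic_iso_std(1) basic_iso_std(3)]
    not_iso_standard[OF standard_bilattices(1) basic_iso_std(1) basic_iso_std(4)]
    not_iso_standard[OF standard_bilattices(2) basic_iso_std(2) basic_iso_std(3)]
    not_iso_standard[OF standard_bilattices(2) basic_iso_std(2) basic_iso_std(4)]
    not_iso_standard[OF standard_bilattices(3) basic_iso_std(3) basic_iso_std(4)])

lemma indecomposable_standard:
  assumes L: "bilattice v \<iota> OB L" and ind: "indecomposable OB L"
  shows "\<exists>M \<in> {lattice_O OB, lattice_P OB \<pi>\<^sub>B, lattice_L1 v \<iota> OB K \<sigma> \<pi> \<pi>\<^sub>B, lattice_L2 v \<iota> OB K \<sigma> \<pi> \<pi>\<^sub>B}.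
    bimodule_iso OB L M"
proof -
  obtain m where m: "bimodule_iso OB L (std m)" using L by (rule exists_iso_std)
  have size: "mult4_size m = 1" by (rule indecomposable_size[OF L ind m])
  have iso: "bimodule_iso OB L M" if "bilattice v \<iota> OB M" "bimodule_iso OB M (std m)" for M :: "('b, 'b vec) bimodule"
    by (rule bimodule_iso_trans[OF m bimodule_iso_sym[OF bilattice_bimodule[OF that(1)] that(2)]])
  obtain r1 r2 t1 t2 where eq: "m = (r1, r2, t1, t2)" by (cases m)
  have "m = (1, 0, 0, 0) \<or> m = (0, 1, 0, 0) \<or> m = (0, 0, 1, 0) \<or> m = (0, 0, 0, 1)"
    using size eq by auto
  then show ?thesis using iso standard_bilattices basic_iso_std by blast
qed

lemma unique_decomposition:
  assumes L: "bilattice v \<iota> OB L"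
  shows "\<exists>!m. bimodule_iso OB L (std m)"
proof (rule ex_ex1I)
  show "\<exists>m. bimodule_iso OB L (std m)" using exists_iso_std[OF L] by blast
  show "m = m'" if "bimodule_iso OB L (std m)" "bimodule_iso OB L (std m')" for m m'
    by (rule iso_std_unique[OF bilattice_bimodule[OF L] that])
qed

end

theorem theorem2p0p2:
  fixes v :: "'f::field \<Rightarrow> int" and \<iota> :: "'f \<Rightarrow> 'b::division_ring"
    and OB K :: "'b set" and \<sigma> :: "'b \<Rightarrow> 'b" and \<pi> :: 'f and \<pi>\<^sub>B :: 'b
  assumes "quaternion_setting v \<iota> OB K \<sigma> \<pi> \<pi>\<^sub>B"
  shows
    "(\<forall>n \<phi>. algebra_embedding v \<iota> OB n \<phi> \<longrightarrow>
        (\<exists>!q. case q of (r1, r2, t1, t2) \<Rightarrow>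
          gl_conjugate OB n \<phi> (emb_sum
            (replicate r1 emb_id @ replicate r2 (emb_tau \<pi>\<^sub>B) @
             replicate t1 (emb_phi1 v \<iota> K \<sigma> \<pi> \<pi>\<^sub>B) @ replicate t2 (emb_phi2 v \<iota> K \<sigma> \<pi> \<pi>\<^sub>B)))))
     \<and> (\<forall>M \<in> {lattice_O OB, lattice_P OB \<pi>\<^sub>B,
              lattice_L1 v \<iota> OB K \<sigma> \<pi> \<pi>\<^sub>B, lattice_L2 v \<iota> OB K \<sigma> \<pi> \<pi>\<^sub>B}.
          bilattice v \<iota> OB M \<and> indecomposable OB M)
     \<and> sorted_wrt (\<lambda>M N. \<not> bimodule_iso OB M N)
         [lattice_O OB, lattice_P OB \<pi>\<^sub>B,
          lattice_L1 v \<iota> OB K \<sigma> \<pi> \<pi>\<^sub>B, lattice_L2 v \<iota> OB K \<sigma> \<pi> \<pi>\<^sub>B]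
     \<and> (\<forall>L :: ('b, 'm) bimodule. bilattice v \<iota> OB L \<and> indecomposable OB L \<longrightarrow>
          (\<exists>M \<in> {lattice_O OB, lattice_P OB \<pi>\<^sub>B,
                 lattice_L1 v \<iota> OB K \<sigma> \<pi> \<pi>\<^sub>B, lattice_L2 v \<iota> OB K \<sigma> \<pi> \<pi>\<^sub>B}. bimodule_iso OB L M))
     \<and> (\<forall>L :: ('b, 'm) bimodule. bilattice v \<iota> OB L \<longrightarrow>
          (\<exists>!q. case q of (r1, r2, t1, t2) \<Rightarrow>
            bimodule_iso OB L
              (lattice_O OB ^\<^sub>b r1 \<oplus>\<^sub>b lattice_P OB \<pi>\<^sub>B ^\<^sub>b r2 \<oplus>\<^sub>b
               lattice_L1 v \<iota> OB K \<sigma> \<pi> \<pi>\<^sub>B ^\<^sub>b t1 \<oplus>\<^sub>b lattice_L2 v \<iota> OB K \<sigma> \<pi> \<pi>\<^sub>B ^\<^sub>b t2)))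
     \<and> (\<forall>r1 r2 t1 t2.
          bimodule_iso OB
            (lattice_O OB ^\<^sub>b r1 \<oplus>\<^sub>b lattice_P OB \<pi>\<^sub>B ^\<^sub>b r2 \<oplus>\<^sub>b
             lattice_L1 v \<iota> OB K \<sigma> \<pi> \<pi>\<^sub>B ^\<^sub>b t1 \<oplus>\<^sub>b lattice_L2 v \<iota> OB K \<sigma> \<pi> \<pi>\<^sub>B ^\<^sub>b t2)
            (natural_bimodule OB ^\<^sub>b r1 \<oplus>\<^sub>b natural_bimodule ((\<lambda>x. \<pi>\<^sub>B * x) ` OB) ^\<^sub>b r2 \<oplus>\<^sub>b
             lattice_L1 v \<iota> OB K \<sigma> \<pi> \<pi>\<^sub>B ^\<^sub>b t1 \<oplus>\<^sub>b lattice_L2 v \<iota> OB K \<sigma> \<pi> \<pi>\<^sub>B ^\<^sub>b t2))"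
proof -
  interpret quaternion_setting v \<iota> OB K \<sigma> \<pi> \<pi>\<^sub>B by (rule assms)
  show ?thesis
  proof (intro conjI allI impI ballI)
    fix n \<phi> assume emb: "algebra_embedding v \<iota> OB n \<phi>"
    \<comment> \<open>For each m conjugacy is equivalent to isomorphism with \<open>std m\<close>,
      so unique existence is inherited from the bilattice attached to \<phi>.\<close>
    have "\<exists>!m. gl_conjugate OB n \<phi> (std_emb m)"
      unfolding gl_conjugate_iff_iso[OF emb] by (rule unique_decomposition[OF emb_bilattice[OF emb]])
    then show "\<exists>!q. case q of (r1, r2, t1, t2) \<Rightarrow>
        gl_conjugate OB n \<phi> (emb_sum
          (replicate r1 emb_id @ replicate r2 (emb_tau \<pi>\<^sub>B) @
           replicate t1 (emb_phi1 v \<iota> K \<sigma> \<pi> \<pi>\<^sub>B) @ replicate t2 (emb_phi2 v \<iota> K \<sigma> \<pi> \<pi>\<^sub>B)))"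
      by (simp add: std_emb_def case_prod_beta)
  next
    fix M assume "M \<in> {lattice_O OB, lattice_P OB \<pi>\<^sub>B,
      lattice_L1 v \<iota> OB K \<sigma> \<pi> \<pi>\<^sub>B, lattice_L2 v \<iota> OB K \<sigma> \<pi> \<pi>\<^sub>B}"
    then show "bilattice v \<iota> OB M" "indecomposable OB M"
      using standard_bilattices standard_indecomposable by auto
  next
    show "sorted_wrt (\<lambda>M N. \<not> bimodule_iso OB M N)
      [lattice_O OB, lattice_P OB \<pi>\<^sub>B, lattice_L1 v \<iota> OB K \<sigma> \<pi> \<pi>\<^sub>B, lattice_L2 v \<iota> OB K \<sigma> \<pi> \<pi>\<^sub>B]"
      by (rule standard_pairwise_not_iso)
  next
    fix L :: "('b, 'm) bimodule" assume "bilattice v \<iota> OB L \<and> indecomposable OB L"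
    then show "\<exists>M \<in> {lattice_O OB, lattice_P OB \<pi>\<^sub>B,
      lattice_L1 v \<iota> OB K \<sigma> \<pi> \<pi>\<^sub>B, lattice_L2 v \<iota> OB K \<sigma> \<pi> \<pi>\<^sub>B}. bimodule_iso OB L M"
      using indecomposable_standard by blast
  next
    fix L :: "('b, 'm) bimodule" assume L: "bilattice v \<iota> OB L"
    show "\<exists>!q. case q of (r1, r2, t1, t2) \<Rightarrow>
        bimodule_iso OB L
          (lattice_O OB ^\<^sub>b r1 \<oplus>\<^sub>b lattice_P OB \<pi>\<^sub>B ^\<^sub>b r2 \<oplus>\<^sub>b
           lattice_L1 v \<iota> OB K \<sigma> \<pi> \<pi>\<^sub>B ^\<^sub>b t1 \<oplus>\<^sub>b lattice_L2 v \<iota> OB K \<sigma> \<pi> \<pi>\<^sub>B ^\<^sub>b t2)"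
      using unique_decomposition[OF L] by (simp add: standard_sum case_prod_beta)
  next
    fix r1 r2 t1 t2
    show "bimodule_iso OB
        (lattice_O OB ^\<^sub>b r1 \<oplus>\<^sub>b lattice_P OB \<pi>\<^sub>B ^\<^sub>b r2 \<oplus>\<^sub>b
         lattice_L1 v \<iota> OB K \<sigma> \<pi> \<pi>\<^sub>B ^\<^sub>b t1 \<oplus>\<^sub>b lattice_L2 v \<iota> OB K \<sigma> \<pi> \<pi>\<^sub>B ^\<^sub>b t2)
        (natural_bimodule OB ^\<^sub>b r1 \<oplus>\<^sub>b natural_bimodule ((\<lambda>x. \<pi>\<^sub>B * x) ` OB) ^\<^sub>b r2 \<oplus>\<^sub>b
         lattice_L1 v \<iota> OB K \<sigma> \<pi> \<pi>\<^sub>B ^\<^sub>b t1 \<oplus>\<^sub>b lattice_L2 v \<iota> OB K \<sigma> \<pi> \<pi>\<^sub>B ^\<^sub>b t2)"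
      by (intro bimodule_iso_sum bimodule_iso_power bimodule_iso_refl lattice_O_natural lattice_P_natural)
  qed
qed

end
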